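(* Let $a,b>0$ be constants with $a+b<\tfrac12$. There exists $\varepsilon_0>0$ such that for every fixed $0<\varepsilon<\varepsilon_0$ the following holds. Consider data $n,\boldsymbol{s},\boldsymbol{t},H$ with $n\to\infty$ such that, uniformly over $1\le j\le n$, $s_j-s$, $x_j$, $t_j-s$ and $y_j$ are $O(n^{1/2+\varepsilon})$; $X=O(n^{1+2\varepsilon})$; and $\frac{(1-2\lambda)^2}{3A}\le a\log n$. Then \[ |\mathcal{D}(\boldsymbol{s},\boldsymbol{t},H)|=\binom{n^2-X-n}{\lambda n^2}^{-1}\prod_{j=1}^n\binom{n-x_j-1}{s_j}\binom{n-y_j-1}{t_j}\exp\Bigl(-\frac12\Bigl(1-\frac{R}{2An^2}\Bigr)\Bigl(1-\frac{C}{2An^2}\Bigr)-\frac{Y+\sum_{j=1}^n(s_j-s)(t_j-s)}{2An^2}+O(n^{-b})\Bigr). \]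
   Context: A simple digraph has no loops and no multiple arcs (arcs $w_jw_k$ and $w_kw_j$ may both be present). Let $\boldsymbol{s}=(s_1,\dots,s_n)$, $\boldsymbol{t}=(t_1,\dots,t_n)$ be vectors of positive integers with equal sums. $\mathcal{D}(\boldsymbol{s},\boldsymbol{t})$ is the set of simple digraphs on vertices $\{w_1,\dots,w_n\}$ in which $w_j$ has out-degree $s_j$ and in-degree $t_j$ for all $j$. $H$ is a fixed simple digraph on the same vertices; $x_j$, $y_j$ are the out-degree and in-degree of $w_j$ in $H$. $\mathcal{D}(\boldsymbol{s},\boldsymbol{t},H)$ is the set of digraphs in $\mathcal{D}(\boldsymbol{s},\boldsymbol{t})$ that are arc-disjoint from $H$. Define $s=n^{-1}\sum_js_j$ $(=n^{-1}\sum_jt_j)$, $\lambda=s/n$, $A=\tfrac12\lambda(1-\lambda)$, $\delta_j=s_j-s+\lambda x_j$, $\eta_j=t_j-s+\lambda y_j$, $X=\sum_jx_j$ (the number of arcs of $H$), $Y=\sum_{w_jw_k\in E(H)}\delta_j\eta_k$ (sum over arcs $w_j\to w_k$ of $H$), $R=\sum_j(s_j-s)^2$, $C=\sum_j(t_j-s)^2$. Asymptotic notation refers to $n\to\infty$. *)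

theory Defs
  imports Complex_Main
begin

text \<open>Vertices are w_0,...,w_{n-1} represented by 0..<n. A simple digraph is a set of
arcs (j,k) with j \<noteq> k, both below n (no loops; multiple arcs impossible in a set).\<close>

definition arcs_on :: "nat \<Rightarrow> (nat \<times> nat) set" where
  "arcs_on n = {(j,k). j < n \<and> k < n \<and> j \<noteq> k}"

definition simple_digraph :: "nat \<Rightarrow> (nat \<times> nat) set \<Rightarrow> bool" where
  "simple_digraph n G \<longleftrightarrow> G \<subseteq> arcs_on n"

definition outdeg :: "(nat \<times> nat) set \<Rightarrow> nat \<Rightarrow> nat" where
  "outdeg G j = card {k. (j,k) \<in> G}"

definition indeg :: "(nat \<times> nat) set \<Rightarrow> nat \<Rightarrow> nat" where
  "indeg G j = card {i. (i,j) \<in> G}"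

definition DsetH :: "nat \<Rightarrow> (nat \<Rightarrow> nat) \<Rightarrow> (nat \<Rightarrow> nat) \<Rightarrow> (nat \<times> nat) set
    \<Rightarrow> (nat \<times> nat) set set" where
  "DsetH n s t H = {G. simple_digraph n G \<and> G \<inter> H = {} \<and>
      (\<forall>j<n. outdeg G j = s j \<and> indeg G j = t j)}"

definition avg_deg :: "nat \<Rightarrow> (nat \<Rightarrow> nat) \<Rightarrow> real" where
  "avg_deg n s = (\<Sum>j<n. real (s j)) / real n"

definition lam :: "nat \<Rightarrow> (nat \<Rightarrow> nat) \<Rightarrow> real" where
  "lam n s = avg_deg n s / real n"

definition Acoef :: "nat \<Rightarrow> (nat \<Rightarrow> nat) \<Rightarrow> real" where
  "Acoef n s = lam n s * (1 - lam n s) / 2"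

definition delta :: "nat \<Rightarrow> (nat \<Rightarrow> nat) \<Rightarrow> (nat \<times> nat) set \<Rightarrow> nat \<Rightarrow> real" where
  "delta n s H j = real (s j) - avg_deg n s + lam n s * real (outdeg H j)"

definition eta :: "nat \<Rightarrow> (nat \<Rightarrow> nat) \<Rightarrow> (nat \<Rightarrow> nat) \<Rightarrow> (nat \<times> nat) set \<Rightarrow> nat \<Rightarrow> real" where
  "eta n s t H j = real (t j) - avg_deg n s + lam n s * real (indeg H j)"

definition Xnum :: "nat \<Rightarrow> (nat \<times> nat) set \<Rightarrow> nat" where
  "Xnum n H = (\<Sum>j<n. outdeg H j)"

definition Yval :: "nat \<Rightarrow> (nat \<Rightarrow> nat) \<Rightarrow> (nat \<Rightarrow> nat) \<Rightarrow> (nat \<times> nat) set \<Rightarrow> real" where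
  "Yval n s t H = (\<Sum>(j,k)\<in>H. delta n s H j * eta n s t H k)"

definition Rval :: "nat \<Rightarrow> (nat \<Rightarrow> nat) \<Rightarrow> real" where
  "Rval n s = (\<Sum>j<n. (real (s j) - avg_deg n s)^2)"

definition Cval :: "nat \<Rightarrow> (nat \<Rightarrow> nat) \<Rightarrow> (nat \<Rightarrow> nat) \<Rightarrow> real" where
  "Cval n s t = (\<Sum>j<n. (real (t j) - avg_deg n s)^2)"

end

theory Submission
  imports Defs "HOL-Library.FuncSet"
begin

text \<open>
  Adjoining the diagonal to H turns digraphs avoiding H into 0-1 matrices with row sums s, column sums t and
  forbidden cells H; let N(t) be their number, for fixed s. Moving an entry of some row from column b to column a
  shows that N(t + e_a - e_b) / N(t) is E[V / (U + 1)] up to a negligible term, where U and V count the rows of a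
  uniformly random matrix that read (1,0) and (0,1) in the columns a, b. Switching pairs of such rows
  yields a Stein identity, and from it concentration of column correlations and the first two moments
  of U. Hence the ratio agrees with F(t + e_a - e_b) / F(t) up to a relative error of about (1 + y_a + y_b) / n^2, where
  F(t) = prod_k C(n - y_k, t_k) exp(B(t)) and B is the exponent in the theorem. Along a path of moves
  N / F stays constant up to a factor 1 + O(n^(-1/2 + o(1))) for all relevant t.

  The constant is found by summing over t: N(t) sums to prod_i C(n - x_i, s_i), and prod_k C(n - y_k, t_k) sums to
  C(n^2 - X, sum s). Since exp x >= 1 + x, comparing the two sums needs only the mean of B when t is the
  vector of column sums of a matrix with independent uniform rows, or of a uniform set of allowed cells; both means are small.
\<close>

text \<open>Two relevant vectors can be n^(3/2 + o(1)) moves apart, and a single y_k may be as large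
  as n^(1/2 + o(1)), so charging every move the worst case would destroy the estimate. An error
  proportional to 1 + y_a + y_b per move is affordable because the y_k add up to only n^(1 + o(1)).
  Concentration alone does not reach this accuracy: E U must be known up to n^(-1/2) (1 + y_a + y_b)
  and its variance to leading order.

  The gain comes from an auxiliary column d. Rows of the centred matrix sum to 0, so n times a
  quantity attached to column b is the sum over d of its differences between b and d. The Stein
  identity controls each difference, and effects of forbidden cells that are too large for one d
  cancel in the sum over d.

  At the end no estimate of the mean of exp B is made. The tangent line at 0 is used once as exp
  (-B) \<ge> 1 - B under random rows and once as exp B \<ge> 1 + B under a uniform set of cells; one
  gives the lower and the other the upper bound for N(t).\<close>

type_synonym arcs = "(nat \<times> nat) set"

section \<open>Switchings and the Stein identity\<close>

definition Mat :: "nat \<Rightarrow> arcs \<Rightarrow> (nat \<Rightarrow> nat) \<Rightarrow> (nat \<Rightarrow> nat) \<Rightarrow> arcs set" where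
  "Mat n H s t = {G. G \<subseteq> {..<n} \<times> {..<n} - H \<and> (\<forall>j<n. outdeg G j = s j \<and> indeg G j = t j)}"

text \<open>These are the rows available for switching between the two columns. Asking both cells to
  be allowed keeps the switched matrix outside \<open>H\<close>; the parameter \<open>J\<close>
  makes it possible to freeze some rows.\<close>

definition drows :: "arcs \<Rightarrow> nat \<Rightarrow> nat \<Rightarrow> nat set \<Rightarrow> arcs \<Rightarrow> nat set" where
  "drows H b d J G = {i\<in>J. (i,b) \<notin> H \<and> (i,d) \<notin> H \<and> (i,b) \<in> G \<and> (i,d) \<notin> G}"

definition sw :: "nat \<Rightarrow> nat \<Rightarrow> nat \<Rightarrow> nat \<Rightarrow> arcs \<Rightarrow> arcs" where
  "sw b d i j G = (G - {(i,b),(j,d)}) \<union> {(i,d),(j,b)}"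

text \<open>Measurability with respect to the cells in \<open>S\<close>. A function with this
  property for an \<open>S\<close> disjoint from \<open>J \<times> {b,d}\<close> cannot notice a
  switch of rows of \<open>J\<close> in columns \<open>b\<close> and \<open>d\<close>, which is how
  invariance is verified throughout.\<close>

definition dep :: "arcs \<Rightarrow> (arcs \<Rightarrow> 'a) \<Rightarrow> bool" where
  "dep S f \<longleftrightarrow> (\<forall>G G'. G \<inter> S = G' \<inter> S \<longrightarrow> f G = f G')"

lemma finite_Mat: "finite (Mat n H s t)"
  by (rule finite_subset[of _ "Pow ({..<n} \<times> {..<n})"]) (auto simp: Mat_def)

lemma card_insert_Diff: "finite A \<Longrightarrow> x \<in> A \<Longrightarrow> y \<notin> A \<Longrightarrow> card (insert y (A - {x})) = card A"
  using card_Suc_Diff1[of A x] by (simp del: card_Diff_insert card_Suc_Diff1 add: card_insert_disjoint)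

lemma finite_row: "G \<subseteq> {..<n::nat} \<times> {..<n::nat} \<Longrightarrow> finite {k. (i,k) \<in> G}"
  by (rule finite_subset[of _ "{..<n}"]) auto

lemma finite_col: "G \<subseteq> {..<n::nat} \<times> {..<n::nat} \<Longrightarrow> finite {i. (i,k) \<in> G}"
  by (rule finite_subset[of _ "{..<n}"]) auto

lemma sw_in_Mat:
  assumes G: "G \<in> Mat n H s t" and bd: "b < n" "d < n" "b \<noteq> d" and J: "J \<subseteq> {..<n}"
    and i: "i \<in> drows H b d J G" and j: "j \<in> drows H d b J G"
  shows "sw b d i j G \<in> Mat n H s t"
proof -
  have sub: "G \<subseteq> {..<n} \<times> {..<n} - H" using G by (simp add: Mat_def)
  have sub': "G \<subseteq> {..<n} \<times> {..<n}" using sub by blast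
  have ij: "i \<noteq> j" using i j by (auto simp: drows_def)
  have iP: "(i,b) \<notin> H" "(i,d) \<notin> H" "(i,b) \<in> G" "(i,d) \<notin> G" "i < n" using i J by (auto simp: drows_def)
  have jP: "(j,b) \<notin> H" "(j,d) \<notin> H" "(j,d) \<in> G" "(j,b) \<notin> G" "j < n" using j J by (auto simp: drows_def)
  have "outdeg (sw b d i j G) k = outdeg G k" for k
  proof -
    have "{l. (k,l) \<in> sw b d i j G} = (if k = i then insert d ({l. (k,l) \<in> G} - {b})
       else if k = j then insert b ({l. (k,l) \<in> G} - {d}) else {l. (k,l) \<in> G})"
      using bd ij by (auto simp: sw_def)
    moreover have "card (insert d ({l. (i,l) \<in> G} - {b})) = card {l. (i,l) \<in> G}"
      "card (insert b ({l. (j,l) \<in> G} - {d})) = card {l. (j,l) \<in> G}"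
      using iP jP finite_row[OF sub'] by (intro card_insert_Diff; simp)+
    ultimately show ?thesis by (simp add: outdeg_def)
  qed
  moreover have "indeg (sw b d i j G) k = indeg G k" for k
  proof -
    have "{l. (l,k) \<in> sw b d i j G} = (if k = b then insert j ({l. (l,k) \<in> G} - {i})
       else if k = d then insert i ({l. (l,k) \<in> G} - {j}) else {l. (l,k) \<in> G})"
      using bd ij by (auto simp: sw_def)
    moreover have "card (insert j ({l. (l,b) \<in> G} - {i})) = card {l. (l,b) \<in> G}"
      "card (insert i ({l. (l,d) \<in> G} - {j})) = card {l. (l,d) \<in> G}"
      using iP jP finite_col[OF sub'] by (intro card_insert_Diff; simp)+
    ultimately show ?thesis by (simp add: indeg_def)
  qed
  moreover have "sw b d i j G \<subseteq> {..<n} \<times> {..<n} - H"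
    using sub iP jP bd by (auto simp: sw_def)
  ultimately show ?thesis using G by (simp add: Mat_def)
qed

lemma drows_sw:
  assumes bd: "b \<noteq> d"
    and i: "i \<in> drows H b d J G" and j: "j \<in> drows H d b J G"
  shows "drows H b d J (sw b d i j G) = insert j (drows H b d J G - {i})"
    "drows H d b J (sw b d i j G) = insert i (drows H d b J G - {j})"
    "sw b d j i (sw b d i j G) = G" "i \<noteq> j"
proof -
  have iP: "i \<in> J" "(i,b) \<notin> H" "(i,d) \<notin> H" "(i,b) \<in> G" "(i,d) \<notin> G" using i by (auto simp: drows_def)
  have jP: "j \<in> J" "(j,b) \<notin> H" "(j,d) \<notin> H" "(j,d) \<in> G" "(j,b) \<notin> G" using j by (auto simp: drows_def)
  show ij: "i \<noteq> j" using iP jP by auto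
  have mb: "(k,b) \<in> sw b d i j G \<longleftrightarrow> k = j \<or> (k \<noteq> i \<and> (k,b) \<in> G)" for k
    using ij bd by (auto simp: sw_def)
  have md: "(k,d) \<in> sw b d i j G \<longleftrightarrow> k = i \<or> (k \<noteq> j \<and> (k,d) \<in> G)" for k
    using ij bd by (auto simp: sw_def)
  show "drows H b d J (sw b d i j G) = insert j (drows H b d J G - {i})"
    unfolding drows_def mb md using iP jP ij by auto
  show "drows H d b J (sw b d i j G) = insert i (drows H d b J G - {j})"
    unfolding drows_def mb md using iP jP ij by auto
  show "sw b d j i (sw b d i j G) = G"
  proof (rule set_eqI)
    fix x
    have *: "x \<in> sw b d j i (sw b d i j G) \<longleftrightarrow> (x = (j,d) \<or> x = (i,b)) \<or> (x \<noteq> (j,b) \<and> x \<noteq> (i,d) \<and> x \<in> G)"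
      unfolding sw_def using ij bd by auto
    show "x \<in> sw b d j i (sw b d i j G) \<longleftrightarrow> x \<in> G"
      unfolding * using iP jP by auto
  qed
qed

lemma sw_Int:
  assumes "S \<inter> (J \<times> {b,d}) = {}" "i \<in> J" "j \<in> J"
  shows "sw b d i j G \<inter> S = G \<inter> S"
  using assms by (auto simp: sw_def)

lemma dep_sw:
  assumes "dep S f" "S \<inter> (J \<times> {b,d}) = {}" "i \<in> drows H b d J G" "j \<in> drows H d b J G"
  shows "f (sw b d i j G) = f G"
proof -
  have "sw b d i j G \<inter> S = G \<inter> S" using assms by (intro sw_Int) (auto simp: drows_def)
  then show ?thesis using assms(1) unfolding dep_def by blast
qed

lemma dep_mono: "dep S f \<Longrightarrow> S \<subseteq> S' \<Longrightarrow> dep S' f"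
  unfolding dep_def
proof (intro allI impI)
  fix G G' assume a: "\<forall>G G'. G \<inter> S = G' \<inter> S \<longrightarrow> f G = f G'" "S \<subseteq> S'" "G \<inter> S' = G' \<inter> S'"
  then have "G \<inter> S = G' \<inter> S" by blast
  then show "f G = f G'" using a(1) by blast
qed

lemma dep_const: "dep S (\<lambda>_. c)" by (simp add: dep_def)

lemma dep_comp1: assumes "dep S f" shows "dep S (\<lambda>G. h (f G))"
  unfolding dep_def
proof (intro allI impI)
  fix G G' assume "G \<inter> S = G' \<inter> S"
  then have "f G = f G'" using assms unfolding dep_def by blast
  then show "h (f G) = h (f G')" by simp
qed

lemma dep_comp2: assumes "dep S f" "dep S g" shows "dep S (\<lambda>G. h (f G) (g G))"
  unfolding dep_def
proof (intro allI impI)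
  fix G G' assume "G \<inter> S = G' \<inter> S"
  then have "f G = f G'" "g G = g G'" using assms unfolding dep_def by blast+
  then show "h (f G) (g G) = h (f G') (g G')" by simp
qed

lemma dep_mem: "x \<in> S \<Longrightarrow> dep S (\<lambda>G. x \<in> G)" unfolding dep_def by blast

lemma dep_drows: "J \<times> {b,d} \<subseteq> S \<Longrightarrow> dep S (drows H b d J)"
  unfolding dep_def
proof (intro allI impI)
  fix G G' assume S: "J \<times> {b,d} \<subseteq> S" and "G \<inter> S = G' \<inter> S"
  then have "x \<in> G \<longleftrightarrow> x \<in> G'" if "x \<in> J \<times> {b,d}" for x using that by blast
  then have "(i,b) \<in> G \<longleftrightarrow> (i,b) \<in> G'" "(i,d) \<in> G \<longleftrightarrow> (i,d) \<in> G'" if "i \<in> J" for i using that by auto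
  then show "drows H b d J G = drows H b d J G'" by (auto simp: drows_def)
qed

lemma finite_drows: "J \<subseteq> {..<n} \<Longrightarrow> finite (drows H b d J G)"
  by (rule finite_subset[of _ "{..<n}"]) (auto simp: drows_def)

lemma card_drows_sw:
  assumes "b \<noteq> d" "J \<subseteq> {..<n}"
    "i \<in> drows H b d J G" "j \<in> drows H d b J G"
  shows "card (drows H b d J (sw b d i j G)) = card (drows H b d J G)"
    "card (drows H d b J (sw b d i j G)) = card (drows H d b J G)"
proof -
  have ni: "j \<notin> drows H b d J G" "i \<notin> drows H d b J G" using assms by (auto simp: drows_def)
  have f: "finite (drows H b d J G)" "finite (drows H d b J G)" using finite_drows[OF assms(2)] by auto
  show "card (drows H b d J (sw b d i j G)) = card (drows H b d J G)"
    unfolding drows_sw(1)[OF assms(1,3,4)] by (rule card_insert_Diff[OF f(1) assms(3) ni(1)])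
  show "card (drows H d b J (sw b d i j G)) = card (drows H d b J G)"
    unfolding drows_sw(2)[OF assms(1,3,4)] by (rule card_insert_Diff[OF f(2) assms(4) ni(2)])
qed

section \<open>Reversible switchings and the Stein identity\<close>

text \<open>After the switch row \<open>j\<close> reads (1,0) and row \<open>i\<close> reads (0,1),
  and switching again restores \<open>G\<close>. So the map sending (G, i, j) to (sw b d i j G, j,
  i) is an involution of the triples; this reversibility plays the role of an exchangeable
  pair.\<close>

lemma sum_swap:
  fixes \<phi> :: "arcs \<Rightarrow> nat \<Rightarrow> nat \<Rightarrow> real"
  assumes bd: "b < n" "d < n" "b \<noteq> d" and J: "J \<subseteq> {..<n}"
  shows "(\<Sum>G\<in>Mat n H s t. \<Sum>i\<in>drows H b d J G. \<Sum>j\<in>drows H d b J G. \<phi> G i j)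
    = (\<Sum>G\<in>Mat n H s t. \<Sum>i\<in>drows H b d J G. \<Sum>j\<in>drows H d b J G. \<phi> (sw b d i j G) j i)"
proof -
  let ?S = "SIGMA G:Mat n H s t. drows H b d J G \<times> drows H d b J G"
  have fin: "finite (drows H b' d' J G)" for b' d' G using finite_drows[OF J] .
  have flat: "(\<Sum>G\<in>Mat n H s t. \<Sum>i\<in>drows H b d J G. \<Sum>j\<in>drows H d b J G. \<psi> G i j)
      = (\<Sum>(G,i,j)\<in>?S. \<psi> G i j)" for \<psi> :: "arcs \<Rightarrow> nat \<Rightarrow> nat \<Rightarrow> real"
    by (simp add: sum.Sigma finite_Mat fin sum.cartesian_product split_def)
  have "(\<Sum>(G,i,j)\<in>?S. \<phi> G i j) = (\<Sum>(G,i,j)\<in>?S. \<phi> (sw b d i j G) j i)"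
  proof (rule sum.reindex_bij_witness[where i = "\<lambda>(G,i,j). (sw b d i j G, j, i)"
        and j = "\<lambda>(G,i,j). (sw b d i j G, j, i)"], goal_cases)
    case (1 a) then show ?case using bd by (auto simp: drows_sw)
  next
    case (2 a) then show ?case using bd J by (auto simp: drows_sw intro: sw_in_Mat)
  next
    case (3 a) then show ?case using bd by (auto simp: drows_sw)
  next
    case (4 a) then show ?case using bd J by (auto simp: drows_sw intro: sw_in_Mat)
  next
    case (5 a) then show ?case using bd by (auto simp: drows_sw)
  qed
  then show ?thesis by (simp only: flat)
qed

text \<open>Fix all of the matrix except which of the switchable rows read (1,0) and which (0,1).
  The column sums fix how many there are of each kind, and the choice is then uniform. For
  switch-invariant weights, \<open>swdev\<close> is the difference of the two weighted sums minus
  its conditional mean under that choice.\<close>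

definition swdev :: "arcs \<Rightarrow> nat \<Rightarrow> nat \<Rightarrow> nat set \<Rightarrow> (nat \<Rightarrow> arcs \<Rightarrow> real) \<Rightarrow> arcs \<Rightarrow> real" where
  "swdev H b d J w G = (\<Sum>i\<in>drows H b d J G. w i G) - (\<Sum>i\<in>drows H d b J G. w i G)
    - (real (card (drows H b d J G)) - real (card (drows H d b J G)))
       / (real (card (drows H b d J G)) + real (card (drows H d b J G)))
       * ((\<Sum>i\<in>drows H b d J G. w i G) + (\<Sum>i\<in>drows H d b J G. w i G))"

text \<open>Clearing the denominator exposes a sum antisymmetric in the pair (i, j), the form to
  which the involution applies. Division by zero yields zero, which is the right value when no row
  can be switched.\<close>

lemma swdev_eq:
  assumes J: "J \<subseteq> {..<n}"
  shows "swdev H b d J w G = 2 * (\<Sum>i\<in>drows H b d J G. \<Sum>j\<in>drows H d b J G. (w i G - w j G)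
     / (real (card (drows H b d J G)) + real (card (drows H d b J G))))"
proof -
  let ?U = "real (card (drows H b d J G))" and ?V = "real (card (drows H d b J G))"
  let ?p = "\<Sum>i\<in>drows H b d J G. w i G" and ?q = "\<Sum>i\<in>drows H d b J G. w i G"
  have 1: "(\<Sum>i\<in>drows H b d J G. \<Sum>j\<in>drows H d b J G. (w i G - w j G) / (?U + ?V))
      = (?V * ?p - ?U * ?q) / (?U + ?V)"
    by (simp flip: sum_divide_distrib add: sum_subtractf sum_distrib_left algebra_simps)
  show ?thesis
  proof (cases "?U + ?V = 0")
    case True
    then have "?U = 0" "?V = 0" by linarith+
    then have "drows H b d J G = {}" "drows H d b J G = {}"
      using finite_drows[OF J] by auto
    then show ?thesis by (simp add: swdev_def)
  next
    case False
    then show ?thesis unfolding 1 swdev_def by (simp add: field_simps)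
  qed
qed

text \<open>The factor \<open>w i G - w j G\<close> changes sign under the involution. Hence the sum
  S weighted with the value of \<open>f\<close> at \<open>G\<close> is the negative of the sum S'
  weighted with the value at the switched matrix, and 2S = S - S'.\<close>

lemma stein_identity:
  fixes w :: "nat \<Rightarrow> arcs \<Rightarrow> real"
  assumes bd: "b < n" "d < n" "b \<noteq> d" and J: "J \<subseteq> {..<n}"
    and inv: "\<And>G i j k. i \<in> drows H b d J G \<Longrightarrow> j \<in> drows H d b J G \<Longrightarrow> w k (sw b d i j G) = w k G"
  shows "(\<Sum>G\<in>Mat n H s t. f G * swdev H b d J w G) =
    (\<Sum>G\<in>Mat n H s t. \<Sum>i\<in>drows H b d J G. \<Sum>j\<in>drows H d b J G.
       (w i G - w j G) * (f G - f (sw b d i j G))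
        / (real (card (drows H b d J G)) + real (card (drows H d b J G))))"
proof -
  let ?D = "\<lambda>G. real (card (drows H b d J G)) + real (card (drows H d b J G))"
  let ?S = "\<Sum>G\<in>Mat n H s t. \<Sum>i\<in>drows H b d J G. \<Sum>j\<in>drows H d b J G. f G * (w i G - w j G) / ?D G"
  let ?S' = "\<Sum>G\<in>Mat n H s t. \<Sum>i\<in>drows H b d J G. \<Sum>j\<in>drows H d b J G. f (sw b d i j G) * (w i G - w j G) / ?D G"
  have "?S = (\<Sum>G\<in>Mat n H s t. \<Sum>i\<in>drows H b d J G. \<Sum>j\<in>drows H d b J G.
     f (sw b d i j G) * (w j (sw b d i j G) - w i (sw b d i j G)) / ?D (sw b d i j G))"
    by (rule sum_swap[OF bd J])
  also have "\<dots> = (\<Sum>G\<in>Mat n H s t. \<Sum>i\<in>drows H b d J G. \<Sum>j\<in>drows H d b J G.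
     - (f (sw b d i j G) * (w i G - w j G) / ?D G))"
    using bd J by (intro sum.cong refl) (simp add: inv card_drows_sw right_diff_distrib minus_divide_left)
  also have "\<dots> = - ?S'" by (simp add: sum_negf)
  finally have eq: "?S = - ?S'" .
  have "(\<Sum>G\<in>Mat n H s t. f G * swdev H b d J w G) = 2 * ?S"
    unfolding swdev_eq[OF J] sum_distrib_left by (intro sum.cong refl) (simp add: algebra_simps)
  also have "\<dots> = ?S - ?S'" using eq by simp
  also have "\<dots> = (\<Sum>G\<in>Mat n H s t. \<Sum>i\<in>drows H b d J G. \<Sum>j\<in>drows H d b J G.
       (w i G - w j G) * (f G - f (sw b d i j G)) / ?D G)"
    by (simp add: sum_subtractf[symmetric] diff_divide_distrib[symmetric] algebra_simps)
  finally show ?thesis .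
qed

lemma stein_mean:
  fixes w :: "nat \<Rightarrow> arcs \<Rightarrow> real"
  assumes bd: "b < n" "d < n" "b \<noteq> d" and J: "J \<subseteq> {..<n}"
    and inv: "\<And>G i j k. i \<in> drows H b d J G \<Longrightarrow> j \<in> drows H d b J G \<Longrightarrow> w k (sw b d i j G) = w k G"
    and invg: "\<And>G i j. i \<in> drows H b d J G \<Longrightarrow> j \<in> drows H d b J G \<Longrightarrow> g (sw b d i j G) = g G"
  shows "(\<Sum>G\<in>Mat n H s t. g G * swdev H b d J w G) = 0"
  by (subst stein_identity[OF bd J inv]) (simp_all add: invg)

text \<open>A switch keeps both row counts and the total weight of the switchable rows, so the
  conditional mean stays and only the plain difference of the weighted sums moves.\<close>

lemma swdev_sw:
  assumes bd: "b \<noteq> d" and J: "J \<subseteq> {..<n}"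
    and inv: "\<And>k. w k (sw b d i j G) = w k G"
    and ij: "i \<in> drows H b d J G" "j \<in> drows H d b J G"
  shows "swdev H b d J w (sw b d i j G) = swdev H b d J w G - 2 * (w i G - w j G)"
proof -
  have ni: "j \<notin> drows H b d J G" "i \<notin> drows H d b J G" using ij by (auto simp: drows_def)
  have f: "finite (drows H b d J G)" "finite (drows H d b J G)" using finite_drows[OF J] by auto
  have 1: "(\<Sum>k\<in>insert j (drows H b d J G - {i}). w k G) = (\<Sum>k\<in>drows H b d J G. w k G) - w i G + w j G"
    using f ij ni by (simp add: sum_diff1)
  have 2: "(\<Sum>k\<in>insert i (drows H d b J G - {j}). w k G) = (\<Sum>k\<in>drows H d b J G. w k G) - w j G + w i G"
    using f ij ni by (simp add: sum_diff1)
  show ?thesis unfolding swdev_def inv card_drows_sw[OF bd J ij]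
    unfolding drows_sw(1,2)[OF bd ij] 1 2 by (simp add: algebra_simps)
qed

section \<open>Exponential moments and tails of the switching deviation\<close>

text \<open>The tangent of exp at the larger of the two arguments bounds the increment. Having both
  exponentials on the right covers either sign of \<open>x\<close> and gives an expression whose two
  halves are exchanged by the switching involution.\<close>

lemma exp_diff_mult_le:
  fixes x y \<theta> :: real
  assumes "\<theta> \<ge> 0"
  shows "x * (exp (\<theta> * y) - exp (\<theta> * (y - 2 * x))) \<le> 2 * \<theta> * x^2 * (exp (\<theta> * y) + exp (\<theta> * (y - 2 * x)))"
proof -
  have key: "exp u - exp v \<le> (u - v) * exp u" for u v :: real
  proof -
    have "exp u * (1 + (v - u)) \<le> exp u * exp (v - u)" by (intro mult_left_mono exp_ge_add_one_self) auto
    also have "\<dots> = exp v" by (simp flip: exp_add)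
    finally show ?thesis by (simp add: algebra_simps)
  qed
  show ?thesis
  proof (cases "x \<ge> 0")
    case True
    have "x * (exp (\<theta> * y) - exp (\<theta> * (y - 2 * x))) \<le> x * ((\<theta> * y - \<theta> * (y - 2 * x)) * exp (\<theta> * y))"
      using True key by (intro mult_left_mono) auto
    also have "\<dots> = 2 * \<theta> * x^2 * exp (\<theta> * y)" by (simp add: algebra_simps power2_eq_square)
    also have "\<dots> \<le> 2 * \<theta> * x^2 * (exp (\<theta> * y) + exp (\<theta> * (y - 2 * x)))"
      using assms by (intro mult_left_mono) auto
    finally show ?thesis .
  next
    case False
    have "(-x) * (exp (\<theta> * (y - 2 * x)) - exp (\<theta> * y)) \<le> (-x) * ((\<theta> * (y - 2 * x) - \<theta> * y) * exp (\<theta> * (y - 2 * x)))"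
      using False key by (intro mult_left_mono) auto
    also have "\<dots> = 2 * \<theta> * x^2 * exp (\<theta> * (y - 2 * x))" by (simp add: algebra_simps power2_eq_square)
    also have "\<dots> \<le> 2 * \<theta> * x^2 * (exp (\<theta> * y) + exp (\<theta> * (y - 2 * x)))"
      using assms by (intro mult_left_mono) auto
    finally show ?thesis by (simp add: algebra_simps)
  qed
qed

text \<open>The Stein identity is used with f = exp (\<theta> * swdev). The half of the bound that
  refers to the switched matrix is brought back by the involution, and the number of pairs is
  controlled by 4UV / (U + V) \<le> U + V \<le> n.\<close>

lemma swdev_mgf_deriv:
  fixes w :: "nat \<Rightarrow> arcs \<Rightarrow> real"
  assumes bd: "b < n" "d < n" "b \<noteq> d" and J: "J \<subseteq> {..<n}"
    and inv: "\<And>G i j k. i \<in> drows H b d J G \<Longrightarrow> j \<in> drows H d b J G \<Longrightarrow> w k (sw b d i j G) = w k G"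
    and w1: "\<And>k G. \<bar>w k G\<bar> \<le> 1" and th: "\<theta> \<ge> 0"
  shows "(\<Sum>G\<in>Mat n H s t. swdev H b d J w G * exp (\<theta> * swdev H b d J w G))
      \<le> 4 * \<theta> * real n * (\<Sum>G\<in>Mat n H s t. exp (\<theta> * swdev H b d J w G))"
proof -
  let ?M = "Mat n H s t" and ?P = "\<lambda>G. drows H b d J G" and ?Q = "\<lambda>G. drows H d b J G"
  let ?D = "\<lambda>G. real (card (drows H b d J G)) + real (card (drows H d b J G))"
  let ?T = "swdev H b d J w"
  have "(\<Sum>G\<in>?M. ?T G * exp (\<theta> * ?T G)) = (\<Sum>G\<in>?M. exp (\<theta> * ?T G) * ?T G)" by (simp add: mult.commute)
  also have "\<dots> = (\<Sum>G\<in>?M. \<Sum>i\<in>?P G. \<Sum>j\<in>?Q G.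
       (w i G - w j G) * (exp (\<theta> * ?T G) - exp (\<theta> * ?T (sw b d i j G))) / ?D G)"
    by (rule stein_identity[OF bd J inv])
  also have "\<dots> \<le> (\<Sum>G\<in>?M. \<Sum>i\<in>?P G. \<Sum>j\<in>?Q G.
       2 * \<theta> * (w i G - w j G)\<^sup>2 * (exp (\<theta> * ?T G) + exp (\<theta> * ?T (sw b d i j G))) / ?D G)"
  proof (intro sum_mono divide_right_mono)
    fix G i j assume ij: "i \<in> ?P G" "j \<in> ?Q G"
    show "(w i G - w j G) * (exp (\<theta> * ?T G) - exp (\<theta> * ?T (sw b d i j G)))
       \<le> 2 * \<theta> * (w i G - w j G)\<^sup>2 * (exp (\<theta> * ?T G) + exp (\<theta> * ?T (sw b d i j G)))"
      unfolding swdev_sw[OF bd(3) J inv[OF ij] ij] by (rule exp_diff_mult_le[OF th])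
  qed auto
  also have "\<dots> = (\<Sum>G\<in>?M. \<Sum>i\<in>?P G. \<Sum>j\<in>?Q G. 2 * \<theta> * (w i G - w j G)\<^sup>2 * exp (\<theta> * ?T G) / ?D G)
     + (\<Sum>G\<in>?M. \<Sum>i\<in>?P G. \<Sum>j\<in>?Q G. 2 * \<theta> * (w i G - w j G)\<^sup>2 * exp (\<theta> * ?T (sw b d i j G)) / ?D G)"
    by (simp add: sum.distrib[symmetric] add_divide_distrib[symmetric] distrib_left)
  also have "(\<Sum>G\<in>?M. \<Sum>i\<in>?P G. \<Sum>j\<in>?Q G. 2 * \<theta> * (w i G - w j G)\<^sup>2 * exp (\<theta> * ?T (sw b d i j G)) / ?D G)
    = (\<Sum>G\<in>?M. \<Sum>i\<in>?P G. \<Sum>j\<in>?Q G. 2 * \<theta> * (w j (sw b d i j G) - w i (sw b d i j G))\<^sup>2 * exp (\<theta> * ?T (sw b d i j G)) / ?D (sw b d i j G))"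
    using bd J by (intro sum.cong refl) (simp add: inv card_drows_sw power2_commute)
  also have "\<dots> = (\<Sum>G\<in>?M. \<Sum>i\<in>?P G. \<Sum>j\<in>?Q G. 2 * \<theta> * (w i G - w j G)\<^sup>2 * exp (\<theta> * ?T G) / ?D G)"
    by (rule sum_swap[OF bd J, symmetric])
  finally have 1: "(\<Sum>G\<in>?M. ?T G * exp (\<theta> * ?T G)) \<le>
      2 * (\<Sum>G\<in>?M. \<Sum>i\<in>?P G. \<Sum>j\<in>?Q G. 2 * \<theta> * (w i G - w j G)\<^sup>2 * exp (\<theta> * ?T G) / ?D G)" by simp
  have 2: "(\<Sum>i\<in>?P G. \<Sum>j\<in>?Q G. 2 * \<theta> * (w i G - w j G)\<^sup>2 * exp (\<theta> * ?T G) / ?D G) \<le> 2 * \<theta> * real n * exp (\<theta> * ?T G)" for G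
  proof -
    let ?U = "real (card (?P G))" and ?V = "real (card (?Q G))"
    have sq: "(w i G - w j G)\<^sup>2 \<le> 4" for i j
    proof -
      have "\<bar>w i G - w j G\<bar> \<le> 2" using w1[of i G] w1[of j G] by linarith
      then have "\<bar>w i G - w j G\<bar>\<^sup>2 \<le> 2\<^sup>2" by (intro power_mono) auto
      then show ?thesis by simp
    qed
    have "(\<Sum>i\<in>?P G. \<Sum>j\<in>?Q G. 2 * \<theta> * (w i G - w j G)\<^sup>2 * exp (\<theta> * ?T G) / ?D G)
       \<le> (\<Sum>i\<in>?P G. \<Sum>j\<in>?Q G. 2 * \<theta> * 4 * exp (\<theta> * ?T G) / ?D G)"
      using th sq by (intro sum_mono divide_right_mono mult_right_mono mult_left_mono) auto
    also have "\<dots> = 2 * \<theta> * exp (\<theta> * ?T G) * (4 * ?U * ?V / (?U + ?V))" by simp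
    also have "\<dots> \<le> 2 * \<theta> * exp (\<theta> * ?T G) * real n"
    proof (intro mult_left_mono)
      have "?P G \<inter> ?Q G = {}" by (auto simp: drows_def)
      then have "card (?P G) + card (?Q G) = card (?P G \<union> ?Q G)" using finite_drows[OF J] by (simp add: card_Un_disjoint)
      also have "\<dots> \<le> card {..<n}" using J by (intro card_mono) (auto simp: drows_def)
      finally have le: "?U + ?V \<le> real n" by simp
      have "4 * ?U * ?V \<le> (?U + ?V) * (?U + ?V)"
        using zero_le_power2[of "?U - ?V"] by (simp add: power2_eq_square algebra_simps)
      then have "4 * ?U * ?V / (?U + ?V) \<le> ?U + ?V"
        by (cases "?U + ?V = 0") (auto simp: divide_simps)
      then show "4 * ?U * ?V / (?U + ?V) \<le> real n" using le by linarith
    qed (use th in auto)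
    finally show ?thesis by (simp add: mult_ac)
  qed
  have "2 * (\<Sum>G\<in>?M. \<Sum>i\<in>?P G. \<Sum>j\<in>?Q G. 2 * \<theta> * (w i G - w j G)\<^sup>2 * exp (\<theta> * ?T G) / ?D G)
     \<le> 2 * (\<Sum>G\<in>?M. 2 * \<theta> * real n * exp (\<theta> * ?T G))"
    by (intro mult_left_mono sum_mono 2) auto
  also have "\<dots> = 4 * \<theta> * real n * (\<Sum>G\<in>?M. exp (\<theta> * ?T G))"
    by (simp add: sum_distrib_left mult_ac)
  finally show ?thesis using 1 by linarith
qed

text \<open>Integrates the previous differential inequality: the moment generating function divided
  by exp (2 x^2 n) has nonpositive derivative for x \<ge> 0.\<close>

lemma swdev_mgf:
  fixes w :: "nat \<Rightarrow> arcs \<Rightarrow> real"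
  assumes bd: "b < n" "d < n" "b \<noteq> d" and J: "J \<subseteq> {..<n}"
    and inv: "\<And>G i j k. i \<in> drows H b d J G \<Longrightarrow> j \<in> drows H d b J G \<Longrightarrow> w k (sw b d i j G) = w k G"
    and w1: "\<And>k G. \<bar>w k G\<bar> \<le> 1" and th: "\<theta> \<ge> 0"
  shows "(\<Sum>G\<in>Mat n H s t. exp (\<theta> * swdev H b d J w G)) \<le> exp (2 * \<theta>\<^sup>2 * real n) * real (card (Mat n H s t))"
proof -
  define m where "m x = (\<Sum>G\<in>Mat n H s t. exp (x * swdev H b d J w G))" for x
  define h where "h x = m x * exp (- 2 * x^2 * real n)" for x
  have "h \<theta> \<le> h 0"
  proof (rule DERIV_nonpos_imp_nonincreasing[OF th])
    fix x :: real assume x: "0 \<le> x" "x \<le> \<theta>"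
    let ?m' = "\<Sum>G\<in>Mat n H s t. swdev H b d J w G * exp (x * swdev H b d J w G)"
    have "(m has_real_derivative ?m') (at x)" unfolding m_def
      by (auto intro!: derivative_eq_intros sum.cong)
    then have "(h has_real_derivative (?m' * exp (- 2 * x^2 * real n) + m x * (exp (- 2 * x^2 * real n) * (- 4 * x * real n)))) (at x)"
      unfolding h_def by (auto intro!: derivative_eq_intros)
    moreover have "?m' * exp (- 2 * x^2 * real n) + m x * (exp (- 2 * x^2 * real n) * (- 4 * x * real n)) \<le> 0"
    proof -
      have "?m' \<le> 4 * x * real n * m x" unfolding m_def
        by (rule swdev_mgf_deriv[OF bd J inv w1 x(1)])
      then have "(?m' - 4 * x * real n * m x) * exp (- 2 * x^2 * real n) \<le> 0"
        by (simp add: mult_le_0_iff)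
      then show ?thesis by (simp add: algebra_simps)
    qed
    ultimately show "\<exists>y. (h has_real_derivative y) (at x) \<and> y \<le> 0" by blast
  qed
  then have "m \<theta> * exp (- 2 * \<theta>\<^sup>2 * real n) * exp (2 * \<theta>\<^sup>2 * real n) \<le> real (card (Mat n H s t)) * exp (2 * \<theta>\<^sup>2 * real n)"
    by (intro mult_right_mono) (auto simp: h_def m_def)
  then show ?thesis by (simp add: m_def mult.assoc flip: exp_add) (simp add: mult.commute)
qed

lemma swdev_upper_tail:
  fixes w :: "nat \<Rightarrow> arcs \<Rightarrow> real"
  assumes bd: "b < n" "d < n" "b \<noteq> d" and J: "J \<subseteq> {..<n}"
    and inv: "\<And>G i j k. i \<in> drows H b d J G \<Longrightarrow> j \<in> drows H d b J G \<Longrightarrow> w k (sw b d i j G) = w k G"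
    and w1: "\<And>k G. \<bar>w k G\<bar> \<le> 1"
  shows "real (card {G\<in>Mat n H s t. swdev H b d J w G > y * sqrt n}) \<le> exp (2 - y) * real (card (Mat n H s t))"
proof -
  have n: "n > 0" using bd by auto
  \<comment> \<open>With this value the factor exp (2 \<theta>^2 n) is the constant exp 2, and the
    tail decays exponentially on the scale sqrt n. This is enough because it is evaluated at a
    multiple of z, which exceeds 40 ln n.\<close>
  define \<theta> where "\<theta> = 1 / sqrt n"
  have th: "\<theta> \<ge> 0" by (simp add: \<theta>_def)
  let ?A = "{G\<in>Mat n H s t. swdev H b d J w G > y * sqrt n}"
  have "real (card ?A) * exp y = (\<Sum>G\<in>?A. exp y)" by simp
  also have "\<dots> \<le> (\<Sum>G\<in>?A. exp (\<theta> * swdev H b d J w G))"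
  proof (rule sum_mono)
    fix G assume "G \<in> ?A"
    then have "\<theta> * (y * sqrt n) \<le> \<theta> * swdev H b d J w G" using th by (intro mult_left_mono) auto
    then show "exp y \<le> exp (\<theta> * swdev H b d J w G)" using n by (simp add: \<theta>_def)
  qed
  also have "\<dots> \<le> (\<Sum>G\<in>Mat n H s t. exp (\<theta> * swdev H b d J w G))"
    by (rule sum_mono2) (auto simp: finite_Mat)
  also have "\<dots> \<le> exp (2 * \<theta>\<^sup>2 * real n) * real (card (Mat n H s t))"
    by (rule swdev_mgf[OF bd J inv w1 th])
  also have "2 * \<theta>\<^sup>2 * real n = 2" using n by (simp add: \<theta>_def power_divide)
  finally show ?thesis by (simp add: exp_diff field_simps)
qed

lemma swdev_uminus: "swdev H b d J (\<lambda>i G. - w i G) G = - swdev H b d J w G"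
  by (simp add: swdev_def sum_negf algebra_simps add_divide_distrib diff_divide_distrib)

lemma swdev_tail:
  fixes w :: "nat \<Rightarrow> arcs \<Rightarrow> real"
  assumes bd: "b < n" "d < n" "b \<noteq> d" and J: "J \<subseteq> {..<n}"
    and inv: "\<And>G i j k. i \<in> drows H b d J G \<Longrightarrow> j \<in> drows H d b J G \<Longrightarrow> w k (sw b d i j G) = w k G"
    and w1: "\<And>k G. \<bar>w k G\<bar> \<le> 1"
  shows "real (card {G\<in>Mat n H s t. \<bar>swdev H b d J w G\<bar> > y * sqrt n}) \<le> 2 * exp (2 - y) * real (card (Mat n H s t))"
proof -
  have "real (card {G\<in>Mat n H s t. swdev H b d J (\<lambda>i G. - w i G) G > y * sqrt n}) \<le> exp (2 - y) * real (card (Mat n H s t))"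
    using inv w1 by (intro swdev_upper_tail[OF bd J]) auto
  moreover have "real (card {G\<in>Mat n H s t. swdev H b d J w G > y * sqrt n}) \<le> exp (2 - y) * real (card (Mat n H s t))"
    by (rule swdev_upper_tail[OF bd J inv w1])
  moreover have "card {G\<in>Mat n H s t. \<bar>swdev H b d J w G\<bar> > y * sqrt n} \<le>
     card ({G\<in>Mat n H s t. swdev H b d J w G > y * sqrt n} \<union> {G\<in>Mat n H s t. swdev H b d J (\<lambda>i G. - w i G) G > y * sqrt n})"
    by (rule card_mono) (auto simp: finite_Mat swdev_uminus)
  moreover have "\<dots> \<le> card {G\<in>Mat n H s t. swdev H b d J w G > y * sqrt n} + card {G\<in>Mat n H s t. swdev H b d J (\<lambda>i G. - w i G) G > y * sqrt n}"
    by (rule card_Un_le)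
  ultimately show ?thesis by linarith
qed

section \<open>Random matrices with given margins\<close>

text \<open>The parameter z stands for n powr (3 * epsilon), and r below for sqrt n; all error terms are bounded by
  powers of z times powers of r.\<close>

locale host =
  fixes n :: nat and H :: "arcs" and s :: "nat \<Rightarrow> nat" and z :: real
  assumes H_sub: "H \<subseteq> {..<n} \<times> {..<n}"
    and z_ge: "z \<ge> 100" and z_pow: "z ^ 60 \<le> sqrt (real n)" and z_ln: "40 * ln (real n) \<le> z"
    and lam_nonneg: "lam n s \<ge> 0" and v_ge: "1 / z \<le> lam n s * (1 - lam n s)"
    and delta_le: "\<And>i. i < n \<Longrightarrow> \<bar>delta n s H i\<bar> \<le> z * sqrt (real n)"
    and out_le: "\<And>i. i < n \<Longrightarrow> real (outdeg H i) \<le> z * sqrt (real n)"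
    and in_le: "\<And>i. i < n \<Longrightarrow> real (indeg H i) \<le> z * sqrt (real n)"
    and X_le: "real (Xnum n H) \<le> z * real n"
begin

abbreviation L where "L \<equiv> lam n s"
abbreviation r where "r \<equiv> sqrt (real n)"
abbreviation v where "v \<equiv> lam n s * (1 - lam n s)"
abbreviation dl where "dl \<equiv> delta n s H"
abbreviation X where "X \<equiv> real (Xnum n H)"

lemma z_pos: "z > 0" using z_ge by simp

lemma z_le_r: "z ^ k \<le> r" if "k \<le> 60"
  using z_pow z_ge that power_increasing[of k 60 z] by linarith

lemma z1: "1 \<le> z ^ k" using z_ge by (simp add: one_le_power)

lemma r_ge: "100 \<le> r" using z_le_r[of 1] z_ge by simp

lemma r_pos: "r > 0" using r_ge by linarith

lemma n_pos: "n > 0"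
proof (rule ccontr)
  assume "\<not> n > 0"
  then have "r = 0" by simp
  then show False using r_ge by simp
qed

lemma rr: "r * r = real n" by simp

lemma n_ge: "10000 \<le> real n" using mult_mono[OF r_ge r_ge] by simp

text \<open>Numerical constants are paid for with one more factor z. This is the origin of the
  slowly growing exponents of z in the bounds that follow.\<close>

lemma absorb: "0 \<le> y \<Longrightarrow> c \<le> 100 \<Longrightarrow> c * (z ^ k * y) \<le> z ^ Suc k * y"
proof -
  assume a: "0 \<le> y" "c \<le> 100"
  have "c * (z ^ k * y) \<le> z * (z ^ k * y)" using a z_ge by (intro mult_right_mono) auto
  then show ?thesis by simp
qed

lemma zr_mono: "j \<le> k \<Longrightarrow> 0 \<le> y \<Longrightarrow> z ^ j * y \<le> z ^ k * y"
  using z_ge by (intro mult_right_mono power_increasing) auto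

text \<open>A tail of size exp (-z) beats the polynomial losses of union bounds and of crude bounds
  on exceptional events.\<close>

lemma exp_z: "exp (- z) * real n ^ 40 \<le> 1"
proof -
  have "exp (real 40 * ln (real n)) = real n ^ 40" using n_pos by (subst exp_of_nat_mult) simp
  then have "real n ^ 40 = exp (40 * ln (real n))" by simp
  also have "\<dots> \<le> exp z" using z_ln by simp
  finally show ?thesis by (simp add: exp_minus field_simps)
qed

lemma v_pos: "v > 0" using v_ge z_pos by (meson divide_pos_pos less_le_trans zero_less_one)

lemma L01: "0 < L" "L < 1"
proof -
  show 1: "0 < L" using v_pos lam_nonneg by (metis less_eq_real_def mult_zero_left less_irrefl)
  show "L < 1" using v_pos 1 by (simp add: zero_less_mult_iff)
qed

lemma v_le: "v \<le> 1" using L01 mult_mono[of L 1 "1 - L" 1] by simp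

lemma inv_v: "1 / v \<le> z" using v_ge v_pos z_pos by (simp add: field_simps)

lemma sum_out: "(\<Sum>i<n. real (outdeg H i)) = X" by (simp add: Xnum_def)

lemma sum_in: "(\<Sum>k<n. real (indeg H k)) = X"
proof -
  have fin: "finite H" using H_sub finite_subset by blast
  have "(\<Sum>k<n. indeg H k) = (\<Sum>k<n. \<Sum>i<n. of_bool ((i,k) \<in> H))"
  proof (rule sum.cong)
    fix k
    have "{i. (i,k) \<in> H} = {i. i < n \<and> (i,k) \<in> H}" using H_sub by auto
    then show "indeg H k = (\<Sum>i<n. of_bool ((i,k) \<in> H))"
      by (simp add: indeg_def sum.If_cases Int_def of_bool_def)
  qed simp
  also have "\<dots> = (\<Sum>i<n. \<Sum>k<n. of_bool ((i,k) \<in> H))" by (rule sum.swap)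
  also have "\<dots> = (\<Sum>i<n. outdeg H i)"
  proof (rule sum.cong)
    fix i
    have "{k. (i,k) \<in> H} = {k. k < n \<and> (i,k) \<in> H}" using H_sub by auto
    then show "(\<Sum>k<n. of_bool ((i,k) \<in> H)) = outdeg H i"
      by (simp add: outdeg_def sum.If_cases Int_def of_bool_def)
  qed simp
  finally show ?thesis by (simp add: Xnum_def flip: of_nat_sum)
qed

lemma avg_L: "avg_deg n s = real n * L" using n_pos by (simp add: lam_def)

lemma sum_dl: "(\<Sum>i<n. dl i) = L * X"
proof -
  have "(\<Sum>i<n. dl i) = (\<Sum>i<n. real (s i)) - real n * avg_deg n s + L * X"
    by (simp add: delta_def sum.distrib sum_subtractf sum_distrib_left[symmetric] sum_out)
  then show ?thesis using n_pos by (simp add: avg_deg_def)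
qed

text \<open>Forbidden cells carry the mean density, so that the row and column sums become n * lam plus the
  quantities delta and eta of the paper.\<close>

definition ent :: "arcs \<Rightarrow> nat \<Rightarrow> nat \<Rightarrow> real" where
  "ent G i k = (if (i,k) \<in> H then L else of_bool ((i,k) \<in> G))"

definition bad :: "nat \<Rightarrow> nat \<Rightarrow> nat set" where
  "bad b d = {i. i < n \<and> ((i,b) \<in> H \<or> (i,d) \<in> H)}"

lemma ent_01: "0 \<le> ent G i k" "ent G i k \<le> 1" using L01 by (auto simp: ent_def)

lemma ent_diff_le: "\<bar>ent G i k - ent G' i' k'\<bar> \<le> 1"
  using ent_01[of G i k] ent_01[of G' i' k'] by linarith

lemma finite_H_col: "finite {i. (i,k) \<in> H}" using H_sub by (rule finite_col)

lemma card_bad: "real (card (bad b d)) \<le> real (indeg H b) + real (indeg H d)"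
proof -
  have "card (bad b d) \<le> card ({i. (i,b) \<in> H} \<union> {i. (i,d) \<in> H})"
    using finite_H_col by (intro card_mono) (auto simp: bad_def)
  also have "\<dots> \<le> indeg H b + indeg H d" unfolding indeg_def by (rule card_Un_le)
  finally show ?thesis by linarith
qed

lemma card_bad_zr: "b < n \<Longrightarrow> d < n \<Longrightarrow> real (card (bad b d)) \<le> 2 * z * r"
  using card_bad[of b d] in_le[of b] in_le[of d] by linarith

text \<open>Away from the rows with a forbidden cell, two columns differ exactly in the switchable
  rows, with sign +1 or -1. The rows in \<open>bad b d\<close> are carried along as a separate
  term.\<close>

lemma diff_decomp:
  assumes J: "J \<subseteq> {..<n}"
  shows "(\<Sum>i\<in>J. w i * (ent G i b - ent G i d)) =
     (\<Sum>i\<in>drows H b d J G. w i) - (\<Sum>i\<in>drows H d b J G. w i) + (\<Sum>i\<in>J \<inter> bad b d. w i * (ent G i b - ent G i d))"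
proof -
  have fin: "finite J" using J finite_subset by blast
  have "(\<Sum>i\<in>J. w i * (ent G i b - ent G i d)) = (\<Sum>i\<in>J. (if i \<in> drows H b d J G then w i else 0)
     - (if i \<in> drows H d b J G then w i else 0) + (if i \<in> bad b d then w i * (ent G i b - ent G i d) else 0))"
    using J by (intro sum.cong refl) (auto simp: drows_def bad_def ent_def)
  also have "\<dots> = (\<Sum>i\<in>J \<inter> drows H b d J G. w i) - (\<Sum>i\<in>J \<inter> drows H d b J G. w i) + (\<Sum>i\<in>J \<inter> bad b d. w i * (ent G i b - ent G i d))"
    using fin by (simp add: sum.distrib sum_subtractf sum.inter_restrict)
  also have "J \<inter> drows H b d J G = drows H b d J G" by (auto simp: drows_def)
  also have "J \<inter> drows H d b J G = drows H d b J G" by (auto simp: drows_def)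
  finally show ?thesis .
qed

lemma LX: "0 \<le> L * X / n^2" "L * X / n^2 \<le> z / r"
proof -
  show "0 \<le> L * X / n^2" using L01 by simp
  have "L * X \<le> 1 * (z * n)" using L01 X_le by (intro mult_mono) auto
  also have "1 * (z * n) \<le> r * (z * n)" using r_ge z_pos by (intro mult_right_mono) (auto simp del: real_sqrt_ge_1_iff)
  also have "\<dots> = z * n * r" by simp
  finally have "L * X * r \<le> z * n * r * r" using r_pos by (intro mult_right_mono) auto
  then show "L * X / n^2 \<le> z / r" using n_pos r_pos by (simp add: divide_simps power2_eq_square mult_ac)
qed

lemma zr_n: "z * r / n = z / r" using r_pos rr by (metis mult_divide_mult_cancel_right less_irrefl)

lemma dl_n: "i < n \<Longrightarrow> \<bar>dl i / n\<bar> \<le> z / r"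
  using delta_le[of i] n_pos zr_n by (simp add: abs_div) (metis divide_right_mono of_nat_0_le_iff)

lemma zr_small: "100 * z ^ k / r \<le> 1" if "k \<le> 59"
proof -
  have "100 * z ^ k \<le> z ^ Suc k" using absorb[of 1 100 k] by simp
  also have "\<dots> \<le> r" using that by (intro z_le_r) auto
  finally show ?thesis using r_pos by simp
qed

lemma zkr: "100 \<le> z ^ k * r"
proof -
  have "1 * 100 \<le> z ^ k * r" by (rule mult_mono[OF z1 r_ge]) (use z_pos in auto)
  then show ?thesis by simp
qed

lemma r_over_n: "r / n = 1 / r" using rr r_pos n_pos by (simp add: field_simps)

lemma r_le_n: "r \<le> real n"
proof -
  have "1 * r \<le> r * r" using r_ge by (intro mult_right_mono) linarith+
  then show ?thesis by simp
qed

lemma n3: "1 / real n ^ 3 \<le> z ^ k / r"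
proof -
  have "r \<le> real n" by (rule r_le_n)
  also have "\<dots> \<le> real n ^ 3" using n_ge power_increasing[of 1 3 "real n"] by simp
  finally have "1 / real n ^ 3 \<le> 1 / r" using r_pos n_pos by (simp add: frac_le)
  also have "\<dots> \<le> z ^ k / r" using z1 r_pos by (intro divide_right_mono) auto
  finally show ?thesis .
qed

end

locale margins = host +
  fixes t :: "nat \<Rightarrow> nat"
  assumes sum_eq: "(\<Sum>j<n. s j) = (\<Sum>j<n. t j)"
    and eta_le: "\<And>k. k < n \<Longrightarrow> \<bar>eta n s t H k\<bar> \<le> z * sqrt (real n)"
    and nonempty: "Mat n H s t \<noteq> {}"
begin

abbreviation M where "M \<equiv> Mat n H s t"
abbreviation et where "et \<equiv> eta n s t H"

text \<open>The additive correction makes all row and column sums of xi vanish.\<close>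

definition xi :: "arcs \<Rightarrow> nat \<Rightarrow> nat \<Rightarrow> real" where
  "xi G i k = ent G i k - L - dl i / n - et k / n + L * X / n^2"

definition EE :: "(arcs \<Rightarrow> real) \<Rightarrow> real" where
  "EE f = (\<Sum>G\<in>M. f G) / card M"

text \<open>The failure probability is at most m / n^10. The factor m stays visible so that events
  can be intersected over up to n columns before the result is used.\<close>

definition hp :: "real \<Rightarrow> (arcs \<Rightarrow> bool) \<Rightarrow> bool" where
  "hp m A \<longleftrightarrow> real (card {G\<in>M. \<not> A G}) * real n ^ 10 \<le> m * card M"

lemma card_M: "0 < real (card M)" using nonempty finite_Mat by (simp add: card_gt_0_iff)

lemma EE_add: "EE (\<lambda>G. f G + g G) = EE f + EE g"
  by (simp add: EE_def sum.distrib add_divide_distrib)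
lemma EE_diff: "EE (\<lambda>G. f G - g G) = EE f - EE g"
  by (simp add: EE_def sum_subtractf diff_divide_distrib)
lemma EE_cmult: "EE (\<lambda>G. c * f G) = c * EE f"
  by (simp add: EE_def sum_distrib_left[symmetric])
lemma EE_cmult2: "EE (\<lambda>G. f G * c) = EE f * c"
  by (simp add: EE_def sum_distrib_right[symmetric])
lemma EE_divide: "EE (\<lambda>G. f G / c) = EE f / c"
  by (simp add: EE_def sum_divide_distrib[symmetric])
lemma EE_minus: "EE (\<lambda>G. - f G) = - EE f"
  by (simp add: EE_def sum_negf)
lemma EE_const: "EE (\<lambda>G. c) = c" using card_M by (simp add: EE_def)
lemma EE_sum: "EE (\<lambda>G. \<Sum>i\<in>I. f i G) = (\<Sum>i\<in>I. EE (f i))"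
  by (simp add: EE_def sum_divide_distrib[symmetric]) (subst sum.swap, simp)
lemma EE_cong: "(\<And>G. G \<in> M \<Longrightarrow> f G = g G) \<Longrightarrow> EE f = EE g"
  by (simp add: EE_def)
lemma EE_mono: "(\<And>G. G \<in> M \<Longrightarrow> f G \<le> g G) \<Longrightarrow> EE f \<le> EE g"
  using card_M by (simp add: EE_def divide_right_mono sum_mono)
lemma EE_abs: "\<bar>EE f\<bar> \<le> EE (\<lambda>G. \<bar>f G\<bar>)"
  using card_M by (simp add: EE_def divide_right_mono)
lemma EE_bound: assumes "\<And>G. G \<in> M \<Longrightarrow> \<bar>f G\<bar> \<le> c" shows "\<bar>EE f\<bar> \<le> c"
proof -
  have "\<bar>EE f\<bar> \<le> EE (\<lambda>G. \<bar>f G\<bar>)" by (rule EE_abs)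
  also have "\<dots> \<le> EE (\<lambda>G. c)" using assms by (rule EE_mono)
  finally show ?thesis by (simp add: EE_const)
qed

lemma hp_mono: assumes "hp m A" "\<And>G. G \<in> M \<Longrightarrow> A G \<Longrightarrow> B G" "m \<le> m'" shows "hp m' B"
proof -
  have "card {G\<in>M. \<not> B G} \<le> card {G\<in>M. \<not> A G}" using assms(2) by (intro card_mono) (auto simp: finite_Mat)
  then have "real (card {G\<in>M. \<not> B G}) * real n ^ 10 \<le> real (card {G\<in>M. \<not> A G}) * real n ^ 10"
    by (intro mult_right_mono) auto
  also have "\<dots> \<le> m * card M" using assms(1) by (simp add: hp_def)
  also have "\<dots> \<le> m' * card M" using assms(3) by (intro mult_right_mono) auto
  finally show ?thesis by (simp add: hp_def)
qed

lemma hp_conj: assumes "hp m A" "hp m' B" shows "hp (m + m') (\<lambda>G. A G \<and> B G)"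
proof -
  have "card {G\<in>M. \<not> (A G \<and> B G)} \<le> card ({G\<in>M. \<not> A G} \<union> {G\<in>M. \<not> B G})"
    by (intro card_mono) (auto simp: finite_Mat)
  also have "\<dots> \<le> card {G\<in>M. \<not> A G} + card {G\<in>M. \<not> B G}" by (rule card_Un_le)
  finally have "real (card {G\<in>M. \<not> (A G \<and> B G)}) \<le> real (card {G\<in>M. \<not> A G}) + real (card {G\<in>M. \<not> B G})" by linarith
  then have "real (card {G\<in>M. \<not> (A G \<and> B G)}) * real n ^ 10 \<le> (real (card {G\<in>M. \<not> A G}) + real (card {G\<in>M. \<not> B G})) * real n ^ 10"
    by (intro mult_right_mono) auto
  then show ?thesis using assms unfolding hp_def by (simp add: distrib_right)
qed

lemma hp_all:
  assumes "finite I" "\<And>d. d \<in> I \<Longrightarrow> hp m (A d)"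
  shows "hp (real (card I) * m) (\<lambda>G. \<forall>d\<in>I. A d G)"
  using assms
proof (induction I rule: finite_induct)
  case empty then show ?case by (simp add: hp_def)
next
  case (insert x F)
  then have "hp (m + real (card F) * m) (\<lambda>G. A x G \<and> (\<forall>d\<in>F. A d G))" by (intro hp_conj) auto
  then show ?case using insert.hyps by (simp add: algebra_simps)
qed

text \<open>Off the good event the integrand is at most n^6, on a set of probability at most n /
  n^10. The resulting n^(-3) is negligible against the main bounds.\<close>

lemma EE_bound_hp:
  assumes "hp m A" "m \<le> real n" "\<And>G. G \<in> M \<Longrightarrow> A G \<Longrightarrow> \<bar>f G\<bar> \<le> c" "\<And>G. G \<in> M \<Longrightarrow> \<bar>f G\<bar> \<le> real n ^ 6" "c \<ge> 0"
  shows "\<bar>EE f\<bar> \<le> c + 1 / real n ^ 3"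
proof -
  have "\<bar>EE f\<bar> \<le> EE (\<lambda>G. \<bar>f G\<bar>)" by (rule EE_abs)
  also have "\<dots> \<le> EE (\<lambda>G. c + real n ^ 6 * of_bool (\<not> A G))"
  proof (rule EE_mono)
    fix G assume "G \<in> M"
    then show "\<bar>f G\<bar> \<le> c + real n ^ 6 * of_bool (\<not> A G)"
      using assms(3)[of G] assms(4)[of G] assms(5) by (cases "A G") auto
  qed
  also have "\<dots> = c + real n ^ 6 * EE (\<lambda>G. of_bool (\<not> A G))" by (simp add: EE_add EE_cmult EE_const)
  also have "EE (\<lambda>G. of_bool (\<not> A G)) = real (card {G\<in>M. \<not> A G}) / card M"
    unfolding EE_def by (simp add: of_bool_def sum.If_cases finite_Mat Int_def)
  also have "c + real n ^ 6 * (real (card {G\<in>M. \<not> A G}) / card M) \<le> c + real n ^ 6 * (real n / real n ^ 10)"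
  proof (intro add_left_mono mult_left_mono)
    have "real (card {G\<in>M. \<not> A G}) * real n ^ 10 \<le> real n * card M"
      using assms(1,2) card_M unfolding hp_def by (meson mult_right_mono order_trans less_imp_le)
    then show "real (card {G\<in>M. \<not> A G}) / card M \<le> real n / real n ^ 10"
      using card_M n_pos by (simp add: field_simps)
  qed auto
  also have "real n ^ 6 * (real n / real n ^ 10) = 1 / real n ^ 3" using n_pos by (simp add: field_simps flip: power_Suc power_add)
  finally show ?thesis by simp
qed

lemma row_sum: assumes "G \<in> M" "i < n" shows "(\<Sum>k<n. ent G i k) = real n * L + dl i"
proof -
  have sub: "G \<subseteq> {..<n} \<times> {..<n} - H" and deg: "outdeg G i = s i" using assms by (auto simp: Mat_def)
  have "(\<Sum>k<n. ent G i k) = (\<Sum>k<n. of_bool ((i,k) \<in> G) + L * of_bool ((i,k) \<in> H))"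
    using sub by (intro sum.cong) (auto simp: ent_def)
  also have "\<dots> = real (card ({..<n} \<inter> {k. (i,k) \<in> G})) + L * real (card ({..<n} \<inter> {k. (i,k) \<in> H}))"
    by (simp add: sum.distrib sum_distrib_left[symmetric] of_bool_def sum.If_cases)
  also have "{..<n} \<inter> {k. (i,k) \<in> G} = {k. (i,k) \<in> G}" using sub by auto
  also have "{..<n} \<inter> {k. (i,k) \<in> H} = {k. (i,k) \<in> H}" using H_sub by auto
  finally show ?thesis using deg avg_L by (simp add: outdeg_def[symmetric] delta_def)
qed

lemma col_sum: assumes "G \<in> M" "k < n" shows "(\<Sum>i<n. ent G i k) = real n * L + et k"
proof -
  have sub: "G \<subseteq> {..<n} \<times> {..<n} - H" and deg: "indeg G k = t k" using assms by (auto simp: Mat_def)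
  have "(\<Sum>i<n. ent G i k) = (\<Sum>i<n. of_bool ((i,k) \<in> G) + L * of_bool ((i,k) \<in> H))"
    using sub by (intro sum.cong) (auto simp: ent_def)
  also have "\<dots> = real (card ({..<n} \<inter> {i. (i,k) \<in> G})) + L * real (card ({..<n} \<inter> {i. (i,k) \<in> H}))"
    by (simp add: sum.distrib sum_distrib_left[symmetric] of_bool_def sum.If_cases)
  also have "{..<n} \<inter> {i. (i,k) \<in> G} = {i. (i,k) \<in> G}" using sub by auto
  also have "{..<n} \<inter> {i. (i,k) \<in> H} = {i. (i,k) \<in> H}" using H_sub by auto
  finally show ?thesis using deg avg_L by (simp add: indeg_def[symmetric] eta_def)
qed

lemma sum_et: "(\<Sum>k<n. et k) = L * X"
proof -
  have "(\<Sum>k<n. et k) = (\<Sum>i<n. real (t i)) - real n * avg_deg n s + L * X"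
    by (simp add: eta_def sum.distrib sum_subtractf sum_distrib_left[symmetric] sum_in)
  moreover have "(\<Sum>i<n. real (t i)) = (\<Sum>i<n. real (s i))" using sum_eq by (simp flip: of_nat_sum)
  ultimately show ?thesis using n_pos by (simp add: avg_deg_def)
qed

lemma xi_row: assumes "G \<in> M" "i < n" shows "(\<Sum>k<n. xi G i k) = 0"
proof -
  have "(\<Sum>k<n. xi G i k) = (\<Sum>k<n. ent G i k) - n * L - dl i - (\<Sum>k<n. et k) / n + L * X / n"
    using n_pos by (simp add: xi_def sum.distrib sum_subtractf sum_divide_distrib[symmetric] power2_eq_square)
  then show ?thesis using row_sum[OF assms] sum_et by simp
qed

lemma xi_col: assumes "G \<in> M" "k < n" shows "(\<Sum>i<n. xi G i k) = 0"
proof -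
  have "(\<Sum>i<n. xi G i k) = (\<Sum>i<n. ent G i k) - n * L - (\<Sum>i<n. dl i) / n - et k + L * X / n"
    using n_pos by (simp add: xi_def sum.distrib sum_subtractf sum_divide_distrib[symmetric] power2_eq_square)
  then show ?thesis using col_sum[OF assms] sum_dl by simp
qed

lemma et_n: "k < n \<Longrightarrow> \<bar>et k / n\<bar> \<le> z / r"
  using eta_le[of k] n_pos zr_n by (simp add: abs_div) (metis divide_right_mono of_nat_0_le_iff)

lemma ent_xi: "i < n \<Longrightarrow> k < n \<Longrightarrow> \<bar>ent G i k - L - xi G i k\<bar> \<le> 3 * z / r"
proof -
  assume "i < n" "k < n"
  then have "\<bar>dl i / n\<bar> \<le> z / r" "\<bar>et k / n\<bar> \<le> z / r" using dl_n et_n by auto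
  moreover have "ent G i k - L - xi G i k = dl i / n + et k / n - L * X / n^2" by (simp add: xi_def)
  moreover have "3 * z / r = z / r + z / r + z / r" by simp
  ultimately show ?thesis using LX by linarith
qed

lemma xi_le: "i < n \<Longrightarrow> k < n \<Longrightarrow> \<bar>xi G i k\<bar> \<le> 2"
proof -
  assume "i < n" "k < n"
  then have "\<bar>ent G i k - L - xi G i k\<bar> \<le> 3 * z / r" by (rule ent_xi)
  also have "\<dots> \<le> 100 * z ^ 1 / r" using z_pos r_pos by (intro divide_right_mono) auto
  also have "\<dots> \<le> 1" by (rule zr_small) simp
  finally show ?thesis using ent_01[of G i k] L01 by linarith
qed

lemma xi_H: "i < n \<Longrightarrow> k < n \<Longrightarrow> (i,k) \<in> H \<Longrightarrow> \<bar>xi G i k\<bar> \<le> 3 * z / r"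
  using ent_xi[of i k G] by (simp add: ent_def)

section \<open>Differences of two columns and concentration of weighted column sums\<close>

definition sg :: "nat set \<Rightarrow> nat \<Rightarrow> nat \<Rightarrow> arcs \<Rightarrow> real" where
  "sg J b d G = real (card (drows H b d J G)) - real (card (drows H d b J G))"

definition dd :: "nat set \<Rightarrow> nat \<Rightarrow> nat \<Rightarrow> arcs \<Rightarrow> real" where
  "dd J b d G = real (card (drows H b d J G)) + real (card (drows H d b J G))"

text \<open>The column sums determine U - V except for the contribution of the rows with forbidden
  cells. So the difference has size z r on every matrix, and only U + V needs a probabilistic
  argument.\<close>

lemma sg_eq:
  assumes "G \<in> M" "b < n" "d < n"
  shows "sg {..<n} b d G = et b - et d - (\<Sum>i\<in>bad b d. ent G i b - ent G i d)"
proof -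
  have "{..<n} \<inter> bad b d = bad b d" by (auto simp: bad_def)
  then show ?thesis
    using diff_decomp[of "{..<n}" "\<lambda>_. 1" G b d] col_sum[OF assms(1,2)] col_sum[OF assms(1,3)]
    by (simp add: sg_def sum_subtractf)
qed

lemma sum_bad_le:
  assumes "b < n" "d < n" "\<And>i. i < n \<Longrightarrow> \<bar>w i\<bar> \<le> 1"
  shows "\<bar>\<Sum>i\<in>bad b d. w i * (ent G i b - ent G i d)\<bar> \<le> card (bad b d)"
proof -
  have "\<bar>\<Sum>i\<in>bad b d. w i * (ent G i b - ent G i d)\<bar> \<le> (\<Sum>i\<in>bad b d. \<bar>w i * (ent G i b - ent G i d)\<bar>)" by (rule sum_abs)
  also have "\<dots> \<le> (\<Sum>i\<in>bad b d. 1)"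
  proof (rule sum_mono)
    fix i assume "i \<in> bad b d"
    then have "\<bar>w i\<bar> * \<bar>ent G i b - ent G i d\<bar> \<le> 1 * 1"
      using assms ent_diff_le[of G i b G i d] by (intro mult_mono) (auto simp: bad_def)
    then show "\<bar>w i * (ent G i b - ent G i d)\<bar> \<le> 1" by (simp add: abs_mult)
  qed
  finally show ?thesis by simp
qed

lemma sg_le: assumes "G \<in> M" "b < n" "d < n" shows "\<bar>sg {..<n} b d G\<bar> \<le> 4 * z * r"
  using sg_eq[OF assms] sum_bad_le[OF assms(2,3), of "\<lambda>_. 1" G] card_bad_zr[OF assms(2,3)] eta_le[OF assms(2)] eta_le[OF assms(3)]
  by simp

lemma sum_drows_le:
  assumes J: "J \<subseteq> {..<n}" and "\<And>i. i < n \<Longrightarrow> \<bar>w i\<bar> \<le> (1::real)"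
  shows "\<bar>(\<Sum>i\<in>drows H b d J G. w i) + (\<Sum>i\<in>drows H d b J G. w i)\<bar> \<le> dd J b d G"
proof -
  have 1: "\<bar>\<Sum>i\<in>drows H b d J G. w i\<bar> \<le> card (drows H b d J G)" for b d
  proof -
    have "\<bar>\<Sum>i\<in>drows H b d J G. w i\<bar> \<le> (\<Sum>i\<in>drows H b d J G. 1)"
      using assms by (intro order_trans[OF sum_abs] sum_mono) (auto simp: drows_def)
    then show ?thesis by simp
  qed
  show ?thesis using 1[of b d] 1[of d b] by (simp add: dd_def)
qed

lemma ratio_le:
  assumes J: "J \<subseteq> {..<n}" and "\<And>i. i < n \<Longrightarrow> \<bar>w i\<bar> \<le> (1::real)"
  shows "\<bar>sg J b d G / dd J b d G * ((\<Sum>i\<in>drows H b d J G. w i) + (\<Sum>i\<in>drows H d b J G. w i))\<bar> \<le> \<bar>sg J b d G\<bar>"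
proof -
  have "dd J b d G \<ge> 0" by (simp add: dd_def)
  have le: "\<bar>(\<Sum>i\<in>drows H b d J G. w i) + (\<Sum>i\<in>drows H d b J G. w i)\<bar> \<le> dd J b d G"
    by (rule sum_drows_le[OF assms])
  have "\<bar>sg J b d G / dd J b d G * ((\<Sum>i\<in>drows H b d J G. w i) + (\<Sum>i\<in>drows H d b J G. w i))\<bar>
    = \<bar>sg J b d G\<bar> / dd J b d G * \<bar>(\<Sum>i\<in>drows H b d J G. w i) + (\<Sum>i\<in>drows H d b J G. w i)\<bar>"
    using \<open>dd J b d G \<ge> 0\<close> by (simp add: abs_mult)
  also have "\<dots> \<le> \<bar>sg J b d G\<bar> / dd J b d G * dd J b d G"
    using le \<open>dd J b d G \<ge> 0\<close> by (intro mult_left_mono) auto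
  also have "\<dots> \<le> \<bar>sg J b d G\<bar>" by simp
  finally show ?thesis .
qed

lemma xi_diff_sum:
  "(\<Sum>i<n. w i * (xi G i b - xi G i d)) = (\<Sum>i<n. w i * (ent G i b - ent G i d)) - (et b - et d) / n * (\<Sum>i<n. w i)"
proof -
  have "(\<Sum>i<n. w i * (xi G i b - xi G i d)) = (\<Sum>i<n. w i * (ent G i b - ent G i d) - (et b - et d) / n * w i)"
    by (intro sum.cong refl) (simp add: xi_def algebra_simps diff_divide_distrib)
  then show ?thesis by (simp add: sum_subtractf sum_distrib_left)
qed

text \<open>Splits off the part that has mean zero under switchings. Each remaining term is at most
  of order z r, by the bounds on U - V, on the number of forbidden cells in a column, and on
  eta.\<close>

lemma xi_diff_decomp:
  "(\<Sum>i<n. w i G * (xi G i b - xi G i d)) = swdev H b d {..<n} w G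
     + sg {..<n} b d G / dd {..<n} b d G * ((\<Sum>i\<in>drows H b d {..<n} G. w i G) + (\<Sum>i\<in>drows H d b {..<n} G. w i G))
     + (\<Sum>i\<in>bad b d. w i G * (ent G i b - ent G i d)) - (et b - et d) / n * (\<Sum>i<n. w i G)"
proof -
  have "{..<n} \<inter> bad b d = bad b d" by (auto simp: bad_def)
  then show ?thesis using diff_decomp[of "{..<n}" "\<lambda>i. w i G" G b d]
    by (simp add: xi_diff_sum[of "\<lambda>i. w i G"] swdev_def sg_def dd_def)
qed

lemma et_diff_sum_le:
  assumes "b < n" "d < n" "\<And>i. i < n \<Longrightarrow> \<bar>w i\<bar> \<le> (1::real)"
  shows "\<bar>(et b - et d) / n * (\<Sum>i<n. w i)\<bar> \<le> 2 * z * r"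
proof -
  have "\<bar>\<Sum>i<n. w i\<bar> \<le> (\<Sum>i<n. 1)" using assms by (intro order_trans[OF sum_abs] sum_mono) auto
  then have "\<bar>\<Sum>i<n. w i\<bar> \<le> n" by simp
  then have "\<bar>(et b - et d) / n\<bar> * \<bar>\<Sum>i<n. w i\<bar> \<le> \<bar>(et b - et d) / n\<bar> * n" by (intro mult_left_mono) auto
  also have "\<dots> = \<bar>et b - et d\<bar>" using n_pos by (simp add: abs_div)
  also have "\<dots> \<le> 2 * z * r" using eta_le[OF assms(1)] eta_le[OF assms(2)] by linarith
  finally show ?thesis by (simp add: abs_mult)
qed

text \<open>The tail bound is taken at y = 2z. One factor exp (-z) absorbs the constants, the other
  one beats n^11.\<close>

lemma swdev_hp:
  assumes bd: "b < n" "d < n" "b \<noteq> d" and J: "J \<subseteq> {..<n}"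
    and w: "\<And>i. dep S (w i)" "S \<inter> (J \<times> {b,d}) = {}" "\<And>i G. \<bar>w i G\<bar> \<le> 1"
  shows "hp (1 / n) (\<lambda>G. \<bar>swdev H b d J w G\<bar> \<le> 2 * z * r)"
proof -
  have "real (card {G\<in>M. \<bar>swdev H b d J w G\<bar> > (2 * z) * r}) \<le> 2 * exp (2 - 2 * z) * card M"
    by (rule swdev_tail[OF bd J _ w(3)]) (rule dep_sw[OF w(1,2)])
  then have "real (card {G\<in>M. \<not> \<bar>swdev H b d J w G\<bar> \<le> 2 * z * r}) * real n ^ 10 \<le> 2 * exp (2 - 2 * z) * card M * real n ^ 10"
    by (intro mult_right_mono) (auto simp: not_le)
  also have "\<dots> \<le> 1 / n * card M"
  proof -
    have "2 * exp (2 - 2 * z) = 2 * exp (2 - z) * exp (- z)" by (simp flip: exp_add)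
    also have "\<dots> \<le> 1 * exp (- z)"
    proof (intro mult_right_mono)
      have "2 * exp (2 - z) \<le> exp 1 * exp (2 - z)" using exp_ge_add_one_self[of 1] by (intro mult_right_mono) auto
      also have "\<dots> \<le> 1" using z_ge by (simp flip: exp_add)
      finally show "2 * exp (2 - z) \<le> 1" .
    qed simp
    finally have "2 * exp (2 - 2 * z) * real n ^ 10 * n \<le> exp (- z) * real n ^ 10 * n"
      by (intro mult_right_mono) auto
    also have "\<dots> = exp (- z) * real n ^ 11" by (simp add: power_Suc[symmetric] mult_ac flip: power_Suc)
    also have "\<dots> \<le> exp (- z) * real n ^ 40" using n_ge by (intro mult_left_mono power_increasing) auto
    also have "\<dots> \<le> 1" by (rule exp_z)
    finally have "2 * exp (2 - 2 * z) * real n ^ 10 \<le> 1 / n" using n_pos by (simp add: field_simps)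
    then have "2 * exp (2 - 2 * z) * real n ^ 10 * card M \<le> 1 / n * card M" by (intro mult_right_mono) auto
    then show ?thesis by (simp add: mult_ac)
  qed
  finally show ?thesis by (simp add: hp_def)
qed

text \<open>Because the row sums of \<open>xi\<close> vanish, an entry is the average of its
  differences to all entries of its row. This converts statements about pairs of columns, accessible
  to switchings, into statements about one column.\<close>

lemma n_xi: assumes "G \<in> M" "i < n" shows "real n * xi G i b = (\<Sum>d<n. xi G i b - xi G i d)"
  using xi_row[OF assms] by (simp add: sum_subtractf)

lemma n_wxi: assumes "G \<in> M" shows "real n * (\<Sum>i<n. w i * xi G i b) = (\<Sum>d<n. \<Sum>i<n. w i * (xi G i b - xi G i d))"
proof -
  have "real n * (\<Sum>i<n. w i * xi G i b) = (\<Sum>i<n. w i * (real n * xi G i b))" by (simp add: sum_distrib_left mult_ac)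
  also have "\<dots> = (\<Sum>i<n. \<Sum>d<n. w i * (xi G i b - xi G i d))"
    by (intro sum.cong refl) (simp add: n_xi[OF assms] sum_distrib_left)
  also have "\<dots> = (\<Sum>d<n. \<Sum>i<n. w i * (xi G i b - xi G i d))" by (rule sum.swap)
  finally show ?thesis .
qed

lemma xi_diff_crude:
  assumes "b < n" "d < n" "\<And>i. i < n \<Longrightarrow> \<bar>w i\<bar> \<le> (1::real)"
  shows "\<bar>\<Sum>i<n. w i * (xi G i b - xi G i d)\<bar> \<le> 4 * n"
proof -
  have "\<bar>\<Sum>i<n. w i * (xi G i b - xi G i d)\<bar> \<le> (\<Sum>i<n. 4)"
  proof (intro order_trans[OF sum_abs] sum_mono)
    fix i assume "i \<in> {..<n}"
    then have "\<bar>w i\<bar> * \<bar>xi G i b - xi G i d\<bar> \<le> 1 * 4"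
      using assms(3)[of i] xi_le[of i b G] xi_le[of i d G] assms(1,2) by (intro mult_mono) auto
    then show "\<bar>w i * (xi G i b - xi G i d)\<bar> \<le> 4" by (simp add: abs_mult)
  qed
  then show ?thesis by simp
qed

text \<open>Switchings between \<open>b\<close> and a column \<open>d\<close> outside
  \<open>K\<close> leave the weights alone, so the deviation bound applies to each such difference.
  The sum over \<open>d\<close> then gives column \<open>b\<close>; the at most four columns in
  \<open>insert b K\<close> are bounded trivially.\<close>

lemma conc:
  assumes b: "b < n" "b \<notin> K" and K: "finite K" "card K \<le> 3"
    and w: "\<And>i. dep (UNIV \<times> K) (w i)" "\<And>i G. \<bar>w i G\<bar> \<le> 1"
  shows "hp 1 (\<lambda>G. \<bar>\<Sum>i<n. w i G * xi G i b\<bar> \<le> z ^ 2 * r)"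
proof -
  let ?I = "{..<n} - insert b K"
  have "hp (real (card ?I) * (1 / n)) (\<lambda>G. \<forall>d\<in>?I. \<bar>swdev H b d {..<n} w G\<bar> \<le> 2 * z * r)"
  proof (rule hp_all)
    fix d assume "d \<in> ?I"
    then show "hp (1 / n) (\<lambda>G. \<bar>swdev H b d {..<n} w G\<bar> \<le> 2 * z * r)"
      using b w by (intro swdev_hp[where S = "UNIV \<times> K"]) auto
  qed simp
  then show ?thesis
  proof (rule hp_mono)
    have "card ?I \<le> card {..<n}" by (intro card_mono) auto
    then show "real (card ?I) * (1 / n) \<le> 1" using n_pos by simp
    fix G assume G: "G \<in> M" and A: "\<forall>d\<in>?I. \<bar>swdev H b d {..<n} w G\<bar> \<le> 2 * z * r"
    have d1: "\<bar>\<Sum>i<n. w i G * (xi G i b - xi G i d)\<bar> \<le> 10 * z * r" if d: "d \<in> ?I" for d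
    proof -
      have "d < n" using d by auto
      have "\<bar>swdev H b d {..<n} w G\<bar> \<le> 2 * z * r" using A d by blast
      moreover have "\<bar>sg {..<n} b d G / dd {..<n} b d G * ((\<Sum>i\<in>drows H b d {..<n} G. w i G) + (\<Sum>i\<in>drows H d b {..<n} G. w i G))\<bar> \<le> 4 * z * r"
        using ratio_le[of "{..<n}" "\<lambda>i. w i G" b d G] w(2) sg_le[OF G b(1) \<open>d < n\<close>] by fastforce
      moreover have "\<bar>\<Sum>i\<in>bad b d. w i G * (ent G i b - ent G i d)\<bar> \<le> 2 * z * r"
        using sum_bad_le[OF b(1) \<open>d < n\<close>, of "\<lambda>i. w i G" G] w(2) card_bad_zr[OF b(1) \<open>d < n\<close>] by fastforce
      moreover have "\<bar>(et b - et d) / n * (\<Sum>i<n. w i G)\<bar> \<le> 2 * z * r"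
        using et_diff_sum_le[OF b(1) \<open>d < n\<close>, of "\<lambda>i. w i G"] w(2) by blast
      ultimately show ?thesis unfolding xi_diff_decomp by linarith
    qed
    have "real n * \<bar>\<Sum>i<n. w i G * xi G i b\<bar> = \<bar>\<Sum>d<n. \<Sum>i<n. w i G * (xi G i b - xi G i d)\<bar>"
      unfolding n_wxi[OF G, symmetric] by (simp add: abs_mult)
    also have "\<dots> \<le> (\<Sum>d<n. \<bar>\<Sum>i<n. w i G * (xi G i b - xi G i d)\<bar>)" by (rule sum_abs)
    also have "\<dots> \<le> (\<Sum>d<n. 10 * z * r + (if d \<in> insert b K then 4 * n else 0))"
    proof (rule sum_mono)
      fix d assume "d \<in> {..<n}"
      then show "\<bar>\<Sum>i<n. w i G * (xi G i b - xi G i d)\<bar> \<le> 10 * z * r + (if d \<in> insert b K then 4 * n else 0)"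
        using d1[of d] xi_diff_crude[of b d "\<lambda>i. w i G" G] b w(2) z_pos r_pos
        by (auto intro: order_trans)
    qed
    also have "\<dots> = n * (10 * z * r) + 4 * n * card ({..<n} \<inter> insert b K)"
      by (simp add: sum.distrib sum.If_cases if_distrib[of real] cong: if_cong) (simp add: Int_def)
    also have "\<dots> \<le> n * (10 * z * r) + 4 * n * 4"
    proof -
      have "card ({..<n} \<inter> insert b K) \<le> card (insert b K)" using K by (intro card_mono) auto
      also have "\<dots> \<le> 4" using K by (simp add: card_insert_if)
      finally have "real (card ({..<n} \<inter> insert b K)) \<le> 4" by linarith
      then have "4 * real n * real (card ({..<n} \<inter> insert b K)) \<le> 4 * real n * 4" by (intro mult_left_mono) auto
      then show ?thesis by simp
    qed
    also have "\<dots> \<le> n * (z ^ 2 * r)"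
    proof -
      have "16 \<le> z * r" using mult_mono[of 1 z 16 r] z_ge r_ge by simp
      then have "10 * z * r + 16 \<le> 11 * (z ^ 1 * r)" by simp
      also have "\<dots> \<le> z ^ 2 * r" using absorb[of r 11 1] r_pos by (simp add: numeral_2_eq_2)
      finally have "real n * (10 * z * r + 16) \<le> n * (z ^ 2 * r)" by (intro mult_left_mono) auto
      then show ?thesis by (simp add: algebra_simps)
    qed
    finally show "\<bar>\<Sum>i<n. w i G * xi G i b\<bar> \<le> z ^ 2 * r" using n_pos by simp
  qed
qed

end

section \<open>Concentration and covariances\<close>

lemma abs_add_le: "\<bar>a\<bar> \<le> x \<Longrightarrow> \<bar>b\<bar> \<le> y \<Longrightarrow> \<bar>a + b\<bar> \<le> x + (y::real)" by linarith
lemma abs_diff_le: "\<bar>a\<bar> \<le> x \<Longrightarrow> \<bar>b\<bar> \<le> y \<Longrightarrow> \<bar>a - b\<bar> \<le> x + (y::real)" by linarith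
lemma abs_mult_le: "\<bar>a\<bar> \<le> x \<Longrightarrow> \<bar>b\<bar> \<le> y \<Longrightarrow> \<bar>a * b\<bar> \<le> x * (y::real)"
  unfolding abs_mult by (intro mult_mono) auto
lemma abs_divide_le: "\<bar>a\<bar> \<le> x \<Longrightarrow> 0 < y \<Longrightarrow> y \<le> b \<Longrightarrow> \<bar>a / b\<bar> \<le> x / (y::real)"
  unfolding abs_divide by (intro frac_le) auto

text \<open>S / D - W / N equals (S - V W - (W / N) (D - V N)) / D, so both deviations enter
  linearly, the second with a coefficient of modulus at most one.\<close>

lemma ratio_perturb:
  fixes S D W N V c z :: real
  assumes "\<bar>S - V * W\<bar> \<le> c" "\<bar>D - V * N\<bar> \<le> c" "\<bar>W / N\<bar> \<le> 1" "N / z \<le> D" "N > 0" "z > 0"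
  shows "\<bar>S / D - W / N\<bar> \<le> 2 * c / (N / z)"
proof -
  have Dp: "D > 0" using assms by (meson divide_pos_pos less_le_trans)
  have "S / D - W / N = (S - V * W - W / N * (D - V * N)) / D"
    using Dp assms(5) by (simp add: field_simps)
  also have "\<bar>\<dots>\<bar> = \<bar>S - V * W - W / N * (D - V * N)\<bar> / D" using Dp by simp
  also have "\<dots> \<le> 2 * c / (N / z)"
  proof (intro frac_le)
    have "\<bar>S - V * W - W / N * (D - V * N)\<bar> \<le> c + 1 * c"
      by (rule abs_diff_le[OF assms(1) abs_mult_le[OF assms(3,2)]])
    then show "\<bar>S - V * W - W / N * (D - V * N)\<bar> \<le> 2 * c" by simp
  qed (use assms in auto)
  finally show ?thesis .
qed

context margins begin

lemma dep_ent: "(i,k) \<in> S \<Longrightarrow> dep S (\<lambda>G. ent G i k)"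
  unfolding ent_def by (rule dep_comp1[of S "\<lambda>G. (i,k) \<in> G" "\<lambda>x. if (i,k) \<in> H then L else of_bool x", OF dep_mem])

lemma dep_xi: "(i,k) \<in> S \<Longrightarrow> dep S (\<lambda>G. xi G i k)"
  unfolding xi_def by (rule dep_comp1[of S "\<lambda>G. ent G i k" "\<lambda>x. x - L - dl i / n - et k / n + L * X / n^2", OF dep_ent])

lemma dep_dd: "J \<times> {b,d} \<subseteq> S \<Longrightarrow> dep S (dd J b d)"
proof -
  assume a: "J \<times> {b,d} \<subseteq> S"
  have 1: "dep S (drows H b d J)" "dep S (drows H d b J)" using a by (intro dep_drows; auto)+
  show ?thesis unfolding dd_def
    using dep_comp2[OF 1, of "\<lambda>x y. real (card x) + real (card y)"] .
qed

lemma dep_sg: "J \<times> {b,d} \<subseteq> S \<Longrightarrow> dep S (sg J b d)"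
proof -
  assume a: "J \<times> {b,d} \<subseteq> S"
  have 1: "dep S (drows H b d J)" "dep S (drows H d b J)" using a by (intro dep_drows; auto)+
  show ?thesis unfolding sg_def
    using dep_comp2[OF 1, of "\<lambda>x y. real (card x) - real (card y)"] .
qed

text \<open>Column \<open>d\<close> becomes part of the weight. The weight is halved because entries
  of \<open>xi\<close> are only bounded by 2, and set to zero for i \<ge> n because the bound on
  weights is demanded for all indices.\<close>

lemma conc_xi:
  assumes b: "b < n" "b \<notin> K" and K: "finite K" "card K \<le> 2" "d \<notin> K" and d: "d < n" "b \<noteq> d"
    and w: "\<And>i. dep (UNIV \<times> K) (w i)" "\<And>i G. \<bar>w i G\<bar> \<le> 1"
  shows "hp 1 (\<lambda>G. \<bar>\<Sum>i<n. w i G * xi G i d * xi G i b\<bar> \<le> 2 * z ^ 2 * r)"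
proof -
  define w' where "w' i G = (if i < n then w i G * xi G i d / 2 else 0)" for i G
  have "hp 1 (\<lambda>G. \<bar>\<Sum>i<n. w' i G * xi G i b\<bar> \<le> z ^ 2 * r)"
  proof (rule conc[of b "insert d K"])
    show "card (insert d K) \<le> 3" using K by (simp add: card_insert_if)
    show "dep (UNIV \<times> insert d K) (w' i)" for i
    proof (cases "i < n")
      case True
      have "dep (UNIV \<times> insert d K) (w i)" using w(1) by (rule dep_mono) auto
      moreover have "dep (UNIV \<times> insert d K) (\<lambda>G. xi G i d)" by (rule dep_xi) auto
      ultimately have "dep (UNIV \<times> insert d K) (\<lambda>G. w i G * xi G i d / 2)"
        by (rule dep_comp2[where h = "\<lambda>x y. x * y / 2"])
      then show ?thesis using True by (simp add: w'_def[abs_def])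
    next
      case False
      then show ?thesis by (simp add: w'_def[abs_def] dep_const)
    qed
    show "\<bar>w' i G\<bar> \<le> 1" for i G
    proof (cases "i < n")
      case True
      then have "\<bar>w i G\<bar> * \<bar>xi G i d\<bar> \<le> 1 * 2" using w(2) xi_le d by (intro mult_mono) auto
      then show ?thesis using True by (simp add: w'_def abs_mult)
    qed (simp add: w'_def)
  qed (use b d K in auto)
  then show ?thesis
  proof (rule hp_mono)
    fix G assume "\<bar>\<Sum>i<n. w' i G * xi G i b\<bar> \<le> z ^ 2 * r"
    moreover have "(\<Sum>i<n. w i G * xi G i d * xi G i b) = 2 * (\<Sum>i<n. w' i G * xi G i b)"
      unfolding sum_distrib_left by (intro sum.cong) (auto simp: w'_def)
    ultimately show "\<bar>\<Sum>i<n. w i G * xi G i d * xi G i b\<bar> \<le> 2 * z ^ 2 * r" by simp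
  qed simp
qed

section \<open>Rows in which two columns differ\<close>

text \<open>Polynomial form of the indicator that exactly one of the two entries is 1, valid in rows
  without forbidden cells. Unlike the indicator it can be expanded in powers of
  \<open>xi\<close>.\<close>

definition fpoly :: "arcs \<Rightarrow> nat \<Rightarrow> nat \<Rightarrow> nat \<Rightarrow> real" where
  "fpoly G b d i = ent G i b + ent G i d - 2 * ent G i b * ent G i d"

lemma fpoly_01: "0 \<le> fpoly G b d i" "fpoly G b d i \<le> 1"
proof -
  let ?a = "ent G i b" and ?b = "ent G i d"
  have "0 \<le> ?a * (1 - ?b)" "0 \<le> ?b * (1 - ?a)" "0 \<le> ?a * ?b" "0 \<le> (1 - ?a) * (1 - ?b)"
    using ent_01 by (auto intro!: mult_nonneg_nonneg)
  then show "0 \<le> fpoly G b d i" "fpoly G b d i \<le> 1" by (auto simp: fpoly_def algebra_simps)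
qed

lemma fpoly_eq: "i < n \<Longrightarrow> i \<notin> bad b d \<Longrightarrow>
   fpoly G b d i = of_bool (i \<in> drows H b d {..<n} G \<or> i \<in> drows H d b {..<n} G)"
  by (auto simp: fpoly_def bad_def ent_def drows_def)

text \<open>Every entry is L + xi up to an error 3 z / r. Substituting this gives the constant term
  2L - 2L^2 = 2v.\<close>

lemma fpoly_expand:
  assumes "i < n" "b < n" "d < n"
  shows "\<bar>fpoly G b d i - 2 * v - ((1 - 2 * L) * (xi G i b + xi G i d) - 2 * xi G i b * xi G i d)\<bar> \<le> 24 * z / r"
proof -
  define p q where "p = ent G i b - L - xi G i b" and "q = ent G i d - L - xi G i d"
  have p: "\<bar>p\<bar> \<le> 3 * z / r" and q: "\<bar>q\<bar> \<le> 3 * z / r" using ent_xi assms by (auto simp: p_def q_def)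
  have "fpoly G b d i - 2 * v - ((1 - 2 * L) * (xi G i b + xi G i d) - 2 * xi G i b * xi G i d)
    = p * (1 - 2 * ent G i d) + q * (1 - 2 * (L + xi G i b))"
    unfolding fpoly_def p_def q_def by (simp add: algebra_simps)
  also have "\<bar>\<dots>\<bar> \<le> \<bar>p\<bar> * \<bar>1 - 2 * ent G i d\<bar> + \<bar>q\<bar> * \<bar>1 - 2 * (L + xi G i b)\<bar>"
    by (metis abs_mult abs_triangle_ineq)
  also have "\<dots> \<le> 3 * z / r * 1 + 3 * z / r * 7"
  proof (intro add_mono mult_mono p q)
    show "\<bar>1 - 2 * ent G i d\<bar> \<le> 1" using ent_01[of G i d] by linarith
    show "\<bar>1 - 2 * (L + xi G i b)\<bar> \<le> 7" using xi_le[OF assms(1,2), of G] L01 unfolding abs_le_iff by simp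
  qed (use z_pos r_pos in auto)
  finally show ?thesis by simp
qed

lemma sum_drows_fpoly:
  "(\<Sum>i\<in>drows H b d {..<n} G. w i) + (\<Sum>i\<in>drows H d b {..<n} G. w i)
    = (\<Sum>i<n. w i * fpoly G b d i) - (\<Sum>i\<in>bad b d. w i * fpoly G b d i)"
proof -
  have e: "{..<n} \<inter> bad b d = bad b d" by (auto simp: bad_def)
  have "(\<Sum>i<n. w i * fpoly G b d i) = (\<Sum>i<n. (if i \<in> drows H b d {..<n} G then w i else 0)
      + (if i \<in> drows H d b {..<n} G then w i else 0) + (if i \<in> bad b d then w i * fpoly G b d i else 0))"
  proof (intro sum.cong refl)
    fix i assume i: "i \<in> {..<n}"
    show "w i * fpoly G b d i = (if i \<in> drows H b d {..<n} G then w i else 0)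
      + (if i \<in> drows H d b {..<n} G then w i else 0) + (if i \<in> bad b d then w i * fpoly G b d i else 0)"
    proof (cases "i \<in> bad b d")
      case True then show ?thesis by (auto simp: bad_def drows_def)
    next
      case False
      have "\<not> (i \<in> drows H b d {..<n} G \<and> i \<in> drows H d b {..<n} G)" by (auto simp: drows_def)
      then show ?thesis using False i fpoly_eq[of i b d G] by auto
    qed
  qed
  also have "\<dots> = (\<Sum>i\<in>{..<n} \<inter> drows H b d {..<n} G. w i) + (\<Sum>i\<in>{..<n} \<inter> drows H d b {..<n} G. w i)
     + (\<Sum>i\<in>{..<n} \<inter> bad b d. w i * fpoly G b d i)"
    by (simp add: sum.distrib sum.inter_restrict)
  also have "{..<n} \<inter> drows H b d {..<n} G = drows H b d {..<n} G" by (auto simp: drows_def)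
  also have "{..<n} \<inter> drows H d b {..<n} G = drows H d b {..<n} G" by (auto simp: drows_def)
  finally show ?thesis unfolding e by simp
qed

text \<open>In the expansion of \<open>fpoly\<close>, the linear terms concentrate by
  \<open>conc\<close> and the quadratic one by \<open>conc_xi\<close>. Each contributes at most
  order z^2 r, so only the constant 2v survives.\<close>

lemma dconc:
  assumes bd: "b < n" "d < n" "b \<noteq> d" and K: "finite K" "card K \<le> 2" "b \<notin> K" "d \<notin> K"
    and w: "\<And>i. dep (UNIV \<times> K) (w i)" "\<And>i G. \<bar>w i G\<bar> \<le> 1"
  shows "hp 3 (\<lambda>G. \<bar>(\<Sum>i\<in>drows H b d {..<n} G. w i G) + (\<Sum>i\<in>drows H d b {..<n} G. w i G) - 2 * v * (\<Sum>i<n. w i G)\<bar> \<le> z ^ 3 * r)"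
proof -
  have h1: "hp 1 (\<lambda>G. \<bar>\<Sum>i<n. w i G * xi G i b\<bar> \<le> z ^ 2 * r)" using K by (intro conc[OF bd(1) K(3) _ _ w]) auto
  have h2: "hp 1 (\<lambda>G. \<bar>\<Sum>i<n. w i G * xi G i d\<bar> \<le> z ^ 2 * r)" using K by (intro conc[OF bd(2) K(4) _ _ w]) auto
  have h3: "hp 1 (\<lambda>G. \<bar>\<Sum>i<n. w i G * xi G i d * xi G i b\<bar> \<le> 2 * z ^ 2 * r)" using K bd by (intro conc_xi[where K = K] w) auto
  show ?thesis
  proof (rule hp_mono[OF hp_conj[OF hp_conj[OF h1 h2] h3]])
    fix G assume "(\<bar>\<Sum>i<n. w i G * xi G i b\<bar> \<le> z ^ 2 * r \<and> \<bar>\<Sum>i<n. w i G * xi G i d\<bar> \<le> z ^ 2 * r) \<and> \<bar>\<Sum>i<n. w i G * xi G i d * xi G i b\<bar> \<le> 2 * z ^ 2 * r"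
    then have a: "\<bar>\<Sum>i<n. w i G * xi G i b\<bar> \<le> z ^ 2 * r" "\<bar>\<Sum>i<n. w i G * xi G i d\<bar> \<le> z ^ 2 * r" "\<bar>\<Sum>i<n. w i G * xi G i d * xi G i b\<bar> \<le> 2 * z ^ 2 * r" by auto
    let ?E = "\<lambda>i. fpoly G b d i - 2 * v - ((1 - 2 * L) * (xi G i b + xi G i d) - 2 * xi G i b * xi G i d)"
    have E: "\<bar>\<Sum>i<n. w i G * ?E i\<bar> \<le> 24 * z * r"
    proof -
      have "\<bar>\<Sum>i<n. w i G * ?E i\<bar> \<le> (\<Sum>i<n. 24 * z / r)"
      proof (intro order_trans[OF sum_abs] sum_mono)
        fix i assume "i \<in> {..<n}"
        then have "\<bar>w i G\<bar> * \<bar>?E i\<bar> \<le> 1 * (24 * z / r)" using w(2) fpoly_expand bd by (intro mult_mono) auto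
        then show "\<bar>w i G * ?E i\<bar> \<le> 24 * z / r" by (simp add: abs_mult)
      qed
      also have "\<dots> = 24 * z * (n / r)" by simp
      also have "n / r = r" by (simp add: real_div_sqrt)
      finally show ?thesis .
    qed
    have B: "\<bar>\<Sum>i\<in>bad b d. w i G * fpoly G b d i\<bar> \<le> 2 * z * r"
    proof -
      have "\<bar>\<Sum>i\<in>bad b d. w i G * fpoly G b d i\<bar> \<le> (\<Sum>i\<in>bad b d. 1)"
      proof (intro order_trans[OF sum_abs] sum_mono)
        fix i
        have "\<bar>w i G\<bar> * \<bar>fpoly G b d i\<bar> \<le> 1 * 1" using w(2) fpoly_01[of G b d i] by (intro mult_mono) auto
        then show "\<bar>w i G * fpoly G b d i\<bar> \<le> 1" by (simp add: abs_mult)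
      qed
      also have "\<dots> \<le> 2 * z * r" using card_bad_zr[OF bd(1,2)] by simp
      finally show ?thesis .
    qed
    have "(\<Sum>i<n. w i G * fpoly G b d i) = (\<Sum>i<n. w i G * ?E i + 2 * v * w i G + (1 - 2 * L) * (w i G * xi G i b) + (1 - 2 * L) * (w i G * xi G i d) - 2 * (w i G * xi G i d * xi G i b))"
      by (intro sum.cong refl) (simp add: algebra_simps)
    also have "\<dots> = (\<Sum>i<n. w i G * ?E i) + 2 * v * (\<Sum>i<n. w i G) + (1 - 2 * L) * (\<Sum>i<n. w i G * xi G i b) + (1 - 2 * L) * (\<Sum>i<n. w i G * xi G i d) - 2 * (\<Sum>i<n. w i G * xi G i d * xi G i b)"
      by (simp only: sum.distrib sum_subtractf sum_distrib_left)
    finally have eq: "(\<Sum>i<n. w i G * fpoly G b d i) - 2 * v * (\<Sum>i<n. w i G) = (\<Sum>i<n. w i G * ?E i) + (1 - 2 * L) * (\<Sum>i<n. w i G * xi G i b) + (1 - 2 * L) * (\<Sum>i<n. w i G * xi G i d) - 2 * (\<Sum>i<n. w i G * xi G i d * xi G i b)" by simp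
    have c: "\<bar>(1 - 2 * L) * u\<bar> \<le> z ^ 2 * r" if "\<bar>u\<bar> \<le> z ^ 2 * r" for u
    proof -
      have "\<bar>1 - 2 * L\<bar> * \<bar>u\<bar> \<le> 1 * (z ^ 2 * r)" using that L01 by (intro mult_mono) auto
      then show ?thesis by (simp add: abs_mult)
    qed
    have "z * r \<le> z ^ 2 * r" using zr_mono[of 1 2 r] by simp
    moreover have "32 * (z ^ 2 * r) \<le> z ^ 3 * r" using absorb[of r 32 2] by (simp add: eval_nat_numeral)
    ultimately show "\<bar>(\<Sum>i\<in>drows H b d {..<n} G. w i G) + (\<Sum>i\<in>drows H d b {..<n} G. w i G) - 2 * v * (\<Sum>i<n. w i G)\<bar> \<le> z ^ 3 * r"
      unfolding sum_drows_fpoly using E B eq c[OF a(1)] c[OF a(2)] a(3) by linarith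
  qed simp
qed

lemma z4: "z ^ 3 * r \<le> n / z"
proof -
  have "z ^ 4 * r \<le> r * r" using z_le_r[of 4] r_pos by (intro mult_right_mono) auto
  then show ?thesis using z_pos by (simp add: field_simps eval_nat_numeral)
qed

lemma dd_conc:
  assumes bd: "b < n" "d < n" "b \<noteq> d"
  shows "hp 3 (\<lambda>G. \<bar>dd {..<n} b d G - 2 * v * n\<bar> \<le> z ^ 3 * r \<and> n / z \<le> dd {..<n} b d G)"
proof (rule hp_mono[OF dconc[OF bd, of "{}" "\<lambda>_ _. 1"]])
  fix G assume a: "\<bar>(\<Sum>i\<in>drows H b d {..<n} G. 1) + (\<Sum>i\<in>drows H d b {..<n} G. 1) - 2 * v * (\<Sum>i<n. 1)\<bar> \<le> z ^ 3 * r"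
  then have b: "\<bar>dd {..<n} b d G - 2 * v * n\<bar> \<le> z ^ 3 * r" by (simp add: dd_def)
  have "1 / z * n \<le> v * n" using v_ge by (intro mult_right_mono) auto
  then show "\<bar>dd {..<n} b d G - 2 * v * n\<bar> \<le> z ^ 3 * r \<and> n / z \<le> dd {..<n} b d G"
    using b z4 by auto
qed (auto simp: dep_const)

text \<open>For weights read off from other columns the switchable rows behave like a typical
  sample: their average weight is the average over all rows up to z^5 / r.\<close>

lemma davg:
  assumes bd: "b < n" "d < n" "b \<noteq> d" and K: "finite K" "card K \<le> 2" "b \<notin> K" "d \<notin> K"
    and w: "\<And>i. dep (UNIV \<times> K) (w i)" "\<And>i G. \<bar>w i G\<bar> \<le> 1"
  shows "hp 6 (\<lambda>G. \<bar>((\<Sum>i\<in>drows H b d {..<n} G. w i G) + (\<Sum>i\<in>drows H d b {..<n} G. w i G)) / dd {..<n} b d G - (\<Sum>i<n. w i G) / n\<bar> \<le> z ^ 5 / r)"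
proof (rule hp_mono[OF hp_conj[OF dconc[OF assms] dd_conc[OF bd]]])
  fix G
  let ?S = "(\<Sum>i\<in>drows H b d {..<n} G. w i G) + (\<Sum>i\<in>drows H d b {..<n} G. w i G)" and ?W = "\<Sum>i<n. w i G" and ?D = "dd {..<n} b d G"
  assume "\<bar>?S - 2 * v * ?W\<bar> \<le> z ^ 3 * r \<and> \<bar>?D - 2 * v * n\<bar> \<le> z ^ 3 * r \<and> n / z \<le> ?D"
  then have a: "\<bar>?S - 2 * v * ?W\<bar> \<le> z ^ 3 * r" "\<bar>?D - 2 * v * n\<bar> \<le> z ^ 3 * r" "n / z \<le> ?D" by auto
  have Dp: "?D > 0" using a(3) n_pos z_pos by (meson divide_pos_pos less_le_trans of_nat_0_less_iff)
  have "\<bar>?W\<bar> \<le> (\<Sum>i<n. 1)" using w(2) by (intro order_trans[OF sum_abs] sum_mono) auto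
  then have W: "\<bar>?W / n\<bar> \<le> 1" using n_pos by simp
  have "\<bar>?S / ?D - ?W / n\<bar> \<le> 2 * (z ^ 3 * r) / (n / z)"
    by (rule ratio_perturb[OF a(1,2) W a(3) _ z_pos]) (use n_pos in simp)
  also have "\<dots> = 2 * z ^ 4 * (r / n)" by (simp add: eval_nat_numeral)
  also note r_over_n
  also have "2 * z ^ 4 * (1 / r) \<le> z ^ 5 / r" using absorb[of "1/r" 2 4] r_pos by (simp add: eval_nat_numeral)
  finally show "\<bar>?S / ?D - ?W / n\<bar> \<le> z ^ 5 / r" .
qed simp

lemma sg_over_dd: assumes "J \<subseteq> {..<n}" shows "\<bar>sg J b d G / dd J b d G\<bar> \<le> 1"
proof -
  have "\<bar>sg J b d G\<bar> \<le> dd J b d G" by (simp add: sg_def dd_def)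
  moreover have "dd J b d G \<ge> 0" by (simp add: dd_def)
  ultimately show ?thesis by (auto simp: divide_le_eq_1)
qed

section \<open>Means of single entries and of weighted column sums\<close>

text \<open>In expectation, the difference of the two weighted sums may be replaced by its
  conditional mean. The extra factor \<open>g\<close> is harmless as long as it does not see the
  switched cells.\<close>

lemma mean_id:
  assumes bd: "b < n" "d < n" "b \<noteq> d" and J: "J \<subseteq> {..<n}"
    and w: "\<And>i. dep S (w i)" and g: "dep S g" and S: "S \<inter> (J \<times> {b,d}) = {}"
  shows "EE (\<lambda>G. g G * ((\<Sum>i\<in>drows H b d J G. w i G) - (\<Sum>i\<in>drows H d b J G. w i G)))
    = EE (\<lambda>G. g G * (sg J b d G / dd J b d G * ((\<Sum>i\<in>drows H b d J G. w i G) + (\<Sum>i\<in>drows H d b J G. w i G))))"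
proof -
  have "(\<Sum>G\<in>M. g G * swdev H b d J w G) = 0"
    by (rule stein_mean[OF bd J]) (auto intro: dep_sw[OF w S] dep_sw[OF g S])
  then have "EE (\<lambda>G. g G * swdev H b d J w G) = 0" by (simp add: EE_def)
  then show ?thesis unfolding swdev_def sg_def dd_def right_diff_distrib[of "g _" "_ - _"] EE_diff by simp
qed

text \<open>With the indicator of row \<open>i\<close> as weight, the difference of weighted sums is
  the difference of two entries of that row, and \<open>mean_id\<close> bounds its mean by that of
  |U - V| / (U + V). Averaging over \<open>d\<close> isolates the entry. Removing the row of
  \<open>Q\<close> from the switchings is what allows \<open>g\<close> to depend on that row; a
  forbidden cell has a small deterministic \<open>xi\<close>.\<close>

lemma cell:
  assumes ic: "i < n" "c < n" "c \<notin> K" and K: "finite K" "card K \<le> 3" and Q: "finite Q" "card Q \<le> 1" "i \<notin> Q"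
    and g: "dep (Q \<times> UNIV \<union> UNIV \<times> K) g" "\<And>G. \<bar>g G\<bar> \<le> 1"
  shows "\<bar>EE (\<lambda>G. g G * xi G i c)\<bar> \<le> z ^ 5 / r"
proof (cases "(i,c) \<in> H")
  case True
  have "\<bar>EE (\<lambda>G. g G * xi G i c)\<bar> \<le> 3 * z / r"
  proof (rule EE_bound)
    fix G
    have "\<bar>g G\<bar> * \<bar>xi G i c\<bar> \<le> 1 * (3 * z / r)" using g(2) xi_H[OF ic(1,2) True] by (intro mult_mono) auto
    then show "\<bar>g G * xi G i c\<bar> \<le> 3 * z / r" by (simp add: abs_mult)
  qed
  also have "3 * z / r \<le> z ^ 2 / r" using absorb[of "1/r" 3 1] r_pos by (simp add: numeral_2_eq_2)
  also have "\<dots> \<le> z ^ 5 / r" using zr_mono[of 2 5 "1/r"] r_pos by simp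
  finally show ?thesis .
next
  case False
  let ?J = "{..<n} - Q" and ?S = "Q \<times> UNIV \<union> UNIV \<times> K"
  \<comment> \<open>Columns for which the switching argument fails: those visible to
    \<open>g\<close> and those where row \<open>i\<close> is blocked. There are at most 4 + z r of
    them, so the trivial bound 4 for each costs only order z / r after division by n.\<close>
  let ?bad = "{d. d < n \<and> (d \<in> insert c K \<or> (i,d) \<in> H)}"
  have step: "\<bar>EE (\<lambda>G. g G * (xi G i c - xi G i d))\<bar> \<le> z ^ 4 / r" if d: "d < n" "d \<notin> ?bad" for d
  proof -
    have d': "c \<noteq> d" "d \<notin> K" "(i,d) \<notin> H" using d by auto
    let ?w = "\<lambda>k (G :: arcs). of_bool (k = i) :: real"
    have S: "?S \<inter> (?J \<times> {c,d}) = {}" using ic d' by auto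
    have P: "(\<Sum>k\<in>drows H c' d' ?J G. ?w k G) = of_bool (i \<in> drows H c' d' ?J G)" for c' d' G
      using finite_drows[of ?J n H c' d' G] by (simp add: of_bool_def sum.delta')
    have "g G * (xi G i c - xi G i d) = g G * ((\<Sum>k\<in>drows H c d ?J G. ?w k G) - (\<Sum>k\<in>drows H d c ?J G. ?w k G)) - g G * ((et c - et d) / n)" for G
      unfolding P using ic Q d' False by (auto simp: xi_def ent_def drows_def algebra_simps diff_divide_distrib)
    then have "EE (\<lambda>G. g G * (xi G i c - xi G i d)) =
        EE (\<lambda>G. g G * ((\<Sum>k\<in>drows H c d ?J G. ?w k G) - (\<Sum>k\<in>drows H d c ?J G. ?w k G))) - EE (\<lambda>G. g G * ((et c - et d) / n))"
      by (simp only: EE_diff)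
    also have "EE (\<lambda>G. g G * ((\<Sum>k\<in>drows H c d ?J G. ?w k G) - (\<Sum>k\<in>drows H d c ?J G. ?w k G))) =
      EE (\<lambda>G. g G * (sg ?J c d G / dd ?J c d G * ((\<Sum>k\<in>drows H c d ?J G. ?w k G) + (\<Sum>k\<in>drows H d c ?J G. ?w k G))))"
      using ic d' d by (intro mean_id[OF _ _ _ _ _ g(1) S]) (auto simp: dep_const)
    finally have eq: "EE (\<lambda>G. g G * (xi G i c - xi G i d)) = EE (\<lambda>G. g G * (sg ?J c d G / dd ?J c d G * ((\<Sum>k\<in>drows H c d ?J G. ?w k G) + (\<Sum>k\<in>drows H d c ?J G. ?w k G)))) - EE (\<lambda>G. g G * ((et c - et d) / n))" .
    have of1: "\<bar>(\<Sum>k\<in>drows H c d ?J G. ?w k G) + (\<Sum>k\<in>drows H d c ?J G. ?w k G)\<bar> \<le> 1" for G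
      unfolding P by (auto simp: drows_def)
    have "\<bar>EE (\<lambda>G. g G * (sg ?J c d G / dd ?J c d G * ((\<Sum>k\<in>drows H c d ?J G. ?w k G) + (\<Sum>k\<in>drows H d c ?J G. ?w k G))))\<bar> \<le> z ^ 3 / r + 1 / real n ^ 3"
    proof (rule EE_bound_hp[OF dd_conc[OF ic(2) d(1) d'(1)]])
      fix G assume G: "G \<in> M" and a: "\<bar>dd {..<n} c d G - 2 * v * n\<bar> \<le> z ^ 3 * r \<and> n / z \<le> dd {..<n} c d G"
      \<comment> \<open>Leaving out the row of \<open>Q\<close> changes each count by at most one,
        so the estimates for all rows carry over.\<close>
      have cd: "real (card (drows H b1 d1 {..<n} G)) - 1 \<le> real (card (drows H b1 d1 ?J G))" "real (card (drows H b1 d1 ?J G)) \<le> real (card (drows H b1 d1 {..<n} G))" for b1 d1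
      proof -
        have e: "drows H b1 d1 ?J G = drows H b1 d1 {..<n} G - Q" by (auto simp: drows_def)
        have "card (drows H b1 d1 {..<n} G) - card Q \<le> card (drows H b1 d1 {..<n} G - Q)" by (rule diff_card_le_card_Diff[OF Q(1)])
        then show "real (card (drows H b1 d1 {..<n} G)) - 1 \<le> real (card (drows H b1 d1 ?J G))" unfolding e using Q(2) by linarith
        show "real (card (drows H b1 d1 ?J G)) \<le> real (card (drows H b1 d1 {..<n} G))" unfolding e
          by (intro of_nat_mono card_mono finite_drows) auto
      qed
      have sgle: "\<bar>sg ?J c d G\<bar> \<le> 4 * z * r + 1"
        using sg_le[OF G ic(2) d(1)] cd[of c d] cd[of d c] unfolding sg_def by linarith
      have zr1: "1 \<le> z * r" using zkr[of 1] by simp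
      have ddge: "n / (2 * z) \<le> dd ?J c d G"
      proof -
        have "2 \<le> n / (2 * z)"
        proof -
          have "z * 4 \<le> z * r" using r_ge z_pos by (intro mult_left_mono) linarith+
          then have "4 * z \<le> z * r" by simp
          also have "\<dots> \<le> r * r" using z_le_r[of 1] r_pos by (intro mult_right_mono) auto
          finally show ?thesis using z_pos by (simp add: field_simps)
        qed
        moreover have "n / z = n / (2 * z) + n / (2 * z)" by (simp add: field_simps)
        moreover have "n / z \<le> dd {..<n} c d G" using a by auto
        ultimately show ?thesis using cd[of c d] cd[of d c] unfolding dd_def by linarith
      qed
      have "\<bar>sg ?J c d G / dd ?J c d G\<bar> \<le> (5 * z * r) / (n / (2 * z))"
        using sgle zr1 n_pos z_pos by (intro abs_divide_le ddge) auto
      also have "\<dots> = 10 * z ^ 2 * (r / n)" by (simp add: eval_nat_numeral)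
      also note r_over_n
      also have "10 * z ^ 2 * (1 / r) \<le> z ^ 3 / r" using absorb[of "1/r" 10 2] r_pos by (simp add: eval_nat_numeral)
      finally have le: "\<bar>sg ?J c d G / dd ?J c d G\<bar> \<le> z ^ 3 / r" .
      have "\<bar>g G * (sg ?J c d G / dd ?J c d G * ((\<Sum>k\<in>drows H c d ?J G. ?w k G) + (\<Sum>k\<in>drows H d c ?J G. ?w k G)))\<bar> \<le> 1 * (z ^ 3 / r * 1)"
        by (intro abs_mult_le g(2) le of1)
      then show "\<bar>g G * (sg ?J c d G / dd ?J c d G * ((\<Sum>k\<in>drows H c d ?J G. ?w k G) + (\<Sum>k\<in>drows H d c ?J G. ?w k G)))\<bar> \<le> z ^ 3 / r"
        by simp
    next
      fix G
      have "\<bar>g G * (sg ?J c d G / dd ?J c d G * ((\<Sum>k\<in>drows H c d ?J G. ?w k G) + (\<Sum>k\<in>drows H d c ?J G. ?w k G)))\<bar> \<le> 1 * (1 * 1)"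
        by (intro abs_mult_le g(2) sg_over_dd of1) auto
      also have "1 * (1 * 1) \<le> real n ^ 6" using n_pos by simp
      finally show "\<bar>g G * (sg ?J c d G / dd ?J c d G * ((\<Sum>k\<in>drows H c d ?J G. ?w k G) + (\<Sum>k\<in>drows H d c ?J G. ?w k G)))\<bar> \<le> real n ^ 6" .
    qed (use n_ge z_pos r_pos in auto)
    moreover have "\<bar>EE (\<lambda>G. g G * ((et c - et d) / n))\<bar> \<le> 2 * z / r"
    proof (rule EE_bound)
      fix G
      have "\<bar>(et c - et d) / n\<bar> \<le> 2 * z / r" using abs_diff_le[OF et_n[OF ic(2)] et_n[OF d(1)]] by (simp add: diff_divide_distrib)
      then have "\<bar>g G\<bar> * \<bar>(et c - et d) / n\<bar> \<le> 1 * (2 * z / r)" using g(2) by (intro mult_mono) auto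
      then show "\<bar>g G * ((et c - et d) / n)\<bar> \<le> 2 * z / r" by (simp add: abs_mult)
    qed
    moreover have "z / r \<le> z ^ 3 / r" using zr_mono[of 1 3 "1/r"] r_pos by simp
    moreover have "4 * (z ^ 3 / r) \<le> z ^ 4 / r" using absorb[of "1/r" 4 3] r_pos by (simp add: eval_nat_numeral)
    moreover have "2 * z / r = 2 * (z / r)" by simp
    ultimately show ?thesis unfolding eq using n3[of 3] by linarith
  qed
  have crude: "\<bar>EE (\<lambda>G. g G * (xi G i c - xi G i d))\<bar> \<le> 4" if d: "d < n" for d
  proof (rule EE_bound)
    fix G
    have "\<bar>g G\<bar> * \<bar>xi G i c - xi G i d\<bar> \<le> 1 * 4" using g(2) xi_le[OF ic(1,2), of G] xi_le[OF ic(1) d, of G] by (intro mult_mono) auto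
    then show "\<bar>g G * (xi G i c - xi G i d)\<bar> \<le> 4" by (simp add: abs_mult)
  qed
  have "real n * EE (\<lambda>G. g G * xi G i c) = EE (\<lambda>G. \<Sum>d<n. g G * (xi G i c - xi G i d))"
    unfolding EE_cmult[symmetric] by (rule EE_cong) (simp add: n_xi[OF _ ic(1)] sum_distrib_left[symmetric] mult.left_commute)
  also have "\<dots> = (\<Sum>d<n. EE (\<lambda>G. g G * (xi G i c - xi G i d)))" by (rule EE_sum)
  finally have e: "real n * EE (\<lambda>G. g G * xi G i c) = (\<Sum>d<n. EE (\<lambda>G. g G * (xi G i c - xi G i d)))" .
  have "real n * \<bar>EE (\<lambda>G. g G * xi G i c)\<bar> = \<bar>\<Sum>d<n. EE (\<lambda>G. g G * (xi G i c - xi G i d))\<bar>"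
    unfolding e[symmetric] abs_mult by simp
  also have "\<dots> \<le> (\<Sum>d<n. z ^ 4 / r + (if d \<in> ?bad then 4 else 0))"
  proof (intro order_trans[OF sum_abs] sum_mono)
    fix d assume "d \<in> {..<n}"
    then show "\<bar>EE (\<lambda>G. g G * (xi G i c - xi G i d))\<bar> \<le> z ^ 4 / r + (if d \<in> ?bad then 4 else 0)"
      using step[of d] crude[of d] z_pos r_pos by (auto intro: order_trans)
  qed
  also have "\<dots> = n * (z ^ 4 / r) + 4 * card ({..<n} \<inter> ?bad)" by (simp add: sum.distrib sum.If_cases) (simp add: Int_def)
  also have "\<dots> \<le> n * (z ^ 4 / r) + 4 * (4 + z * r)"
  proof -
    have "card ({..<n} \<inter> ?bad) \<le> card (insert c K \<union> {k. (i,k) \<in> H})"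
      using K finite_row[OF H_sub] by (intro card_mono) auto
    also have "\<dots> \<le> card (insert c K) + outdeg H i" unfolding outdeg_def by (rule card_Un_le)
    also have "\<dots> \<le> 4 + outdeg H i" using K by (simp add: card_insert_if)
    finally have "real (card ({..<n} \<inter> ?bad)) \<le> 4 + z * r" using out_le[OF ic(1)] by linarith
    then show ?thesis by simp
  qed
  also have "n * (z ^ 4 / r) = z ^ 4 * r" using rr r_pos by (simp add: field_simps)
  also have "z ^ 4 * r + 4 * (4 + z * r) \<le> z ^ 5 * r"
  proof -
    have "16 \<le> z ^ 4 * r" using mult_mono[of 1 "z ^ 4" 16 r] z1[of 4] r_ge by simp
    moreover have "z * r \<le> z ^ 4 * r" using zr_mono[of 1 4 r] by simp
    moreover have "6 * (z ^ 4 * r) \<le> z ^ 5 * r" using absorb[of r 6 4] by (simp add: eval_nat_numeral)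
    moreover have "z ^ 4 * r + 4 * (4 + z * r) = z ^ 4 * r + 16 + 4 * (z * r)" by simp
    ultimately show ?thesis by linarith
  qed
  also have "\<dots> = n * (z ^ 5 / r)" using rr r_pos by (simp add: field_simps)
  finally show ?thesis by (rule mult_left_le_imp_le) (use n_pos in simp)
qed

text \<open>A single \<open>d\<close> may contribute as much as order z r. Summed over
  \<open>d\<close>, a row forbidden in column \<open>c\<close> sees nearly its whole row sum of L -
  ent, which is minus delta and of size z r; there are at most z r such rows. Rows forbidden only in
  column \<open>d\<close> number at most X altogether. The average per column is thus of order
  z^2.\<close>

lemma bad_sum:
  assumes G: "G \<in> M" and c: "c < n" and K: "finite K" "card K \<le> 3" and u: "\<And>i. i < n \<Longrightarrow> \<bar>u i\<bar> \<le> 2"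
  shows "\<bar>\<Sum>d\<in>{..<n} - insert c K. \<Sum>i\<in>bad c d. u i * (ent G i c - ent G i d)\<bar> \<le> 6 * z ^ 2 * n"
proof -
  let ?I = "{..<n} - insert c K" and ?Hc = "{i. (i,c) \<in> H}" and ?Hd = "\<lambda>d. {i. (i,d) \<in> H} - {i. (i,c) \<in> H}"
  have Hn: "i < n" if "(i,k) \<in> H" for i k using that H_sub by auto
  have split: "(\<Sum>i\<in>bad c d. u i * (ent G i c - ent G i d)) =
     (\<Sum>i\<in>?Hc. u i * (L - ent G i d)) + (\<Sum>i\<in>?Hd d. u i * (ent G i c - ent G i d))" for d
  proof -
    have e: "bad c d = ?Hc \<union> ?Hd d" using Hn by (auto simp: bad_def)
    have "(\<Sum>i\<in>bad c d. u i * (ent G i c - ent G i d)) = (\<Sum>i\<in>?Hc. u i * (ent G i c - ent G i d)) + (\<Sum>i\<in>?Hd d. u i * (ent G i c - ent G i d))"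
      unfolding e using finite_H_col by (intro sum.union_disjoint) auto
    also have "(\<Sum>i\<in>?Hc. u i * (ent G i c - ent G i d)) = (\<Sum>i\<in>?Hc. u i * (L - ent G i d))"
      by (intro sum.cong refl) (simp add: ent_def)
    finally show ?thesis .
  qed
  have first: "\<bar>\<Sum>d\<in>?I. \<Sum>i\<in>?Hc. u i * (L - ent G i d)\<bar> \<le> (z * r) * (2 * (2 * (z * r)))"
  proof -
    have "(\<Sum>d\<in>?I. \<Sum>i\<in>?Hc. u i * (L - ent G i d)) = (\<Sum>i\<in>?Hc. u i * (\<Sum>d\<in>?I. L - ent G i d))"
      by (subst sum.swap) (simp add: sum_distrib_left)
    also have "\<bar>\<dots>\<bar> \<le> (\<Sum>i\<in>?Hc. 2 * (2 * (z * r)))"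
    proof (rule order_trans[OF sum_abs], intro sum_mono abs_mult_le)
      fix i assume "i \<in> ?Hc"
      then have i: "i < n" using Hn by auto
      show "\<bar>u i\<bar> \<le> 2" using u i by blast
      have "(\<Sum>d\<in>?I. L - ent G i d) = (\<Sum>d<n. L - ent G i d) - (\<Sum>d\<in>{..<n} \<inter> insert c K. L - ent G i d)"
        by (subst sum_diff[symmetric]) (auto intro!: sum.cong)
      moreover have "(\<Sum>d<n. L - ent G i d) = - dl i" using row_sum[OF G i] by (simp add: sum_subtractf)
      moreover have "\<bar>\<Sum>d\<in>{..<n} \<inter> insert c K. L - ent G i d\<bar> \<le> 4"
      proof -
        have "\<bar>\<Sum>d\<in>{..<n} \<inter> insert c K. L - ent G i d\<bar> \<le> (\<Sum>d\<in>{..<n} \<inter> insert c K. 1)"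
        proof (intro order_trans[OF sum_abs] sum_mono)
          fix d show "\<bar>L - ent G i d\<bar> \<le> 1" using ent_01[of G i d] L01 by linarith
        qed
        moreover have "card ({..<n} \<inter> insert c K) \<le> card (insert c K)" using K by (intro card_mono) auto
        moreover have "card (insert c K) \<le> 4" using K by (simp add: card_insert_if)
        ultimately show ?thesis by simp
      qed
      ultimately show "\<bar>\<Sum>d\<in>?I. L - ent G i d\<bar> \<le> 2 * (z * r)"
        using delta_le[OF i] zkr[of 1] by simp
    qed
    also have "\<dots> = real (indeg H c) * (2 * (2 * (z * r)))" by (simp add: indeg_def)
    also have "\<dots> \<le> (z * r) * (2 * (2 * (z * r)))" using in_le[OF c] z_pos r_pos by (intro mult_right_mono) auto
    finally show ?thesis .
  qed
  have second: "\<bar>\<Sum>d\<in>?I. \<Sum>i\<in>?Hd d. u i * (ent G i c - ent G i d)\<bar> \<le> 2 * (z * n)"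
  proof -
    have "\<bar>\<Sum>d\<in>?I. \<Sum>i\<in>?Hd d. u i * (ent G i c - ent G i d)\<bar> \<le> (\<Sum>d\<in>?I. 2 * real (indeg H d))"
    proof (rule order_trans[OF sum_abs], rule sum_mono)
      fix d
      have "\<bar>\<Sum>i\<in>?Hd d. u i * (ent G i c - ent G i d)\<bar> \<le> (\<Sum>i\<in>?Hd d. 2 * 1)"
      proof (intro order_trans[OF sum_abs] sum_mono abs_mult_le ent_diff_le)
        fix i assume "i \<in> ?Hd d" then show "\<bar>u i\<bar> \<le> 2" using u Hn by blast
      qed
      also have "\<dots> = 2 * real (card (?Hd d))" by simp
      also have "\<dots> \<le> 2 * real (indeg H d)" unfolding indeg_def using finite_H_col by (simp add: card_mono)
      finally show "\<bar>\<Sum>i\<in>?Hd d. u i * (ent G i c - ent G i d)\<bar> \<le> 2 * real (indeg H d)" .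
    qed
    also have "\<dots> \<le> (\<Sum>d<n. 2 * real (indeg H d))" by (rule sum_mono2) auto
    also have "\<dots> = 2 * X" by (simp add: sum_distrib_left[symmetric] sum_in)
    finally show ?thesis using X_le by linarith
  qed
  have "(z * r) * (2 * (2 * (z * r))) = 4 * z ^ 2 * (r * r)" by (simp add: power2_eq_square)
  then have "(z * r) * (2 * (2 * (z * r))) = 4 * z ^ 2 * n" by (simp only: rr)
  moreover have "z * n \<le> z ^ 2 * n" using zr_mono[of 1 2 "real n"] by simp
  ultimately show ?thesis unfolding split sum.distrib using first second by linarith
qed

text \<open>In mean, the bound z^2 r of \<open>conc\<close> improves to a power of z. The term
  \<open>swdev\<close> has mean zero against \<open>g\<close>. By \<open>davg\<close> the
  conditional mean is (U - V) W / n up to order z r * z^5 / r, and inserting \<open>sg_eq\<close>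
  cancels the eta terms. What is left is the forbidden-row term, which \<open>bad_sum\<close>
  controls after summation over \<open>d\<close>.\<close>

lemma sum_est:
  assumes c: "c < n" "c \<notin> K" and K: "finite K" "card K \<le> 2"
    and w: "\<And>i. dep (UNIV \<times> K) (w i)" "\<And>i G. \<bar>w i G\<bar> \<le> 1" and g: "dep (UNIV \<times> K) g" "\<And>G. \<bar>g G\<bar> \<le> 1"
  shows "\<bar>EE (\<lambda>G. g G * (\<Sum>i<n. w i G * xi G i c))\<bar> \<le> z ^ 8"
proof -
  let ?I = "{..<n} - insert c K"
  define W where "W G = (\<Sum>i<n. w i G)" for G
  \<comment> \<open>The subtraction of the mean weight stems from the forbidden rows inside U - V,
    multiplied by W / n.\<close>
  define B where "B d G = (\<Sum>i\<in>bad c d. (w i G - W G / n) * (ent G i c - ent G i d))" for d G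
  have W1: "\<bar>W G / n\<bar> \<le> 1" for G
  proof -
    have "\<bar>W G\<bar> \<le> (\<Sum>i<n. 1)" unfolding W_def using w(2) by (intro order_trans[OF sum_abs] sum_mono) auto
    then show ?thesis using n_pos by simp
  qed
  have step: "\<bar>EE (\<lambda>G. g G * (\<Sum>i<n. w i G * (xi G i c - xi G i d))) - EE (\<lambda>G. g G * B d G)\<bar> \<le> z ^ 7" if d: "d \<in> ?I" for d
  proof -
    have d': "d < n" "c \<noteq> d" "d \<notin> K" using d by auto
    let ?SS = "\<lambda>G. (\<Sum>i\<in>drows H c d {..<n} G. w i G) + (\<Sum>i\<in>drows H d c {..<n} G. w i G)"
    let ?T = "\<lambda>G. sg {..<n} c d G * (?SS G / dd {..<n} c d G - W G / n)"
    have sw0: "EE (\<lambda>G. g G * swdev H c d {..<n} w G) = 0"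
    proof -
      have S: "UNIV \<times> K \<inter> {..<n} \<times> {c, d} = {}" using c d' by auto
      have "(\<Sum>G\<in>M. g G * swdev H c d {..<n} w G) = 0"
        by (rule stein_mean) (auto simp: c d' intro: dep_sw[OF w(1) S] dep_sw[OF g(1) S])
      then show ?thesis by (simp add: EE_def)
    qed
    have "EE (\<lambda>G. g G * (\<Sum>i<n. w i G * (xi G i c - xi G i d))) = EE (\<lambda>G. g G * swdev H c d {..<n} w G + g G * B d G + g G * ?T G)"
    proof (rule EE_cong)
      fix G assume G: "G \<in> M"
      have "B d G = (\<Sum>i\<in>bad c d. w i G * (ent G i c - ent G i d)) - W G / n * (\<Sum>i\<in>bad c d. ent G i c - ent G i d)"
        by (subst sum_distrib_left, subst sum_subtractf[symmetric]) (simp add: B_def left_diff_distrib)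
      then have "(\<Sum>i<n. w i G * (xi G i c - xi G i d)) = swdev H c d {..<n} w G + B d G + ?T G"
        unfolding xi_diff_decomp W_def[symmetric] sg_eq[OF G c(1) d'(1)] by (simp add: algebra_simps diff_divide_distrib add_divide_distrib)
      then show "g G * (\<Sum>i<n. w i G * (xi G i c - xi G i d)) = g G * swdev H c d {..<n} w G + g G * B d G + g G * ?T G"
        by (simp add: distrib_left)
    qed
    then have "EE (\<lambda>G. g G * (\<Sum>i<n. w i G * (xi G i c - xi G i d))) - EE (\<lambda>G. g G * B d G) = EE (\<lambda>G. g G * ?T G)"
      by (simp add: EE_add sw0)
    moreover have "\<bar>EE (\<lambda>G. g G * ?T G)\<bar> \<le> 4 * z ^ 6 + 1 / real n ^ 3"
    proof (rule EE_bound_hp)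
      show "hp 6 (\<lambda>G. \<bar>?SS G / dd {..<n} c d G - (\<Sum>i<n. w i G) / n\<bar> \<le> z ^ 5 / r)"
        by (rule davg[OF c(1) d'(1,2) K c(2) d'(3) w])
      fix G assume G: "G \<in> M"
      have sgG: "\<bar>sg {..<n} c d G\<bar> \<le> 4 * z * r" by (rule sg_le[OF G c(1) d'(1)])
      show "\<bar>g G * ?T G\<bar> \<le> 4 * z ^ 6" if "\<bar>?SS G / dd {..<n} c d G - (\<Sum>i<n. w i G) / n\<bar> \<le> z ^ 5 / r"
      proof -
        have "\<bar>g G * ?T G\<bar> \<le> 1 * ((4 * z * r) * (z ^ 5 / r))"
          using that unfolding W_def[symmetric] by (intro abs_mult_le g(2) sgG)
        also have "\<dots> = 4 * z ^ 6" using r_pos by (simp add: eval_nat_numeral)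
        finally show ?thesis .
      qed
      have "\<bar>?SS G / dd {..<n} c d G\<bar> \<le> 1"
      proof -
        have "\<bar>?SS G\<bar> \<le> dd {..<n} c d G" by (rule sum_drows_le) (use w(2) in auto)
        moreover have "dd {..<n} c d G \<ge> 0" by (simp add: dd_def)
        ultimately show ?thesis by (auto simp: divide_le_eq_1)
      qed
      then have "\<bar>?SS G / dd {..<n} c d G - W G / n\<bar> \<le> 1 + 1" using W1 by (intro abs_diff_le)
      then have "\<bar>g G * ?T G\<bar> \<le> 1 * ((4 * z * r) * (1 + 1))" by (intro abs_mult_le g(2) sgG)
      also have "\<dots> = 8 * (z * r)" by simp
      also have "\<dots> \<le> r * (r * r)" using z_le_r[of 1] r_ge z_pos by (intro mult_mono) auto
      also have "\<dots> \<le> real n * real n" using r_le_n by (simp add: mult_right_mono)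
      also have "\<dots> = real n ^ 2" by (simp add: power2_eq_square)
      also have "\<dots> \<le> real n ^ 6" using n_ge by (intro power_increasing) auto
      finally show "\<bar>g G * ?T G\<bar> \<le> real n ^ 6" .
    qed (use n_ge z_pos in auto)
    moreover have "1 / real n ^ 3 \<le> 1" using n_ge by simp
    moreover have "1 \<le> z ^ 6" by (rule z1)
    moreover have "5 * z ^ 6 \<le> z ^ 7" using absorb[of 1 5 6] by (simp add: eval_nat_numeral)
    ultimately show ?thesis by linarith
  qed
  have crude: "\<bar>EE (\<lambda>G. g G * (\<Sum>i<n. w i G * (xi G i c - xi G i d)))\<bar> \<le> 4 * n" if "d < n" for d
  proof (rule EE_bound)
    fix G
    have "\<bar>g G * (\<Sum>i<n. w i G * (xi G i c - xi G i d))\<bar> \<le> 1 * real (4 * n)"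
      using xi_diff_crude[OF c(1) that, of "\<lambda>i. w i G" G] w(2) by (intro abs_mult_le g(2)) auto
    then show "\<bar>g G * (\<Sum>i<n. w i G * (xi G i c - xi G i d))\<bar> \<le> 4 * n" by simp
  qed
  let ?e = "\<lambda>d. EE (\<lambda>G. g G * (\<Sum>i<n. w i G * (xi G i c - xi G i d)))"
  have "real n * EE (\<lambda>G. g G * (\<Sum>i<n. w i G * xi G i c)) = EE (\<lambda>G. \<Sum>d<n. g G * (\<Sum>i<n. w i G * (xi G i c - xi G i d)))"
    unfolding EE_cmult[symmetric] by (rule EE_cong) (simp add: n_wxi sum_distrib_left[symmetric] mult.left_commute)
  also have "\<dots> = (\<Sum>d<n. ?e d)" by (rule EE_sum)
  also have "\<dots> = (\<Sum>d\<in>?I. ?e d) + (\<Sum>d\<in>{..<n} \<inter> insert c K. ?e d)"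
    by (subst sum.union_disjoint[symmetric]) (auto intro!: sum.cong)
  also have "(\<Sum>d\<in>?I. ?e d) = (\<Sum>d\<in>?I. ?e d - EE (\<lambda>G. g G * B d G)) + EE (\<lambda>G. g G * (\<Sum>d\<in>?I. B d G))"
    by (simp add: sum_subtractf EE_sum[symmetric] sum_distrib_left)
  finally have eq: "real n * EE (\<lambda>G. g G * (\<Sum>i<n. w i G * xi G i c)) = (\<Sum>d\<in>?I. ?e d - EE (\<lambda>G. g G * B d G)) + EE (\<lambda>G. g G * (\<Sum>d\<in>?I. B d G)) + (\<Sum>d\<in>{..<n} \<inter> insert c K. ?e d)" .
  have p1: "\<bar>\<Sum>d\<in>?I. ?e d - EE (\<lambda>G. g G * B d G)\<bar> \<le> n * z ^ 7"
  proof -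
    have "\<bar>\<Sum>d\<in>?I. ?e d - EE (\<lambda>G. g G * B d G)\<bar> \<le> (\<Sum>d\<in>?I. z ^ 7)" by (intro order_trans[OF sum_abs] sum_mono step)
    also have "\<dots> \<le> (\<Sum>d<n. z ^ 7)" using z_pos by (intro sum_mono2) auto
    finally show ?thesis by simp
  qed
  have p2: "\<bar>EE (\<lambda>G. g G * (\<Sum>d\<in>?I. B d G))\<bar> \<le> 6 * z ^ 2 * n"
  proof (rule EE_bound)
    fix G assume G: "G \<in> M"
    have "\<bar>\<Sum>d\<in>?I. B d G\<bar> \<le> 6 * z ^ 2 * n" unfolding B_def
    proof (rule bad_sum[OF G c(1) K(1)])
      show "\<bar>w i G - W G / n\<bar> \<le> 2" for i using abs_diff_le[OF w(2)[of i G] W1[of G]] by simp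
    qed (use K in auto)
    then have "\<bar>g G * (\<Sum>d\<in>?I. B d G)\<bar> \<le> 1 * (6 * z ^ 2 * n)" by (intro abs_mult_le g(2))
    then show "\<bar>g G * (\<Sum>d\<in>?I. B d G)\<bar> \<le> 6 * z ^ 2 * n" by simp
  qed
  have p3: "\<bar>\<Sum>d\<in>{..<n} \<inter> insert c K. ?e d\<bar> \<le> 12 * n"
  proof -
    have "\<bar>\<Sum>d\<in>{..<n} \<inter> insert c K. ?e d\<bar> \<le> (\<Sum>d\<in>{..<n} \<inter> insert c K. 4 * real n)"
      using crude by (intro order_trans[OF sum_abs] sum_mono) auto
    also have "\<dots> = real (card ({..<n} \<inter> insert c K)) * (4 * real n)" by simp
    also have "\<dots> \<le> 3 * (4 * real n)"
    proof (rule mult_right_mono)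
      have "card ({..<n} \<inter> insert c K) \<le> card (insert c K)" using K by (intro card_mono) auto
      also have "\<dots> \<le> 3" using K by (simp add: card_insert_if)
      finally show "real (card ({..<n} \<inter> insert c K)) \<le> 3" by linarith
    qed simp
    finally show ?thesis by simp
  qed
  have "real n * \<bar>EE (\<lambda>G. g G * (\<Sum>i<n. w i G * xi G i c))\<bar> = \<bar>real n * EE (\<lambda>G. g G * (\<Sum>i<n. w i G * xi G i c))\<bar>" by (simp add: abs_mult)
  also have "\<dots> \<le> n * z ^ 7 + 6 * z ^ 2 * n + 12 * n" unfolding eq by (rule abs_add_le[OF abs_add_le[OF p1 p2] p3])
  also have "\<dots> = n * (z ^ 7 + 6 * z ^ 2 + 12)" by (simp add: algebra_simps)
  also have "\<dots> \<le> n * z ^ 8"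
  proof (rule mult_left_mono)
    have "z ^ 2 \<le> z ^ 7" using zr_mono[of 2 7 1] by simp
    moreover have "1 \<le> z ^ 7" by (rule z1)
    moreover have "20 * z ^ 7 \<le> z ^ 8" using absorb[of 1 20 7] by (simp add: eval_nat_numeral)
    ultimately show "z ^ 7 + 6 * z ^ 2 + 12 \<le> z ^ 8" by linarith
  qed simp
  finally show ?thesis using n_pos by simp
qed

end

lemma clip_id: "\<bar>x\<bar> \<le> (1::real) \<Longrightarrow> max (-1) (min 1 x) = x" by (auto simp: abs_le_iff)

context margins begin

section \<open>Mean correlation of two columns\<close>

definition KK :: "nat \<Rightarrow> nat \<Rightarrow> arcs \<Rightarrow> real" where
  "KK a b G = (\<Sum>i<n. xi G i a * xi G i b)"

text \<open>Extension by zero beyond the vertex set, since the lemmas on weights require a bound for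
  every index.\<close>

definition xc :: "nat \<Rightarrow> nat \<Rightarrow> arcs \<Rightarrow> real" where
  "xc a i G = (if i < n then xi G i a else 0)"

lemma dep_xc: "(i,a) \<in> S \<Longrightarrow> dep S (xc a i)"
proof -
  assume "(i,a) \<in> S"
  then have "dep S (\<lambda>G. xi G i a)" by (rule dep_xi)
  then show ?thesis unfolding xc_def by (rule dep_comp1[where h = "\<lambda>x. if i < n then x else 0"])
qed

lemma xc_le: "a < n \<Longrightarrow> \<bar>xc a i G\<bar> \<le> 2" using xi_le[of i a G] by (simp add: xc_def)

lemma dep_xc2: "(i,a) \<in> S \<Longrightarrow> dep S (\<lambda>G. xc a i G / 2)"
  by (rule dep_comp1[where h = "\<lambda>x. x / 2"]) (rule dep_xc)

lemma xc_le2: "a < n \<Longrightarrow> \<bar>xc a i G / 2\<bar> \<le> 1" using xc_le[of a i G] by simp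

lemma KK_comm: "KK a b G = KK b a G" by (simp add: KK_def mult.commute)

lemma KK_le: assumes "a < n" "b < n" shows "\<bar>KK a b G\<bar> \<le> 4 * real n"
proof -
  have "\<bar>KK a b G\<bar> \<le> (\<Sum>i<n. 2 * 2)" unfolding KK_def
    using xi_le assms by (intro order_trans[OF sum_abs] sum_mono abs_mult_le) auto
  then show ?thesis by simp
qed

text \<open>The correlations of one column with all columns, itself included, cancel. As
  \<open>KK a a\<close> is close to n v, this predicts mean -v for each of the other n - 1
  correlations, which is what \<open>kmean\<close> establishes.\<close>

lemma KK_sum: assumes "G \<in> M" shows "(\<Sum>d<n. KK a d G) = 0"
proof -
  have "(\<Sum>d<n. KK a d G) = (\<Sum>i<n. xi G i a * (\<Sum>d<n. xi G i d))"
    unfolding KK_def sum_distrib_left by (rule sum.swap)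
  also have "\<dots> = 0" using xi_row[OF assms] by (intro sum.neutral) auto
  finally show ?thesis .
qed

lemma kconc: assumes "a < n" "b < n" "a \<noteq> b" shows "hp 1 (\<lambda>G. \<bar>KK a b G\<bar> \<le> 2 * z ^ 2 * r)"
  using conc_xi[of b "{}" a "\<lambda>_ _. 1"] assms by (simp add: dep_const KK_def)

text \<open>For a 0-1 entry x one has (x - L)^2 = (1 - 2L) x + L^2, so the sum of squares is
  determined by the column sum and the number of forbidden cells. Passing from ent - L to
  \<open>xi\<close> costs order z r.\<close>

lemma KK_self:
  assumes G: "G \<in> M" and a: "a < n"
  shows "\<bar>KK a a G - n * v\<bar> \<le> z ^ 2 * r"
proof -
  define p where "p i = ent G i a - L - xi G i a" for i
  have p: "\<bar>p i\<bar> \<le> 3 * z / r" if "i < n" for i using ent_xi[OF that a] by (simp add: p_def)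
  have zr1: "3 * z / r \<le> 1" using zr_small[of 1] z_pos r_pos by (simp add: divide_simps)
  have 1: "(\<Sum>i<n. (ent G i a - L)\<^sup>2) = n * v + (1 - 2 * L) * et a - real (indeg H a) * v"
  proof -
    have "(\<Sum>i<n. (ent G i a - L)\<^sup>2) = (\<Sum>i<n. (1 - 2 * L) * ent G i a + L^2 - (if (i,a) \<in> H then v else 0))"
      by (intro sum.cong refl) (auto simp: ent_def power2_eq_square algebra_simps)
    also have "\<dots> = (1 - 2 * L) * (n * L + et a) + n * L^2 - (\<Sum>i<n. if (i,a) \<in> H then v else 0)"
      by (simp add: sum.distrib sum_subtractf sum_distrib_left[symmetric] col_sum[OF G a])
    also have "(\<Sum>i<n. if (i,a) \<in> H then v else 0) = real (indeg H a) * v"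
    proof -
      have "{i. (i,a) \<in> H} = {..<n} \<inter> {i. (i,a) \<in> H}" using H_sub by auto
      then show ?thesis by (simp add: sum.If_cases indeg_def)
    qed
    finally show ?thesis by (simp add: algebra_simps power2_eq_square)
  qed
  have 2: "\<bar>KK a a G - (\<Sum>i<n. (ent G i a - L)\<^sup>2)\<bar> \<le> 9 * z * r"
  proof -
    have "KK a a G - (\<Sum>i<n. (ent G i a - L)\<^sup>2) = (\<Sum>i<n. p i * (p i - 2 * (ent G i a - L)))"
      unfolding KK_def sum_subtractf[symmetric] by (intro sum.cong refl) (simp add: p_def power2_eq_square algebra_simps)
    also have "\<bar>\<dots>\<bar> \<le> (\<Sum>i<n. 3 * z / r * 3)"
    proof (rule order_trans[OF sum_abs], intro sum_mono abs_mult_le)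
      fix i assume "i \<in> {..<n}" then have i: "i < n" by simp
      show "\<bar>p i\<bar> \<le> 3 * z / r" by (rule p[OF i])
      have "\<bar>p i\<bar> \<le> 1" using p[OF i] zr1 by linarith
      moreover have "\<bar>ent G i a - L\<bar> \<le> 1" using ent_01[of G i a] L01 by linarith
      ultimately have "\<bar>p i - 2 * (ent G i a - L)\<bar> \<le> 1 + 2 * 1" by (intro abs_diff_le abs_mult_le) auto
      then show "\<bar>p i - 2 * (ent G i a - L)\<bar> \<le> 3" by simp
    qed
    also have "\<dots> = 9 * z * (n / r)" by simp
    also have "n / r = r" by (simp add: real_div_sqrt)
    finally show ?thesis .
  qed
  have 3: "\<bar>(1 - 2 * L) * et a\<bar> \<le> 1 * (z * r)"
    using L01 eta_le[OF a] by (intro abs_mult_le) auto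
  have 4: "\<bar>real (indeg H a) * v\<bar> \<le> (z * r) * 1"
    using in_le[OF a] v_le v_pos by (intro abs_mult_le) auto
  have "11 * (z ^ 1 * r) \<le> z ^ Suc 1 * r" using absorb[of r 11 1] by simp
  then have "11 * (z * r) \<le> z ^ 2 * r" by (simp add: numeral_2_eq_2)
  then show ?thesis using 1 2 3 4 by linarith
qed

lemma KK_sum_est: assumes "a < n" "b < n" "a \<noteq> b" shows "\<bar>EE (KK a b)\<bar> \<le> 2 * z ^ 8"
proof -
  have "\<bar>EE (\<lambda>G. 1 * (\<Sum>i<n. xc a i G / 2 * xi G i b))\<bar> \<le> z ^ 8"
    by (rule sum_est[where K = "{a}"]) (use assms in \<open>auto simp: dep_const intro!: dep_xc2 xc_le2[simplified]\<close>)
  moreover have e: "(\<Sum>i<n. xc a i G / 2 * xi G i b) = KK a b G / 2" for G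
    unfolding KK_def sum_divide_distrib by (intro sum.cong) (auto simp: xc_def)
  ultimately have "\<bar>EE (KK a b) / 2\<bar> \<le> z ^ 8" by (simp only: e mult_1 EE_divide)
  then show ?thesis by simp
qed

text \<open>The weights are column \<open>a\<close> of \<open>xi\<close>, whose sum is zero, so the
  eta term of the general decomposition disappears.\<close>

lemma KK_diff:
  assumes "G \<in> M" "a < n" shows "KK a b G - KK a d G = swdev H b d {..<n} (xc a) G
     + sg {..<n} b d G / dd {..<n} b d G * ((\<Sum>i\<in>drows H b d {..<n} G. xc a i G) + (\<Sum>i\<in>drows H d b {..<n} G. xc a i G))
     + (\<Sum>i\<in>bad b d. xi G i a * (ent G i b - ent G i d))"
proof -
  have "(\<Sum>i<n. xc a i G) = (\<Sum>i<n. xi G i a)" by (intro sum.cong) (auto simp: xc_def)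
  then have 0: "(\<Sum>i<n. xc a i G) = 0" using xi_col[OF assms] by simp
  have "KK a b G - KK a d G = (\<Sum>i<n. xc a i G * (xi G i b - xi G i d))"
    unfolding KK_def sum_subtractf[symmetric] by (intro sum.cong) (auto simp: xc_def algebra_simps)
  moreover have "(\<Sum>i\<in>bad b d. xc a i G * (ent G i b - ent G i d)) = (\<Sum>i\<in>bad b d. xi G i a * (ent G i b - ent G i d))"
    by (intro sum.cong) (auto simp: bad_def xc_def)
  ultimately show ?thesis using xi_diff_decomp[of "xc a" G b d] 0 by simp
qed

lemma sum_drows_le2:
  assumes a: "a < n"
  shows "\<bar>(\<Sum>i\<in>drows H b d {..<n} G. xc a i G) + (\<Sum>i\<in>drows H d b {..<n} G. xc a i G)\<bar> \<le> 2 * real n"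
proof -
  have "\<bar>(\<Sum>i\<in>drows H b d {..<n} G. xc a i G / 2) + (\<Sum>i\<in>drows H d b {..<n} G. xc a i G / 2)\<bar> \<le> dd {..<n} b d G"
    using xc_le2[OF a] by (intro sum_drows_le) auto
  moreover have "dd {..<n} b d G \<le> n"
  proof -
    have "drows H b d {..<n} G \<inter> drows H d b {..<n} G = {}" by (auto simp: drows_def)
    then have "card (drows H b d {..<n} G) + card (drows H d b {..<n} G) = card (drows H b d {..<n} G \<union> drows H d b {..<n} G)"
      using finite_drows[of "{..<n}" n] by (simp add: card_Un_disjoint)
    also have "\<dots> \<le> card {..<n}" by (intro card_mono) (auto simp: drows_def)
    finally show ?thesis by (simp add: dd_def)
  qed
  ultimately show ?thesis by (simp add: sum_divide_distrib[symmetric])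
qed

lemma sg_dd_good:
  assumes "G \<in> M" "b < n" "d < n" "n / z \<le> dd {..<n} b d G"
  shows "\<bar>sg {..<n} b d G / dd {..<n} b d G\<bar> \<le> z ^ 3 / r"
proof -
  have "\<bar>sg {..<n} b d G / dd {..<n} b d G\<bar> \<le> (4 * z * r) / (n / z)"
    using n_pos z_pos by (intro abs_divide_le sg_le assms) auto
  also have "\<dots> = 4 * z ^ 2 * (r / n)" by (simp add: eval_nat_numeral)
  also note r_over_n
  also have "4 * z ^ 2 * (1 / r) \<le> z ^ 3 / r" using absorb[of "1/r" 4 2] r_pos by (simp add: eval_nat_numeral)
  finally show ?thesis .
qed

lemma n_powers: "c * real n \<le> real n ^ 2" "c * real n ^ 2 \<le> real n ^ 3" "c * real n ^ 3 \<le> real n ^ 4" if "c \<le> 10000"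
proof -
  have c: "c \<le> real n" using that n_ge by linarith
  show "c * real n \<le> real n ^ 2" using mult_right_mono[OF c, of "real n"] by (simp add: eval_nat_numeral)
  show "c * real n ^ 2 \<le> real n ^ 3" using mult_right_mono[OF c, of "real n ^ 2"] by (simp add: eval_nat_numeral)
  show "c * real n ^ 3 \<le> real n ^ 4" using mult_right_mono[OF c, of "real n ^ 3"] by (simp add: eval_nat_numeral)
qed

lemma n_pow_mono: "j \<le> k \<Longrightarrow> real n ^ j \<le> real n ^ k"
  using n_ge by (intro power_increasing) auto

text \<open>The roles of the columns are exchanged: the ratio (U - V) / (U + V) and the set of
  switchable rows depend on columns \<open>b\<close> and \<open>d\<close> only, while the summed
  weights are column \<open>a\<close>. Hence \<open>sum_est\<close> applies to column
  \<open>a\<close> with K = {b, d}, and \<open>cell\<close> handles the forbidden rows one by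
  one.\<close>

lemma kmean_step:
  assumes ab: "a < n" "b < n" "d < n" "a \<noteq> b" "a \<noteq> d" "b \<noteq> d"
  shows "\<bar>EE (\<lambda>G. KK a b G - KK a d G)\<bar> \<le> z ^ 12 / r + z ^ 5 / r * (real (indeg H b) + real (indeg H d))"
proof -
  let ?SS = "\<lambda>G. (\<Sum>i\<in>drows H b d {..<n} G. xc a i G) + (\<Sum>i\<in>drows H d b {..<n} G. xc a i G)"
  let ?q = "\<lambda>G. sg {..<n} b d G / dd {..<n} b d G"
  let ?B = "\<lambda>G. \<Sum>i\<in>bad b d. xi G i a * (ent G i b - ent G i d)"
  have S: "UNIV \<times> {a} \<inter> {..<n} \<times> {b, d} = {}" using ab by auto
  have "(\<Sum>G\<in>M. 1 * swdev H b d {..<n} (xc a) G) = 0"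
    by (rule stein_mean) (use ab in \<open>auto intro: dep_sw[OF dep_xc S]\<close>)
  then have sw0: "EE (swdev H b d {..<n} (xc a)) = 0" by (simp add: EE_def)
  have "EE (\<lambda>G. KK a b G - KK a d G) = EE (\<lambda>G. swdev H b d {..<n} (xc a) G + ?q G * ?SS G + ?B G)"
    using KK_diff ab by (intro EE_cong) auto
  then have eq: "EE (\<lambda>G. KK a b G - KK a d G) = EE (\<lambda>G. ?q G * ?SS G) + EE ?B"
    by (simp add: EE_add sw0)
  \<comment> \<open>The ratio divided by its typical size z^3 / r, clipped because
    \<open>sum_est\<close> needs a factor bounded by 1 on every set of arcs. With high probability
    the clipping does nothing.\<close>
  define g where "g G = max (-1) (min 1 (?q G * (r / z ^ 3)))" for G
  define w where "w i G = (of_bool (i \<in> drows H b d {..<n} G \<or> i \<in> drows H d b {..<n} G) :: real)" for i G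
  have SS: "?SS G = (\<Sum>i<n. w i G * xi G i a)" for G
  proof -
    have "(\<Sum>i<n. w i G * xi G i a) = (\<Sum>i<n. (if i \<in> drows H b d {..<n} G then xc a i G else 0) + (if i \<in> drows H d b {..<n} G then xc a i G else 0))"
      by (intro sum.cong refl) (auto simp: w_def xc_def drows_def)
    also have "\<dots> = (\<Sum>i\<in>{..<n} \<inter> drows H b d {..<n} G. xc a i G) + (\<Sum>i\<in>{..<n} \<inter> drows H d b {..<n} G. xc a i G)"
      by (simp add: sum.distrib sum.inter_restrict)
    also have "{..<n} \<inter> drows H b d {..<n} G = drows H b d {..<n} G" by (auto simp: drows_def)
    also have "{..<n} \<inter> drows H d b {..<n} G = drows H d b {..<n} G" by (auto simp: drows_def)
    finally show ?thesis by simp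
  qed
  have dg: "dep (UNIV \<times> {b,d}) g"
  proof -
    have "dep (UNIV \<times> {b,d}) (sg {..<n} b d)" "dep (UNIV \<times> {b,d}) (dd {..<n} b d)"
      by (auto intro!: dep_sg dep_dd)
    then show ?thesis unfolding g_def by (rule dep_comp2[where h = "\<lambda>x y. max (-1) (min 1 (x / y * (r / z ^ 3)))"])
  qed
  have dw: "dep (UNIV \<times> {b,d}) (w i)" for i
  proof -
    have "dep (UNIV \<times> {b,d}) (drows H b d {..<n})" "dep (UNIV \<times> {b,d}) (drows H d b {..<n})"
      by (auto intro!: dep_drows)
    then show ?thesis unfolding w_def by (rule dep_comp2[where h = "\<lambda>x y. of_bool (i \<in> x \<or> i \<in> y)"])
  qed
  have p1: "\<bar>EE (\<lambda>G. g G * ?SS G)\<bar> \<le> z ^ 8" unfolding SS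
    by (rule sum_est[OF ab(1) _ _ _ dw _ dg]) (use ab in \<open>auto simp: w_def g_def\<close>)
  have p2: "\<bar>EE (\<lambda>G. ?q G * ?SS G - z ^ 3 / r * (g G * ?SS G))\<bar> \<le> 0 + 1 / real n ^ 3"
  proof (rule EE_bound_hp[OF dd_conc[OF ab(2,3,6)]])
    fix G assume G: "G \<in> M" and "\<bar>dd {..<n} b d G - 2 * v * n\<bar> \<le> z ^ 3 * r \<and> n / z \<le> dd {..<n} b d G"
    then have "\<bar>?q G\<bar> \<le> z ^ 3 / r" using ab by (intro sg_dd_good) auto
    then have "\<bar>?q G\<bar> * (r / z ^ 3) \<le> z ^ 3 / r * (r / z ^ 3)" using r_pos z_pos by (intro mult_right_mono) auto
    then have "\<bar>?q G * (r / z ^ 3)\<bar> \<le> 1" using r_pos z_pos unfolding abs_mult by simp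
    then have "g G = ?q G * (r / z ^ 3)" unfolding g_def by (rule clip_id)
    then have "z ^ 3 / r * g G = ?q G" using r_pos z_pos by simp
    then show "\<bar>?q G * ?SS G - z ^ 3 / r * (g G * ?SS G)\<bar> \<le> 0" by (simp add: mult.assoc[symmetric])
  next
    fix G
    have "\<bar>g G\<bar> \<le> 1" by (simp add: g_def)
    have z3: "\<bar>z ^ 3 / r\<bar> \<le> 1" using z_le_r[of 3] r_pos z_pos by simp
    have "\<bar>?q G * ?SS G - z ^ 3 / r * (g G * ?SS G)\<bar> \<le> 1 * (2 * real n) + 1 * (1 * (2 * real n))"
      by (intro abs_diff_le abs_mult_le sg_over_dd sum_drows_le2 ab z3 \<open>\<bar>g G\<bar> \<le> 1\<close>) auto
    also have "\<dots> = 4 * real n" by simp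
    also have "\<dots> \<le> real n ^ 2" by (rule n_powers) simp
    also have "\<dots> \<le> real n ^ 6" by (rule n_pow_mono) simp
    finally show "\<bar>?q G * ?SS G - z ^ 3 / r * (g G * ?SS G)\<bar> \<le> real n ^ 6" .
  qed (use n_ge in auto)
  have p3: "\<bar>EE ?B\<bar> \<le> z ^ 5 / r * (real (indeg H b) + real (indeg H d))"
  proof -
    have e: "EE ?B = (\<Sum>i\<in>bad b d. EE (\<lambda>G. (ent G i b - ent G i d) * xi G i a))"
      unfolding EE_sum by (intro sum.cong refl EE_cong) (rule mult.commute)
    have "\<bar>EE ?B\<bar> \<le> (\<Sum>i\<in>bad b d. z ^ 5 / r)" unfolding e
    proof (rule order_trans[OF sum_abs], rule sum_mono)
      fix i assume "i \<in> bad b d"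
      then have i: "i < n" by (simp add: bad_def)
      have dep: "dep ({} \<times> UNIV \<union> UNIV \<times> {b,d}) (\<lambda>G. ent G i b - ent G i d)"
        by (intro dep_comp2[where h = "\<lambda>x y. x - y"] dep_ent) auto
      show "\<bar>EE (\<lambda>G. (ent G i b - ent G i d) * xi G i a)\<bar> \<le> z ^ 5 / r"
      proof (rule cell[OF i ab(1) _ _ _ _ _ _ dep ent_diff_le])
        show "a \<notin> {b,d}" using ab by simp
        show "card {b,d} \<le> 3" using ab by simp
      qed simp_all
    qed
    also have "\<dots> = z ^ 5 / r * real (card (bad b d))" by simp
    also have "\<dots> \<le> z ^ 5 / r * (real (indeg H b) + real (indeg H d))"
      using card_bad z_pos r_pos by (intro mult_left_mono) auto
    finally show ?thesis .
  qed
  have "\<bar>EE (\<lambda>G. ?q G * ?SS G)\<bar> \<le> z ^ 12 / r"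
  proof -
    define e1 e2 e3 where "e1 = EE (\<lambda>G. ?q G * ?SS G)" and "e2 = EE (\<lambda>G. ?q G * ?SS G - z ^ 3 / r * (g G * ?SS G))"
      and "e3 = EE (\<lambda>G. g G * ?SS G)"
    have e: "e1 = e2 + z ^ 3 / r * e3"
      unfolding e1_def e2_def e3_def EE_diff EE_cmult by (simp only: diff_add_cancel)
    have "\<bar>e2\<bar> \<le> 0 + 1 / real n ^ 3" unfolding e2_def by (rule p2)
    moreover have "\<bar>z ^ 3 / r * e3\<bar> \<le> z ^ 3 / r * z ^ 8"
      unfolding e3_def by (rule abs_mult_le[OF _ p1]) (use z_pos r_pos in simp)
    ultimately have "\<bar>e1\<bar> \<le> (0 + 1 / real n ^ 3) + z ^ 3 / r * z ^ 8" unfolding e by (rule abs_add_le)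
    also have "z ^ 3 / r * z ^ 8 = z ^ (3 + 8) / r" unfolding power_add by simp
    also have "z ^ (3 + 8) / r = z ^ 11 / r" by simp
    also have "(0 + 1 / real n ^ 3) + z ^ 11 / r \<le> 2 * (z ^ 11 * (1 / r))" using n3[of 11] by simp
    also have "\<dots> \<le> z ^ 12 / r" using absorb[of "1/r" 2 11] r_pos by (simp add: eval_nat_numeral)
    finally show ?thesis unfolding e1_def .
  qed
  then show ?thesis unfolding eq using p3 by (rule abs_add_le)
qed

text \<open>By \<open>KK_sum\<close>, n times the mean is the sum over \<open>d\<close> of the
  differences. The choice d = a supplies -n v and the others are small. The degree of
  \<open>b\<close> in \<open>H\<close> enters through the forbidden rows, which do not average out
  at this accuracy.\<close>

lemma kmean:
  assumes ab: "a < n" "b < n" "a \<noteq> b"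
  shows "\<bar>EE (KK a b) + v\<bar> \<le> z ^ 13 / r * (1 + real (indeg H b))"
proof -
  let ?I = "{..<n} - {a,b}"
  have "real n * EE (KK a b) = EE (\<lambda>G. \<Sum>d<n. KK a b G - KK a d G)"
    unfolding EE_cmult[symmetric] by (rule EE_cong) (simp add: sum_subtractf KK_sum)
  also have "\<dots> = (\<Sum>d<n. EE (\<lambda>G. KK a b G - KK a d G))" by (rule EE_sum)
  also have "\<dots> = (\<Sum>d\<in>?I. EE (\<lambda>G. KK a b G - KK a d G)) + (\<Sum>d\<in>{a,b}. EE (\<lambda>G. KK a b G - KK a d G))"
    using ab by (intro sum.subset_diff) auto
  also have "(\<Sum>d\<in>{a,b}. EE (\<lambda>G. KK a b G - KK a d G)) = EE (KK a b) - EE (KK a a)"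
    using ab by (simp add: EE_diff EE_const)
  finally have eq: "real n * EE (KK a b) = (\<Sum>d\<in>?I. EE (\<lambda>G. KK a b G - KK a d G)) + (EE (KK a b) - EE (KK a a))" .
  have p1: "\<bar>\<Sum>d\<in>?I. EE (\<lambda>G. KK a b G - KK a d G)\<bar> \<le> n * (z ^ 12 / r) + z ^ 5 / r * (n * real (indeg H b) + X)"
  proof -
    have "\<bar>\<Sum>d\<in>?I. EE (\<lambda>G. KK a b G - KK a d G)\<bar> \<le> (\<Sum>d\<in>?I. z ^ 12 / r + z ^ 5 / r * (real (indeg H b) + real (indeg H d)))"
      using ab by (intro order_trans[OF sum_abs] sum_mono kmean_step) auto
    also have "\<dots> \<le> (\<Sum>d<n. z ^ 12 / r + z ^ 5 / r * (real (indeg H b) + real (indeg H d)))"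
      using z_pos r_pos by (intro sum_mono2) auto
    also have "\<dots> = n * (z ^ 12 / r) + z ^ 5 / r * (n * real (indeg H b) + X)"
      by (simp only: sum.distrib sum_distrib_left[symmetric] sum_constant card_lessThan sum_in)
    finally show ?thesis .
  qed
  have p2: "\<bar>EE (KK a a) - n * v\<bar> \<le> z ^ 2 * r"
  proof -
    have "EE (KK a a) - n * v = EE (\<lambda>G. KK a a G - n * v)" by (simp add: EE_diff EE_const)
    then show ?thesis using KK_self ab by (simp only:) (rule EE_bound, auto)
  qed
  have eq2: "real n * (EE (KK a b) + v) = (\<Sum>d\<in>?I. EE (\<lambda>G. KK a b G - KK a d G)) + (EE (KK a b) - (EE (KK a a) - n * v))"
    using eq by (simp add: algebra_simps)
  have "\<bar>real n * (EE (KK a b) + v)\<bar> \<le> (n * (z ^ 12 / r) + z ^ 5 / r * (n * real (indeg H b) + X)) + (2 * z ^ 8 + z ^ 2 * r)"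
    unfolding eq2 by (intro abs_add_le abs_diff_le p1 p2 KK_sum_est ab)
  also have "\<dots> \<le> n * (z ^ 13 / r * (1 + real (indeg H b)))"
  proof -
    have nr: "n * (x / r) = x * r" for x using rr r_pos by (simp add: field_simps)
    have a1: "z ^ 5 / r * X \<le> z ^ 5 / r * (z * n)" using X_le z_pos r_pos by (intro mult_left_mono) auto
    have a2: "z ^ 5 / r * (z * n) = n * (z ^ 6 / r)" by (simp add: eval_nat_numeral)
    have a3: "z ^ 8 \<le> z ^ 12 * r"
    proof -
      have "z ^ 8 \<le> z ^ 12" using z_ge by (intro power_increasing) auto
      moreover have "1 \<le> r" using r_ge by linarith
      ultimately have "z ^ 8 * 1 \<le> z ^ 12 * r" by (rule mult_mono) (use z_pos in auto)
      then show ?thesis by simp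
    qed
    have a4: "z ^ 6 * r \<le> z ^ 12 * r" "z ^ 2 * r \<le> z ^ 12 * r" using zr_mono[of 6 12 r] zr_mono[of 2 12 r] by auto
    have a5: "10 * (z ^ 12 * r) \<le> z ^ 13 * r" using absorb[of r 10 12] by (simp add: eval_nat_numeral)
    have a6: "z ^ 5 / r * (n * real (indeg H b)) \<le> n * (z ^ 13 / r * real (indeg H b))"
    proof -
      have "z ^ 5 / r \<le> z ^ 13 / r" using zr_mono[of 5 13 "1/r"] r_pos by simp
      then have "z ^ 5 / r * (n * real (indeg H b)) \<le> z ^ 13 / r * (n * real (indeg H b))" by (intro mult_right_mono) auto
      then show ?thesis by (simp add: mult_ac)
    qed
    \<comment> \<open>The bounds are passed as plain variables, so that the products inside them are
      atoms for linear arithmetic.\<close>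
    have lin: "A + (B + C) + (2 * D + E) \<le> P + Q" if "A = a12" "C \<le> C'" "C' = C''" "C'' = a6" "D \<le> a12" "a6 \<le> a12"
      "E \<le> a12" "10 * a12 \<le> a13" "B \<le> Q" "P = a13" "1 \<le> D" for A B C C' C'' D E P Q a12 a6 a13 :: real
      using that by linarith
    show ?thesis unfolding distrib_left mult_1_right
      by (rule lin[OF nr a1 a2 nr a3 a4 a5 a6 nr z1])
  qed
  finally have "real n * \<bar>EE (KK a b) + v\<bar> \<le> n * (z ^ 13 / r * (1 + real (indeg H b)))" by (simp add: abs_mult)
  then show ?thesis by (rule mult_left_le_imp_le) (use n_pos in simp)
qed

end

context margins
begin

section \<open>Single entries to second order\<close>

lemma ent_cell:
  assumes ic: "i < n" "c < n" "c \<notin> K" and K: "finite K" "card K \<le> 3" and Q: "finite Q" "card Q \<le> 1" "i \<notin> Q"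
    and g: "dep (Q \<times> UNIV \<union> UNIV \<times> K) g" "\<And>G. \<bar>g G\<bar> \<le> 1"
  shows "\<bar>EE (\<lambda>G. g G * (ent G i c - L))\<bar> \<le> z ^ 6 / r"
proof -
  define p where "p = dl i / n + et c / n - L * X / n^2"
  have pe: "ent G i c - L = xi G i c + p" for G by (simp add: xi_def p_def)
  have p: "\<bar>p\<bar> \<le> 3 * z / r" using ent_xi[OF ic(1,2), of "{}"] pe[of "{}"] by simp
  have e: "EE (\<lambda>G. g G * (ent G i c - L)) = EE (\<lambda>G. g G * xi G i c) + EE (\<lambda>G. g G * p)"
    unfolding pe distrib_left EE_add ..
  have "\<bar>EE (\<lambda>G. g G * p)\<bar> \<le> 1 * (3 * z / r)" by (intro EE_bound abs_mult_le g(2) p)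
  then have "\<bar>EE (\<lambda>G. g G * (ent G i c - L))\<bar> \<le> z ^ 5 / r + 1 * (3 * z / r)"
    unfolding e by (intro abs_add_le cell[OF assms])
  moreover have "z / r \<le> z ^ 5 / r" using zr_mono[of 1 5 "1/r"] r_pos by simp
  moreover have "4 * (z ^ 5 / r) \<le> z ^ 6 / r" using absorb[of "1/r" 4 5] r_pos by (simp add: eval_nat_numeral)
  moreover have "1 * (3 * z / r) = 3 * (z / r)" by simp
  ultimately show ?thesis by linarith
qed

lemma fpoly_abs: "\<bar>fpoly G b d i\<bar> \<le> 1" using fpoly_01[of G b d i] by simp

lemma fpoly_mean:
  assumes "i < n" "b < n" "d < n" "b \<noteq> d"
  shows "\<bar>EE (\<lambda>G. fpoly G b d i) - 2 * v\<bar> \<le> z ^ 6 / r"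
proof -
  let ?E = "\<lambda>G. fpoly G b d i - 2 * v - ((1 - 2 * L) * (xi G i b + xi G i d) - 2 * xi G i b * xi G i d)"
  have c1: "\<bar>EE (\<lambda>G. xi G i c)\<bar> \<le> z ^ 5 / r" if "c < n" for c
    using cell[OF assms(1) that, of "{}" "{}" "\<lambda>_. 1"] by (simp add: dep_const)
  have c2: "\<bar>EE (\<lambda>G. xc b i G / 2 * xi G i d)\<bar> \<le> z ^ 5 / r"
  proof (rule cell[where K = "{b}" and Q = "{}"])
    show "dep ({} \<times> UNIV \<union> UNIV \<times> {b}) (\<lambda>G. xc b i G / 2)" by (rule dep_xc2) simp
    show "\<bar>xc b i G / 2\<bar> \<le> 1" for G by (rule xc_le2[OF assms(2)])
  qed (use assms in auto)
  have eq: "(\<lambda>G. fpoly G b d i - 2 * v) = (\<lambda>G. ?E G + ((1 - 2 * L) * xi G i b + (1 - 2 * L) * xi G i d - 4 * (xc b i G / 2 * xi G i d)))"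
    using assms(1) by (auto simp: xc_def algebra_simps)
  have "EE (\<lambda>G. fpoly G b d i) - 2 * v = EE (\<lambda>G. fpoly G b d i - 2 * v)" by (simp add: EE_diff EE_const)
  also have "\<dots> = EE ?E + ((1 - 2 * L) * EE (\<lambda>G. xi G i b) + (1 - 2 * L) * EE (\<lambda>G. xi G i d) - 4 * EE (\<lambda>G. xc b i G / 2 * xi G i d))"
    by (simp only: eq EE_add EE_diff EE_cmult)
  finally have e: "EE (\<lambda>G. fpoly G b d i) - 2 * v = EE ?E + ((1 - 2 * L) * EE (\<lambda>G. xi G i b) + (1 - 2 * L) * EE (\<lambda>G. xi G i d) - 4 * EE (\<lambda>G. xc b i G / 2 * xi G i d))" .
  have L1: "\<bar>1 - 2 * L\<bar> \<le> 1" using L01 by simp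
  have "\<bar>EE (\<lambda>G. fpoly G b d i) - 2 * v\<bar> \<le> 24 * z / r + (1 * (z ^ 5 / r) + 1 * (z ^ 5 / r) + 4 * (z ^ 5 / r))"
    unfolding e by (intro abs_add_le abs_diff_le abs_mult_le L1 c1 c2 assms EE_bound fpoly_expand) auto
  moreover have "z / r \<le> z ^ 5 / r" using zr_mono[of 1 5 "1/r"] r_pos by simp
  moreover have "30 * (z ^ 5 / r) \<le> z ^ 6 / r" using absorb[of "1/r" 30 5] r_pos by (simp add: eval_nat_numeral)
  moreover have "24 * z / r = 24 * (z / r)" by simp
  ultimately show ?thesis by linarith
qed

lemma dep_fpoly: "(i,b) \<in> S \<Longrightarrow> (i,d) \<in> S \<Longrightarrow> dep S (\<lambda>G. fpoly G b d i)"
  unfolding fpoly_def by (intro dep_comp2[where h = "\<lambda>x y. x + y - 2 * x * y"] dep_ent)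

text \<open>At leading order the conditional mean is (et b - et d) / n, which the eta corrections
  inside \<open>xi\<close> cancel exactly. To see this, 1 / (U + V) is replaced by its typical value
  \<open>c0\<close> and the mean of \<open>fpoly\<close> by 2v. Each replacement changes a quantity
  of order 1 / r by a relative 1 / r, up to powers of z. The forbidden rows are other rows, whose
  entries have mean of order 1 / r even after weighting with row \<open>i\<close>.\<close>

lemma cell2_step:
  assumes i: "i < n" "b < n" "d < n" "b \<noteq> d" "(i,b) \<notin> H" "(i,d) \<notin> H"
  shows "\<bar>EE (\<lambda>G. xi G i b - xi G i d)\<bar> \<le> z ^ 10 / n"
proof -
  let ?f = "\<lambda>G. fpoly G b d i" and ?sg = "sg {..<n} b d" and ?dd = "dd {..<n} b d"
  let ?w = "\<lambda>k (G :: arcs). of_bool (k = i) :: real"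
  define c0 where "c0 = 1 / (2 * v * n)"
  have c0: "\<bar>c0\<bar> \<le> z / (2 * n)"
  proof -
    have "c0 = 1 / v * (1 / (2 * n))" by (simp add: c0_def)
    also have "\<dots> \<le> z * (1 / (2 * n))" using inv_v by (intro mult_right_mono) auto
    finally show ?thesis using v_pos by (simp add: c0_def)
  qed
  have ib: "i \<notin> bad b d" using i by (simp add: bad_def)
  have P: "(\<Sum>k\<in>drows H b' d' {..<n} G. ?w k G) = of_bool (i \<in> drows H b' d' {..<n} G)" for b' d' G
    using finite_drows[of "{..<n}" n H b' d' G] by (simp add: of_bool_def sum.delta')
  have f: "(\<Sum>k\<in>drows H b d {..<n} G. ?w k G) + (\<Sum>k\<in>drows H d b {..<n} G. ?w k G) = ?f G" for G
    unfolding P fpoly_eq[OF i(1) ib] by (auto simp: drows_def)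
  have "EE (\<lambda>G. xi G i b - xi G i d) = EE (\<lambda>G. 1 * ((\<Sum>k\<in>drows H b d {..<n} G. ?w k G) - (\<Sum>k\<in>drows H d b {..<n} G. ?w k G)) - (et b - et d) / n)"
    unfolding P using i by (intro EE_cong) (auto simp: xi_def ent_def drows_def diff_divide_distrib)
  also have "\<dots> = EE (\<lambda>G. 1 * ((\<Sum>k\<in>drows H b d {..<n} G. ?w k G) - (\<Sum>k\<in>drows H d b {..<n} G. ?w k G))) - (et b - et d) / n"
    by (simp only: EE_diff EE_const)
  also have "EE (\<lambda>G. 1 * ((\<Sum>k\<in>drows H b d {..<n} G. ?w k G) - (\<Sum>k\<in>drows H d b {..<n} G. ?w k G)))
      = EE (\<lambda>G. 1 * (?sg G / ?dd G * ((\<Sum>k\<in>drows H b d {..<n} G. ?w k G) + (\<Sum>k\<in>drows H d b {..<n} G. ?w k G))))"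
    by (rule mean_id[where S = "{}"]) (use i in \<open>auto simp: dep_const\<close>)
  finally have e1: "EE (\<lambda>G. xi G i b - xi G i d) = EE (\<lambda>G. ?sg G / ?dd G * ?f G) - (et b - et d) / n"
    by (simp only: f mult_1)
  define F where "F = EE ?f"
  define B where "B = (\<Sum>j\<in>bad b d. EE (\<lambda>G. ?f G * (ent G j b - ent G j d)))"
  have "EE (\<lambda>G. ?sg G * ?f G) = EE (\<lambda>G. (et b - et d) * ?f G - (\<Sum>j\<in>bad b d. ?f G * (ent G j b - ent G j d)))"
  proof (rule EE_cong)
    fix G assume G: "G \<in> M"
    show "?sg G * ?f G = (et b - et d) * ?f G - (\<Sum>j\<in>bad b d. ?f G * (ent G j b - ent G j d))"
      unfolding sg_eq[OF G i(2,3)] sum_distrib_left[symmetric] left_diff_distrib by (simp only: mult.commute)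
  qed
  also have "\<dots> = (et b - et d) * F - B" by (simp only: EE_diff EE_cmult EE_sum F_def B_def)
  finally have e2: "EE (\<lambda>G. ?sg G * ?f G) = (et b - et d) * F - B" .
  define D1 where "D1 = EE (\<lambda>G. ?sg G * ?f G * (1 / ?dd G - c0))"
  have "EE (\<lambda>G. ?sg G / ?dd G * ?f G) = EE (\<lambda>G. ?sg G * ?f G * (1 / ?dd G - c0) + c0 * (?sg G * ?f G))"
    by (intro EE_cong) (simp add: algebra_simps)
  also have "\<dots> = D1 + c0 * ((et b - et d) * F - B)" by (simp only: EE_add EE_cmult e2 D1_def)
  finally have e3: "EE (\<lambda>G. ?sg G / ?dd G * ?f G) = D1 + c0 * ((et b - et d) * F - B)" .
  have e4: "EE (\<lambda>G. xi G i b - xi G i d) = D1 + (et b - et d) * (c0 * (F - 2 * v)) - c0 * B"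
  proof -
    have "1 / (2 * y * m) * (2 * y) = 1 / m" if "y \<noteq> 0" for y m :: real using that by simp
    from this[of v "real n"] have "c0 * (2 * v) = 1 / n" unfolding c0_def using v_pos by linarith
    then have "(et b - et d) / n = (et b - et d) * (c0 * (2 * v))" by simp
    then show ?thesis unfolding e1 e3 by (simp add: algebra_simps)
  qed
  \<comment> \<open>A product of two small factors: U - V is of order z r, and 1 / (U + V) deviates
    from \<open>c0\<close> by order z^5 r / n^2.\<close>
  have D1: "\<bar>D1\<bar> \<le> z ^ 7 / n + 1 / real n ^ 3" unfolding D1_def
  proof (rule EE_bound_hp[OF dd_conc[OF i(2,3,4)]])
    fix G assume G: "G \<in> M" and "\<bar>?dd G - 2 * v * n\<bar> \<le> z ^ 3 * r \<and> n / z \<le> ?dd G"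
    then have a: "\<bar>?dd G - 2 * v * n\<bar> \<le> z ^ 3 * r" "n / z \<le> ?dd G" by auto
    have pos: "0 < n / z" using n_pos z_pos by simp
    have Dp: "?dd G > 0" using a(2) pos by linarith
    have Vp: "2 * v * n > 0" using v_pos n_pos by simp
    have Vge: "2 * n / z \<le> 2 * v * n" using v_ge mult_right_mono[OF v_ge, of "2 * real n"] by (simp add: mult_ac)
    have "1 / ?dd G - c0 = (2 * v * n - ?dd G) / (?dd G * (2 * v * n))"
    proof -
      have "1 / x - 1 / y = (y - x) / (x * y)" if "x > 0" "y > 0" for x y :: real using that by (simp add: field_simps)
      from this[OF Dp Vp] show ?thesis unfolding c0_def .
    qed
    moreover have "\<bar>(2 * v * n - ?dd G) / (?dd G * (2 * v * n))\<bar> \<le> (z ^ 3 * r) / ((n / z) * (2 * n / z))"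
    proof (rule abs_divide_le)
      show "\<bar>2 * v * n - ?dd G\<bar> \<le> z ^ 3 * r" using a(1) by (simp add: abs_minus_commute)
      show "0 < (n / z) * (2 * n / z)" using n_pos z_pos by simp
      show "(n / z) * (2 * n / z) \<le> ?dd G * (2 * v * n)" by (rule mult_mono[OF a(2) Vge]) (use Dp pos in auto)
    qed
    ultimately have c: "\<bar>1 / ?dd G - c0\<bar> \<le> (z ^ 3 * r) / ((n / z) * (2 * n / z))" by simp
    have "\<bar>?sg G * ?f G * (1 / ?dd G - c0)\<bar> \<le> (4 * z * r) * 1 * ((z ^ 3 * r) / ((n / z) * (2 * n / z)))"
      by (intro abs_mult_le sg_le fpoly_abs c G i)
    also have "\<dots> = 2 * z ^ 6 * (r * r / (n * n))" by (simp add: eval_nat_numeral)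
    also have "r * r / (n * n) = 1 / n" using n_pos by simp
    also have "2 * z ^ 6 * (1 / n) \<le> z ^ 7 / n" using absorb[of "1/n" 2 6] by (simp add: eval_nat_numeral)
    finally show "\<bar>?sg G * ?f G * (1 / ?dd G - c0)\<bar> \<le> z ^ 7 / n" .
  next
    fix G assume G: "G \<in> M"
    have "\<bar>1 / ?dd G\<bar> \<le> 1" unfolding dd_def by (simp add: divide_le_eq_1 flip: of_nat_add) linarith
    moreover have "\<bar>c0\<bar> \<le> 1"
    proof -
      have "z / (2 * n) \<le> 1" using z_le_r[of 1] r_le_n n_pos by simp
      then show ?thesis using c0 by linarith
    qed
    ultimately have "\<bar>?sg G * ?f G * (1 / ?dd G - c0)\<bar> \<le> (4 * z * r) * 1 * (1 + 1)"
      by (intro abs_mult_le abs_diff_le sg_le fpoly_abs G i)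
    also have "\<dots> = 8 * (z * r)" by simp
    also have "\<dots> \<le> 8 * (r * r)" using z_le_r[of 1] r_pos by (intro mult_left_mono mult_right_mono) auto
    also have "\<dots> = 8 * real n" by simp
    also have "\<dots> \<le> real n ^ 2" by (rule n_powers) simp
    also have "\<dots> \<le> real n ^ 6" by (rule n_pow_mono) simp
    finally show "\<bar>?sg G * ?f G * (1 / ?dd G - c0)\<bar> \<le> real n ^ 6" .
  qed (use n_ge z_pos in auto)
  have D2: "\<bar>(et b - et d) * (c0 * (F - 2 * v))\<bar> \<le> (2 * z * r) * (z / (2 * n) * (z ^ 6 / r))"
  proof (intro abs_mult_le c0)
    show "\<bar>et b - et d\<bar> \<le> 2 * z * r" using abs_diff_le[OF eta_le[OF i(2)] eta_le[OF i(3)]] by simp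
    show "\<bar>F - 2 * v\<bar> \<le> z ^ 6 / r" unfolding F_def by (rule fpoly_mean[OF i(1-4)])
  qed
  have B: "\<bar>B\<bar> \<le> 2 * z * r * (2 * (z ^ 6 / r))"
  proof -
    have "\<bar>B\<bar> \<le> (\<Sum>j\<in>bad b d. 2 * (z ^ 6 / r))" unfolding B_def
    proof (rule order_trans[OF sum_abs], rule sum_mono)
      fix j assume j: "j \<in> bad b d"
      then have jn: "j < n" and ji: "j \<notin> {i}" using ib by (auto simp: bad_def)
      have c: "\<bar>EE (\<lambda>G. ?f G * (ent G j k - L))\<bar> \<le> z ^ 6 / r" if "k < n" for k
      proof (rule ent_cell[OF jn that _ _ _ _ _ ji _ fpoly_abs])
        show "dep ({i} \<times> UNIV \<union> UNIV \<times> {}) ?f" by (rule dep_fpoly) auto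
      qed auto
      have "EE (\<lambda>G. ?f G * (ent G j b - ent G j d)) = EE (\<lambda>G. ?f G * (ent G j b - L) - ?f G * (ent G j d - L))"
        by (intro EE_cong) (simp add: algebra_simps)
      then have "\<bar>EE (\<lambda>G. ?f G * (ent G j b - ent G j d))\<bar> \<le> z ^ 6 / r + z ^ 6 / r"
        unfolding EE_diff using abs_diff_le[OF c[OF i(2)] c[OF i(3)]] by simp
      then show "\<bar>EE (\<lambda>G. ?f G * (ent G j b - ent G j d))\<bar> \<le> 2 * (z ^ 6 / r)" by simp
    qed
    also have "\<dots> = real (card (bad b d)) * (2 * (z ^ 6 / r))" by simp
    also have "\<dots> \<le> 2 * z * r * (2 * (z ^ 6 / r))" using card_bad_zr[OF i(2,3)] z_pos r_pos by (intro mult_right_mono) auto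
    finally show ?thesis .
  qed
  have D3: "\<bar>c0 * B\<bar> \<le> z / (2 * n) * (2 * z * r * (2 * (z ^ 6 / r)))" by (intro abs_mult_le c0 B)
  have lin: "x \<le> E'" if "x \<le> A + B' + C + D" "C = P" "D = 2 * P" "A \<le> P" "B' \<le> P" "5 * P \<le> Q" "Q \<le> E'" for x A B' C D E' P Q :: real
    using that by linarith
  have b0: "\<bar>EE (\<lambda>G. xi G i b - xi G i d)\<bar> \<le> (z ^ 7 / n + 1 / real n ^ 3) + (2 * z * r) * (z / (2 * n) * (z ^ 6 / r)) + z / (2 * n) * (2 * z * r * (2 * (z ^ 6 / r)))"
    unfolding e4 by (intro abs_add_le abs_diff_le D1 D2 D3)
  have b1: "(2 * z * r) * (z / (2 * n) * (z ^ 6 / r)) = z ^ 8 / n" using r_pos by (simp add: eval_nat_numeral)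
  have b2: "z / (2 * n) * (2 * z * r * (2 * (z ^ 6 / r))) = 2 * (z ^ 8 / n)" using r_pos by (simp add: eval_nat_numeral)
  have b3: "z ^ 7 / n \<le> z ^ 8 / n" using zr_mono[of 7 8 "1/n"] by simp
  have b4: "1 / real n ^ 3 \<le> z ^ 8 / n"
  proof -
    have "real n \<le> real n ^ 3" using n_pow_mono[of 1 3] by simp
    then have "1 / real n ^ 3 \<le> 1 / n" using n_pos by (intro divide_left_mono) auto
    also have "\<dots> \<le> z ^ 8 / n" using z1 by (intro divide_right_mono) auto
    finally show ?thesis .
  qed
  have b5: "5 * (z ^ 8 / n) \<le> z ^ 9 / n" using absorb[of "1/n" 5 8] by (simp add: eval_nat_numeral)
  have b6: "z ^ 9 / n \<le> z ^ 10 / n" using zr_mono[of 9 10 "1/n"] by simp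
  show ?thesis by (rule lin[OF b0 b1 b2 b3 b4 b5 b6])
qed

text \<open>Averages the previous bound over \<open>d\<close>. In the at most z r columns where row
  \<open>i\<close> is blocked the first-order bound is used; together they cost 2 z^6 before
  division by n.\<close>

lemma cell2:
  assumes i: "i < n" "b < n" "(i,b) \<notin> H"
  shows "\<bar>EE (\<lambda>G. xi G i b)\<bar> \<le> z ^ 11 / n"
proof -
  let ?h = "{k. (i,k) \<in> H}"
  have e: "real n * EE (\<lambda>G. xi G i b) = (\<Sum>d<n. EE (\<lambda>G. xi G i b - xi G i d))"
    unfolding EE_cmult[symmetric] EE_sum[symmetric] using n_xi[OF _ i(1)] by (intro EE_cong) auto
  have c1: "\<bar>EE (\<lambda>G. xi G i c)\<bar> \<le> z ^ 5 / r" if "c < n" for c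
    using cell[OF i(1) that, of "{}" "{}" "\<lambda>_. 1"] by (simp add: dep_const)
  have "\<bar>real n * EE (\<lambda>G. xi G i b)\<bar> \<le> (\<Sum>d<n. z ^ 10 / n + (if d \<in> ?h then 2 * (z ^ 5 / r) else 0))"
    unfolding e
  proof (rule order_trans[OF sum_abs], rule sum_mono)
    fix d assume "d \<in> {..<n}"
    then have d: "d < n" by simp
    show "\<bar>EE (\<lambda>G. xi G i b - xi G i d)\<bar> \<le> z ^ 10 / n + (if d \<in> ?h then 2 * (z ^ 5 / r) else 0)"
    proof (cases "d \<in> ?h")
      case True
      have "\<bar>EE (\<lambda>G. xi G i b - xi G i d)\<bar> \<le> z ^ 5 / r + z ^ 5 / r"
        unfolding EE_diff by (intro abs_diff_le c1 i d)
      moreover have "0 \<le> z ^ 10 / n" using z_pos by simp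
      ultimately have "\<bar>EE (\<lambda>G. xi G i b - xi G i d)\<bar> \<le> z ^ 10 / n + 2 * (z ^ 5 / r)" by linarith
      then show ?thesis using True by simp
    next
      case False
      show ?thesis
      proof (cases "d = b")
        case True then show ?thesis using z_pos r_pos by (simp add: EE_const)
      next
        case f: False then show ?thesis using cell2_step[OF i(1,2) d _ i(3)] False by auto
      qed
    qed
  qed
  also have "\<dots> = n * (z ^ 10 / n) + real (card ({..<n} \<inter> ?h)) * (2 * (z ^ 5 / r))"
    by (simp add: sum.distrib sum.If_cases)
  also have "{..<n} \<inter> ?h = ?h" using H_sub by auto
  also have "real (card ?h) * (2 * (z ^ 5 / r)) \<le> z * r * (2 * (z ^ 5 / r))"
    using out_le[OF i(1)] z_pos r_pos unfolding outdeg_def by (intro mult_right_mono) auto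
  also have "z * r * (2 * (z ^ 5 / r)) = 2 * z ^ 6" using r_pos by (simp add: eval_nat_numeral)
  also have "n * (z ^ 10 / n) + 2 * z ^ 6 \<le> z ^ 11"
  proof -
    have "z ^ 6 \<le> z ^ 10" using zr_mono[of 6 10 1] by simp
    moreover have "5 * z ^ 10 \<le> z ^ 11" using absorb[of 1 5 10] by (simp add: eval_nat_numeral)
    ultimately show ?thesis using n_pos z1[of 10] by simp
  qed
  finally have "real n * \<bar>EE (\<lambda>G. xi G i b)\<bar> \<le> n * (z ^ 11 / n)" using n_pos by (simp add: abs_mult)
  then show ?thesis by (rule mult_left_le_imp_le) (use n_pos in simp)
qed

section \<open>Second moment of the correlation of two columns\<close>

text \<open>A switch between \<open>b\<close> and \<open>d\<close> leaves column \<open>a\<close>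
  alone, while in column \<open>b\<close> row \<open>i\<close> loses its 1 and row \<open>j\<close>
  gains one.\<close>

lemma KK_sw:
  assumes "a \<noteq> b" "a \<noteq> d" "b \<noteq> d" "i \<in> drows H b d {..<n} G" "j \<in> drows H d b {..<n} G"
  shows "KK a b G - KK a b (sw b d i j G) = xi G i a - xi G j a"
proof -
  have ij: "i < n" "j < n" "i \<noteq> j" "(i,b) \<notin> H" "(j,b) \<notin> H" "(i,b) \<in> G" "(j,b) \<notin> G" using assms by (auto simp: drows_def)
  have 1: "xi (sw b d i j G) k a = xi G k a" for k using assms by (auto simp: xi_def ent_def sw_def)
  have 2: "xi G k b - xi (sw b d i j G) k b = of_bool (k = i) - of_bool (k = j)" for k
    using assms ij by (auto simp: xi_def ent_def sw_def)
  have "KK a b G - KK a b (sw b d i j G) = (\<Sum>k<n. xi G k a * (of_bool (k = i) - of_bool (k = j)))"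
    unfolding KK_def sum_subtractf[symmetric] by (intro sum.cong refl) (simp add: 1 2[symmetric] right_diff_distrib)
  also have "\<dots> = (\<Sum>k<n. (if k = i then xi G k a else 0) - (if k = j then xi G k a else 0))"
    by (intro sum.cong refl) auto
  also have "\<dots> = xi G i a - xi G j a" using ij by (simp add: sum_subtractf)
  finally show ?thesis .
qed

lemma sum_sq_diff:
  fixes x :: "'a \<Rightarrow> real"
  shows "(\<Sum>i\<in>P. \<Sum>j\<in>Q. (x i - x j)\<^sup>2) = real (card Q) * (\<Sum>i\<in>P. (x i)\<^sup>2) + real (card P) * (\<Sum>j\<in>Q. (x j)\<^sup>2) - 2 * (\<Sum>i\<in>P. x i) * (\<Sum>j\<in>Q. x j)"
proof -
  have "(\<Sum>i\<in>P. \<Sum>j\<in>Q. (x i - x j)\<^sup>2) = (\<Sum>i\<in>P. \<Sum>j\<in>Q. (x i)\<^sup>2 + (x j)\<^sup>2 - 2 * (x i * x j))"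
    by (simp add: power2_diff mult.assoc)
  also have "\<dots> = real (card Q) * (\<Sum>i\<in>P. (x i)\<^sup>2) + real (card P) * (\<Sum>j\<in>Q. (x j)\<^sup>2) - 2 * ((\<Sum>i\<in>P. x i) * (\<Sum>j\<in>Q. x j))"
    by (simp add: sum.distrib sum_subtractf sum_distrib_left[symmetric] sum_product)
  finally show ?thesis by simp
qed

lemma swdev_half: "swdev H b d J (\<lambda>i G. w i G / 2) G = swdev H b d J w G / 2"
  unfolding swdev_def sum_divide_distrib[symmetric] by (simp add: diff_divide_distrib add_divide_distrib)

text \<open>Isolates (P2 + Q2) / 2, the only term that will be of order n. The others carry the
  small ratio (U - V) / (U + V) or a product of two concentrated sums.\<close>

lemma half_split:
  fixes U V P2 Q2 P1 Q1 :: real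
  assumes "U + V > 0"
  shows "(V * P2 + U * Q2 - 2 * P1 * Q1) / (U + V) = (P2 + Q2) / 2 - (U - V) / (U + V) * ((P2 - Q2) / 2) - 2 * P1 * Q1 / (U + V)"
proof -
  have "V * P2 + U * Q2 - 2 * P1 * Q1 = (U + V) * ((P2 + Q2) / 2) - (U - V) * ((P2 - Q2) / 2) - 2 * P1 * Q1"
    by (simp add: field_simps)
  moreover have "(D * A - B * C - E) / D = A - B / D * C - E / D" if "D > 0" for A B C D E :: real
    using that by (simp add: field_simps)
  ultimately show ?thesis using assms by (simp only:)
qed

text \<open>The assumptions \<open>g1\<close> to \<open>g4\<close> are the high-probability events.
  On them the double sum is close to half the sum of squares over the switchable rows, that is to v
  times the sum over all rows, and \<open>KK_self\<close> evaluates the latter as n v.\<close>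

lemma second_step_pointwise:
  assumes ab: "a < n" "b < n" "d < n" "a \<noteq> b" "a \<noteq> d" "b \<noteq> d" and G: "G \<in> M"
    and g1: "n / z \<le> dd {..<n} b d G"
    and g2: "\<bar>swdev H b d {..<n} (\<lambda>i G. xc a i G / 2) G\<bar> \<le> 2 * z * r"
    and g3: "\<bar>(\<Sum>i\<in>drows H b d {..<n} G. xc a i G / 2) + (\<Sum>i\<in>drows H d b {..<n} G. xc a i G / 2) - 2 * v * (\<Sum>i<n. xc a i G / 2)\<bar> \<le> z ^ 3 * r"
    and g4: "\<bar>(\<Sum>i\<in>drows H b d {..<n} G. (xc a i G / 2)\<^sup>2) + (\<Sum>i\<in>drows H d b {..<n} G. (xc a i G / 2)\<^sup>2) - 2 * v * (\<Sum>i<n. (xc a i G / 2)\<^sup>2)\<bar> \<le> z ^ 3 * r"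
  shows "\<bar>(\<Sum>i\<in>drows H b d {..<n} G. \<Sum>j\<in>drows H d b {..<n} G. (xc a i G - xc a j G)\<^sup>2 / dd {..<n} b d G) - n * v^2\<bar> \<le> z ^ 4 * r"
proof -
  define U V where "U = real (card (drows H b d {..<n} G))" and "V = real (card (drows H d b {..<n} G))"
  define P1 Q1 where "P1 = (\<Sum>i\<in>drows H b d {..<n} G. xc a i G)" and "Q1 = (\<Sum>i\<in>drows H d b {..<n} G. xc a i G)"
  define P2 Q2 where "P2 = (\<Sum>i\<in>drows H b d {..<n} G. (xc a i G)\<^sup>2)" and "Q2 = (\<Sum>i\<in>drows H d b {..<n} G. (xc a i G)\<^sup>2)"
  have ddU: "dd {..<n} b d G = U + V" and sgU: "sg {..<n} b d G = U - V" by (simp_all add: dd_def sg_def U_def V_def)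
  have pos: "0 < n / z" using n_pos z_pos by simp
  have UV: "U + V > 0" using g1 pos unfolding ddU by linarith
  have UVn: "U + V \<le> n"
  proof -
    have "drows H b d {..<n} G \<inter> drows H d b {..<n} G = {}" by (auto simp: drows_def)
    then have "card (drows H b d {..<n} G) + card (drows H d b {..<n} G) = card (drows H b d {..<n} G \<union> drows H d b {..<n} G)"
      using finite_drows[of "{..<n}" n] by (simp add: card_Un_disjoint)
    also have "\<dots> \<le> card {..<n}" by (intro card_mono) (auto simp: drows_def)
    finally show ?thesis by (simp add: U_def V_def)
  qed
  have eq: "(\<Sum>i\<in>drows H b d {..<n} G. \<Sum>j\<in>drows H d b {..<n} G. (xc a i G - xc a j G)\<^sup>2 / dd {..<n} b d G)
    = (P2 + Q2) / 2 - (U - V) / (U + V) * ((P2 - Q2) / 2) - 2 * P1 * Q1 / (U + V)"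
    unfolding ddU half_split[OF UV, symmetric] sum_divide_distrib[symmetric] sum_sq_diff
    by (simp add: U_def V_def P1_def Q1_def P2_def Q2_def)
  have q: "\<bar>(U - V) / (U + V)\<bar> \<le> z ^ 3 / r" using sg_dd_good[OF G ab(2,3) g1] unfolding ddU sgU .
  have sq4: "(xc a i G)\<^sup>2 \<le> 4" for i
    using abs_mult_le[OF xc_le[OF ab(1), of i G] xc_le[OF ab(1), of i G]] by (simp add: power2_eq_square)
  have P2: "0 \<le> P2" "P2 \<le> 4 * U" unfolding P2_def U_def
    using sum_bounded_above[of "drows H b d {..<n} G" "\<lambda>i. (xc a i G)\<^sup>2" 4] sq4 by (auto intro: sum_nonneg simp: mult.commute)
  have Q2: "0 \<le> Q2" "Q2 \<le> 4 * V" unfolding Q2_def V_def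
    using sum_bounded_above[of "drows H d b {..<n} G" "\<lambda>i. (xc a i G)\<^sup>2" 4] sq4 by (auto intro: sum_nonneg simp: mult.commute)
  have d2: "\<bar>P2 - Q2\<bar> \<le> 4 * n" using P2 Q2 UVn by linarith
  have t2: "\<bar>(U - V) / (U + V) * ((P2 - Q2) / 2)\<bar> \<le> 2 * (z ^ 3 * r)"
  proof -
    have "\<bar>(U - V) / (U + V) * ((P2 - Q2) / 2)\<bar> \<le> z ^ 3 / r * (2 * real n)" using d2 by (intro abs_mult_le q) simp
    also have "\<dots> = 2 * z ^ 3 * (n / r)" by simp
    also have "n / r = r" by (simp add: real_div_sqrt)
    finally show ?thesis by simp
  qed
  have s1: "(\<Sum>i<n. xc a i G) = 0"
  proof -
    have "(\<Sum>i<n. xc a i G) = (\<Sum>i<n. xi G i a)" by (intro sum.cong) (auto simp: xc_def)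
    then show ?thesis using xi_col[OF G ab(1)] by simp
  qed
  have s2: "(\<Sum>i<n. (xc a i G)\<^sup>2) = KK a a G" unfolding KK_def by (intro sum.cong) (auto simp: xc_def power2_eq_square)
  have SD: "\<bar>P1 + Q1\<bar> \<le> 2 * (z ^ 3 * r)"
    using g3 unfolding sum_divide_distrib[symmetric] s1 P1_def[symmetric] Q1_def[symmetric] by simp
  have sd2: "\<bar>P2 + Q2 - 2 * v * KK a a G\<bar> \<le> 4 * (z ^ 3 * r)"
    using g4 unfolding power_divide sum_divide_distrib[symmetric] s2 P2_def[symmetric] Q2_def[symmetric] by simp
  have t1: "\<bar>(P2 + Q2) / 2 - n * v^2\<bar> \<le> 3 * (z ^ 3 * r)"
  proof -
    have "\<bar>v * (KK a a G - n * v)\<bar> \<le> 1 * (z ^ 2 * r)"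
      by (rule abs_mult_le[OF _ KK_self[OF G ab(1)]]) (use v_pos v_le in simp)
    moreover have "(P2 + Q2) / 2 - n * v^2 = (P2 + Q2 - 2 * v * KK a a G) / 2 + v * (KK a a G - n * v)"
      by (simp add: field_simps power2_eq_square)
    moreover have "z ^ 2 * r \<le> z ^ 3 * r" using zr_mono[of 2 3 r] by simp
    moreover have "\<bar>(P2 + Q2 - 2 * v * KK a a G) / 2\<bar> \<le> 2 * (z ^ 3 * r)" using sd2 by simp
    ultimately have "\<bar>(P2 + Q2) / 2 - n * v^2\<bar> \<le> 2 * (z ^ 3 * r) + 1 * (z ^ 2 * r)"
      using abs_add_le by (simp only:)
    then show ?thesis using \<open>z ^ 2 * r \<le> z ^ 3 * r\<close> by linarith
  qed
  have df: "\<bar>P1 - Q1\<bar> \<le> 5 * (z ^ 3 * r)"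
  proof -
    have e: "P1 - Q1 = swdev H b d {..<n} (xc a) G + (U - V) / (U + V) * (P1 + Q1)"
      by (simp add: swdev_def P1_def Q1_def U_def V_def)
    have "\<bar>swdev H b d {..<n} (xc a) G\<bar> \<le> 4 * z * r" using g2 unfolding swdev_half by simp
    moreover have "\<bar>(U - V) / (U + V) * (P1 + Q1)\<bar> \<le> 1 * (2 * (z ^ 3 * r))"
      using q z_le_r[of 3] r_pos by (intro abs_mult_le SD) (auto intro: order_trans)
    ultimately have "\<bar>P1 - Q1\<bar> \<le> 4 * z * r + 1 * (2 * (z ^ 3 * r))" unfolding e by (rule abs_add_le)
    moreover have "2 * (z * r) \<le> z ^ 2 * r" using absorb[of r 2 1] by (simp add: numeral_2_eq_2)
    moreover have "z ^ 2 * r \<le> z ^ 3 * r" using zr_mono[of 2 3 r] by simp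
    ultimately show ?thesis using zkr[of 3] by linarith
  qed
  \<comment> \<open>The sum P1 + Q1 is small because column \<open>a\<close> of \<open>xi\<close>
    sums to zero, and the difference by the bound on \<open>swdev\<close>; hence each of them is
    small.\<close>
  have P1: "\<bar>P1\<bar> \<le> 4 * (z ^ 3 * r)" "\<bar>Q1\<bar> \<le> 4 * (z ^ 3 * r)" using SD df zkr[of 3] by linarith+
  have t3: "\<bar>2 * P1 * Q1 / (U + V)\<bar> \<le> z ^ 3 * r"
  proof -
    have "\<bar>2 * P1 * Q1 / (U + V)\<bar> \<le> (2 * (4 * (z ^ 3 * r)) * (4 * (z ^ 3 * r))) / (n / z)"
      using g1 unfolding ddU by (intro abs_divide_le abs_mult_le P1 pos) auto
    also have "\<dots> = 32 * (z ^ 3 * z ^ 3 * z) * (r * r / n)"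
    proof -
      have "(2 * (4 * (x * y)) * (4 * (x * y))) / (N / c) = 32 * (x * x * c) * (y * y / N)" for x y N c :: real
        by simp
      then show ?thesis by blast
    qed
    also have "z ^ 3 * z ^ 3 * z = z ^ 7" by (simp add: eval_nat_numeral)
    also have "r * r / n = 1" using n_pos by simp
    also have "32 * z ^ 7 * 1 \<le> z ^ 8" using absorb[of 1 32 7] by (simp add: eval_nat_numeral)
    also have "\<dots> \<le> r" by (rule z_le_r) simp
    also have "\<dots> \<le> z ^ 3 * r" using zr_mono[of 0 3 r] by simp
    finally show ?thesis .
  qed
  have "6 * (z ^ 3 * r) \<le> z ^ 4 * r" using absorb[of r 6 3] by (simp add: eval_nat_numeral)
  moreover have "\<bar>A - B - C - D\<bar> \<le> z4" if "\<bar>A - D\<bar> \<le> 3 * y" "\<bar>B\<bar> \<le> 2 * y" "\<bar>C\<bar> \<le> y" "6 * y \<le> z4" for A B C D y z4 :: real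
    using that by linarith
  ultimately show ?thesis unfolding eq using t1 t2 t3 by blast
qed

text \<open>The Stein identity with f = \<open>KK a b\<close> and column \<open>a\<close> as
  weights: by \<open>KK_sw\<close> the increment of f equals the difference of the two weights, so
  squares appear.\<close>

lemma second_step:
  assumes ab: "a < n" "b < n" "d < n" "a \<noteq> b" "a \<noteq> d" "b \<noteq> d"
  shows "\<bar>EE (\<lambda>G. KK a b G * swdev H b d {..<n} (xc a) G) - n * v^2\<bar> \<le> z ^ 4 * r + 1 / real n ^ 3"
proof -
  let ?F = "\<lambda>G. \<Sum>i\<in>drows H b d {..<n} G. \<Sum>j\<in>drows H d b {..<n} G. (xc a i G - xc a j G)\<^sup>2 / dd {..<n} b d G"
  have S: "UNIV \<times> {a} \<inter> {..<n} \<times> {b, d} = {}" using ab by auto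
  have "(\<Sum>G\<in>M. KK a b G * swdev H b d {..<n} (xc a) G) = (\<Sum>G\<in>M. \<Sum>i\<in>drows H b d {..<n} G. \<Sum>j\<in>drows H d b {..<n} G.
       (xc a i G - xc a j G) * (KK a b G - KK a b (sw b d i j G))
        / (real (card (drows H b d {..<n} G)) + real (card (drows H d b {..<n} G))))"
    by (rule stein_identity) (use ab in \<open>auto intro: dep_sw[OF dep_xc S]\<close>)
  also have "\<dots> = (\<Sum>G\<in>M. ?F G)"
  proof (intro sum.cong refl)
    fix G i j assume "i \<in> drows H b d {..<n} G" "j \<in> drows H d b {..<n} G"
    then have "KK a b G - KK a b (sw b d i j G) = xc a i G - xc a j G"
      using ab by (subst KK_sw) (auto simp: xc_def drows_def)
    then show "(xc a i G - xc a j G) * (KK a b G - KK a b (sw b d i j G))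
        / (real (card (drows H b d {..<n} G)) + real (card (drows H d b {..<n} G))) = (xc a i G - xc a j G)\<^sup>2 / dd {..<n} b d G"
      by (simp add: dd_def power2_eq_square)
  qed
  finally have "EE (\<lambda>G. KK a b G * swdev H b d {..<n} (xc a) G) = EE ?F" by (simp add: EE_def)
  then have e: "EE (\<lambda>G. KK a b G * swdev H b d {..<n} (xc a) G) - n * v^2 = EE (\<lambda>G. ?F G - n * v^2)"
    by (simp only: EE_diff EE_const)
  have w1: "\<And>i. dep (UNIV \<times> {a}) (\<lambda>G. xc a i G / 2)" by (rule dep_xc2) simp
  have w2: "\<And>i. dep (UNIV \<times> {a}) (\<lambda>G. (xc a i G / 2)\<^sup>2)" by (rule dep_comp1[OF w1])
  have w2le: "\<bar>(xc a i G / 2)\<^sup>2\<bar> \<le> 1" for i G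
    using abs_mult_le[OF xc_le2[OF ab(1), of i G] xc_le2[OF ab(1), of i G]] by (simp add: power2_eq_square)
  have h1: "hp 3 (\<lambda>G. \<bar>dd {..<n} b d G - 2 * v * n\<bar> \<le> z ^ 3 * r \<and> n / z \<le> dd {..<n} b d G)" by (rule dd_conc[OF ab(2,3,6)])
  have h2: "hp (1 / n) (\<lambda>G. \<bar>swdev H b d {..<n} (\<lambda>i G. xc a i G / 2) G\<bar> \<le> 2 * z * r)"
    by (rule swdev_hp[OF ab(2,3,6) _ w1 S]) (use xc_le2[OF ab(1)] in auto)
  have h3: "hp 3 (\<lambda>G. \<bar>(\<Sum>i\<in>drows H b d {..<n} G. xc a i G / 2) + (\<Sum>i\<in>drows H d b {..<n} G. xc a i G / 2) - 2 * v * (\<Sum>i<n. xc a i G / 2)\<bar> \<le> z ^ 3 * r)"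
    by (rule dconc[OF ab(2,3,6) _ _ _ _ w1]) (use ab xc_le2[OF ab(1)] in auto)
  have h4: "hp 3 (\<lambda>G. \<bar>(\<Sum>i\<in>drows H b d {..<n} G. (xc a i G / 2)\<^sup>2) + (\<Sum>i\<in>drows H d b {..<n} G. (xc a i G / 2)\<^sup>2) - 2 * v * (\<Sum>i<n. (xc a i G / 2)\<^sup>2)\<bar> \<le> z ^ 3 * r)"
    by (rule dconc[OF ab(2,3,6) _ _ _ _ w2]) (use ab w2le in auto)
  show ?thesis unfolding e
  proof (rule EE_bound_hp[OF hp_conj[OF hp_conj[OF h1 h2] hp_conj[OF h3 h4]]])
    have "1 / real n \<le> 1" using n_ge by simp
    then show "3 + 1 / real n + (3 + 3) \<le> real n" using n_ge by linarith
    fix G assume G: "G \<in> M"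
    show "\<bar>?F G - n * v^2\<bar> \<le> z ^ 4 * r"
      if "((\<bar>dd {..<n} b d G - 2 * v * n\<bar> \<le> z ^ 3 * r \<and> n / z \<le> dd {..<n} b d G) \<and> \<bar>swdev H b d {..<n} (\<lambda>i G. xc a i G / 2) G\<bar> \<le> 2 * z * r) \<and>
        \<bar>(\<Sum>i\<in>drows H b d {..<n} G. xc a i G / 2) + (\<Sum>i\<in>drows H d b {..<n} G. xc a i G / 2) - 2 * v * (\<Sum>i<n. xc a i G / 2)\<bar> \<le> z ^ 3 * r \<and>
        \<bar>(\<Sum>i\<in>drows H b d {..<n} G. (xc a i G / 2)\<^sup>2) + (\<Sum>i\<in>drows H d b {..<n} G. (xc a i G / 2)\<^sup>2) - 2 * v * (\<Sum>i<n. (xc a i G / 2)\<^sup>2)\<bar> \<le> z ^ 3 * r"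
      by (rule second_step_pointwise[OF ab G]) (use that in blast)+
    have "\<bar>?F G\<bar> \<le> (\<Sum>i<n. \<Sum>j<n. 16)"
    proof -
      have t: "0 \<le> (xc a i G - xc a j G)\<^sup>2 / dd {..<n} b d G \<and> (xc a i G - xc a j G)\<^sup>2 / dd {..<n} b d G \<le> 16"
        if "i \<in> drows H b d {..<n} G" for i j
      proof -
        have "card (drows H b d {..<n} G) > 0" using that finite_drows[of "{..<n}" n H b d G] by (auto simp: card_gt_0_iff)
        then have d1: "1 \<le> dd {..<n} b d G" by (simp add: dd_def)
        have "\<bar>xc a i G - xc a j G\<bar> \<le> 2 + 2" by (intro abs_diff_le xc_le ab)
        from abs_mult_le[OF this this] have "(xc a i G - xc a j G)\<^sup>2 \<le> 16" by (simp add: power2_eq_square)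
        then have "(xc a i G - xc a j G)\<^sup>2 / dd {..<n} b d G \<le> 16 / 1" using d1 by (intro frac_le) auto
        then show ?thesis using d1 by simp
      qed
      have "?F G \<le> (\<Sum>i\<in>drows H b d {..<n} G. \<Sum>j\<in>drows H d b {..<n} G. 16)" using t by (intro sum_mono) auto
      also have "\<dots> \<le> (\<Sum>i\<in>drows H b d {..<n} G. \<Sum>j<n. 16)" by (intro sum_mono sum_mono2) (auto simp: drows_def)
      also have "\<dots> \<le> (\<Sum>i<n. \<Sum>j<n. 16)" by (intro sum_mono2) (auto simp: drows_def)
      finally have "?F G \<le> (\<Sum>i<n. \<Sum>j<n. 16)" .
      moreover have "0 \<le> ?F G" using t by (intro sum_nonneg) auto
      ultimately show ?thesis by simp
    qed
    then have "\<bar>?F G\<bar> \<le> 16 * real n ^ 2" by (simp add: power2_eq_square)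
    moreover have "\<bar>n * v^2\<bar> \<le> real n * 1" using v_le v_pos by (intro abs_mult_le) (auto simp: power_le_one)
    ultimately have "\<bar>?F G - n * v^2\<bar> \<le> 16 * real n ^ 2 + real n * 1" by (rule abs_diff_le)
    also have "\<dots> \<le> 17 * real n ^ 2" using n_powers(1)[of 1] by simp
    also have "\<dots> \<le> real n ^ 3" by (rule n_powers) simp
    also have "\<dots> \<le> real n ^ 6" by (rule n_pow_mono) simp
    finally show "\<bar>?F G - n * v^2\<bar> \<le> real n ^ 6" .
  qed (use z_pos r_pos in auto)
qed

lemma KK_q_SS:
  assumes ab: "a < n" "b < n" "d < n" "a \<noteq> b" "a \<noteq> d" "b \<noteq> d"
  shows "\<bar>EE (\<lambda>G. KK a b G * (sg {..<n} b d G / dd {..<n} b d G * ((\<Sum>i\<in>drows H b d {..<n} G. xc a i G) + (\<Sum>i\<in>drows H d b {..<n} G. xc a i G))))\<bar>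
     \<le> 4 * z ^ 8 * r + 1 / real n ^ 3"
proof -
  let ?SS = "\<lambda>G. (\<Sum>i\<in>drows H b d {..<n} G. xc a i G) + (\<Sum>i\<in>drows H d b {..<n} G. xc a i G)"
  have w1: "\<And>i. dep (UNIV \<times> {a}) (\<lambda>G. xc a i G / 2)" by (rule dep_xc2) simp
  have h1: "hp 3 (\<lambda>G. \<bar>dd {..<n} b d G - 2 * v * n\<bar> \<le> z ^ 3 * r \<and> n / z \<le> dd {..<n} b d G)" by (rule dd_conc[OF ab(2,3,6)])
  have h3: "hp 3 (\<lambda>G. \<bar>(\<Sum>i\<in>drows H b d {..<n} G. xc a i G / 2) + (\<Sum>i\<in>drows H d b {..<n} G. xc a i G / 2) - 2 * v * (\<Sum>i<n. xc a i G / 2)\<bar> \<le> z ^ 3 * r)"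
    by (rule dconc[OF ab(2,3,6) _ _ _ _ w1]) (use ab xc_le2[OF ab(1)] in auto)
  show ?thesis
  proof (rule EE_bound_hp[OF hp_conj[OF hp_conj[OF h1 h3] kconc[OF ab(1,2,4)]]])
    fix G assume G: "G \<in> M"
    show "\<bar>KK a b G * (sg {..<n} b d G / dd {..<n} b d G * ?SS G)\<bar> \<le> 4 * z ^ 8 * r"
      if "((\<bar>dd {..<n} b d G - 2 * v * n\<bar> \<le> z ^ 3 * r \<and> n / z \<le> dd {..<n} b d G) \<and>
        \<bar>(\<Sum>i\<in>drows H b d {..<n} G. xc a i G / 2) + (\<Sum>i\<in>drows H d b {..<n} G. xc a i G / 2) - 2 * v * (\<Sum>i<n. xc a i G / 2)\<bar> \<le> z ^ 3 * r) \<and> \<bar>KK a b G\<bar> \<le> 2 * z ^ 2 * r"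
    proof -
      have "(\<Sum>i<n. xc a i G) = (\<Sum>i<n. xi G i a)" by (intro sum.cong) (auto simp: xc_def)
      then have "(\<Sum>i<n. xc a i G / 2) = 0" using xi_col[OF G ab(1)] by (simp add: sum_divide_distrib[symmetric])
      then have "\<bar>(\<Sum>i\<in>drows H b d {..<n} G. xc a i G) / 2 + (\<Sum>i\<in>drows H d b {..<n} G. xc a i G) / 2\<bar> \<le> z ^ 3 * r"
        using that by (simp add: sum_divide_distrib[symmetric])
      then have "\<bar>?SS G\<bar> \<le> 2 * (z ^ 3 * r)" by linarith
      moreover have "\<bar>sg {..<n} b d G / dd {..<n} b d G\<bar> \<le> z ^ 3 / r" using that by (intro sg_dd_good G ab) blast
      ultimately have "\<bar>KK a b G * (sg {..<n} b d G / dd {..<n} b d G * ?SS G)\<bar> \<le> (2 * z ^ 2 * r) * (z ^ 3 / r * (2 * (z ^ 3 * r)))"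
        using that by (intro abs_mult_le) auto
      also have "\<dots> = 4 * z ^ 8 * r" using r_pos by (simp add: eval_nat_numeral)
      finally show ?thesis .
    qed
    have "\<bar>KK a b G * (sg {..<n} b d G / dd {..<n} b d G * ?SS G)\<bar> \<le> (4 * real n) * (1 * (2 * real n))"
      by (intro abs_mult_le KK_le sg_over_dd sum_drows_le2 ab) auto
    also have "\<dots> = 8 * real n ^ 2" by (simp add: power2_eq_square)
    also have "\<dots> \<le> real n ^ 3" by (rule n_powers) simp
    also have "\<dots> \<le> real n ^ 6" by (rule n_pow_mono) simp
    finally show "\<bar>KK a b G * (sg {..<n} b d G / dd {..<n} b d G * ?SS G)\<bar> \<le> real n ^ 6" .
  qed (use n_ge z_pos r_pos in auto)
qed

text \<open>By \<open>KK_sum\<close>, n times the square of \<open>KK a b\<close> is the sum over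
  \<open>d\<close> of \<open>KK a b * (KK a b - KK a d)\<close>. Each of the n - 2 main values of
  \<open>d\<close> contributes n v^2 through \<open>second_step\<close>. For the other terms the
  concentration of \<open>KK a b\<close> is sufficient.\<close>

lemma second:
  assumes ab: "a < n" "b < n" "a \<noteq> b"
  shows "\<bar>EE (\<lambda>G. (KK a b G)\<^sup>2) - n * v^2\<bar> \<le> z ^ 9 * r"
proof -
  let ?I = "{..<n} - {b,a}"
  let ?SS = "\<lambda>d G. (\<Sum>i\<in>drows H b d {..<n} G. xc a i G) + (\<Sum>i\<in>drows H d b {..<n} G. xc a i G)"
  let ?q = "\<lambda>d G. sg {..<n} b d G / dd {..<n} b d G"
  let ?B = "\<lambda>d G. \<Sum>i\<in>bad b d. xi G i a * (ent G i b - ent G i d)"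
  let ?K = "KK a b"
  have pt: "real n * (?K G)\<^sup>2 = (\<Sum>d\<in>?I. ?K G * swdev H b d {..<n} (xc a) G + ?K G * (?q d G * ?SS d G)) + ?K G * (\<Sum>d\<in>?I. ?B d G) + ?K G * (?K G - KK a a G)"
    if G: "G \<in> M" for G
  proof -
    have "real n * (?K G)\<^sup>2 = (\<Sum>d<n. ?K G * (?K G - KK a d G))"
      unfolding sum_distrib_left[symmetric] sum_subtractf using KK_sum[OF G] by (simp add: power2_eq_square)
    also have "\<dots> = (\<Sum>d\<in>?I. ?K G * (?K G - KK a d G)) + (\<Sum>d\<in>{b,a}. ?K G * (?K G - KK a d G))"
      using ab by (intro sum.subset_diff) auto
    also have "(\<Sum>d\<in>{b,a}. ?K G * (?K G - KK a d G)) = ?K G * (?K G - KK a a G)" using ab by simp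
    also have "(\<Sum>d\<in>?I. ?K G * (?K G - KK a d G)) = (\<Sum>d\<in>?I. ?K G * swdev H b d {..<n} (xc a) G + ?K G * (?q d G * ?SS d G) + ?K G * ?B d G)"
      by (intro sum.cong refl) (simp only: KK_diff[OF G ab(1)] distrib_left)
    also have "\<dots> = (\<Sum>d\<in>?I. ?K G * swdev H b d {..<n} (xc a) G + ?K G * (?q d G * ?SS d G)) + ?K G * (\<Sum>d\<in>?I. ?B d G)"
      by (simp only: sum.distrib sum_distrib_left[of "?K G" "\<lambda>d. ?B d G"])
    finally show ?thesis .
  qed
  define T1 where "T1 = (\<Sum>d\<in>?I. EE (\<lambda>G. ?K G * swdev H b d {..<n} (xc a) G))"
  define T2 where "T2 = (\<Sum>d\<in>?I. EE (\<lambda>G. ?K G * (?q d G * ?SS d G)))"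
  define T3 where "T3 = EE (\<lambda>G. ?K G * (\<Sum>d\<in>?I. ?B d G))"
  define T4 where "T4 = EE (\<lambda>G. ?K G * (?K G - KK a a G))"
  have "real n * EE (\<lambda>G. (?K G)\<^sup>2) = EE (\<lambda>G. real n * (?K G)\<^sup>2)" by (rule EE_cmult[symmetric])
  also have "\<dots> = EE (\<lambda>G. (\<Sum>d\<in>?I. ?K G * swdev H b d {..<n} (xc a) G + ?K G * (?q d G * ?SS d G)) + ?K G * (\<Sum>d\<in>?I. ?B d G) + ?K G * (?K G - KK a a G))"
    by (rule EE_cong) (rule pt)
  also have "\<dots> = T1 + T2 + T3 + T4"
    unfolding T1_def T2_def T3_def T4_def by (simp only: EE_add EE_sum sum.distrib)
  finally have e: "real n * EE (\<lambda>G. (?K G)\<^sup>2) = T1 + T2 + T3 + T4" .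
  have cI: "real (card ?I) = real n - 2" "real (card ?I) \<le> n"
  proof -
    have "card ?I = n - 2" using ab by (subst card_Diff_subset) auto
    then show "real (card ?I) = real n - 2" using n_ge by (simp add: of_nat_diff)
    then show "real (card ?I) \<le> n" by simp
  qed
  have "1 / real n ^ 3 \<le> 1" using n_ge by simp
  then have n3': "1 / real n ^ 3 \<le> r" using r_ge by linarith
  have b1: "\<bar>T1 - n * (n * v^2)\<bar> \<le> n * (z ^ 4 * r + r) + 2 * n"
  proof -
    have "T1 - card ?I * (n * v^2) = (\<Sum>d\<in>?I. EE (\<lambda>G. ?K G * swdev H b d {..<n} (xc a) G) - n * v^2)"
      by (simp add: T1_def sum_subtractf)
    then have "\<bar>T1 - card ?I * (n * v^2)\<bar> \<le> (\<Sum>d\<in>?I. \<bar>EE (\<lambda>G. ?K G * swdev H b d {..<n} (xc a) G) - n * v^2\<bar>)"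
      by (simp only: sum_abs)
    also have "\<dots> \<le> (\<Sum>d\<in>?I. z ^ 4 * r + r)"
    proof (rule sum_mono)
      fix d assume "d \<in> ?I"
      then have "\<bar>EE (\<lambda>G. ?K G * swdev H b d {..<n} (xc a) G) - n * v^2\<bar> \<le> z ^ 4 * r + 1 / real n ^ 3" using ab by (intro second_step) auto
      then show "\<bar>EE (\<lambda>G. ?K G * swdev H b d {..<n} (xc a) G) - n * v^2\<bar> \<le> z ^ 4 * r + r" using n3' by linarith
    qed
    also have "\<dots> = card ?I * (z ^ 4 * r + r)" by simp
    also have "\<dots> \<le> n * (z ^ 4 * r + r)" using cI(2) z_pos r_pos by (intro mult_right_mono) auto
    finally have 1: "\<bar>T1 - card ?I * (n * v^2)\<bar> \<le> n * (z ^ 4 * r + r)" .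
    have 2: "\<bar>n * v^2\<bar> \<le> real n * 1" using v_le v_pos by (intro abs_mult_le) (auto simp: power_le_one)
    have "T1 - n * (n * v^2) = (T1 - card ?I * (n * v^2)) - 2 * (n * v^2)" unfolding cI(1) by (simp add: algebra_simps)
    then have "\<bar>T1 - n * (n * v^2)\<bar> \<le> n * (z ^ 4 * r + r) + 2 * (real n * 1)"
      using abs_diff_le[OF 1 abs_mult_le[of 2 2, OF _ 2]] by simp
    then show ?thesis by simp
  qed
  have b2: "\<bar>T2\<bar> \<le> n * (4 * z ^ 8 * r + r)"
  proof -
    have "\<bar>T2\<bar> \<le> (\<Sum>d\<in>?I. 4 * z ^ 8 * r + r)" unfolding T2_def
    proof (rule order_trans[OF sum_abs], rule sum_mono)
      fix d assume "d \<in> ?I"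
      then have "\<bar>EE (\<lambda>G. ?K G * (?q d G * ?SS d G))\<bar> \<le> 4 * z ^ 8 * r + 1 / real n ^ 3" using ab by (intro KK_q_SS) auto
      then show "\<bar>EE (\<lambda>G. ?K G * (?q d G * ?SS d G))\<bar> \<le> 4 * z ^ 8 * r + r" using n3' by linarith
    qed
    also have "\<dots> = card ?I * (4 * z ^ 8 * r + r)" by simp
    also have "\<dots> \<le> n * (4 * z ^ 8 * r + r)" using cI(2) z_pos r_pos by (intro mult_right_mono) auto
    finally show ?thesis .
  qed
  have b3: "\<bar>T3\<bar> \<le> (2 * z ^ 2 * r) * (6 * z ^ 2 * n) + 1 / real n ^ 3" unfolding T3_def
  proof (rule EE_bound_hp[OF kconc[OF ab]])
    fix G assume G: "G \<in> M"
    have bs: "\<bar>\<Sum>d\<in>?I. ?B d G\<bar> \<le> 6 * z ^ 2 * n"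
      by (rule bad_sum[OF G ab(2)]) (use xi_le ab in auto)
    show "\<bar>?K G * (\<Sum>d\<in>?I. ?B d G)\<bar> \<le> (2 * z ^ 2 * r) * (6 * z ^ 2 * n)" if "\<bar>?K G\<bar> \<le> 2 * z ^ 2 * r"
      by (intro abs_mult_le bs that)
    have "\<bar>?K G * (\<Sum>d\<in>?I. ?B d G)\<bar> \<le> (4 * real n) * (6 * z ^ 2 * n)" by (intro abs_mult_le bs KK_le ab)
    also have "\<dots> = 24 * (z ^ 2 * real n ^ 2)" by (simp add: power2_eq_square)
    also have "\<dots> \<le> 24 * (real n * real n ^ 2)" using z_le_r[of 2] r_le_n by (intro mult_left_mono mult_right_mono) auto
    also have "\<dots> = 24 * real n ^ 3" by (simp add: eval_nat_numeral)
    also have "\<dots> \<le> real n ^ 4" by (rule n_powers) simp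
    also have "\<dots> \<le> real n ^ 6" by (rule n_pow_mono) simp
    finally show "\<bar>?K G * (\<Sum>d\<in>?I. ?B d G)\<bar> \<le> real n ^ 6" .
  qed (use n_ge z_pos r_pos in auto)
  have b4: "\<bar>T4\<bar> \<le> (2 * z ^ 2 * r) * (8 * real n) + 1 / real n ^ 3" unfolding T4_def
  proof (rule EE_bound_hp[OF kconc[OF ab]])
    fix G
    have d: "\<bar>?K G - KK a a G\<bar> \<le> 8 * real n" using abs_diff_le[OF KK_le[OF ab(1,2), of G] KK_le[OF ab(1,1), of G]] by simp
    show "\<bar>?K G * (?K G - KK a a G)\<bar> \<le> (2 * z ^ 2 * r) * (8 * real n)" if "\<bar>?K G\<bar> \<le> 2 * z ^ 2 * r"
      by (intro abs_mult_le d that)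
    have "\<bar>?K G * (?K G - KK a a G)\<bar> \<le> (4 * real n) * (8 * real n)" by (intro abs_mult_le d KK_le ab)
    also have "\<dots> = 32 * real n ^ 2" by (simp add: power2_eq_square)
    also have "\<dots> \<le> real n ^ 3" by (rule n_powers) simp
    also have "\<dots> \<le> real n ^ 6" by (rule n_pow_mono) simp
    finally show "\<bar>?K G * (?K G - KK a a G)\<bar> \<le> real n ^ 6" .
  qed (use n_ge z_pos r_pos in auto)
  have "real n * \<bar>EE (\<lambda>G. (?K G)\<^sup>2) - n * v^2\<bar> = \<bar>real n * EE (\<lambda>G. (?K G)\<^sup>2) - n * (n * v^2)\<bar>"
    by (simp add: abs_mult right_diff_distrib[symmetric])
  also have "\<dots> = \<bar>(T1 - n * (n * v^2)) + T2 + T3 + T4\<bar>" unfolding e by (simp add: algebra_simps)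
  also have "\<dots> \<le> (n * (z ^ 4 * r + r) + 2 * n) + n * (4 * z ^ 8 * r + r) + ((2 * z ^ 2 * r) * (6 * z ^ 2 * n) + 1 / real n ^ 3) + ((2 * z ^ 2 * r) * (8 * real n) + 1 / real n ^ 3)"
    by (intro abs_add_le b1 b2 b3 b4)
  also have "\<dots> \<le> n * (z ^ 9 * r)"
  proof -
    have "1 / real n ^ 3 \<le> 1" using n_ge by simp
    moreover have "1 \<le> real n" using n_ge by simp
    ultimately have "(n * (z ^ 4 * r + r) + 2 * n) + n * (4 * z ^ 8 * r + r) + ((2 * z ^ 2 * r) * (6 * z ^ 2 * n) + 1 / real n ^ 3) + ((2 * z ^ 2 * r) * (8 * real n) + 1 / real n ^ 3)
       \<le> (n * (z ^ 4 * r + r) + 2 * n) + n * (4 * z ^ 8 * r + r) + ((2 * z ^ 2 * r) * (6 * z ^ 2 * n) + n) + ((2 * z ^ 2 * r) * (8 * real n) + n)" by linarith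
    also have "\<dots> = n * (z ^ 4 * r + r + 2 + 4 * (z ^ 8 * r) + r + 12 * (z ^ 4 * r) + 1 + 16 * (z ^ 2 * r) + 1)"
      by (simp add: algebra_simps eval_nat_numeral)
    also have "\<dots> \<le> n * (z ^ 9 * r)"
    proof (rule mult_left_mono)
      have "z ^ 4 * r \<le> z ^ 8 * r" "z ^ 2 * r \<le> z ^ 8 * r" "r \<le> z ^ 8 * r"
        using zr_mono[of 4 8 r] zr_mono[of 2 8 r] zr_mono[of 0 8 r] by auto
      moreover have "50 * (z ^ 8 * r) \<le> z ^ 9 * r" using absorb[of r 50 8] by (simp add: eval_nat_numeral)
      ultimately show "z ^ 4 * r + r + 2 + 4 * (z ^ 8 * r) + r + 12 * (z ^ 4 * r) + 1 + 16 * (z ^ 2 * r) + 1 \<le> z ^ 9 * r"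
        using zkr[of 8] by linarith
    qed simp
    finally show ?thesis .
  qed
  finally show ?thesis by (rule mult_left_le_imp_le) (use n_pos in simp)
qed

end

section \<open>Moments of the switching counts\<close>

context margins begin

definition hs :: "nat \<Rightarrow> nat \<Rightarrow> nat set" where
  "hs a b = {i. (i,a) \<in> H \<and> (i,b) \<notin> H}"

text \<open>In a row where only the cell in column \<open>a\<close> is forbidden, the cell in column
  \<open>b\<close> is still random. Its fluctuation is collected here. Rows forbidden in both
  columns are deterministic and need no such term.\<close>

definition E1 :: "nat \<Rightarrow> nat \<Rightarrow> arcs \<Rightarrow> real" where
  "E1 a b G = (\<Sum>i\<in>hs a b. ent G i b - L)"

definition W1 :: "nat \<Rightarrow> nat \<Rightarrow> arcs \<Rightarrow> real" where
  "W1 a b G = (\<Sum>i<n. dl i / n * (xi G i a + xi G i b))"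

definition S2 :: real where "S2 = (\<Sum>i<n. (dl i / n - L * X / n^2)\<^sup>2)"

definition T3 :: "nat \<Rightarrow> nat \<Rightarrow> arcs \<Rightarrow> real" where
  "T3 a b G = (1 - L) * E1 b a G - L * E1 a b G"

text \<open>The centre of the expansion of U + 1, where U counts the rows with entry 1 in column a and 0 in column b.\<close>

definition u0 :: "nat \<Rightarrow> nat \<Rightarrow> real" where
  "u0 a b = n * (L + et a / n) * (1 - L - et b / n) - real (card (bad a b)) * v + 1 + v - Rval n s / n^2"

definition uu :: "nat \<Rightarrow> nat \<Rightarrow> arcs \<Rightarrow> real" where
  "uu a b G = real (card (drows H a b {..<n} G)) + 1 - u0 a b"

definition yy :: "nat \<Rightarrow> nat \<Rightarrow> real" where "yy a b = real (indeg H a) + real (indeg H b)"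

lemma yy_nonneg: "0 \<le> yy a b" by (simp add: yy_def)

lemma yy_le: "a < n \<Longrightarrow> b < n \<Longrightarrow> yy a b \<le> 2 * (z * r)"
  using in_le[of a] in_le[of b] by (simp add: yy_def)

lemma hs_sub: "hs a b \<subseteq> {..<n}" using H_sub by (auto simp: hs_def)

lemma finite_hs: "finite (hs a b)" using hs_sub finite_subset by blast

lemma card_hs: "real (card (hs a b)) \<le> real (indeg H a)"
  unfolding indeg_def using finite_H_col by (intro of_nat_mono card_mono) (auto simp: hs_def)

lemma ent_L_le: "\<bar>ent G i k - L\<bar> \<le> 1" using ent_01[of G i k] L01 by linarith

lemma E1_le: "\<bar>E1 a b G\<bar> \<le> real (indeg H a)"
proof -
  have "\<bar>E1 a b G\<bar> \<le> (\<Sum>i\<in>hs a b. 1)" unfolding E1_def by (intro order_trans[OF sum_abs] sum_mono ent_L_le)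
  then show ?thesis using card_hs[of a b] by simp
qed

lemma bad_decomp: "bad a b = hs a b \<union> hs b a \<union> {i. (i,a) \<in> H \<and> (i,b) \<in> H}"
  using H_sub by (auto simp: bad_def hs_def)

lemma sum_bad:
  "(\<Sum>i\<in>bad a b. f i) = (\<Sum>i\<in>hs a b. f i) + (\<Sum>i\<in>hs b a. f i) + (\<Sum>i\<in>{i. (i,a) \<in> H \<and> (i,b) \<in> H}. f i)"
proof -
  have "finite {i. (i,a) \<in> H \<and> (i,b) \<in> H}" by (rule finite_subset[OF _ finite_H_col[of a]]) auto
  then show ?thesis unfolding bad_decomp using finite_hs
    by (subst sum.union_disjoint; (subst sum.union_disjoint)?) (auto simp: hs_def)
qed

lemma bad_E1: "(\<Sum>i\<in>bad b a. ent G i b - ent G i a) = E1 a b G - E1 b a G"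
proof -
  have "(\<Sum>i\<in>hs b a. ent G i b - ent G i a) = - E1 b a G"
    unfolding E1_def sum_negf[symmetric] by (intro sum.cong) (auto simp: hs_def ent_def)
  moreover have "(\<Sum>i\<in>hs a b. ent G i b - ent G i a) = E1 a b G"
    unfolding E1_def by (intro sum.cong) (auto simp: hs_def ent_def)
  moreover have "(\<Sum>i\<in>{i. (i,b) \<in> H \<and> (i,a) \<in> H}. ent G i b - ent G i a) = 0"
    by (intro sum.neutral) (auto simp: ent_def)
  ultimately show ?thesis unfolding sum_bad by linarith
qed

lemma bad_T3: "(\<Sum>i\<in>bad a b. ent G i a * (1 - ent G i b)) = T3 a b G + real (card (bad a b)) * v"
proof -
  have "(\<Sum>i\<in>hs b a. ent G i a * (1 - ent G i b) - v) = (1 - L) * E1 b a G"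
    unfolding E1_def sum_distrib_left by (intro sum.cong) (auto simp: hs_def ent_def algebra_simps)
  moreover have "(\<Sum>i\<in>hs a b. ent G i a * (1 - ent G i b) - v) = - L * E1 a b G"
    unfolding E1_def sum_distrib_left by (intro sum.cong) (auto simp: hs_def ent_def algebra_simps)
  moreover have "(\<Sum>i\<in>{i. (i,a) \<in> H \<and> (i,b) \<in> H}. ent G i a * (1 - ent G i b) - v) = 0"
    by (intro sum.neutral) (auto simp: ent_def)
  ultimately have "(\<Sum>i\<in>bad a b. ent G i a * (1 - ent G i b) - v) = T3 a b G" unfolding sum_bad T3_def by linarith
  then show ?thesis by (simp add: sum_subtractf)
qed

lemma card_drows_ent:
  "real (card (drows H a b {..<n} G)) = (\<Sum>i<n. ent G i a * (1 - ent G i b)) - (\<Sum>i\<in>bad a b. ent G i a * (1 - ent G i b))"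
proof -
  have e: "{..<n} \<inter> bad a b = bad a b" by (auto simp: bad_def)
  have "(\<Sum>i<n. ent G i a * (1 - ent G i b)) = (\<Sum>i<n. (if i \<in> drows H a b {..<n} G then 1 else 0) + (if i \<in> bad a b then ent G i a * (1 - ent G i b) else 0))"
    by (intro sum.cong refl) (auto simp: drows_def bad_def ent_def)
  also have "\<dots> = (\<Sum>i\<in>{..<n} \<inter> drows H a b {..<n} G. 1) + (\<Sum>i\<in>{..<n} \<inter> bad a b. ent G i a * (1 - ent G i b))"
    by (simp only: sum.distrib sum.inter_restrict[OF finite_lessThan])
  also have "{..<n} \<inter> drows H a b {..<n} G = drows H a b {..<n} G" by (auto simp: drows_def)
  finally show ?thesis unfolding e by simp
qed

text \<open>Each entry is split into a column part L + eta / n, a row part whose sum over the rows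
  is zero, and \<open>xi\<close>. All mixed sums vanish by the zero column sums, except the product
  of the row part with \<open>xi\<close>, which is \<open>W1\<close>.\<close>

lemma sum_ent_prod:
  assumes G: "G \<in> M" and ab: "a < n" "b < n"
  shows "(\<Sum>i<n. ent G i a * ent G i b) = n * (L + et a / n) * (L + et b / n) + S2 + W1 a b G + KK a b G"
proof -
  define c where "c i = dl i / n - L * X / n^2" for i
  have c0: "(\<Sum>i<n. c i) = 0" using sum_dl n_pos
    by (simp add: c_def sum_subtractf sum_divide_distrib[symmetric] power2_eq_square)
  have e: "ent G i k = L + et k / n + c i + xi G i k" for i k by (simp add: xi_def c_def)
  have S2c: "(\<Sum>i<n. (c i)\<^sup>2) = S2" by (simp add: S2_def c_def)
  let ?A = "L + et a / n" and ?B = "L + et b / n"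
  have "(\<Sum>i<n. ent G i a * ent G i b) = (\<Sum>i<n. ?A * ?B + (?A + ?B) * c i + (c i)\<^sup>2 + ?A * xi G i b + ?B * xi G i a
      + c i * (xi G i a + xi G i b) + xi G i a * xi G i b)"
    by (intro sum.cong refl) (simp only: e, simp add: algebra_simps power2_eq_square)
  also have "\<dots> = n * (?A * ?B) + (?A + ?B) * (\<Sum>i<n. c i) + S2 + ?A * (\<Sum>i<n. xi G i b) + ?B * (\<Sum>i<n. xi G i a)
      + (\<Sum>i<n. c i * (xi G i a + xi G i b)) + KK a b G"
    unfolding sum.distrib S2c[symmetric] KK_def sum_distrib_left by simp
  also have "(\<Sum>i<n. c i * (xi G i a + xi G i b)) = W1 a b G - L * X / n^2 * ((\<Sum>i<n. xi G i a) + (\<Sum>i<n. xi G i b))"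
    unfolding W1_def c_def by (simp add: left_diff_distrib sum_subtractf sum_distrib_left sum.distrib distrib_left)
  finally show ?thesis unfolding c0 xi_col[OF G ab(1)] xi_col[OF G ab(2)] by simp
qed

text \<open>The terms v and Rval / n^2 in \<open>u0\<close> anticipate the mean -v of
  \<open>KK a b\<close> and the value of \<open>S2\<close>, so that every summand on the right is
  nearly centred.\<close>

lemma uu_eq:
  assumes G: "G \<in> M" and ab: "a < n" "b < n"
  shows "uu a b G = - (KK a b G + v) - W1 a b G - T3 a b G - (S2 - Rval n s / n^2)"
proof -
  have "(\<Sum>i<n. ent G i a * (1 - ent G i b)) = (\<Sum>i<n. ent G i a) - (\<Sum>i<n. ent G i a * ent G i b)"
    by (simp add: right_diff_distrib sum_subtractf)
  also have "\<dots> = n * (L + et a / n) - (n * (L + et a / n) * (L + et b / n) + S2 + W1 a b G + KK a b G)"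
    unfolding sum_ent_prod[OF assms] col_sum[OF G ab(1)] using n_pos by (simp add: distrib_left)
  also have "\<dots> = n * (L + et a / n) * (1 - L - et b / n) - S2 - W1 a b G - KK a b G"
    by (simp add: algebra_simps)
  finally show ?thesis unfolding uu_def u0_def card_drows_ent bad_T3 by simp
qed

text \<open>Up to the factor n, the squared quantity is s_i - s plus L times the deviation of x_i
  from X / n. The second part is small in total because the x_i add up to X.\<close>

lemma S2_le: "\<bar>S2 - Rval n s / n^2\<bar> \<le> z ^ 3 / r"
proof -
  define \<sigma> \<rho> where "\<sigma> i = real (s i) - avg_deg n s" and "\<rho> i = L * (real (outdeg H i) - X / n)" for i
  have Xn: "0 \<le> X / n" "X / n \<le> z" using X_le n_pos by (auto simp: field_simps)
  have rho: "\<bar>\<rho> i\<bar> \<le> real (outdeg H i) + z" for i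
  proof -
    have "\<bar>real (outdeg H i) - X / n\<bar> \<le> real (outdeg H i) + z" using Xn by linarith
    then have "\<bar>\<rho> i\<bar> \<le> 1 * (real (outdeg H i) + z)" unfolding \<rho>_def using L01 by (intro abs_mult_le) auto
    then show ?thesis by simp
  qed
  have "z * 1 \<le> z * r" using r_ge z_pos by (intro mult_left_mono) linarith+
  then have zr2: "z \<le> z * r" by simp
  have sig: "\<bar>2 * \<sigma> i + \<rho> i\<bar> \<le> 6 * (z * r)" if i: "i < n" for i
  proof -
    have "\<sigma> i = dl i - L * real (outdeg H i)" by (simp add: \<sigma>_def delta_def)
    moreover have "\<bar>L * real (outdeg H i)\<bar> \<le> 1 * (z * r)" using L01 out_le[OF i] by (intro abs_mult_le) auto
    ultimately have "\<bar>\<sigma> i\<bar> \<le> 2 * (z * r)" using delta_le[OF i] by linarith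
    then show ?thesis using rho[of i] out_le[OF i] zr2 by linarith
  qed
  have "S2 = (\<Sum>i<n. (\<sigma> i + \<rho> i)\<^sup>2) / n^2" unfolding S2_def sum_divide_distrib
  proof (intro sum.cong refl)
    fix i
    have "dl i / n - L * X / n^2 = (\<sigma> i + \<rho> i) / n"
      using n_pos by (simp add: \<sigma>_def \<rho>_def delta_def power2_eq_square field_simps)
    then show "(dl i / n - L * X / n^2)\<^sup>2 = (\<sigma> i + \<rho> i)\<^sup>2 / n^2" by (simp add: power_divide)
  qed
  moreover have "(\<Sum>i<n. (\<sigma> i + \<rho> i)\<^sup>2) = Rval n s + (\<Sum>i<n. \<rho> i * (2 * \<sigma> i + \<rho> i))"
    unfolding Rval_def \<sigma>_def[symmetric] sum.distrib[symmetric] by (intro sum.cong refl) (simp add: power2_eq_square algebra_simps)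
  ultimately have e: "S2 - Rval n s / n^2 = (\<Sum>i<n. \<rho> i * (2 * \<sigma> i + \<rho> i)) / n^2" by (simp add: add_divide_distrib)
  have "\<bar>\<Sum>i<n. \<rho> i * (2 * \<sigma> i + \<rho> i)\<bar> \<le> (\<Sum>i<n. (real (outdeg H i) + z) * (6 * (z * r)))"
    by (rule order_trans[OF sum_abs], intro sum_mono abs_mult_le rho sig) simp
  also have "\<dots> = (X + n * z) * (6 * (z * r))" by (simp add: sum_distrib_right[symmetric] sum.distrib sum_out)
  also have "\<dots> \<le> (2 * (z * n)) * (6 * (z * r))" using X_le z_pos r_pos by (intro mult_right_mono) auto
  finally have "\<bar>\<Sum>i<n. \<rho> i * (2 * \<sigma> i + \<rho> i)\<bar> / n^2 \<le> (2 * (z * n)) * (6 * (z * r)) / n^2" by (intro divide_right_mono) auto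
  also have "\<dots> = 12 * z ^ 2 * (r / n)" using n_pos by (simp add: power2_eq_square)
  also note r_over_n
  also have "12 * z ^ 2 * (1 / r) \<le> z ^ 3 / r" using absorb[of "1/r" 12 2] r_pos by (simp add: eval_nat_numeral)
  finally show ?thesis unfolding e by simp
qed

lemma S2_le1: "\<bar>S2 - Rval n s / n^2\<bar> \<le> 1" using S2_le z_le_r[of 3] r_pos by (auto intro: order_trans)

section \<open>Means and products of the minor terms\<close>

definition wd :: "nat \<Rightarrow> real" where "wd i = (if i < n then dl i / (z * r) else 0)"

lemma wd_le: "\<bar>wd i\<bar> \<le> 1" using delta_le[of i] z_pos r_pos by (simp add: wd_def)

lemma W1_wd: "W1 a b G = z / r * ((\<Sum>i<n. wd i * xi G i a) + (\<Sum>i<n. wd i * xi G i b))"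
proof -
  have e: "dl i / n = z / r * wd i" if "i < n" for i
  proof -
    have "z / r * wd i = dl i / (r * r)" using that z_pos r_pos by (simp add: wd_def)
    then show ?thesis by simp
  qed
  show ?thesis unfolding W1_def sum.distrib[symmetric] sum_distrib_left
    by (intro sum.cong refl) (simp add: e distrib_left)
qed

lemma W1_hp: assumes "a < n" "b < n" shows "hp 2 (\<lambda>G. \<bar>W1 a b G\<bar> \<le> 2 * z ^ 3)"
proof (rule hp_mono[OF hp_conj[OF conc[of a "{}" "\<lambda>i _. wd i"] conc[of b "{}" "\<lambda>i _. wd i"]]])
  fix G assume "\<bar>\<Sum>i<n. wd i * xi G i a\<bar> \<le> z\<^sup>2 * r \<and> \<bar>\<Sum>i<n. wd i * xi G i b\<bar> \<le> z\<^sup>2 * r"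
  then have "\<bar>z / r * ((\<Sum>i<n. wd i * xi G i a) + (\<Sum>i<n. wd i * xi G i b))\<bar> \<le> z / r * (z^2 * r + z^2 * r)"
    using z_pos r_pos by (intro abs_mult_le abs_add_le) auto
  also have "\<dots> = 2 * z ^ 3" using r_pos by (simp add: field_simps eval_nat_numeral)
  finally show "\<bar>W1 a b G\<bar> \<le> 2 * z ^ 3" unfolding W1_wd .
qed (use assms wd_le in \<open>auto simp: dep_const\<close>)

lemma W1_all: assumes "a < n" "b < n" shows "\<bar>W1 a b G\<bar> \<le> 4 * real n"
proof -
  have zr1: "z / r \<le> 1" using z_le_r[of 1] r_pos by simp
  have "\<bar>W1 a b G\<bar> \<le> (\<Sum>i<n. 1 * (2 + 2))" unfolding W1_def
  proof (rule order_trans[OF sum_abs], intro sum_mono abs_mult_le abs_add_le)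
    fix i assume "i \<in> {..<n}"
    then have i: "i < n" by simp
    show "\<bar>dl i / n\<bar> \<le> 1" by (rule order_trans[OF dl_n[OF i] zr1])
    show "\<bar>xi G i a\<bar> \<le> 2" "\<bar>xi G i b\<bar> \<le> 2" using xi_le i assms by auto
  qed
  then show ?thesis by simp
qed

lemma W1_mean: assumes "a < n" "b < n" shows "\<bar>EE (W1 a b)\<bar> \<le> z ^ 10 / r"
proof -
  have m: "\<bar>EE (\<lambda>G. \<Sum>i<n. wd i * xi G i c)\<bar> \<le> z ^ 8" if "c < n" for c
    using sum_est[of c "{}" "\<lambda>i _. wd i" "\<lambda>_. 1"] that wd_le by (simp add: dep_const)
  have "EE (W1 a b) = z / r * (EE (\<lambda>G. \<Sum>i<n. wd i * xi G i a) + EE (\<lambda>G. \<Sum>i<n. wd i * xi G i b))"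
    unfolding W1_wd[abs_def] EE_cmult EE_add ..
  then have "\<bar>EE (W1 a b)\<bar> \<le> z / r * (z ^ 8 + z ^ 8)"
    using abs_mult_le[of "z / r" "z / r", OF _ abs_add_le[OF m[OF assms(1)] m[OF assms(2)]]] z_pos r_pos by simp
  also have "\<dots> = 2 * z ^ 9 * (1 / r)" by (simp add: eval_nat_numeral)
  also have "\<dots> \<le> z ^ 10 / r" using absorb[of "1/r" 2 9] r_pos by (simp add: eval_nat_numeral)
  finally show ?thesis .
qed

text \<open>Coinciding rows are bounded trivially. For distinct rows \<open>ent_cell\<close>
  applies, with the first entry as the factor \<open>g\<close> and its row frozen.\<close>

lemma ent_prod:
  assumes A: "A \<subseteq> {..<n}" "B \<subseteq> {..<n}" and c: "c < n" "c' < n"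
  shows "\<bar>EE (\<lambda>G. (\<Sum>i\<in>A. ent G i c - L) * (\<Sum>j\<in>B. ent G j c' - L))\<bar> \<le> card A * (1 + card B * (z ^ 6 / r))"
proof -
  have fin: "finite A" "finite B" using A finite_subset by blast+
  have e: "EE (\<lambda>G. (\<Sum>i\<in>A. ent G i c - L) * (\<Sum>j\<in>B. ent G j c' - L)) = (\<Sum>i\<in>A. \<Sum>j\<in>B. EE (\<lambda>G. (ent G i c - L) * (ent G j c' - L)))"
    unfolding sum_product EE_sum ..
  have z6: "0 \<le> z ^ 6 / r" using z_pos r_pos by simp
  have "\<bar>EE (\<lambda>G. (\<Sum>i\<in>A. ent G i c - L) * (\<Sum>j\<in>B. ent G j c' - L))\<bar> \<le> (\<Sum>i\<in>A. \<Sum>j\<in>B. (if j = i then 1 else 0) + z ^ 6 / r)"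
    unfolding e
  proof (rule order_trans[OF sum_abs], rule sum_mono, rule order_trans[OF sum_abs], rule sum_mono)
    fix i j assume ij: "i \<in> A" "j \<in> B"
    show "\<bar>EE (\<lambda>G. (ent G i c - L) * (ent G j c' - L))\<bar> \<le> (if j = i then 1 else 0) + z ^ 6 / r"
    proof (cases "j = i")
      case True
      have "\<bar>EE (\<lambda>G. (ent G i c - L) * (ent G j c' - L))\<bar> \<le> 1 * 1" by (intro EE_bound abs_mult_le ent_L_le)
      then have "\<bar>EE (\<lambda>G. (ent G i c - L) * (ent G j c' - L))\<bar> \<le> 1 + z ^ 6 / r" using z6 by linarith
      then show ?thesis using True by simp
    next
      case False
      have d: "dep ({i} \<times> UNIV \<union> UNIV \<times> {}) (\<lambda>G. ent G i c - L)"
        by (rule dep_comp1[where h = "\<lambda>x. x - L"]) (rule dep_ent, simp)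
      have "\<bar>EE (\<lambda>G. (ent G i c - L) * (ent G j c' - L))\<bar> \<le> z ^ 6 / r"
        by (rule ent_cell[OF _ c(2) _ _ _ _ _ _ d ent_L_le]) (use ij A False in auto)
      then show ?thesis using False by simp
    qed
  qed
  also have "\<dots> \<le> (\<Sum>i\<in>A. 1 + card B * (z ^ 6 / r))"
    using fin by (intro sum_mono) (simp add: sum.distrib)
  also have "\<dots> = card A * (1 + card B * (z ^ 6 / r))" by simp
  finally show ?thesis .
qed

text \<open>The at most z r rows of the second factor compensate the decay 1 / r of a pair of
  distinct rows. The bound therefore involves the degree of one column only, instead of a product of
  two degrees.\<close>

lemma E1_prod:
  assumes "a < n" "b < n" "c < n" "d < n"
  shows "\<bar>EE (\<lambda>G. E1 a b G * E1 c d G)\<bar> \<le> z ^ 8 * real (indeg H a)"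
proof -
  have z6: "0 \<le> z ^ 6 / r" using z_pos r_pos by simp
  have "\<bar>EE (\<lambda>G. E1 a b G * E1 c d G)\<bar> \<le> card (hs a b) * (1 + card (hs c d) * (z ^ 6 / r))"
    unfolding E1_def by (intro ent_prod hs_sub assms)
  also have "\<dots> \<le> real (indeg H a) * (1 + (z * r) * (z ^ 6 / r))"
    using card_hs[of a b] order_trans[OF card_hs[of c d] in_le[OF assms(3)]] z6
    by (intro mult_mono add_left_mono mult_right_mono) auto
  also have "(z * r) * (z ^ 6 / r) = z ^ 7" using r_pos by (simp add: eval_nat_numeral)
  also have "real (indeg H a) * (1 + z ^ 7) \<le> real (indeg H a) * z ^ 8"
  proof (rule mult_left_mono)
    have "5 * z ^ 7 \<le> z ^ 8" using absorb[of 1 5 7] by (simp add: eval_nat_numeral)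
    then show "1 + z ^ 7 \<le> z ^ 8" using z1[of 7] by linarith
  qed simp
  finally show ?thesis by (simp add: mult.commute)
qed

lemma E1_crude: assumes "a < n" "b < n" shows "\<bar>EE (E1 a b)\<bar> \<le> z ^ 6 / r * real (indeg H a)"
proof -
  have "EE (E1 a b) = (\<Sum>i\<in>hs a b. EE (\<lambda>G. 1 * (ent G i b - L)))" unfolding E1_def[abs_def] EE_sum by simp
  then have "\<bar>EE (E1 a b)\<bar> \<le> (\<Sum>i\<in>hs a b. \<bar>EE (\<lambda>G. 1 * (ent G i b - L))\<bar>)" by (simp only: sum_abs)
  also have "\<dots> \<le> (\<Sum>i\<in>hs a b. z ^ 6 / r)"
  proof (rule sum_mono)
    fix i assume "i \<in> hs a b"
    then have "i < n" using hs_sub by blast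
    then show "\<bar>EE (\<lambda>G. 1 * (ent G i b - L))\<bar> \<le> z ^ 6 / r"
      by (rule ent_cell[where K = "{}" and Q = "{}"]) (use assms in \<open>auto simp: dep_const\<close>)
  qed
  also have "\<dots> = real (card (hs a b)) * (z ^ 6 / r)" by simp
  also have "\<dots> \<le> real (indeg H a) * (z ^ 6 / r)" using card_hs z_pos r_pos by (intro mult_right_mono) auto
  finally show ?thesis by (simp add: mult.commute)
qed

text \<open>The explicit main term is the origin of the quantity Y in the exponent. The remainder
  involves means of \<open>xi\<close> at allowed cells only, where \<open>cell2\<close> provides
  order 1 / n in place of 1 / r.\<close>

lemma E1_mean: assumes ab: "a < n" "b < n"
  shows "\<bar>EE (E1 a b) - ((\<Sum>i\<in>hs a b. dl i) + real (card (hs a b)) * et b) / n\<bar> \<le> z ^ 12 / n * real (indeg H a)"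
proof -
  have e: "EE (E1 a b) - ((\<Sum>i\<in>hs a b. dl i) + real (card (hs a b)) * et b) / n = (\<Sum>i\<in>hs a b. EE (\<lambda>G. xi G i b) - L * X / n^2)"
  proof -
    have x: "EE (\<lambda>G. ent G i b - L) = (EE (\<lambda>G. xi G i b) - L * X / n^2) + (dl i / n + et b / n)" for i
    proof -
      have "(\<lambda>G. ent G i b - L) = (\<lambda>G. xi G i b + (dl i / n + et b / n - L * X / n^2))" by (simp add: xi_def)
      then have "EE (\<lambda>G. ent G i b - L) = EE (\<lambda>G. xi G i b) + (dl i / n + et b / n - L * X / n^2)" by (simp only: EE_add EE_const)
      then show ?thesis by simp
    qed
    have "EE (E1 a b) = (\<Sum>i\<in>hs a b. EE (\<lambda>G. ent G i b - L))" unfolding E1_def[abs_def] EE_sum ..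
    also have "\<dots> = (\<Sum>i\<in>hs a b. EE (\<lambda>G. xi G i b) - L * X / n^2) + ((\<Sum>i\<in>hs a b. dl i) / n + real (card (hs a b)) * (et b / n))"
      unfolding x by (simp add: sum.distrib sum_divide_distrib)
    finally show ?thesis by (simp add: add_divide_distrib)
  qed
  have "\<bar>\<Sum>i\<in>hs a b. EE (\<lambda>G. xi G i b) - L * X / n^2\<bar> \<le> (\<Sum>i\<in>hs a b. z ^ 11 / n + z / n)"
  proof (rule order_trans[OF sum_abs], intro sum_mono abs_diff_le)
    fix i assume i: "i \<in> hs a b"
    then show "\<bar>EE (\<lambda>G. xi G i b)\<bar> \<le> z ^ 11 / n" using hs_sub ab by (intro cell2) (auto simp: hs_def)
    have "L * X \<le> 1 * (z * n)" using L01 X_le by (intro mult_mono) auto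
    then have "L * X / n^2 \<le> 1 * (z * n) / n^2" by (intro divide_right_mono) auto
    then show "\<bar>L * X / n^2\<bar> \<le> z / n" using L01 n_pos by (simp add: power2_eq_square)
  qed
  also have "\<dots> = real (card (hs a b)) * (z ^ 11 / n + z / n)" by simp
  also have "\<dots> \<le> real (indeg H a) * (z ^ 12 / n)"
  proof (rule mult_mono[OF card_hs])
    have "z / n \<le> z ^ 11 / n" using zr_mono[of 1 11 "1/n"] by simp
    moreover have "2 * (z ^ 11 / n) \<le> z ^ 12 / n" using absorb[of "1/n" 2 11] by (simp add: eval_nat_numeral)
    ultimately show "z ^ 11 / n + z / n \<le> z ^ 12 / n" by linarith
  qed (use z_pos in auto)
  finally show ?thesis unfolding e by (simp add: mult.commute)
qed

text \<open>For each single row, column \<open>b\<close> supplies both the factor and the weights,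
  and \<open>sum_est\<close> is applied to column \<open>a\<close>. Multiplying the separate bounds
  would lose a factor of order r.\<close>

lemma E1_KK: assumes ab: "a < n" "b < n" "a \<noteq> b" shows "\<bar>EE (\<lambda>G. E1 a b G * KK a b G)\<bar> \<le> 2 * z ^ 8 * real (indeg H a)"
proof -
  have k: "(\<Sum>j<n. xc b j G / 2 * xi G j a) = KK a b G / 2" for G
    unfolding KK_def sum_divide_distrib by (intro sum.cong) (auto simp: xc_def)
  have one: "\<bar>EE (\<lambda>G. (ent G i b - L) * KK a b G)\<bar> \<le> 2 * z ^ 8" for i
  proof -
    have "\<bar>EE (\<lambda>G. (ent G i b - L) * (\<Sum>j<n. xc b j G / 2 * xi G j a))\<bar> \<le> z ^ 8"
    proof (rule sum_est[where K = "{b}"])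
      show "dep (UNIV \<times> {b}) (\<lambda>G. ent G i b - L)" by (rule dep_comp1[where h = "\<lambda>x. x - L"]) (rule dep_ent, simp)
      show "\<bar>xc b j G / 2\<bar> \<le> 1" for j G by (rule xc_le2[OF ab(2)])
      show "dep (UNIV \<times> {b}) (\<lambda>G. xc b j G / 2)" for j by (rule dep_xc2) simp
    qed (use ab ent_L_le in auto)
    then have "\<bar>EE (\<lambda>G. (ent G i b - L) * KK a b G) / 2\<bar> \<le> z ^ 8" by (simp only: k times_divide_eq_right EE_divide)
    then show ?thesis by simp
  qed
  have "EE (\<lambda>G. E1 a b G * KK a b G) = (\<Sum>i\<in>hs a b. EE (\<lambda>G. (ent G i b - L) * KK a b G))"
    unfolding E1_def sum_distrib_right EE_sum ..
  then have "\<bar>EE (\<lambda>G. E1 a b G * KK a b G)\<bar> \<le> (\<Sum>i\<in>hs a b. \<bar>EE (\<lambda>G. (ent G i b - L) * KK a b G)\<bar>)" by (simp only: sum_abs)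
  also have "\<dots> \<le> (\<Sum>i\<in>hs a b. 2 * z ^ 8)" by (intro sum_mono one)
  also have "\<dots> = real (card (hs a b)) * (2 * z ^ 8)" by simp
  also have "\<dots> \<le> real (indeg H a) * (2 * z ^ 8)" using card_hs z_pos by (intro mult_right_mono) auto
  finally show ?thesis by (simp add: mult.commute)
qed

lemma E1_KK': assumes ab: "a < n" "b < n" "a \<noteq> b" shows "\<bar>EE (\<lambda>G. E1 b a G * KK a b G)\<bar> \<le> 2 * z ^ 8 * real (indeg H b)"
  using E1_KK[of b a] ab by (simp add: KK_comm[of a b])

lemma T3_le: "\<bar>T3 a b G\<bar> \<le> yy a b"
proof -
  have "\<bar>(1 - L) * E1 b a G - L * E1 a b G\<bar> \<le> 1 * real (indeg H b) + 1 * real (indeg H a)"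
    using L01 by (intro abs_diff_le abs_mult_le E1_le) auto
  then show ?thesis by (simp add: T3_def yy_def)
qed

lemma EE_T3:
  "EE (\<lambda>G. f G * T3 a b G) = (1 - L) * EE (\<lambda>G. E1 b a G * f G) - L * EE (\<lambda>G. E1 a b G * f G)"
  unfolding T3_def EE_cmult[symmetric] EE_diff[symmetric] by (simp add: algebra_simps)

lemma EE_T3_le:
  assumes "\<bar>EE (\<lambda>G. E1 b a G * f G)\<bar> \<le> c * real (indeg H b)" "\<bar>EE (\<lambda>G. E1 a b G * f G)\<bar> \<le> c * real (indeg H a)"
  shows "\<bar>EE (\<lambda>G. f G * T3 a b G)\<bar> \<le> c * yy a b"
proof -
  have "\<bar>EE (\<lambda>G. f G * T3 a b G)\<bar> \<le> 1 * (c * real (indeg H b)) + 1 * (c * real (indeg H a))"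
    unfolding EE_T3 using L01 by (intro abs_diff_le abs_mult_le assms) auto
  then show ?thesis by (simp add: yy_def algebra_simps)
qed

section \<open>Mean and variance of U\<close>

lemma uu_hp: assumes ab: "a < n" "b < n" "a \<noteq> b" shows "hp 3 (\<lambda>G. \<bar>uu a b G\<bar> \<le> z ^ 3 * r)"
proof (rule hp_mono[OF hp_conj[OF kconc[OF ab] W1_hp[OF ab(1,2)]]])
  fix G assume G: "G \<in> M" and g: "\<bar>KK a b G\<bar> \<le> 2 * z^2 * r \<and> \<bar>W1 a b G\<bar> \<le> 2 * z ^ 3"
  have t: "\<bar>T3 a b G\<bar> \<le> 2 * (z * r)" using T3_le[of a b G] yy_le[OF ab(1,2)] by linarith
  have lin: "\<bar>- (K + v') - W - T - D\<bar> \<le> F" if "\<bar>K\<bar> \<le> 2 * A" "\<bar>v'\<bar> \<le> 1" "\<bar>W\<bar> \<le> 2 * B" "\<bar>T\<bar> \<le> 2 * C" "\<bar>D\<bar> \<le> 1"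
    "B \<le> A" "C \<le> A" "100 \<le> A" "10 * A \<le> F" for K v' W T D A B C F :: real using that by linarith
  have "z ^ 3 \<le> z ^ 2 * r"
  proof -
    have "z ^ 2 * z \<le> z ^ 2 * r" using z_le_r[of 1] z_pos by (intro mult_left_mono) auto
    then show ?thesis by (simp add: eval_nat_numeral)
  qed
  moreover have "z * r \<le> z ^ 2 * r" using zr_mono[of 1 2 r] by simp
  moreover have "10 * (z ^ 2 * r) \<le> z ^ 3 * r" using absorb[of r 10 2] by (simp add: eval_nat_numeral)
  moreover have "\<bar>KK a b G\<bar> \<le> 2 * (z ^ 2 * r)" using g by simp
  moreover have "\<bar>v\<bar> \<le> 1" using v_pos v_le by simp
  ultimately show "\<bar>uu a b G\<bar> \<le> z ^ 3 * r" unfolding uu_eq[OF G ab(1,2)]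
    using g t S2_le1 zkr[of 2] lin[of "KK a b G" "z^2 * r" v "W1 a b G" "z ^ 3" "T3 a b G" "z * r"] by blast
qed simp

lemma uu_all: assumes ab: "a < n" "b < n" and G: "G \<in> M" shows "\<bar>uu a b G\<bar> \<le> 13 * real n"
proof -
  have lin: "\<bar>- (K + v') - W - T - D\<bar> \<le> 13 * N" if "\<bar>K\<bar> \<le> 4 * N" "\<bar>v'\<bar> \<le> 1" "\<bar>W\<bar> \<le> 4 * N" "\<bar>T\<bar> \<le> 2 * N" "\<bar>D\<bar> \<le> 1"
    "1 \<le> N" for K v' W T D N :: real using that by linarith
  have "z * r \<le> r * r" using z_le_r[of 1] r_pos by (intro mult_right_mono) auto
  then have "\<bar>T3 a b G\<bar> \<le> 2 * real n" using T3_le[of a b G] yy_le[OF ab(1,2)] by simp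
  moreover have "\<bar>v\<bar> \<le> 1" using v_pos v_le by simp
  moreover have "1 \<le> real n" using n_ge by linarith
  ultimately show ?thesis unfolding uu_eq[OF G ab] using KK_le[OF ab, of G] W1_all[OF ab, of G] S2_le1 by (intro lin) auto
qed

lemma uu_mean: assumes ab: "a < n" "b < n" "a \<noteq> b" shows "\<bar>EE (uu a b)\<bar> \<le> z ^ 14 / r * (1 + yy a b)"
proof -
  have e: "EE (uu a b) = - (EE (KK a b) + v) - EE (W1 a b) - EE (T3 a b) - (S2 - Rval n s / n^2)"
  proof -
    have "EE (uu a b) = EE (\<lambda>G. - (KK a b G + v) - W1 a b G - T3 a b G - (S2 - Rval n s / n^2))"
      using ab by (intro EE_cong uu_eq) auto
    then show ?thesis by (simp only: EE_diff EE_minus EE_add EE_const)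
  qed
  have "EE (T3 a b) = (1 - L) * EE (E1 b a) - L * EE (E1 a b)" unfolding T3_def[abs_def] EE_diff EE_cmult ..
  then have t: "\<bar>EE (T3 a b)\<bar> \<le> 1 * (z ^ 6 / r * real (indeg H b)) + 1 * (z ^ 6 / r * real (indeg H a))"
    using abs_diff_le[OF abs_mult_le[OF _ E1_crude[OF ab(2,1)]] abs_mult_le[OF _ E1_crude[OF ab(1,2)]], of "1 - L" 1 L 1] L01 by simp
  have lin: "\<bar>- K - W - T - D\<bar> \<le> F * (1 + y)" if "\<bar>K\<bar> \<le> A * (1 + y1)" "\<bar>W\<bar> \<le> A" "\<bar>T\<bar> \<le> 1 * (B * y1) + 1 * (B * y2)" "\<bar>D\<bar> \<le> A"
      "B \<le> A" "10 * A \<le> F" "y = y2 + y1" "0 \<le> y1" "0 \<le> y2" "0 \<le> A" for K W T D A B F y y1 y2 :: real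
  proof -
    have "B * y1 \<le> A * y1" "B * y2 \<le> A * y2" using that by (auto intro: mult_right_mono)
    moreover have "10 * A * (1 + y) \<le> F * (1 + y)" using that by (intro mult_right_mono) auto
    moreover have "10 * A * (1 + y) = 10 * A + 10 * (A * y1) + 10 * (A * y2)" using that(7) by (simp add: algebra_simps)
    moreover have "A * (1 + y1) = A + A * y1" by (simp add: algebra_simps)
    moreover have "0 \<le> A * y1" "0 \<le> A * y2" using that by auto
    ultimately show ?thesis using that(1-4,10) by linarith
  qed
  have "z ^ 10 / r \<le> z ^ 13 / r" "z ^ 6 / r \<le> z ^ 13 / r" "z ^ 3 / r \<le> z ^ 13 / r"
    using zr_mono[of 10 13 "1/r"] zr_mono[of 6 13 "1/r"] zr_mono[of 3 13 "1/r"] r_pos by auto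
  moreover have "10 * (z ^ 13 / r) \<le> z ^ 14 / r" using absorb[of "1/r" 10 13] r_pos by (simp add: eval_nat_numeral)
  moreover have "0 \<le> z ^ 13 / r" using z_pos r_pos by simp
  ultimately show ?thesis unfolding e
    using kmean[OF ab] W1_mean[OF ab(1,2)] t S2_le
    by (intro lin[of _ "z ^ 13 / r" "real (indeg H b)" _ _ "z ^ 6 / r" "real (indeg H a)"]) (auto simp: yy_def)
qed

lemma W1_KK: assumes ab: "a < n" "b < n" "a \<noteq> b" shows "\<bar>EE (\<lambda>G. KK a b G * W1 a b G)\<bar> \<le> z ^ 6 * r"
proof -
  have "\<bar>EE (\<lambda>G. KK a b G * W1 a b G)\<bar> \<le> (2 * z ^ 2 * r) * (2 * z ^ 3) + 1 / real n ^ 3"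
  proof (rule EE_bound_hp[OF hp_conj[OF kconc[OF ab] W1_hp[OF ab(1,2)]]])
    fix G
    show "\<bar>KK a b G * W1 a b G\<bar> \<le> (2 * z ^ 2 * r) * (2 * z ^ 3)" if "\<bar>KK a b G\<bar> \<le> 2 * z^2 * r \<and> \<bar>W1 a b G\<bar> \<le> 2 * z ^ 3"
      using that by (intro abs_mult_le) auto
    have "\<bar>KK a b G * W1 a b G\<bar> \<le> (4 * real n) * (4 * real n)" by (intro abs_mult_le KK_le W1_all ab)
    also have "\<dots> = 16 * real n ^ 2" by (simp add: power2_eq_square)
    also have "\<dots> \<le> real n ^ 3" by (rule n_powers) simp
    also have "\<dots> \<le> real n ^ 6" by (rule n_pow_mono) simp
    finally show "\<bar>KK a b G * W1 a b G\<bar> \<le> real n ^ 6" .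
  qed (use n_ge z_pos r_pos in auto)
  moreover have "1 / real n ^ 3 \<le> 1" using n_ge by simp
  moreover have "(2 * z ^ 2 * r) * (2 * z ^ 3) = 4 * (z ^ 5 * r)" by (simp add: eval_nat_numeral)
  moreover have "5 * (z ^ 5 * r) \<le> z ^ 6 * r" using absorb[of r 5 5] by (simp add: eval_nat_numeral)
  ultimately show ?thesis using zkr[of 5] by linarith
qed

lemma W1_sq: assumes ab: "a < n" "b < n" shows "\<bar>EE (\<lambda>G. (W1 a b G)\<^sup>2)\<bar> \<le> z ^ 7"
proof -
  have "\<bar>EE (\<lambda>G. (W1 a b G)\<^sup>2)\<bar> \<le> (2 * z ^ 3) * (2 * z ^ 3) + 1 / real n ^ 3"
  proof (rule EE_bound_hp[OF W1_hp[OF ab]])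
    fix G
    show "\<bar>(W1 a b G)\<^sup>2\<bar> \<le> (2 * z ^ 3) * (2 * z ^ 3)" if "\<bar>W1 a b G\<bar> \<le> 2 * z ^ 3"
      using abs_mult_le[OF that that] by (simp add: power2_eq_square)
    have "\<bar>W1 a b G * W1 a b G\<bar> \<le> (4 * real n) * (4 * real n)" by (intro abs_mult_le W1_all ab)
    also have "\<dots> = 16 * real n ^ 2" by (simp add: power2_eq_square)
    also have "\<dots> \<le> real n ^ 3" by (rule n_powers) simp
    also have "\<dots> \<le> real n ^ 6" by (rule n_pow_mono) simp
    finally show "\<bar>(W1 a b G)\<^sup>2\<bar> \<le> real n ^ 6" by (simp add: power2_eq_square)
  qed (use n_ge z_pos r_pos in auto)
  moreover have "1 / real n ^ 3 \<le> 1" using n_ge by simp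
  moreover have "(2 * z ^ 3) * (2 * z ^ 3) = 4 * z ^ 6" by (simp add: eval_nat_numeral)
  moreover have "5 * z ^ 6 \<le> z ^ 7" using absorb[of 1 5 6] by (simp add: eval_nat_numeral)
  ultimately show ?thesis using z1[of 6] by linarith
qed

lemma T3_sq: assumes ab: "a < n" "b < n" shows "\<bar>EE (\<lambda>G. (T3 a b G)\<^sup>2)\<bar> \<le> z ^ 10 * r"
proof -
  have sw: "EE (\<lambda>G. T3 a b G * T3 a b G) = (1 - L) * EE (\<lambda>G. E1 b a G * T3 a b G) - L * EE (\<lambda>G. E1 a b G * T3 a b G)"
    by (rule EE_T3)
  have p: "\<bar>EE (\<lambda>G. E1 c d G * T3 a b G)\<bar> \<le> 2 * (z ^ 9 * r)" if "c < n" "d < n" for c d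
  proof -
    have y: "z ^ 8 * real (indeg H k) \<le> z ^ 9 * r" if "k < n" for k
    proof -
      have "z ^ 8 * real (indeg H k) \<le> z ^ 8 * (z * r)" using in_le[OF that] z_pos by (intro mult_left_mono) auto
      then show ?thesis by (simp add: eval_nat_numeral)
    qed
    have q1: "\<bar>EE (\<lambda>G. E1 b a G * E1 c d G)\<bar> \<le> z ^ 9 * r" using E1_prod[OF ab(2,1) that] y[OF ab(2)] by linarith
    have q2: "\<bar>EE (\<lambda>G. E1 a b G * E1 c d G)\<bar> \<le> z ^ 9 * r" using E1_prod[OF ab that] y[OF ab(1)] by linarith
    have "\<bar>EE (\<lambda>G. E1 c d G * T3 a b G)\<bar> \<le> 1 * (z ^ 9 * r) + 1 * (z ^ 9 * r)"
      unfolding EE_T3 using L01 by (intro abs_diff_le abs_mult_le q1 q2) auto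
    then show ?thesis by (simp only: mult_1 mult_2)
  qed
  have "\<bar>EE (\<lambda>G. T3 a b G * T3 a b G)\<bar> \<le> 1 * (2 * (z ^ 9 * r)) + 1 * (2 * (z ^ 9 * r))"
    unfolding sw using L01 ab by (intro abs_diff_le abs_mult_le p) auto
  moreover have "4 * (z ^ 9 * r) \<le> z ^ 10 * r" using absorb[of r 4 9] by (simp add: eval_nat_numeral)
  moreover have "x \<le> q" if "x \<le> 1 * (2 * p) + 1 * (2 * p)" "4 * p \<le> q" for x p q :: real using that by linarith
  ultimately show ?thesis unfolding power2_eq_square by blast
qed

text \<open>The variance comes from \<open>KK\<close> alone. The cross term of \<open>KK\<close>
  with \<open>T3\<close> would be of order n if bounded by absolute values, like the main term; the
  mean estimates \<open>E1_KK\<close> and \<open>E1_KK'\<close> bring it down to order r.\<close>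

lemma uu_second: assumes ab: "a < n" "b < n" "a \<noteq> b" shows "\<bar>EE (\<lambda>G. (uu a b G)\<^sup>2) - n * v^2\<bar> \<le> z ^ 12 * r"
proof -
  define c where "c = v + (S2 - Rval n s / n^2)"
  have c: "\<bar>c\<bar> \<le> 2" using S2_le1 v_pos v_le by (simp add: c_def)
  let ?K = "KK a b" and ?W = "W1 a b" and ?T = "T3 a b"
  let ?Z = "\<lambda>G. c + ?W G + ?T G"
  have "EE (\<lambda>G. (uu a b G)\<^sup>2) = EE (\<lambda>G. (?K G)\<^sup>2 + (2 * c * ?K G + 2 * (?K G * ?W G) + 2 * (?K G * ?T G)) + (?Z G)\<^sup>2)"
    by (rule EE_cong) (simp add: uu_eq ab c_def power2_eq_square algebra_simps)
  then have e: "EE (\<lambda>G. (uu a b G)\<^sup>2) - n * v^2 = (EE (\<lambda>G. (?K G)\<^sup>2) - n * v^2) + (2 * c * EE ?K + 2 * EE (\<lambda>G. ?K G * ?W G) + 2 * EE (\<lambda>G. ?K G * ?T G)) + EE (\<lambda>G. (?Z G)\<^sup>2)"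
    by (simp only: EE_add EE_cmult add_diff_eq diff_add_eq)
  have k: "\<bar>EE (\<lambda>G. ?K G * ?T G)\<bar> \<le> 4 * (z ^ 9 * r)"
  proof -
    have "\<bar>EE (\<lambda>G. ?K G * ?T G)\<bar> \<le> 2 * z ^ 8 * yy a b" by (rule EE_T3_le[OF E1_KK'[OF ab] E1_KK[OF ab]])
    also have "\<dots> \<le> 2 * z ^ 8 * (2 * (z * r))" using yy_le[OF ab(1,2)] z_pos by (intro mult_left_mono) auto
    finally show ?thesis by (simp add: eval_nat_numeral)
  qed
  have Z: "\<bar>EE (\<lambda>G. (?Z G)\<^sup>2)\<bar> \<le> 3 * (4 + z ^ 7 + z ^ 10 * r)"
  proof -
    have sq: "(x + y + w)\<^sup>2 \<le> 3 * (x^2 + y^2 + w^2)" for x y w :: real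
      using zero_le_power2[of "x - y"] zero_le_power2[of "x - w"] zero_le_power2[of "y - w"] by (simp add: power2_eq_square algebra_simps)
    have "EE (\<lambda>G. (?Z G)\<^sup>2) \<le> EE (\<lambda>G. 3 * (c^2 + (?W G)\<^sup>2 + (?T G)\<^sup>2))" by (intro EE_mono sq)
    also have "\<dots> = 3 * (c^2 + EE (\<lambda>G. (?W G)\<^sup>2) + EE (\<lambda>G. (?T G)\<^sup>2))" by (simp only: EE_add EE_cmult EE_const)
    also have "\<dots> \<le> 3 * (4 + z ^ 7 + z ^ 10 * r)"
    proof -
      have "c^2 \<le> 4" using abs_mult_le[OF c c] by (simp add: power2_eq_square)
      moreover have "3 * (x + y + w) \<le> 3 * (4 + p + q)" if "x \<le> 4" "\<bar>y\<bar> \<le> p" "\<bar>w\<bar> \<le> q" for x y w p q :: real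
        using that unfolding distrib_left by linarith
      ultimately show ?thesis using W1_sq[OF ab(1,2)] T3_sq[OF ab(1,2)] by blast
    qed
    finally have "EE (\<lambda>G. (?Z G)\<^sup>2) \<le> 3 * (4 + z ^ 7 + z ^ 10 * r)" .
    moreover have "0 \<le> EE (\<lambda>G. (?Z G)\<^sup>2)" using EE_mono[of "\<lambda>_. 0" "\<lambda>G. (?Z G)\<^sup>2"] by (simp add: EE_const)
    ultimately show ?thesis by simp
  qed
  have ck: "\<bar>2 * c * EE ?K\<bar> \<le> 2 * 2 * (2 * z ^ 8)" by (intro abs_mult_le c KK_sum_est ab) auto
  have lin: "x \<le> F" if "x \<le> A + (2 * 2 * (2 * B) + 2 * C + 2 * (4 * A)) + 3 * (4 + D + E)" "A \<le> E" "C \<le> E" "B \<le> E" "D \<le> E" "50 * E \<le> F'" "F' \<le> F" "100 \<le> E"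
    for x A B C D E F F' :: real using that unfolding distrib_left by linarith
  have b0: "\<bar>EE (\<lambda>G. (uu a b G)\<^sup>2) - n * v^2\<bar> \<le> z ^ 9 * r + (2 * 2 * (2 * z ^ 8) + 2 * (z ^ 6 * r) + 2 * (4 * (z ^ 9 * r))) + 3 * (4 + z ^ 7 + z ^ 10 * r)"
    unfolding e by (intro abs_add_le second ab ck Z abs_mult_le[of 2 2] W1_KK k) auto
  have b1: "z ^ 9 * r \<le> z ^ 10 * r" "z ^ 6 * r \<le> z ^ 10 * r" using zr_mono[of 9 10 r] zr_mono[of 6 10 r] by auto
  have b2: "z ^ 8 \<le> z ^ 10 * r" "z ^ 7 \<le> z ^ 10 * r"
  proof -
    have "z ^ 8 \<le> r" "z ^ 7 \<le> r" by (rule z_le_r, simp)+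
    moreover have "r \<le> z ^ 10 * r" using zr_mono[of 0 10 r] by simp
    ultimately show "z ^ 8 \<le> z ^ 10 * r" "z ^ 7 \<le> z ^ 10 * r" by linarith+
  qed
  have b3: "50 * (z ^ 10 * r) \<le> z ^ 11 * r" using absorb[of r 50 10] by (simp add: eval_nat_numeral)
  have b4: "z ^ 11 * r \<le> z ^ 12 * r" using zr_mono[of 11 12 r] by simp
  show ?thesis by (rule lin[OF b0 b1 b2 b3 b4 zkr])
qed

text \<open>By \<open>sg_eq\<close> and \<open>bad_E1\<close> this is the random part of V - U, up
  to sign.\<close>

definition ee :: "nat \<Rightarrow> nat \<Rightarrow> arcs \<Rightarrow> real" where
  "ee a b G = E1 a b G - E1 b a G"

lemma ee_le: "\<bar>ee a b G\<bar> \<le> yy a b"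
  unfolding ee_def yy_def by (intro abs_diff_le E1_le)

lemma EE_ee: "EE (\<lambda>G. ee a b G * f G) = EE (\<lambda>G. E1 a b G * f G) - EE (\<lambda>G. E1 b a G * f G)"
  unfolding ee_def EE_diff[symmetric] by (simp add: algebra_simps)

text \<open>Separate bounds for the two factors would give (y_a + y_b) r up to powers of z.
  Expanding the second factor by \<open>uu_eq\<close> and estimating each product in mean removes
  the factor r.\<close>

lemma ee_uu: assumes ab: "a < n" "b < n" "a \<noteq> b" shows "\<bar>EE (\<lambda>G. ee a b G * uu a b G)\<bar> \<le> z ^ 10 * (1 + yy a b)"
proof -
  define c where "c = v + (S2 - Rval n s / n^2)"
  have c: "\<bar>c\<bar> \<le> 2" using S2_le1 v_pos v_le by (simp add: c_def)
  let ?y = "yy a b"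
  have "EE (\<lambda>G. ee a b G * uu a b G) = EE (\<lambda>G. - (ee a b G * KK a b G) - c * ee a b G - ee a b G * W1 a b G - ee a b G * T3 a b G)"
    by (rule EE_cong) (simp add: uu_eq ab c_def algebra_simps)
  then have e: "EE (\<lambda>G. ee a b G * uu a b G) = - EE (\<lambda>G. ee a b G * KK a b G) - c * EE (ee a b) - EE (\<lambda>G. ee a b G * W1 a b G) - EE (\<lambda>G. ee a b G * T3 a b G)"
    by (simp only: EE_diff EE_minus EE_cmult)
  have t1: "\<bar>EE (\<lambda>G. ee a b G * KK a b G)\<bar> \<le> 2 * z ^ 8 * real (indeg H a) + 2 * z ^ 8 * real (indeg H b)"
    unfolding EE_ee by (intro abs_diff_le E1_KK E1_KK' ab)
  have t2: "\<bar>c * EE (ee a b)\<bar> \<le> 2 * ?y" by (intro abs_mult_le c EE_bound ee_le)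
  have t3: "\<bar>EE (\<lambda>G. ee a b G * W1 a b G)\<bar> \<le> ?y * (2 * z ^ 3) + 1 / real n ^ 3"
  proof (rule EE_bound_hp[OF W1_hp[OF ab(1,2)]])
    fix G
    show "\<bar>ee a b G * W1 a b G\<bar> \<le> ?y * (2 * z ^ 3)" if "\<bar>W1 a b G\<bar> \<le> 2 * z ^ 3" by (intro abs_mult_le ee_le that)
    have "z * r \<le> r * r" using z_le_r[of 1] r_pos by (intro mult_right_mono) auto
    then have "\<bar>ee a b G\<bar> \<le> 2 * real n" using ee_le[of a b G] yy_le[OF ab(1,2)] by simp
    then have "\<bar>ee a b G * W1 a b G\<bar> \<le> (2 * real n) * (4 * real n)" by (intro abs_mult_le W1_all ab)
    also have "\<dots> = 8 * real n ^ 2" by (simp add: power2_eq_square)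
    also have "\<dots> \<le> real n ^ 3" by (rule n_powers) simp
    also have "\<dots> \<le> real n ^ 6" by (rule n_pow_mono) simp
    finally show "\<bar>ee a b G * W1 a b G\<bar> \<le> real n ^ 6" .
  qed (use n_ge z_pos yy_nonneg in auto)
  have p: "\<bar>EE (\<lambda>G. E1 k l G * ee a b G)\<bar> \<le> 2 * z ^ 8 * real (indeg H k)" if "k < n" "l < n" for k l
  proof -
    have "EE (\<lambda>G. E1 k l G * ee a b G) = EE (\<lambda>G. E1 k l G * E1 a b G) - EE (\<lambda>G. E1 k l G * E1 b a G)"
      unfolding ee_def EE_diff[symmetric] by (simp add: algebra_simps)
    then have "\<bar>EE (\<lambda>G. E1 k l G * ee a b G)\<bar> \<le> z ^ 8 * real (indeg H k) + z ^ 8 * real (indeg H k)"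
      using abs_diff_le[OF E1_prod[OF that ab(1,2)] E1_prod[OF that ab(2,1)]] by simp
    then show ?thesis by (simp only: mult_2 distrib_right)
  qed
  have t4: "\<bar>EE (\<lambda>G. ee a b G * T3 a b G)\<bar> \<le> 2 * z ^ 8 * ?y" by (rule EE_T3_le[OF p[OF ab(2,1)] p[OF ab(1,2)]])
  have "\<bar>EE (\<lambda>G. ee a b G * uu a b G)\<bar> \<le> (2 * z ^ 8 * real (indeg H a) + 2 * z ^ 8 * real (indeg H b)) + 2 * ?y + (?y * (2 * z ^ 3) + 1 / real n ^ 3) + 2 * z ^ 8 * ?y"
    unfolding e by (intro abs_diff_le) (use t1 t2 t3 t4 in auto)
  also have "\<dots> = 4 * (z ^ 8 * ?y) + 2 * ?y + 2 * (z ^ 3 * ?y) + 1 / real n ^ 3" by (simp add: yy_def algebra_simps)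
  also have "\<dots> \<le> z ^ 10 * (1 + ?y)"
  proof -
    have "z ^ 3 * ?y \<le> z ^ 8 * ?y" "?y \<le> z ^ 8 * ?y" using zr_mono[of 3 8 ?y] zr_mono[of 0 8 ?y] yy_nonneg by auto
    moreover have "10 * (z ^ 8 * ?y) \<le> z ^ 9 * ?y" using absorb[of ?y 10 8] yy_nonneg by (simp add: eval_nat_numeral)
    moreover have "z ^ 9 * ?y \<le> z ^ 10 * ?y" using zr_mono[of 9 10 ?y] yy_nonneg by auto
    moreover have "1 / real n ^ 3 \<le> 1" using n_ge by simp
    moreover have "z ^ 10 * (1 + ?y) = z ^ 10 + z ^ 10 * ?y" by (simp add: algebra_simps)
    moreover have "0 \<le> z ^ 8 * ?y" using z_pos yy_nonneg by simp
    ultimately show ?thesis using z1[of 10] by linarith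
  qed
  finally show ?thesis .
qed

lemma ee_mean: assumes ab: "a < n" "b < n"
  shows "\<bar>EE (ee a b) - ((\<Sum>i\<in>hs a b. dl i) - (\<Sum>i\<in>hs b a. dl i) + real (card (hs a b)) * et b - real (card (hs b a)) * et a) / n\<bar> \<le> z ^ 12 / n * yy a b"
proof -
  have "EE (ee a b) = EE (E1 a b) - EE (E1 b a)" unfolding ee_def[abs_def] EE_diff ..
  then have "EE (ee a b) - ((\<Sum>i\<in>hs a b. dl i) - (\<Sum>i\<in>hs b a. dl i) + real (card (hs a b)) * et b - real (card (hs b a)) * et a) / n
    = (EE (E1 a b) - ((\<Sum>i\<in>hs a b. dl i) + real (card (hs a b)) * et b) / n) - (EE (E1 b a) - ((\<Sum>i\<in>hs b a. dl i) + real (card (hs b a)) * et a) / n)"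
    by (simp add: diff_divide_distrib add_divide_distrib)
  then have "\<bar>EE (ee a b) - ((\<Sum>i\<in>hs a b. dl i) - (\<Sum>i\<in>hs b a. dl i) + real (card (hs a b)) * et b - real (card (hs b a)) * et a) / n\<bar>
    \<le> z ^ 12 / n * real (indeg H a) + z ^ 12 / n * real (indeg H b)"
    using abs_diff_le[OF E1_mean[OF ab] E1_mean[OF ab(2,1)]] by simp
  then show ?thesis by (simp add: yy_def distrib_left)
qed

end

section \<open>Expansion of the ratio\<close>

text \<open>Here e stands for 1 / sqrt n, and Y for (1 + y_a + y_b) / n, the error admitted per move in units of 1 / n.\<close>

locale small_scale =
  fixes z e Y :: real
  assumes z100: "z \<ge> 100" and e_pos: "e > 0" and e_small: "z ^ 30 * e \<le> 1" and Y_ge: "e^2 \<le> Y"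
begin

definition S :: "nat \<Rightarrow> nat \<Rightarrow> real \<Rightarrow> bool" where "S k m x \<longleftrightarrow> \<bar>x\<bar> \<le> z ^ k * e ^ m"
definition SY :: "nat \<Rightarrow> nat \<Rightarrow> real \<Rightarrow> bool" where "SY k m x \<longleftrightarrow> \<bar>x\<bar> \<le> z ^ k * e ^ m * Y"

lemma zp: "z > 0" using z100 by simp

lemma zk1: "1 \<le> z ^ k" using z100 by (simp add: one_le_power)

lemma Y_pos: "Y > 0" using Y_ge e_pos by (meson less_le_trans zero_less_power)

lemma e_le1: "e \<le> 1"
proof -
  have "1 * e \<le> z ^ 30 * e" using zk1 e_pos by (intro mult_right_mono) auto
  then show ?thesis using e_small by linarith
qed

lemma S_nonneg: "0 \<le> z ^ k * e ^ m" using zp e_pos by simp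

lemma S_weaken: assumes "S k m x" "k \<le> k'" "m' \<le> m" shows "S k' m' x"
proof -
  have "z ^ k * e ^ m \<le> z ^ k' * e ^ m'"
    using assms z100 e_pos e_le1 by (intro mult_mono power_increasing power_decreasing) auto
  then show ?thesis using assms(1) by (simp add: S_def)
qed

lemma SY_weaken: assumes "SY k m x" "k \<le> k'" "m' \<le> m" shows "SY k' m' x"
proof -
  have "z ^ k * e ^ m * Y \<le> z ^ k' * e ^ m' * Y"
    using assms z100 e_pos e_le1 Y_pos by (intro mult_right_mono mult_mono power_increasing power_decreasing) auto
  then show ?thesis using assms(1) by (simp add: SY_def)
qed

text \<open>Two powers of e buy one factor Y, so four powers of e are always negligible, whatever
  the degrees in \<open>H\<close>.\<close>

lemma S_SY: assumes "S k (m + 2) x" shows "SY k m x"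
proof -
  have "z ^ k * e ^ (m + 2) = z ^ k * e ^ m * e^2" unfolding power_add by (rule mult.assoc[symmetric])
  also have "\<dots> \<le> z ^ k * e ^ m * Y" using Y_ge S_nonneg by (intro mult_left_mono) auto
  finally show ?thesis using assms by (simp add: S_def SY_def)
qed

lemma S_SY': "S k m x \<Longrightarrow> p + 2 \<le> m \<Longrightarrow> SY k p x"
  by (rule S_SY, rule S_weaken) auto

lemma zsucc: "z ^ k + z ^ k \<le> z ^ Suc k"
proof -
  have "2 * z ^ k \<le> z * z ^ k" using z100 zk1[of k] by (intro mult_right_mono) auto
  then show ?thesis by simp
qed

lemma S_add0: assumes "S k m x" "S k m y" shows "S (Suc k) m (x + y)"
proof -
  have "\<bar>x + y\<bar> \<le> z ^ k * e ^ m + z ^ k * e ^ m" using assms unfolding S_def by (rule abs_add_le)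
  also have "\<dots> = (z ^ k + z ^ k) * e ^ m" by (simp add: algebra_simps)
  also have "\<dots> \<le> z ^ Suc k * e ^ m" using zsucc e_pos by (intro mult_right_mono) auto
  finally show ?thesis by (simp add: S_def)
qed

lemma S_add: assumes "S k m x" "S l p y" shows "S (Suc (max k l)) (min m p) (x + y)"
  by (rule S_add0; rule S_weaken[OF assms(1)] S_weaken[OF assms(2)]) auto

lemma SY_add0: assumes "SY k m x" "SY k m y" shows "SY (Suc k) m (x + y)"
proof -
  have "\<bar>x + y\<bar> \<le> z ^ k * e ^ m * Y + z ^ k * e ^ m * Y" using assms unfolding SY_def by (rule abs_add_le)
  also have "\<dots> = (z ^ k + z ^ k) * (e ^ m * Y)" by (simp add: algebra_simps)
  also have "\<dots> \<le> z ^ Suc k * (e ^ m * Y)" using zsucc e_pos Y_pos by (intro mult_right_mono) auto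
  finally show ?thesis by (simp add: SY_def mult_ac)
qed

lemma SY_add: assumes "SY k m x" "SY l p y" shows "SY (Suc (max k l)) (min m p) (x + y)"
  by (rule SY_add0; rule SY_weaken[OF assms(1)] SY_weaken[OF assms(2)]) auto

lemma S_minus: "S k m x \<Longrightarrow> S k m (- x)" by (simp add: S_def)
lemma SY_minus: "SY k m x \<Longrightarrow> SY k m (- x)" by (simp add: SY_def)

lemma S_diff: assumes "S k m x" "S l p y" shows "S (Suc (max k l)) (min m p) (x - y)"
  using S_add[OF assms(1) S_minus[OF assms(2)]] by simp
lemma SY_diff: assumes "SY k m x" "SY l p y" shows "SY (Suc (max k l)) (min m p) (x - y)"
  using SY_add[OF assms(1) SY_minus[OF assms(2)]] by simp

lemma S_mult: assumes "S k m x" "S l p y" shows "S (k + l) (m + p) (x * y)"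
proof -
  have "\<bar>x * y\<bar> \<le> (z ^ k * e ^ m) * (z ^ l * e ^ p)" using assms by (intro abs_mult_le) (auto simp: S_def)
  then show ?thesis by (simp add: S_def power_add mult_ac)
qed

lemma SY_multL: assumes "SY k m x" "S l p y" shows "SY (k + l) (m + p) (x * y)"
proof -
  have "\<bar>x * y\<bar> \<le> (z ^ k * e ^ m * Y) * (z ^ l * e ^ p)" using assms by (intro abs_mult_le) (auto simp: S_def SY_def)
  then show ?thesis by (simp add: SY_def power_add mult_ac)
qed

lemma SY_multR: assumes "S k m x" "SY l p y" shows "SY (k + l) (m + p) (x * y)"
  using SY_multL[OF assms(2,1)] by (simp add: mult.commute add.commute)

lemma S_inv: assumes "1 / (2 * z) \<le> w" shows "S 2 0 (1 / w)"
proof -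
  have w: "0 < w" using assms zp by (meson divide_pos_pos less_le_trans zero_less_mult_iff zero_less_numeral zero_less_one)
  have "1 / w \<le> 1 / (1 / (2 * z))" using assms zp w by (intro divide_left_mono) auto
  also have "\<dots> = 2 * z" by simp
  also have "\<dots> \<le> z ^ 2" using z100 by (simp add: power2_eq_square)
  finally show ?thesis using w by (simp add: S_def)
qed

lemma S_const: assumes "\<bar>x\<bar> \<le> 1" shows "S 0 0 x" using assms by (simp add: S_def)
lemma S_const1: assumes "\<bar>x\<bar> \<le> z" shows "S 1 0 x" using assms by (simp add: S_def)
lemma S_e2: "S 0 2 (e^2)" using e_pos by (simp add: S_def)

lemma S_small: assumes "S k 1 x" "k + 1 \<le> 29" shows "\<bar>x\<bar> \<le> 1 / z"
proof -
  have "\<bar>x\<bar> \<le> z ^ k * e" using assms by (simp add: S_def)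
  also have "\<dots> \<le> 1 / z"
  proof -
    have "z ^ (k + 1) * e \<le> z ^ 30 * e" using assms z100 e_pos by (intro mult_right_mono power_increasing) auto
    then have "z * (z ^ k * e) \<le> 1" using e_small by (simp add: mult_ac)
    then show ?thesis using zp by (simp add: field_simps)
  qed
  finally show ?thesis .
qed

end

lemma exp_quadratic:
  fixes x :: real
  assumes "\<bar>x\<bar> \<le> 1"
  shows "\<bar>exp x - 1 - x\<bar> \<le> x\<^sup>2"
proof -
  have "exp x \<le> 1 + x + x^2"
  proof (cases "0 \<le> x")
    case True then show ?thesis using assms by (intro exp_bound) auto
  next
    case False
    define y where "y = - x"
    have y: "0 \<le> y" using False by (simp add: y_def)
    have q: "0 < 1 + y + y^2 / 2" using y by (simp add: add_pos_nonneg)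
    have "exp x = 1 / exp y" by (simp add: y_def exp_minus field_simps)
    also have "\<dots> \<le> 1 / (1 + y + y^2 / 2)" using exp_lower_Taylor_quadratic[OF y] q by (intro divide_left_mono) auto
    also have "\<dots> \<le> 1 - y + y^2"
    proof -
      have "(1 - y + y^2) * (1 + y + y^2 / 2) = 1 + (y * y / 2 + y * y * y / 2 + y * y * y * y / 2)" by (simp add: power2_eq_square field_simps)
      moreover have "0 \<le> y * y / 2 + y * y * y / 2 + y * y * y * y / 2" using y by simp
      ultimately have "1 \<le> (1 - y + y^2) * (1 + y + y^2 / 2)" by linarith
      then show ?thesis using q by (simp add: divide_le_eq)
    qed
    finally show ?thesis by (simp add: y_def)
  qed
  moreover have "1 + x \<le> exp x" by (rule exp_ge_add_one_self)
  ultimately show ?thesis unfolding abs_le_iff by (smt (verit) zero_le_power2)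
qed

text \<open>All quantities are dimensionless: a, b are eta_a / n, eta_b / n; A, B, C are the sizes of H_a, H_b and of their
  intersection over n (H_k being the column k of H); D is the difference of the sums of delta over H_a and H_b, over n^2.\<close>

locale ratio_point = small_scale +
  fixes L a b A B C D \<rho> :: real
  assumes L: "0 < L" "L < 1" and v: "1 / z \<le> L * (1 - L)"
    and a: "\<bar>a\<bar> \<le> z * e" and b: "\<bar>b\<bar> \<le> z * e"
    and A: "0 \<le> A" "A \<le> z * e" and B: "0 \<le> B" "B \<le> z * e" and C: "0 \<le> C" "C \<le> A" "C \<le> B"
    and AY: "A + B \<le> Y" and D: "\<bar>D\<bar> \<le> (A + B) * (z * e)" and \<rho>: "0 \<le> \<rho>" "\<rho> \<le> 4 * z^2"
begin

text \<open>In the application U0 is \<open>u0\<close> over n with leading part P, T is (eta_b -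
  eta_a - 1) / n, and eb is the main term of the mean of \<open>ee\<close> over n. X1, X2 and N1
  belong to the binomial coefficients, whose quotient is (X1 X2 + N1) / ((X1 + e^2) (X2 + e^2)); N
  is the numerator of the leading part on the matrix side.\<close>

definition v where "v = L * (1 - L)"
definition P where "P = (L + a) * (1 - L - b) - (A + B - C) * v"
definition q where "q = 1 + v - \<rho>"
definition U0 where "U0 = P + e^2 * q"
definition T where "T = b - a - e^2"
definition eb where "eb = D + (A - C) * b - (B - C) * a"
definition X1 where "X1 = (1 - A) * L + a"
definition X2 where "X2 = (1 - B) * (1 - L) - b"
definition N where "N = (1 - A + C) * b - (1 - B + C) * a"
definition N1 where "N1 = (1 - A) * b - (1 - B) * a"
definition g where "g = a * (1 - L) - b * L"

lemma vz: "1 / z \<le> v" using v by (simp add: v_def)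
lemma v_pos: "0 < v" using L by (simp add: v_def)
lemma v_le: "v \<le> L" "v \<le> 1 - L" "v \<le> 1" using L mult_mono[of L 1 "1 - L" 1] by (auto simp: v_def)

lemma Sa: "S 1 1 a" "S 1 1 b" using a b by (auto simp: S_def)
lemma SA: "S 1 1 A" "S 1 1 B" "S 1 1 C" using A B C by (auto simp: S_def)
lemma SYA: "SY 0 0 A" "SY 0 0 B" "SY 0 0 C" using A B C AY by (auto simp: SY_def)
lemma SD: "SY 1 1 D"
proof -
  have "(A + B) * (z * e) \<le> Y * (z * e)" using AY zp e_pos by (intro mult_right_mono) auto
  then show ?thesis using D by (simp add: SY_def mult_ac)
qed
lemma SD2: "S 3 2 D"
proof -
  have "(A + B) * (z * e) \<le> (z * e + z * e) * (z * e)" using zp e_pos by (intro mult_right_mono add_mono A B) auto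
  also have "\<dots> = 2 * (z ^ 2 * e ^ 2)" by (simp add: power2_eq_square)
  also have "\<dots> \<le> z * (z ^ 2 * e ^ 2)" using z100 zp e_pos by (intro mult_right_mono) auto
  also have "\<dots> = z ^ 3 * e ^ 2" by (simp add: eval_nat_numeral)
  finally show ?thesis using D by (simp add: S_def)
qed
lemma SL: "S 0 0 L" "S 0 0 (1 - L)" "S 0 0 v" using L v_pos v_le by (auto intro!: S_const)
lemma Srho: "S 3 0 \<rho>"
proof -
  have "4 * z^2 \<le> z * z^2" using z100 by (intro mult_right_mono) auto
  then show ?thesis using \<rho> by (simp add: S_def eval_nat_numeral)
qed
lemma Sq: "S 5 0 q"
  unfolding q_def by (rule S_weaken[OF S_diff[OF S_add[OF S_const[of 1] SL(3)] Srho]]) auto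

lemma inv_ge: "1 / (2 * z) \<le> w" if "1 / z \<le> w" for w
proof -
  have "1 / (2 * z) \<le> 1 / z" using zp by (simp add: field_simps)
  then show ?thesis using that by linarith
qed

lemma Siv: "S 2 0 (1 / v)" by (intro S_inv inv_ge vz)
lemma SiL: "S 2 0 (1 / L)" "S 2 0 (1 / (1 - L))" using vz v_le by (auto intro!: S_inv inv_ge)

lemma SB: "S 3 1 (A + B - C)" by (rule S_weaken[OF S_diff[OF S_add[OF SA(1,2)] SA(3)]]) auto
lemma SYB: "SY 2 0 (A + B - C)" by (rule SY_weaken[OF SY_diff[OF SY_add[OF SYA(1,2)] SYA(3)]]) auto

lemma Sg: "S 2 1 g" unfolding g_def by (rule S_weaken[OF S_diff[OF S_mult[OF Sa(1) SL(2)] S_mult[OF Sa(2) SL(1)]]]) auto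

lemma P_v: "P - v = g - a * b - (A + B - C) * v" by (simp add: P_def v_def g_def algebra_simps)

lemma SPv: "S 5 1 (P - v)" unfolding P_v
  by (rule S_weaken[OF S_diff[OF S_diff[OF Sg S_mult[OF Sa]] S_mult[OF SB SL(3)]]]) auto

lemma half: assumes "S k 1 (w - u)" "k \<le> 27" "1 / z \<le> u" shows "1 / (2 * z) \<le> w"
proof -
  have "\<bar>z * (w - u)\<bar> \<le> 1 / z"
  proof (rule S_small)
    show "S (Suc k) 1 (z * (w - u))" using S_mult[OF S_const1[of z] assms(1)] zp by simp
  qed (use assms in auto)
  then have "\<bar>w - u\<bar> * z \<le> 1 / z" using zp by (simp add: abs_mult mult.commute)
  moreover have "1 / z \<le> 1 / 2" using z100 by simp
  ultimately have "\<bar>w - u\<bar> * z \<le> 1 / 2" by linarith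
  then have "\<bar>w - u\<bar> \<le> 1 / (2 * z)" using zp by (simp add: field_simps)
  moreover have "1 / z = 1 / (2 * z) + 1 / (2 * z)" by (simp add: field_simps)
  ultimately show ?thesis using assms(3) by linarith
qed

lemma P_ge: "1 / (2 * z) \<le> P" by (rule half[OF SPv _ vz]) simp
lemma SiP: "S 2 0 (1 / P)" by (rule S_inv[OF P_ge])

lemma SU0v: "S 6 1 (U0 - v)"
proof -
  have e: "U0 - v = (P - v) + e^2 * q" by (simp add: U0_def)
  show ?thesis unfolding e by (rule S_weaken[OF S_add[OF SPv S_mult[OF S_e2 Sq]]]) auto
qed
lemma U0_ge: "1 / (2 * z) \<le> U0" by (rule half[OF SU0v _ vz]) simp
lemma SiU0: "S 2 0 (1 / U0)" by (rule S_inv[OF U0_ge])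

lemma pos: "0 < P" "0 < U0" using P_ge U0_ge zp by (meson divide_pos_pos less_le_trans zero_less_mult_iff zero_less_numeral zero_less_one)+

lemma SX1: "S 2 1 (X1 - L)" "SY 0 0 (A * L)" "S 2 1 (a - A * L)"
proof -
  show "S 2 1 (a - A * L)" by (rule S_weaken[OF S_diff[OF Sa(1) S_mult[OF SA(1) SL(1)]]]) auto
  moreover have "X1 - L = a - A * L" by (simp add: X1_def algebra_simps)
  ultimately show "S 2 1 (X1 - L)" by simp
  show "SY 0 0 (A * L)" using SY_multL[OF SYA(1) SL(1)] by simp
qed
lemma SX2: "S 2 1 (X2 - (1 - L))" "SY 0 0 (B * (1 - L))" "S 2 1 (b + B * (1 - L))"
proof -
  show s: "S 2 1 (b + B * (1 - L))" by (rule S_weaken[OF S_add[OF Sa(2) S_mult[OF SA(2) SL(2)]]]) auto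
  have "X2 - (1 - L) = - (b + B * (1 - L))" by (simp add: X2_def algebra_simps)
  then show "S 2 1 (X2 - (1 - L))" using S_minus[OF s] by simp
  show "SY 0 0 (B * (1 - L))" using SY_multL[OF SYA(2) SL(2)] by simp
qed
lemma X_ge: "1 / (2 * z) \<le> X1" "1 / (2 * z) \<le> X2"
  using half[OF SX1(1)] half[OF SX2(1)] vz v_le by auto
lemma SiX: "S 2 0 (1 / X1)" "S 2 0 (1 / X2)" using X_ge by (auto intro: S_inv)
lemma X_pos: "0 < X1" "0 < X2" using X_ge zp by (meson divide_pos_pos less_le_trans zero_less_mult_iff zero_less_numeral zero_less_one)+

lemma Sba: "S 2 1 (b - a)" by (rule S_weaken[OF S_diff[OF Sa(2,1)]]) auto
lemma ST: "S 3 1 T" unfolding T_def by (rule S_weaken[OF S_diff[OF Sba S_e2]]) auto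

lemma Seb: "SY 4 1 eb"
proof -
  have 1: "SY 1 0 (A - C)" "SY 1 0 (B - C)" using SY_diff[OF SYA(1,3)] SY_diff[OF SYA(2,3)] by auto
  show ?thesis unfolding eb_def
    by (rule SY_weaken[OF SY_diff[OF SY_add[OF SD SY_multL[OF 1(1) Sa(2)]] SY_multL[OF 1(2) Sa(1)]]]) auto
qed

lemma Seb2: "S 6 2 eb"
proof -
  have 1: "S 2 1 (A - C)" "S 2 1 (B - C)" using S_diff[OF SA(1,3)] S_diff[OF SA(2,3)] by (auto simp: numeral_2_eq_2)
  show ?thesis unfolding eb_def
    by (rule S_weaken[OF S_diff[OF S_add[OF SD2 S_mult[OF 1(1) Sa(2)]] S_mult[OF 1(2) Sa(1)]]]) auto
qed

lemma SY_fin: "S k m x \<Longrightarrow> 4 \<le> m \<Longrightarrow> k \<le> 35 \<Longrightarrow> SY 35 2 x"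
  by (rule S_SY'[of 35 4], rule S_weaken) auto

lemma SY_fin': "SY k m x \<Longrightarrow> 2 \<le> m \<Longrightarrow> k \<le> 35 \<Longrightarrow> SY 35 2 x"
  by (rule SY_weaken) auto

lemma SY_add_fin: "SY k 2 x \<Longrightarrow> SY k 2 y \<Longrightarrow> SY (Suc k) 2 (x + y)" by (rule SY_add0)

lemma SP: "S 6 0 P" "S 7 0 U0"
proof -
  have "P = (P - v) + v" "U0 = (U0 - v) + v" by simp_all
  then show "S 6 0 P" "S 7 0 U0"
    using S_weaken[OF S_add[OF SPv SL(3)], of 6 0] S_weaken[OF S_add[OF SU0v SL(3)], of 7 0] by auto
qed

lemma Sd: "S 5 2 (e^2 * q)" using S_mult[OF S_e2 Sq] by simp

text \<open>As in the next steps, an exact identity writes the remainder as products of small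
  factors, whose orders are then added up. Here 1 / U0 is expanded at P to first order; eb is
  dropped from the correction because it already carries a factor Y.\<close>

lemma step1: "SY 36 2 ((T - eb) / U0 - ((T - eb) / P - T * (e^2 * q) / P^2))"
proof -
  have id: "x / (p + d) - (x / p - y * d / p^2) = (y - x) * d * (1 / p) * (1 / p) + x * (d * d) * (1 / p) * (1 / p) * (1 / (p + d))"
    if "p > 0" "p + d > 0" for x y p d :: real using that by (simp add: divide_simps power2_eq_square) algebra
  have pd: "P + e^2 * q > 0" using pos(2) by (simp add: U0_def)
  have eq: "(T - eb) / U0 - ((T - eb) / P - T * (e^2 * q) / P^2) = (T - (T - eb)) * (e^2 * q) * (1 / P) * (1 / P) + (T - eb) * (e^2 * q * (e^2 * q)) * (1 / P) * (1 / P) * (1 / U0)"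
    unfolding U0_def by (rule id[OF pos(1) pd])
  have e: "T - (T - eb) = eb" by simp
  have t1: "SY 35 2 (eb * (e^2 * q) * (1 / P) * (1 / P))"
    by (rule SY_fin'[OF SY_multL[OF SY_multL[OF SY_multL[OF Seb Sd] SiP] SiP]]) auto
  have t2: "SY 35 2 ((T - eb) * (e^2 * q * (e^2 * q)) * (1 / P) * (1 / P) * (1 / U0))"
    by (rule SY_fin[OF S_mult[OF S_mult[OF S_mult[OF S_mult[OF S_diff[OF ST Seb2] S_mult[OF Sd Sd]] SiP] SiP] SiU0]]) auto
  show ?thesis unfolding eq e using SY_add_fin[OF t1 t2] by simp
qed

lemma step2: "SY 36 2 (T * (e^2 * q) / P^2 - (b - a) * (e^2 * q) / v^2)"
proof -
  have id: "t * d / p^2 - t' * d / w^2 = - (t' * d * (p - w) * (p + w) * (1 / p) * (1 / p) * (1 / w) * (1 / w)) + (t - t') * d * (1 / p) * (1 / p)"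
    if "p > 0" "w > 0" for t t' d p w :: real using that by (simp add: divide_simps power2_eq_square) algebra
  have e: "T - (b - a) = - e\<^sup>2" by (simp add: T_def)
  have t1: "SY 35 2 (- ((b - a) * (e^2 * q) * (P - v) * (P + v) * (1 / P) * (1 / P) * (1 / v) * (1 / v)))"
    by (rule SY_fin[OF S_minus[OF S_mult[OF S_mult[OF S_mult[OF S_mult[OF S_mult[OF S_mult[OF S_mult[OF Sba Sd] SPv] S_add[OF SP(1) SL(3)]] SiP] SiP] Siv] Siv]]]) auto
  have t2: "SY 35 2 (- e\<^sup>2 * (e^2 * q) * (1 / P) * (1 / P))"
    by (rule SY_fin[OF S_mult[OF S_mult[OF S_mult[OF S_minus[OF S_e2] Sd] SiP] SiP]]) auto
  show ?thesis unfolding id[OF pos(1) v_pos] e using SY_add_fin[OF t1 t2] by simp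
qed

lemma step3: "SY 36 2 (T * v^2 * e^2 / U0 ^ 3 - (b - a) * e^2 / v)"
proof -
  have id: "t * w^2 * d / p ^ 3 - t' * d / w = (t - t') * d * (w * w) * (1 / p) * (1 / p) * (1 / p) + - (t' * d * (p - w) * (p * p + p * w + w * w) * (1 / p) * (1 / p) * (1 / p) * (1 / w))"
    if "p > 0" "w > 0" for t t' d p w :: real using that by (simp add: divide_simps power2_eq_square power3_eq_cube) algebra
  have e: "T - (b - a) = - e\<^sup>2" by (simp add: T_def)
  have t1: "SY 35 2 (- e\<^sup>2 * e^2 * (v * v) * (1 / U0) * (1 / U0) * (1 / U0))"
    by (rule SY_fin[OF S_mult[OF S_mult[OF S_mult[OF S_mult[OF S_mult[OF S_minus[OF S_e2] S_e2] S_mult[OF SL(3) SL(3)]] SiU0] SiU0] SiU0]]) auto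
  have sq: "S 16 0 (U0 * U0 + U0 * v + v * v)"
    by (rule S_weaken[OF S_add[OF S_add[OF S_mult[OF SP(2) SP(2)] S_mult[OF SP(2) SL(3)]] S_mult[OF SL(3) SL(3)]]]) auto
  have t2: "SY 35 2 (- ((b - a) * e^2 * (U0 - v) * (U0 * U0 + U0 * v + v * v) * (1 / U0) * (1 / U0) * (1 / U0) * (1 / v)))"
    by (rule SY_fin[OF S_minus[OF S_mult[OF S_mult[OF S_mult[OF S_mult[OF S_mult[OF S_mult[OF S_mult[OF Sba S_e2] SU0v] sq] SiU0] SiU0] SiU0] Siv]]]) auto
  show ?thesis unfolding id[OF pos(2) v_pos] e using SY_add_fin[OF t1 t2] by simp
qed

lemma step4: "(T - eb) / P = N / P - e^2 / P - D / P"
proof -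
  have "T - eb = N - e^2 - D" by (simp add: T_def eb_def N_def algebra_simps)
  then show ?thesis by (simp add: diff_divide_distrib)
qed

lemma step4a: "SY 35 2 (D / P - D / v)"
proof -
  have id: "d / p - d / w = - (d * (p - w) * (1 / p) * (1 / w))" if "p > 0" "w > 0" for d p w :: real
    using that by (simp add: field_simps)
  show ?thesis unfolding id[OF pos(1) v_pos]
    by (rule SY_fin'[OF SY_minus[OF SY_multL[OF SY_multL[OF SY_multL[OF SD SPv] SiP] Siv]]]) auto
qed

text \<open>Expands 1 / P at v to first order in P - v, of which only the linear part g has to be
  kept: after multiplication by e^2 the product a b is of order e^4, and the degree terms carry
  Y.\<close>

lemma step4b: "SY 37 2 (e^2 / P - (e^2 / v - e^2 * g / v^2))"
proof -
  have id: "x / p - (x / w - x * y / w^2) = (x * (m1 + m2)) * (1 / w) * (1 / w) + x * ((p - w) * (p - w)) * (1 / w) * (1 / w) * (1 / p)"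
    if "p > 0" "w > 0" "p - w = y - m1 - m2" for x y p w m1 m2 :: real
  proof -
    have y: "y = (p - w) + m1 + m2" using that(3) by simp
    show ?thesis unfolding y using that(1,2) by (simp add: divide_simps power2_eq_square) algebra
  qed
  have t1: "SY 36 2 ((e^2 * (a * b + (A + B - C) * v)) * (1 / v) * (1 / v))"
  proof -
    have "SY 3 2 (e^2 * (a * b + (A + B - C) * v))"
    proof -
      have "SY 2 2 (e^2 * (a * b))" by (rule S_SY'[OF S_weaken[OF S_mult[OF S_e2 S_mult[OF Sa]], of 2 4]]) auto
      moreover have "SY 2 2 (e^2 * ((A + B - C) * v))" by (rule SY_weaken[OF SY_multR[OF S_e2 SY_multL[OF SYB SL(3)]]]) auto
      ultimately show ?thesis unfolding distrib_left by (rule SY_weaken[OF SY_add]) auto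
    qed
    from SY_multL[OF SY_multL[OF this Siv] Siv] show ?thesis by (rule SY_weaken) auto
  qed
  have t2: "SY 36 2 (e^2 * ((P - v) * (P - v)) * (1 / v) * (1 / v) * (1 / P))"
    by (rule SY_weaken[OF SY_fin[OF S_mult[OF S_mult[OF S_mult[OF S_mult[OF S_e2 S_mult[OF SPv SPv]] Siv] Siv] SiP]]]) auto
  show ?thesis unfolding id[OF pos(1) v_pos P_v] using SY_add_fin[OF t1 t2] by simp
qed

text \<open>The quotient of binomial coefficients with the shifts by one removed is 1 + om. The
  shifts themselves are collected in the factor \<open>gg\<close>.\<close>

definition om where "om = N1 / (X1 * X2)"

definition kap where "kap = A * (L * b) - B * ((1 - L) * a) + A * (B * v)"

lemma X12: "X1 * X2 = P - C * v + kap"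
  by (simp add: X1_def X2_def P_def kap_def v_def algebra_simps)

lemma SYkap: "SY 3 1 kap"
  unfolding kap_def
  by (rule SY_weaken[OF SY_add[OF SY_diff[OF SY_multL[OF SYA(1) S_mult[OF SL(1) Sa(2)]] SY_multL[OF SYA(2) S_mult[OF SL(2) Sa(1)]]] SY_multL[OF SYA(1) S_mult[OF SA(2) SL(3)]]]]) auto

lemma SX12v: "S 6 1 (X1 * X2 - v)"
proof -
  have e: "X1 * X2 - v = L * (X2 - (1 - L)) + (1 - L) * (X1 - L) + (X1 - L) * (X2 - (1 - L))"
    by (simp add: v_def algebra_simps)
  show ?thesis unfolding e
    by (rule S_weaken[OF S_add[OF S_add[OF S_mult[OF SL(1) SX2(1)] S_mult[OF SL(2) SX1(1)]] S_mult[OF SX1(1) SX2(1)]]]) auto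
qed

lemma SN1: "S 4 1 N1" and Sw: "S 9 2 (v * N1 - (b - a) * (X1 * X2))"
proof -
  have e: "N1 = (b - a) + (B * a - A * b)" by (simp add: N1_def algebra_simps)
  have s: "S 3 2 (B * a - A * b)" by (rule S_weaken[OF S_diff[OF S_mult[OF SA(2) Sa(1)] S_mult[OF SA(1) Sa(2)]]]) auto
  show "S 4 1 N1" unfolding e by (rule S_weaken[OF S_add[OF Sba s]]) auto
  have e2: "v * N1 - (b - a) * (X1 * X2) = v * (B * a - A * b) - (b - a) * (X1 * X2 - v)" unfolding e by (simp add: algebra_simps)
  show "S 9 2 (v * N1 - (b - a) * (X1 * X2))" unfolding e2
    by (rule S_weaken[OF S_diff[OF S_mult[OF SL(3) s] S_mult[OF Sba SX12v]]]) auto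
qed

text \<open>The overlap C of the two forbidden columns enters N as C (b - a) and P as C v, but is
  absent from N1 and X1 X2. Its effect on the quotient nearly cancels, because v N1 is (b - a) X1 X2
  up to second order.\<close>

lemma step5: "SY 36 2 (om - N / P)"
proof -
  have id: "m / (x1 * x2) - m' / p = (c * (w * m - d * (x1 * x2))) * (1 / x1) * (1 / x2) * (1 / p) + - (m * k * (1 / x1) * (1 / x2) * (1 / p))"
    if "x1 > 0" "x2 > 0" "p > 0" "m' = m + c * d" "p = x1 * x2 + c * w - k" for m m' x1 x2 p c w d k :: real
  proof -
    have "m / (x1 * x2) - m' / p = (m * p - m' * (x1 * x2)) * (1 / x1) * (1 / x2) * (1 / p)"
      using that(1-3) by (simp add: divide_simps)
    also have "m * p - m' * (x1 * x2) = c * (w * m - d * (x1 * x2)) - m * k" unfolding that(4) by (subst that(5)) (simp add: algebra_simps)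
    finally show ?thesis by (simp add: algebra_simps)
  qed
  have NN: "N = N1 + C * (b - a)" by (simp add: N_def N1_def algebra_simps)
  have PP: "P = X1 * X2 + C * v - kap" using X12 by simp
  have t1: "SY 35 2 ((C * (v * N1 - (b - a) * (X1 * X2))) * (1 / X1) * (1 / X2) * (1 / P))"
    by (rule SY_fin'[OF SY_multL[OF SY_multL[OF SY_multL[OF SY_multL[OF SYA(3) Sw] SiX(1)] SiX(2)] SiP]]) auto
  have t2: "SY 35 2 (- (N1 * kap * (1 / X1) * (1 / X2) * (1 / P)))"
    by (rule SY_fin'[OF SY_minus[OF SY_multL[OF SY_multL[OF SY_multL[OF SY_multR[OF SN1 SYkap] SiX(1)] SiX(2)] SiP]]]) auto
  show ?thesis unfolding om_def id[OF X_pos pos(1) NN PP] using SY_add_fin[OF t1 t2] by simp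
qed

definition p where "p = e^2 / X1"
definition q' where "q' = e^2 / X2"

lemma inv_expand: "x / (w + d) - (x / w - x * c / w^2) = (x * m) * (1 / w) * (1 / w) + x * (d * d) * (1 / w) * (1 / w) * (1 / (w + d))"
  if "w > 0" "w + d > 0" "d = c - m" for x w d c m :: real
proof -
  have c: "c = d + m" using that(3) by simp
  show ?thesis unfolding c using that(1,2) by (simp add: divide_simps power2_eq_square) algebra
qed

lemma step6: "SY 36 2 (p - (e^2 / L - e^2 * a / L^2))"
proof -
  have x: "X1 = L + (a - A * L)" by (simp add: X1_def algebra_simps)
  have pos': "0 < L + (a - A * L)" using X_pos(1) unfolding x .
  have t1: "SY 35 2 ((e^2 * (A * L)) * (1 / L) * (1 / L))"
    by (rule SY_fin'[OF SY_multL[OF SY_multL[OF SY_multR[OF S_e2 SX1(2)] SiL(1)] SiL(1)]]) auto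
  have t2: "SY 35 2 (e^2 * ((a - A * L) * (a - A * L)) * (1 / L) * (1 / L) * (1 / X1))"
    by (rule SY_fin[OF S_mult[OF S_mult[OF S_mult[OF S_mult[OF S_e2 S_mult[OF SX1(3) SX1(3)]] SiL(1)] SiL(1)] SiX(1)]]) auto
  have "p - (e^2 / L - e^2 * a / L^2) = (e^2 * (A * L)) * (1 / L) * (1 / L) + e^2 * ((a - A * L) * (a - A * L)) * (1 / L) * (1 / L) * (1 / X1)"
    unfolding p_def x by (rule inv_expand[OF L(1) pos' refl])
  then show ?thesis using SY_add_fin[OF t1 t2] by simp
qed

lemma step6': "SY 36 2 (q' - (e^2 / (1 - L) + e^2 * b / (1 - L)\<^sup>2))"
proof -
  have x: "X2 = (1 - L) + - (b + B * (1 - L))" by (simp add: X2_def algebra_simps)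
  have pos': "0 < (1 - L) + - (b + B * (1 - L))" using X_pos(2) unfolding x .
  have L': "0 < 1 - L" using L by simp
  have t1: "SY 35 2 ((e^2 * (B * (1 - L))) * (1 / (1 - L)) * (1 / (1 - L)))"
    by (rule SY_fin'[OF SY_multL[OF SY_multL[OF SY_multR[OF S_e2 SX2(2)] SiL(2)] SiL(2)]]) auto
  have t2: "SY 35 2 (e^2 * (- (b + B * (1 - L)) * - (b + B * (1 - L))) * (1 / (1 - L)) * (1 / (1 - L)) * (1 / X2))"
    by (rule SY_fin[OF S_mult[OF S_mult[OF S_mult[OF S_mult[OF S_e2 S_mult[OF S_minus[OF SX2(3)] S_minus[OF SX2(3)]]] SiL(2)] SiL(2)] SiX(2)]]) auto
  have "q' - (e^2 / (1 - L) - e^2 * (- b) / (1 - L)\<^sup>2) = (e^2 * (B * (1 - L))) * (1 / (1 - L)) * (1 / (1 - L)) + e^2 * (- (b + B * (1 - L)) * - (b + B * (1 - L))) * (1 / (1 - L)) * (1 / (1 - L)) * (1 / X2)"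
    unfolding q'_def x by (rule inv_expand[OF L' pos']) simp
  then show ?thesis using SY_add_fin[OF t1 t2] by simp
qed

lemma pq: "0 \<le> p" "0 \<le> q'" "S 2 2 p" "S 2 2 q'"
proof -
  have "p = e^2 * (1 / X1)" "q' = e^2 * (1 / X2)" by (simp_all add: p_def q'_def)
  then show "S 2 2 p" "S 2 2 q'" using S_mult[OF S_e2 SiX(1)] S_mult[OF S_e2 SiX(2)] by (auto simp: numeral_2_eq_2)
  show "0 \<le> p" "0 \<le> q'" using X_pos by (auto simp: p_def q'_def)
qed

text \<open>At leading order this is the partial fraction identity 1 / L + 1 / (1 - L) = 1 / (L (1 -
  L)).\<close>

lemma pq_lead: "S 12 3 (p + q' - e^2 / v)"
proof -
  have id: "x / w - x / u = - (x * (w - u) * (1 / w) * (1 / u))" if "w > 0" "u > 0" for x w u :: real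
    using that by (simp add: field_simps)
  have L': "0 < 1 - L" using L by simp
  have "e^2 / v = e^2 / L + e^2 / (1 - L)" using L by (simp add: v_def field_simps)
  then have e: "p + q' - e^2 / v = (e^2 / X1 - e^2 / L) + (e^2 / X2 - e^2 / (1 - L))" by (simp add: p_def q'_def)
  show ?thesis unfolding e id[OF X_pos(1) L(1)] id[OF X_pos(2) L']
    by (rule S_weaken[OF S_add[OF S_minus[OF S_mult[OF S_mult[OF S_mult[OF S_e2 SX1(1)] SiX(1)] SiL(1)]] S_minus[OF S_mult[OF S_mult[OF S_mult[OF S_e2 SX2(1)] SiX(2)] SiL(2)]]]]) auto
qed

lemma om_lead: "S 15 2 (om - (b - a) / v)" and Som: "S 8 1 om"
proof -
  have id: "m / (x1 * x2) - d / w = (w * m - d * (x1 * x2)) * (1 / w) * (1 / x1) * (1 / x2)" if "w > 0" "x1 > 0" "x2 > 0" for m d w x1 x2 :: real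
    using that by (simp add: divide_simps)
  show "S 15 2 (om - (b - a) / v)" unfolding om_def id[OF v_pos X_pos]
    by (rule S_weaken[OF S_mult[OF S_mult[OF S_mult[OF Sw Siv] SiX(1)] SiX(2)]]) auto
  have "om = N1 * (1 / X1) * (1 / X2)" by (simp add: om_def)
  then show "S 8 1 om" using S_mult[OF S_mult[OF SN1 SiX(1)] SiX(2)] by simp
qed

definition gg where "gg = 1 / ((1 + p) * (1 + q'))"

lemma gg_01: "S 0 0 gg"
proof -
  have "1 * 1 \<le> (1 + p) * (1 + q')" using pq by (intro mult_mono) auto
  then show ?thesis by (intro S_const) (simp add: gg_def)
qed

lemma one: "S 0 0 1" by (simp add: S_const)

lemma step7: "SY 36 2 ((1 + om) * gg - (1 + om - (p + q') - om * (p + q')))"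
proof -
  have id: "1 / ((1 + x) * (1 + y)) - (1 - x - y) = ((x + y) * (x + y) - x * y * (1 - x - y)) * (1 / ((1 + x) * (1 + y)))" if "x \<ge> 0" "y \<ge> 0" for x y :: real
  proof -
    have "(1 + x) * (1 + y) \<noteq> 0" using that by (metis add_pos_nonneg less_irrefl mult_pos_pos zero_less_one)
    moreover have "1 / w - c = d * (1 / w)" if "w \<noteq> 0" "1 - c * w = d" for w c d :: real using that by (simp add: field_simps)
    moreover have "1 - (1 - x - y) * ((1 + x) * (1 + y)) = (x + y) * (x + y) - x * y * (1 - x - y)" by algebra
    ultimately show ?thesis by blast
  qed
  have e: "(1 + om) * gg - (1 + om - (p + q') - om * (p + q')) = (1 + om) * (gg - (1 - p - q'))" by (simp add: algebra_simps)
  have s: "S 9 4 ((p + q') * (p + q') - p * q' * (1 - p - q'))"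
    by (rule S_weaken[OF S_diff[OF S_mult[OF S_add[OF pq(3,4)] S_add[OF pq(3,4)]] S_mult[OF S_mult[OF pq(3,4)] S_diff[OF S_diff[OF one pq(3)] pq(4)]]]]) auto
  have e2: "gg - (1 - p - q') = ((p + q') * (p + q') - p * q' * (1 - p - q')) * gg" unfolding gg_def by (rule id[OF pq(1,2)])
  show ?thesis unfolding e unfolding e2
    by (rule SY_weaken[OF SY_fin[OF S_mult[OF S_add[OF one Som] S_mult[OF s gg_01]]]]) auto
qed

lemma step7b: "SY 36 2 (om * (p + q') - (b - a) * e^2 / v^2)"
proof -
  have e: "om * (p + q') - (b - a) * e^2 / v^2 = (om - (b - a) / v) * (p + q') + (b - a) * (1 / v) * (p + q' - e^2 / v)"
    using v_pos by (simp add: field_simps power2_eq_square)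
  have t1: "SY 35 2 ((om - (b - a) / v) * (p + q'))"
    by (rule SY_fin[OF S_mult[OF om_lead S_add[OF pq(3,4)]]]) auto
  have t2: "SY 35 2 ((b - a) * (1 / v) * (p + q' - e^2 / v))"
    by (rule SY_fin[OF S_mult[OF S_mult[OF Sba Siv] pq_lead]]) auto
  show ?thesis unfolding e using SY_add_fin[OF t1 t2] by simp
qed

definition expo where "expo = (1 - \<rho> / v) * (e^2 * (a - b - L * (A - B) + e^2)) / v - D / v"
definition E0 where "E0 = - ((b - a) * e^2 * (1 - \<rho> / v) / v) - D / v"

lemma Srv: "S 6 0 (1 - \<rho> / v)"
proof -
  have "S 6 0 (1 - \<rho> * (1 / v))" by (rule S_weaken[OF S_diff[OF one S_mult[OF Srho Siv]]]) auto
  then show ?thesis by simp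
qed

lemma step8: "SY 35 2 (expo - E0)"
proof -
  have e: "expo - E0 = (e^2 * (e^2 - L * (A - B))) * (1 - \<rho> / v) * (1 / v)"
    using v_pos by (simp add: expo_def E0_def field_simps)
  have t: "SY 2 2 (e^2 * (e^2 - L * (A - B)))"
  proof -
    have "SY 0 2 (e^2 * e^2)" using S_SY'[OF S_mult[OF S_e2 S_e2], of 2] by simp
    moreover have "SY 1 2 (e^2 * (L * (A - B)))" by (rule SY_weaken[OF SY_multR[OF S_e2 SY_multR[OF SL(1) SY_diff[OF SYA(1,2)]]]]) auto
    ultimately show ?thesis unfolding right_diff_distrib[of "e^2"] by (rule SY_weaken[OF SY_diff]) auto
  qed
  show ?thesis unfolding e by (rule SY_fin'[OF SY_multL[OF SY_multL[OF t Srv] Siv]]) auto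
qed

lemma Sexpo: "S 14 2 expo" "SY 14 1 expo"
proof -
  have e: "expo = (1 - \<rho> / v) * (e^2 * (a - b - L * (A - B) + e^2)) * (1 / v) - D * (1 / v)" by (simp add: expo_def)
  have s: "S 13 3 ((1 - \<rho> / v) * (e^2 * (a - b - L * (A - B) + e^2)) * (1 / v))"
    by (rule S_weaken[OF S_mult[OF S_mult[OF Srv S_mult[OF S_e2 S_add[OF S_diff[OF S_diff[OF Sa(1,2)] S_mult[OF SL(1) S_diff[OF SA(1,2)]]] S_e2]]] Siv]]) auto
  show "S 14 2 expo" unfolding e by (rule S_weaken[OF S_diff[OF s S_mult[OF SD2 Siv]]]) auto
  have "SY 13 1 ((1 - \<rho> / v) * (e^2 * (a - b - L * (A - B) + e^2)) * (1 / v))" by (rule S_SY'[OF s]) simp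
  then show "SY 14 1 expo" unfolding e by (rule SY_weaken[OF SY_diff[OF _ SY_multL[OF SD Siv]]]) auto
qed

lemma Gr1: "S 9 1 ((1 + om) * gg - 1)"
proof -
  have ggm: "gg - 1 = - ((p + q' + p * q') * gg)"
  proof -
    have "(1 + p) * (1 + q') \<noteq> 0" using pq by (metis add_pos_nonneg less_irrefl mult_pos_pos zero_less_one)
    then show ?thesis unfolding gg_def by (simp add: field_simps)
  qed
  have "(1 + om) * gg - 1 = om * gg + (gg - 1)" by algebra
  also have "\<dots> = om * gg + - ((p + q' + p * q') * gg)" unfolding ggm ..
  finally show "S 9 1 ((1 + om) * gg - 1)"
    using S_weaken[OF S_add[OF S_mult[OF Som gg_01] S_minus[OF S_mult[OF S_add[OF S_add[OF pq(3,4)] S_mult[OF pq(3,4)]] gg_01]]], of 9 1]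
    by simp
qed

lemma expo_le: "\<bar>expo\<bar> \<le> 1 / z" by (rule S_small[of 14], rule S_weaken[OF Sexpo(1)]) auto

lemma expo_le1: "\<bar>expo\<bar> \<le> 1"
proof -
  have "1 / z \<le> 1" using z100 by simp
  then show ?thesis using expo_le by linarith
qed

text \<open>A lower bound on the target ratio, needed to turn the additive error of the expansion
  into a relative one.\<close>

lemma Phi_ge: "1 / 2 \<le> (1 + om) * gg * exp expo"
proof -
  have z: "1 / z \<le> 1 / 100" using z100 by simp
  have "\<bar>(1 + om) * gg - 1\<bar> \<le> 1 / z" by (rule S_small[OF Gr1]) simp
  then have 1: "9 / 10 \<le> (1 + om) * gg" using z by linarith
  have 2: "9 / 10 \<le> exp expo" using exp_ge_add_one_self[of expo] expo_le z by linarith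
  have "1 / 2 \<le> 9 / 10 * (9 / 10 :: real)" by simp
  also have "\<dots> \<le> (1 + om) * gg * exp expo" using 1 2 by (intro mult_mono) auto
  finally show ?thesis .
qed

lemma Gr_eq: "(1 + om) * gg = ((1 - A) * (1 - L) - a) * ((1 - B) * L + b) / ((X1 + e^2) * (X2 + e^2))"
proof -
  have n: "X1 * X2 + N1 = ((1 - A) * (1 - L) - a) * ((1 - B) * L + b)" by (simp add: X1_def X2_def N1_def algebra_simps)
  have p: "X1 * (1 + p) = X1 + e^2" "X2 * (1 + q') = X2 + e^2" using X_pos by (simp_all add: p_def q'_def field_simps)
  have "(1 + om) * gg = (X1 * X2 + N1) / (X1 * X2) * (1 / ((1 + p) * (1 + q')))" using X_pos by (simp add: om_def gg_def field_simps)
  also have "\<dots> = (X1 * X2 + N1) / ((X1 * (1 + p)) * (X2 * (1 + q')))" by (simp add: mult_ac)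
  finally show ?thesis unfolding n p .
qed

lemma step9: "SY 38 2 ((1 + om) * gg * exp expo - (1 + om) * gg - E0)"
proof -
  have id: "x * y - x - w = x * (y - 1 - u) + (x - 1) * u + (u - w)" for x y u w :: real by algebra
  have ee: "SY 28 3 (exp expo - 1 - expo)"
    using exp_quadratic[OF expo_le1] SY_multL[OF Sexpo(2) Sexpo(1)] by (simp add: SY_def power2_eq_square power3_eq_cube)
  have G: "S 9 0 ((1 + om) * gg)" by (rule S_weaken[OF S_mult[OF S_add[OF one Som] gg_01]]) auto
  have t1: "SY 37 2 ((1 + om) * gg * (exp expo - 1 - expo))" by (rule SY_weaken[OF SY_multR[OF G ee]]) auto
  have t2: "SY 35 2 (((1 + om) * gg - 1) * expo)" by (rule SY_fin'[OF SY_multR[OF Gr1 Sexpo(2)]]) auto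
  have t3: "SY 36 2 (((1 + om) * gg - 1) * expo + (expo - E0))" using SY_add_fin[OF t2 step8] by simp
  show ?thesis unfolding id[of "(1 + om) * gg" "exp expo" E0 expo] add.assoc
    by (rule SY_weaken[OF SY_add[OF t1 t3]]) auto
qed

text \<open>The left expression is the mean of V / (U + 1) with its moments replaced by their main
  terms, and it is compared with binomial quotient times exponential. The first-order parts agree by
  \<open>step5\<close>, the D terms agree directly, and the remaining contributions of orders e^2
  and e^3 cancel.\<close>

lemma ratio_point_main: "SY 39 2 (1 + (T - eb) / U0 + T * v^2 * e^2 / U0 ^ 3 - (1 + om) * gg * exp expo)"
proof -
  \<comment> \<open>This cancellation decides the shape of the exponent: the terms in \<rho> coming
    from q are balanced exactly by the factor 1 - \<rho> / v in \<open>expo\<close>.\<close>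
  have base: "- (e^2 / v) + e^2 * g / v^2 - (b - a) * (e^2 * q) / v^2 + (b - a) * e^2 / v
     + (e^2 / L - e^2 * a / L^2) + (e^2 / (1 - L) + e^2 * b / (1 - L)\<^sup>2) + (b - a) * e^2 / v^2
     + (b - a) * e^2 * (1 - \<rho> / v) / v = 0"
  proof -
    have id: "- (c / (l * m)) + c * (a * m - b * l) / (l * m)\<^sup>2 - (b - a) * (c * (1 + l * m - r)) / (l * m)\<^sup>2 + (b - a) * c / (l * m)
     + (c / l - c * a / l^2) + (c / m + c * b / m^2) + (b - a) * c / (l * m)\<^sup>2
     + (b - a) * c * (1 - r / (l * m)) / (l * m) = 0" if "l > 0" "m > 0" "l + m = 1" for l m c a b r :: real
    proof -
      \<comment> \<open>With the inverses as variables the claim is polynomial, modulo l i = 1, m j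
        = 1 and l + m = 1.\<close>
      define i j where "i = 1 / l" and "j = 1 / m"
      have ij: "l * i = 1" "m * j = 1" using that by (simp_all add: i_def j_def)
      have "- (c * (i * j)) + c * (a * m - b * l) * (i * j)\<^sup>2 - (b - a) * (c * (1 + l * m - r)) * (i * j)\<^sup>2 + (b - a) * c * (i * j)
        + (c * i - c * a * i^2) + (c * j + c * b * j^2) + (b - a) * c * (i * j)\<^sup>2 + (b - a) * c * (1 - r * (i * j)) * (i * j) = 0"
        using ij that(3) by algebra
      then show ?thesis unfolding i_def j_def by (simp add: power_divide)
    qed
    show ?thesis unfolding v_def g_def q_def using id[of L "1 - L" "e^2" a b \<rho>] L by simp
  qed
  have K: "\<bar>x\<bar> \<le> z ^ 38 * e^2 * Y" if "SY k 2 x" "k \<le> 38" for k x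
    using SY_weaken[OF that(1), of 38 2] that(2) by (simp add: SY_def)
  have le: "11 * (z ^ 38 * e^2 * Y) \<le> z * (z ^ 38 * e^2 * Y)" using z100 zp Y_pos by (intro mult_right_mono) auto
  have Z: "z ^ 39 * e^2 * Y = z * (z ^ 38 * e^2 * Y)" by (simp add: eval_nat_numeral)
  have lin: "\<bar>1 + tU + w3 - Ph\<bar> \<le> Z" if "\<bar>tU - (tP - y2)\<bar> \<le> k" "\<bar>y2 - y2'\<bar> \<le> k" "\<bar>w3 - w3'\<bar> \<le> k" "tP = nP - eP - dP" "\<bar>dP - dv\<bar> \<le> k"
     "\<bar>eP - (ev - eg)\<bar> \<le> k" "\<bar>o' - nP\<bar> \<le> k" "\<bar>p' - p1\<bar> \<le> k" "\<bar>r' - r1\<bar> \<le> k" "\<bar>Gr - (1 + o' - (p' + r') - op)\<bar> \<le> k" "\<bar>op - op1\<bar> \<le> k"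
     "\<bar>Ph - Gr - e0\<bar> \<le> k" "e0 = - e1 - dv" "- ev + eg - y2' + w3' + p1 + r1 + op1 + e1 = 0" "11 * k \<le> Z"
    for tU tP y2 y2' w3 w3' nP eP dP dv ev eg o' p' p1 r' r1 Gr op op1 Ph e0 e1 k Z :: real
    using that unfolding abs_le_iff by linarith
  show ?thesis unfolding SY_def Z
    by (rule lin[OF K[OF step1] K[OF step2] K[OF step3] step4 K[OF step4a] K[OF step4b] K[OF step5] K[OF step6] K[OF step6'] K[OF step7] K[OF step7b] K[OF step9] E0_def base le]) simp_all
qed

end

section \<open>Counts with neighbouring column sums\<close>

definition mv :: "nat \<Rightarrow> nat \<Rightarrow> nat \<Rightarrow> arcs \<Rightarrow> arcs" where
  "mv b a i G = insert (i,a) (G - {(i,b)})"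

text \<open>Subtraction is truncated, so this describes a genuine move only if \<open>t b\<close> is
  positive.\<close>

definition shift :: "nat \<Rightarrow> nat \<Rightarrow> (nat \<Rightarrow> nat) \<Rightarrow> nat \<Rightarrow> nat" where
  "shift a b t = t(a := Suc (t a), b := t b - 1)"

lemma shift_shift: "a \<noteq> b \<Longrightarrow> 1 \<le> t b \<Longrightarrow> shift b a (shift a b t) = t"
  by (auto simp: shift_def)

lemma mv_in_Mat:
  assumes G: "G \<in> Mat n H s t" and ab: "a < n" "b < n" "a \<noteq> b" and i: "i \<in> drows H b a {..<n} G"
  shows "mv b a i G \<in> Mat n H s (shift a b t)"
proof -
  have sub: "G \<subseteq> {..<n} \<times> {..<n} - H" using G by (simp add: Mat_def)
  have sub': "G \<subseteq> {..<n} \<times> {..<n}" using sub by blast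
  have iP: "(i,b) \<notin> H" "(i,a) \<notin> H" "(i,b) \<in> G" "(i,a) \<notin> G" "i < n" using i by (auto simp: drows_def)
  have "outdeg (mv b a i G) k = outdeg G k" for k
  proof -
    have "{l. (k,l) \<in> mv b a i G} = (if k = i then insert a ({l. (k,l) \<in> G} - {b}) else {l. (k,l) \<in> G})"
      using ab by (auto simp: mv_def)
    moreover have "card (insert a ({l. (i,l) \<in> G} - {b})) = card {l. (i,l) \<in> G}"
      using iP finite_row[OF sub'] by (intro card_insert_Diff) auto
    ultimately show ?thesis by (simp add: outdeg_def)
  qed
  moreover have "indeg (mv b a i G) k = shift a b (indeg G) k" for k
  proof -
    have "{l. (l,k) \<in> mv b a i G} = (if k = a then insert i {l. (l,k) \<in> G} else if k = b then {l. (l,k) \<in> G} - {i} else {l. (l,k) \<in> G})"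
      using ab by (auto simp: mv_def)
    then show ?thesis using ab iP finite_col[OF sub'] by (simp add: indeg_def shift_def)
  qed
  moreover have "mv b a i G \<subseteq> {..<n} \<times> {..<n} - H" using sub iP ab by (auto simp: mv_def)
  ultimately show ?thesis using G ab by (simp add: Mat_def shift_def)
qed

lemma mv_mv: "a \<noteq> b \<Longrightarrow> i \<in> drows H b a J G \<Longrightarrow> mv a b i (mv b a i G) = G"
  by (auto simp: mv_def drows_def)

lemma drows_mv: "a \<noteq> b \<Longrightarrow> i \<in> drows H b a J G \<Longrightarrow> drows H a b J (mv b a i G) = insert i (drows H a b J G)"
  by (auto simp: mv_def drows_def)

text \<open>Double counting of matrices with a marked moved row. If row \<open>i\<close> of
  \<open>G\<close> is moved, the target has U + 1 rows that can be moved back. Weight 1 / (U + 1)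
  therefore gives every target total weight one, apart from the targets that admit no backward
  move.\<close>

lemma single_move_sum:
  assumes ab: "a < n" "b < n" "a \<noteq> b" and tb: "1 \<le> t b"
  shows "(\<Sum>G\<in>Mat n H s t. real (card (drows H b a {..<n} G)) / (real (card (drows H a b {..<n} G)) + 1))
    = real (card {G\<in>Mat n H s (shift a b t). drows H a b {..<n} G \<noteq> {}})"
proof -
  let ?M = "Mat n H s t" and ?M' = "Mat n H s (shift a b t)" and ?U = "drows H a b {..<n}" and ?V = "drows H b a {..<n}"
  have fin: "finite (drows H x y {..<n} G)" for x y G by (simp add: drows_def)
  have "(\<Sum>G\<in>?M. real (card (?V G)) / (real (card (?U G)) + 1)) = (\<Sum>G\<in>?M. \<Sum>i\<in>?V G. 1 / (real (card (?U G)) + 1))" by simp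
  also have "\<dots> = (\<Sum>(G,i)\<in>(SIGMA G:?M. ?V G). 1 / (real (card (?U G)) + 1))"
    using fin finite_Mat by (subst sum.Sigma) auto
  also have "\<dots> = (\<Sum>(G,i)\<in>(SIGMA G:?M'. ?U G). 1 / real (card (?U G)))"
  proof (rule sum.reindex_bij_witness[where j = "\<lambda>(G,i). (mv b a i G, i)" and i = "\<lambda>(G,i). (mv a b i G, i)"], goal_cases)
    case (1 x) then show ?case using ab mv_mv by auto
  next
    case (2 x) then show ?case using ab mv_in_Mat[of _ n H s t a b] drows_mv by fastforce
  next
    case (3 x) then show ?case using ab mv_mv by auto
  next
    case (4 x)
    then obtain G i where x: "x = (G,i)" "G \<in> ?M'" "i \<in> ?U G" by auto
    have "mv a b i G \<in> Mat n H s (shift b a (shift a b t))" using x ab by (intro mv_in_Mat) auto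
    moreover have "i \<in> ?V (mv a b i G)" using x ab by (simp add: drows_mv)
    ultimately show ?case using x ab tb by (simp add: shift_shift)
  next
    case (5 x)
    then obtain G i where x: "x = (G,i)" "G \<in> ?M" "i \<in> ?V G" by auto
    have "i \<notin> ?U G" using x by (auto simp: drows_def)
    then show ?case using x ab fin by (simp add: drows_mv)
  qed
  also have "\<dots> = (\<Sum>G\<in>?M'. \<Sum>i\<in>?U G. 1 / real (card (?U G)))"
    using fin finite_Mat by (subst sum.Sigma) auto
  also have "\<dots> = (\<Sum>G\<in>?M'. of_bool (?U G \<noteq> {}))"
    using fin by (intro sum.cong) auto
  finally show ?thesis using finite_Mat by (simp add: of_bool_def sum.If_cases Int_def)
qed

context host
begin

lemma Rval_le: "Rval n s / n^2 \<le> 4 * z^2" "0 \<le> Rval n s / n^2"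
proof -
  have "Rval n s \<le> (\<Sum>j<n. (2 * (z * r))\<^sup>2)" unfolding Rval_def
  proof (rule sum_mono)
    fix j assume "j \<in> {..<n}"
    then have j: "j < n" by simp
    have "L * real (outdeg H j) \<le> 1 * (z * r)" using L01 out_le[OF j] by (intro mult_mono) auto
    moreover have "0 \<le> L * real (outdeg H j)" using L01 by simp
    ultimately have "\<bar>real (s j) - avg_deg n s\<bar> \<le> 2 * (z * r)" using delta_le[OF j] unfolding delta_def by linarith
    then show "(real (s j) - avg_deg n s)\<^sup>2 \<le> (2 * (z * r))\<^sup>2" by (rule abs_le_square_iff[THEN iffD1, OF order_trans]) simp
  qed
  also have "\<dots> = 4 * z^2 * n^2" by (simp add: power_mult_distrib) (simp add: power2_eq_square)
  finally show "Rval n s / n^2 \<le> 4 * z^2" using n_pos by (simp add: divide_le_eq)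
  show "0 \<le> Rval n s / n^2" by (simp add: Rval_def sum_nonneg)
qed

end

context margins
begin

section \<open>The ratio for one move\<close>

text \<open>The increment of \<open>Yval\<close> under the move: rows forbidden in both columns
  contribute to both sums of delta and cancel.\<close>

definition DH :: "nat \<Rightarrow> nat \<Rightarrow> real" where "DH a b = (\<Sum>i\<in>hs a b. dl i) - (\<Sum>i\<in>hs b a. dl i)"
definition hc :: "nat \<Rightarrow> nat \<Rightarrow> real" where "hc a b = real (card {i. (i,a) \<in> H \<and> (i,b) \<in> H})"

lemma finite_hc: "finite {i. (i,a) \<in> H \<and> (i,b) \<in> H}"
  by (rule finite_subset[OF _ finite_H_col[of a]]) auto

lemma hc_sym: "hc b a = hc a b" unfolding hc_def by (rule arg_cong[where f = "\<lambda>S. real (card S)"]) auto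

lemma indeg_hs: "real (indeg H a) = real (card (hs a b)) + hc a b"
proof -
  have "{i. (i,a) \<in> H} = hs a b \<union> {i. (i,a) \<in> H \<and> (i,b) \<in> H}" by (auto simp: hs_def)
  moreover have "card (hs a b \<union> {i. (i,a) \<in> H \<and> (i,b) \<in> H}) = card (hs a b) + card {i. (i,a) \<in> H \<and> (i,b) \<in> H}"
    using finite_hs finite_hc by (intro card_Un_disjoint) (auto simp: hs_def)
  ultimately have "indeg H a = card (hs a b) + card {i. (i,a) \<in> H \<and> (i,b) \<in> H}" unfolding indeg_def by (rule trans[OF arg_cong[of _ _ card]])
  then show ?thesis by (simp add: hc_def)
qed

lemma card_bad_hs: "real (card (bad a b)) = real (indeg H a) + real (indeg H b) - hc a b"
  using sum_bad[of "\<lambda>_. 1::real" a b] indeg_hs[of a b] indeg_hs[of b a] hc_sym[of a b] unfolding hc_def by simp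

lemma sum_hs_dl: "\<bar>\<Sum>i\<in>hs a b. dl i\<bar> \<le> real (indeg H a) * (z * r)"
proof -
  have "\<bar>\<Sum>i\<in>hs a b. dl i\<bar> \<le> (\<Sum>i\<in>hs a b. z * r)" using hs_sub delta_le by (intro order_trans[OF sum_abs] sum_mono) auto
  also have "\<dots> \<le> real (indeg H a) * (z * r)" using card_hs z_pos by (simp add: mult_right_mono)
  finally show ?thesis .
qed

lemma ratio_point_inst:
  assumes ab: "a < n" "b < n"
  shows "ratio_point z (1 / r) ((1 + yy a b) / n) L (et a / n) (et b / n) (real (indeg H a) / n) (real (indeg H b) / n)
    (hc a b / n) (DH a b / n^2) (Rval n s / n^2)"
proof
  show "z \<ge> 100" by (rule z_ge)
  show "0 < 1 / r" using r_pos by simp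
  show "z ^ 30 * (1 / r) \<le> 1" using z_le_r[of 30] r_pos by (simp add: divide_le_eq)
  have "(1 / r)\<^sup>2 = 1 / n" by (simp add: power_divide)
  then show "(1 / r)\<^sup>2 \<le> (1 + yy a b) / n" using yy_nonneg[of a b] n_pos by (simp add: divide_right_mono)
  show "0 < L" "L < 1" by (rule L01)+
  show "1 / z \<le> L * (1 - L)" by (rule v_ge)
  show "\<bar>et a / n\<bar> \<le> z * (1 / r)" "\<bar>et b / n\<bar> \<le> z * (1 / r)" using et_n ab by auto
  have in': "real (indeg H k) / n \<le> z * (1 / r)" if "k < n" for k
    using divide_right_mono[OF in_le[OF that], of n] zr_n by simp
  show "real (indeg H a) / n \<le> z * (1 / r)" "real (indeg H b) / n \<le> z * (1 / r)" using in' ab by auto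
  show "0 \<le> real (indeg H a) / n" "0 \<le> real (indeg H b) / n" by auto
  show "0 \<le> hc a b / n" by (simp add: hc_def)
  show "hc a b / n \<le> real (indeg H a) / n" "hc a b / n \<le> real (indeg H b) / n"
    using indeg_hs[of a b] indeg_hs[of b a] hc_sym[of a b] by (auto intro!: divide_right_mono)
  show "real (indeg H a) / n + real (indeg H b) / n \<le> (1 + yy a b) / n" by (simp add: yy_def add_divide_distrib)
  have "\<bar>DH a b\<bar> \<le> real (indeg H a) * (z * r) + real (indeg H b) * (z * r)" unfolding DH_def
    by (intro abs_diff_le sum_hs_dl)
  then have "\<bar>DH a b\<bar> / n^2 \<le> (real (indeg H a) * (z * r) + real (indeg H b) * (z * r)) / n^2" by (rule divide_right_mono) simp
  also have "\<dots> = (real (indeg H a) / n + real (indeg H b) / n) * (z * r / n)" using n_pos by (simp add: field_simps power2_eq_square)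
  finally show "\<bar>DH a b / n^2\<bar> \<le> (real (indeg H a) / n + real (indeg H b) / n) * (z * (1 / r))" unfolding zr_n by simp
  show "0 \<le> Rval n s / n^2" "Rval n s / n^2 \<le> 4 * z^2" by (rule Rval_le)+
qed

text \<open>The quotient of the target function after and before the move in closed form, as
  \<open>FF_shift\<close> confirms: two binomial quotients and the increment of the
  exponent.\<close>

definition Phi :: "nat \<Rightarrow> nat \<Rightarrow> real" where
  "Phi a b = (real n - indeg H a - t a) * t b / ((t a + 1) * (real n - indeg H b - t b + 1))
    * exp ((1 - Rval n s / (v * n^2)) * (real (t a) - t b + 1) / (v * n^2) - DH a b / (v * n^2))"

lemma et_t: "et k = t k - n * L + L * indeg H k" by (simp add: eta_def avg_L)

lemma u0_ge: assumes ab: "a < n" "b < n" shows "n / (2 * z) \<le> u0 a b"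
proof -
  interpret rp: ratio_point z "1 / r" "(1 + yy a b) / n" L "et a / n" "et b / n" "real (indeg H a) / n" "real (indeg H b) / n"
    "hc a b / n" "DH a b / n^2" "Rval n s / n^2" by (rule ratio_point_inst[OF ab])
  have "u0 a b = n * rp.U0" unfolding u0_def rp.U0_def rp.P_def rp.q_def rp.v_def card_bad_hs
    using n_pos by (simp add: power_divide field_simps)
  then show ?thesis using mult_left_mono[OF rp.U0_ge, of n] by simp
qed

text \<open>Exactly, V = (U + 1) + \<tau> - ee with \<tau> = eta_b - eta_a - 1, and U + 1 = u0 + uu.
  Expanding 1 / (U + 1) at \<open>u0\<close> to second order leaves the moments of \<open>uu\<close>
  and \<open>ee\<close> treated above; the deterministic comparison with \<open>Phi\<close> is
  \<open>ratio_point_main\<close>.\<close>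

lemma EE_ratio:
  assumes ab: "a < n" "b < n" "a \<noteq> b"
  shows "\<bar>EE (\<lambda>G. real (card (drows H b a {..<n} G)) / (real (card (drows H a b {..<n} G)) + 1)) - Phi a b\<bar> \<le> z ^ 40 / n^2 * (1 + yy a b)"
    "1 / 2 \<le> Phi a b"
proof -
  interpret rp: ratio_point z "1 / r" "(1 + yy a b) / n" L "et a / n" "et b / n" "real (indeg H a) / n" "real (indeg H b) / n"
    "hc a b / n" "DH a b / n^2" "Rval n s / n^2" by (rule ratio_point_inst[OF ab(1,2)])
  have e2: "(1 / r)\<^sup>2 = 1 / n" by (simp add: power_divide)
  have np: "real n > 0" using n_pos by simp
  define \<tau> where "\<tau> = et b - et a - 1"
  define w where "w = 1 / rp.U0"
  define c where "c = w / n"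
  have u0: "u0 a b = n * rp.U0" unfolding u0_def rp.U0_def rp.P_def rp.q_def rp.v_def card_bad_hs
    using n_pos by (simp add: power_divide field_simps)
  have cu: "c * u0 a b = 1" using rp.pos np by (simp add: c_def w_def u0)
  have \<tau>T: "\<tau> = n * rp.T" using np by (simp add: \<tau>_def rp.T_def e2 field_simps)
  have Phi_eq: "Phi a b = (1 + rp.om) * rp.gg * exp rp.expo"
  proof -
    have 1: "(1 - real (indeg H a) / n) * (1 - L) - et a / n = (real n - indeg H a - t a) / n"
      "(1 - real (indeg H b) / n) * L + et b / n = t b / n"
      "rp.X1 + (1 / r)\<^sup>2 = (t a + 1) / n" "rp.X2 + (1 / r)\<^sup>2 = (real n - indeg H b - t b + 1) / n"
      using np unfolding rp.X1_def rp.X2_def e2 by (simp_all add: et_t field_simps)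
    have 2: "rp.expo = (1 - Rval n s / (v * n^2)) * (real (t a) - t b + 1) / (v * n^2) - DH a b / (v * n^2)"
    proof -
      have "(1 / r)\<^sup>2 * (et a / n - et b / n - L * (real (indeg H a) / n - real (indeg H b) / n) + (1 / r)\<^sup>2) = (real (t a) - t b + 1) / n^2"
        using np unfolding e2 by (simp add: et_t field_simps power2_eq_square)
      then show ?thesis unfolding rp.expo_def by (simp add: rp.v_def mult.commute)
    qed
    show ?thesis unfolding rp.Gr_eq 1 2 Phi_def using np by simp
  qed
  show "1 / 2 \<le> Phi a b" unfolding Phi_eq by (rule rp.Phi_ge)
  let ?U = "\<lambda>G. real (card (drows H a b {..<n} G))" and ?V = "\<lambda>G. real (card (drows H b a {..<n} G))"
  let ?d = "uu a b" and ?e = "ee a b"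
  \<comment> \<open>The exact remainder of the geometric expansion of 1 / (u0 + uu) after the
    quadratic term; \<open>c\<close> is the inverse of \<open>u0\<close>.\<close>
  let ?rem = "\<lambda>G. (\<tau> - ?e G) * (?d G) ^ 3 * c ^ 3 / (?U G + 1)"
  have pt: "?V G / (?U G + 1) = 1 + \<tau> * c - ?e G * c - \<tau> * c^2 * ?d G + \<tau> * c ^ 3 * (?d G)\<^sup>2 + (?e G * ?d G) * c^2 - (?e G * (?d G)\<^sup>2) * c ^ 3 - ?rem G"
    if G: "G \<in> M" for G
  proof -
    have "?V G - ?U G = et b - et a - ?e G" using sg_eq[OF G ab(2,1)] unfolding sg_def bad_E1 ee_def .
    then have V: "?V G = (?U G + 1) + (\<tau> - ?e G)" by (simp add: \<tau>_def)
    have id: "(u + x) / u = 1 + x * (c - d * c^2 + d^2 * c ^ 3) - x * d ^ 3 * c ^ 3 / u" if "c * u' = 1" "u = u' + d" "u > 0" for u u' x d :: real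
    proof -
      have "u + x = u + x * ((c - d * c^2 + d^2 * c ^ 3) * u - d ^ 3 * c ^ 3)" using that(1) unfolding that(2) by algebra
      then have "(u + x) / u = (u * (1 + x * (c - d * c^2 + d^2 * c ^ 3)) - x * d ^ 3 * c ^ 3) / u" by (simp add: algebra_simps)
      then show ?thesis using that(3) by (simp add: diff_divide_distrib)
    qed
    have "?V G / (?U G + 1) = 1 + (\<tau> - ?e G) * (c - ?d G * c^2 + (?d G)\<^sup>2 * c ^ 3) - ?rem G"
      unfolding V by (rule id[OF cu]) (auto simp: uu_def)
    then show ?thesis by (simp add: algebra_simps)
  qed
  have "EE (\<lambda>G. ?V G / (?U G + 1)) = EE (\<lambda>G. 1 + \<tau> * c - ?e G * c - \<tau> * c^2 * ?d G + \<tau> * c ^ 3 * (?d G)\<^sup>2 + (?e G * ?d G) * c^2 - (?e G * (?d G)\<^sup>2) * c ^ 3 - ?rem G)"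
    by (rule EE_cong[OF pt])
  then have EEeq: "EE (\<lambda>G. ?V G / (?U G + 1)) = 1 + \<tau> * c - EE ?e * c - \<tau> * c^2 * EE ?d + \<tau> * c ^ 3 * EE (\<lambda>G. (?d G)\<^sup>2)
     + EE (\<lambda>G. ?e G * ?d G) * c^2 - EE (\<lambda>G. ?e G * (?d G)\<^sup>2) * c ^ 3 - EE ?rem"
    by (simp only: EE_diff EE_add EE_cmult EE_cmult2 EE_const)
  \<comment> \<open>Compares the expanded mean with its idealised form, in which the mean of
    \<open>ee\<close> becomes N eb, that of the square of \<open>uu\<close> becomes N v^2, and the
    other moments vanish. Each difference is a separate term.\<close>
  have id: "(1 + (N * T) * (w / N) - ea * (w / N) - (N * T) * (w / N)\<^sup>2 * ed + (N * T) * (w / N) ^ 3 * edd + eed * (w / N)\<^sup>2 - eedd * (w / N) ^ 3 - er)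
     - (1 + (T - eb) * w + T * v'\<^sup>2 * (1 / N) * w ^ 3)
    = - ((ea - N * eb) / N * w) - T * (ed / N) * w * w + T * ((edd - N * v'\<^sup>2) / N^2) * w * w * w + eed / N^2 * w * w - eedd / N ^ 3 * w * w * w - er"
    if "N > 0" for N T w ea ed edd eed eedd er eb v' :: real
    using that by (simp add: field_simps power2_eq_square power3_eq_cube)
  have Sw: "rp.S 2 0 w" unfolding w_def by (rule rp.SiU0)
  have Yn: "0 \<le> (1 + yy a b) / n" using yy_nonneg[of a b] by simp
  have t1: "rp.SY 14 2 (- ((EE ?e - n * rp.eb) / n * w))"
  proof -
    have "n * rp.eb = ((\<Sum>i\<in>hs a b. dl i) - (\<Sum>i\<in>hs b a. dl i) + real (card (hs a b)) * et b - real (card (hs b a)) * et a) / n"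
      unfolding rp.eb_def unfolding DH_def indeg_hs[of a b] indeg_hs[of b a] hc_sym[of a b] using np by (simp add: field_simps power2_eq_square)
    then have "\<bar>EE ?e - n * rp.eb\<bar> \<le> z ^ 12 / n * yy a b" using ee_mean[OF ab(1,2)] by simp
    also have "\<dots> \<le> z ^ 12 / n * (1 + yy a b)" using z_pos by (intro mult_left_mono) auto
    finally have "\<bar>EE ?e - n * rp.eb\<bar> / n \<le> z ^ 12 / n * (1 + yy a b) / n" by (rule divide_right_mono) simp
    then have "rp.SY 12 2 ((EE ?e - n * rp.eb) / n)" unfolding rp.SY_def e2 by simp
    from rp.SY_minus[OF rp.SY_multL[OF this Sw]] show ?thesis by simp
  qed
  have t2: "rp.SY 21 2 (rp.T * (EE ?d / n) * w * w)"
  proof -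
    have "\<bar>EE ?d\<bar> / n \<le> z ^ 14 / r * (1 + yy a b) / n" by (rule divide_right_mono[OF uu_mean[OF ab]]) simp
    then have "rp.SY 14 1 (EE ?d / n)" unfolding rp.SY_def by simp
    from rp.SY_multL[OF rp.SY_multL[OF rp.SY_multR[OF rp.ST this] Sw] Sw] show ?thesis by (rule rp.SY_weaken) auto
  qed
  have r3: "r / n^2 = (1 / r) ^ 3"
  proof -
    have "r / (r * r)\<^sup>2 = (1 / r) ^ 3" using r_pos by (simp add: field_simps power2_eq_square power3_eq_cube del: real_sqrt_mult_self)
    then show ?thesis by simp
  qed
  have t3: "rp.SY 21 2 (rp.T * ((EE (\<lambda>G. (?d G)\<^sup>2) - n * v^2) / n^2) * w * w * w)"
  proof -
    have "\<bar>EE (\<lambda>G. (?d G)\<^sup>2) - n * v^2\<bar> / n^2 \<le> z ^ 12 * r / n^2" by (rule divide_right_mono[OF uu_second[OF ab]]) simp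
    then have "\<bar>EE (\<lambda>G. (?d G)\<^sup>2) - n * v^2\<bar> / n^2 \<le> z ^ 12 * (1 / r) ^ 3" unfolding r3[symmetric] by simp
    then have "rp.S 12 3 ((EE (\<lambda>G. (?d G)\<^sup>2) - n * v^2) / n^2)" unfolding rp.S_def by simp
    from rp.S_mult[OF rp.S_mult[OF rp.S_mult[OF rp.S_mult[OF rp.ST this] Sw] Sw] Sw]
    show ?thesis by (intro rp.S_SY'[of 21 4]) auto
  qed
  have e2n: "(1 / r)\<^sup>2 * ((1 + yy a b) / n) = (1 + yy a b) / n^2" unfolding e2 by (simp add: power2_eq_square)
  have t4: "rp.SY 14 2 (EE (\<lambda>G. ?e G * ?d G) / n^2 * w * w)"
  proof -
    have "\<bar>EE (\<lambda>G. ?e G * ?d G)\<bar> / n^2 \<le> z ^ 10 * (1 + yy a b) / n^2" by (rule divide_right_mono[OF ee_uu[OF ab]]) simp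
    then have "rp.SY 10 2 (EE (\<lambda>G. ?e G * ?d G) / n^2)" unfolding rp.SY_def mult.assoc e2n by simp
    from rp.SY_multL[OF rp.SY_multL[OF this Sw] Sw] show ?thesis by simp
  qed
  have t5: "rp.SY 7 2 (EE (\<lambda>G. ?e G * (?d G)\<^sup>2) / n ^ 3 * w * w * w)"
  proof -
    have "\<bar>EE (\<lambda>G. ?e G * (?d G)\<^sup>2)\<bar> \<le> EE (\<lambda>G. \<bar>?e G * (?d G)\<^sup>2\<bar>)" by (rule EE_abs)
    also have "\<dots> \<le> EE (\<lambda>G. yy a b * (?d G)\<^sup>2)" by (rule EE_mono) (auto simp: abs_mult intro!: mult_right_mono ee_le)
    also have "\<dots> = yy a b * EE (\<lambda>G. (?d G)\<^sup>2)" by (rule EE_cmult)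
    also have "\<dots> \<le> yy a b * (2 * real n)"
    proof (rule mult_left_mono[OF _ yy_nonneg])
      have "z ^ 12 * r \<le> r * r" using z_le_r[of 12] r_pos by (intro mult_right_mono) auto
      moreover have "real n * v^2 \<le> real n * 1" using v_pos v_le by (intro mult_left_mono power_le_one) auto
      ultimately show "EE (\<lambda>G. (?d G)\<^sup>2) \<le> 2 * real n" using uu_second[OF ab] by simp
    qed
    also have "\<dots> \<le> (1 + yy a b) * (z * real n)" using z_ge yy_nonneg[of a b] by (intro mult_mono) auto
    finally have "\<bar>EE (\<lambda>G. ?e G * (?d G)\<^sup>2)\<bar> / n ^ 3 \<le> (1 + yy a b) * (z * real n) / n ^ 3" by (rule divide_right_mono) simp
    also have "\<dots> = z ^ 1 * ((1 / r)\<^sup>2 * ((1 + yy a b) / n))" unfolding e2n using np by (simp add: field_simps power2_eq_square power3_eq_cube)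
    finally have "rp.SY 1 2 (EE (\<lambda>G. ?e G * (?d G)\<^sup>2) / n ^ 3)" unfolding rp.SY_def by (simp add: mult.assoc)
    from rp.SY_multL[OF rp.SY_multL[OF rp.SY_multL[OF this Sw] Sw] Sw] show ?thesis by (rule rp.SY_weaken) auto
  qed
  \<comment> \<open>With high probability |uu| \<le> z^3 r, and the cubic remainder is then of order
    z^14 / n^2. On the exceptional event |uu| \<le> 13 n keeps it below n^6.\<close>
  have t6: "rp.SY 22 2 (EE ?rem)"
  proof -
    have "1 / (r * r)\<^sup>2 = (1 / r) ^ 4" by (simp add: field_simps eval_nat_numeral del: real_sqrt_mult_self)
    then have r4: "1 / n^2 = (1 / r) ^ 4" by simp
    have c: "0 \<le> c" "c \<le> 2 * z / n" using rp.U0_ge rp.pos z_pos np by (simp_all add: c_def w_def field_simps)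
    have c1: "c \<le> 1"
    proof -
      have "2 * z \<le> z * z" using z_ge by (intro mult_right_mono) auto
      also have "\<dots> \<le> r" using z_le_r[of 2] by (simp add: power2_eq_square)
      also have "\<dots> \<le> n" by (rule r_le_n)
      finally have "2 * z / n \<le> 1" using np by simp
      then show ?thesis using c by linarith
    qed
    have \<tau>e: "\<bar>\<tau> - ?e G\<bar> \<le> 5 * (z * r)" for G
      using ee_le[of a b G] yy_le[OF ab(1,2)] eta_le[OF ab(1)] eta_le[OF ab(2)] zkr[of 1] unfolding \<tau>_def power_one_right by linarith
    have U1: "1 \<le> ?U G + 1" for G by simp
    have "\<bar>EE ?rem\<bar> \<le> z ^ 21 * (1 / r) ^ 4 + 1 / real n ^ 3"
    proof (rule EE_bound_hp[OF uu_hp[OF ab]])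
      show "3 \<le> real n" using n_ge by linarith
      fix G assume G: "G \<in> M"
      { assume d: "\<bar>?d G\<bar> \<le> z ^ 3 * r"
        have u: "n / (4 * z) \<le> ?U G + 1"
        proof -
          have "n / (2 * z) \<le> u0 a b" by (rule u0_ge[OF ab(1,2)])
          moreover have "z ^ 3 * r \<le> n / (4 * z)"
          proof -
            have "4 * (z ^ 4 * r) \<le> z ^ 5 * r" using absorb[of r 4 4] r_pos by (simp add: eval_nat_numeral)
            also have "\<dots> \<le> r * r" using z_le_r[of 5] r_pos by (intro mult_right_mono) auto
            finally show ?thesis using z_pos by (simp add: field_simps eval_nat_numeral)
          qed
          moreover have "n / (2 * z) = n / (4 * z) + n / (4 * z)" by (simp add: field_simps)
          moreover have "?U G + 1 = u0 a b + ?d G" by (simp add: uu_def)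
          ultimately show ?thesis using d by linarith
        qed
        have "\<bar>?rem G\<bar> \<le> 5 * (z * r) * (z ^ 3 * r) ^ 3 * (2 * z / n) ^ 3 / (n / (4 * z))"
          using c d np z_pos u \<tau>e unfolding power_abs[symmetric]
          by (intro abs_divide_le abs_mult_le) (auto simp: power_abs intro!: power_mono)
        also have "\<dots> = 160 * (z ^ 14 * (r * r * (r * r)) / (n ^ 4))" using np z_pos by (simp add: field_simps eval_nat_numeral del: real_sqrt_mult_self)
        also have "\<dots> = 160 * (z ^ 14 * (1 / n^2))" using np by (simp add: field_simps eval_nat_numeral)
        also have "\<dots> \<le> z ^ 21 * (1 / n^2)"
        proof -
          have "160 * z ^ 14 \<le> z ^ 7 * z ^ 14"
          proof (rule mult_right_mono)
            have "z ^ 2 \<le> z ^ 7" using z_ge by (intro power_increasing) auto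
            moreover have "160 \<le> z ^ 2" using mult_mono[OF z_ge z_ge] z_pos by (simp add: power2_eq_square)
            ultimately show "160 \<le> z ^ 7" by linarith
          qed (use z_pos in auto)
          then have "160 * z ^ 14 * (1 / n^2) \<le> z ^ 7 * z ^ 14 * (1 / n^2)" by (rule mult_right_mono) simp
          then show ?thesis by (simp flip: power_add)
        qed
        finally show "\<bar>?rem G\<bar> \<le> z ^ 21 * (1 / r) ^ 4" unfolding r4 . }
      have "\<bar>(?d G) ^ 3\<bar> \<le> (13 * real n) ^ 3" unfolding power_abs using uu_all[OF ab(1,2) G] by (rule power_mono) simp
      then have "\<bar>?rem G\<bar> \<le> 5 * (z * r) * (13 * real n) ^ 3 * 1 / 1"
        using c c1 U1 \<tau>e by (intro abs_divide_le abs_mult_le) (auto simp: power_abs intro!: power_le_one)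
      also have "\<dots> \<le> 5 * real n * (13 * real n) ^ 3 * 1 / 1"
      proof -
        have "z * r \<le> r * r" using z_le_r[of 1] r_pos by (intro mult_right_mono) auto
        then have "z * r \<le> n" by simp
        then show ?thesis by (intro divide_right_mono mult_right_mono mult_left_mono) auto
      qed
      also have "\<dots> = 10985 * real n ^ 4" by (simp add: eval_nat_numeral)
      also have "\<dots> \<le> real n ^ 2 * real n ^ 4"
      proof (rule mult_right_mono)
        have "10000 * 10000 \<le> real n * real n" by (intro mult_mono n_ge) auto
        then show "10985 \<le> real n ^ 2" by (simp add: power2_eq_square)
      qed auto
      finally show "\<bar>?rem G\<bar> \<le> real n ^ 6" by (simp flip: power_add)
    qed (use z_pos in auto)
    moreover have "1 / real n ^ 3 \<le> z ^ 21 * (1 / r) ^ 4"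
    proof -
      have "1 / real n ^ 3 \<le> 1 / n^2" using n_ge by (intro divide_left_mono power_increasing) auto
      also have "\<dots> = 1 * (1 / r) ^ 4" using r4 by simp
      also have "\<dots> \<le> z ^ 21 * (1 / r) ^ 4" by (intro mult_right_mono z1) auto
      finally show ?thesis .
    qed
    moreover have "2 * (z ^ 21 * (1 / r) ^ 4) \<le> z ^ 22 * (1 / r) ^ 4" using absorb[of "(1 / r) ^ 4" 2 21] by simp
    ultimately have "rp.S 22 4 (EE ?rem)" unfolding rp.S_def by linarith
    then show ?thesis by (rule rp.S_SY') simp
  qed
  have E1: "rp.SY 30 2 (EE (\<lambda>G. ?V G / (?U G + 1)) - (1 + (rp.T - rp.eb) / rp.U0 + rp.T * v^2 * (1 / r)\<^sup>2 / rp.U0 ^ 3))"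
  proof -
    have "EE (\<lambda>G. ?V G / (?U G + 1)) - (1 + (rp.T - rp.eb) * w + rp.T * v^2 * (1 / n) * w ^ 3)
      = - ((EE ?e - n * rp.eb) / n * w) - rp.T * (EE ?d / n) * w * w + rp.T * ((EE (\<lambda>G. (?d G)\<^sup>2) - n * v^2) / n^2) * w * w * w
        + EE (\<lambda>G. ?e G * ?d G) / n^2 * w * w - EE (\<lambda>G. ?e G * (?d G)\<^sup>2) / n ^ 3 * w * w * w - EE ?rem"
      unfolding EEeq unfolding c_def unfolding \<tau>T of_nat_power by (rule id[OF np])
    moreover have "rp.SY 30 2 \<dots>"
      by (rule rp.SY_weaken[OF rp.SY_diff[OF rp.SY_diff[OF rp.SY_add[OF rp.SY_add[OF rp.SY_diff[OF t1 t2] t3] t4] t5] t6]]) auto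
    ultimately show ?thesis unfolding e2 by (simp add: w_def power_divide)
  qed
  have "rp.SY 40 2 ((EE (\<lambda>G. ?V G / (?U G + 1)) - (1 + (rp.T - rp.eb) / rp.U0 + rp.T * v^2 * (1 / r)\<^sup>2 / rp.U0 ^ 3)) + (1 + (rp.T - rp.eb) / rp.U0 + rp.T * v^2 * (1 / r)\<^sup>2 / rp.U0 ^ 3 - Phi a b))"
    unfolding Phi_eq by (rule rp.SY_weaken[OF rp.SY_add[OF E1 rp.ratio_point_main[unfolded rp.v_def]]]) auto
  then have "\<bar>EE (\<lambda>G. ?V G / (?U G + 1)) - Phi a b\<bar> \<le> z ^ 40 * ((1 / r)\<^sup>2 * ((1 + yy a b) / n))" unfolding rp.SY_def by (simp add: mult.assoc)
  then show "\<bar>EE (\<lambda>G. ?V G / (?U G + 1)) - Phi a b\<bar> \<le> z ^ 40 / n^2 * (1 + yy a b)" unfolding e2n by simp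
qed

end

context host
begin

section \<open>The target function and its behaviour under a move\<close>

text \<open>Counts the sets of allowed cells with column sums \<open>t\<close> when nothing is
  imposed on the rows; see \<open>count_OmU\<close>.\<close>

definition wt :: "(nat \<Rightarrow> nat) \<Rightarrow> real" where
  "wt t = (\<Prod>k<n. real ((n - indeg H k) choose t k))"

text \<open>The exponent of the theorem, with v = 2A. As \<open>H\<close> contains the diagonal
  here, \<open>Yval\<close> already accounts for the sum of (s_j - s) (t_j - s), up to the error
  bounded in \<open>Yval_dg\<close>.\<close>

definition Bt :: "(nat \<Rightarrow> nat) \<Rightarrow> real" where
  "Bt t = - (1/2) * (1 - Rval n s / (v * n^2)) * (1 - Cval n s t / (v * n^2)) - Yval n s t H / (v * n^2)"

definition FF :: "(nat \<Rightarrow> nat) \<Rightarrow> real" where "FF t = wt t * exp (Bt t)"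

definition bx :: "(nat \<Rightarrow> nat) \<Rightarrow> bool" where
  "bx t \<longleftrightarrow> (\<Sum>j<n. s j) = (\<Sum>j<n. t j) \<and> (\<forall>k<n. \<bar>eta n s t H k\<bar> \<le> z * r)"

text \<open>Both n L and n (1 - L) are at least n / z, whereas z r is at most n / (4 z). Degrees
  therefore stay away from 0 and from the number of allowed cells.\<close>

lemma range_aux:
  fixes x y :: real
  assumes "\<bar>x - n * L + L * y\<bar> \<le> z * r" "0 \<le> y" "y \<le> z * r"
  shows "0 < x" "x + y < n" "y \<le> n / 2"
proof -
  have "4 * (z ^ 2 * r) \<le> z ^ 3 * r" using absorb[of r 4 2] r_pos by (simp add: eval_nat_numeral)
  also have "\<dots> \<le> r * r" using z_le_r[of 3] r_pos by (intro mult_right_mono) auto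
  finally have zr: "z * r \<le> n / (4 * z)" using z_pos by (simp add: field_simps eval_nat_numeral)
  have zr1: "0 < z * r" using z_pos r_pos by simp
  have "n / (4 * z) \<le> real n / 2" using z_ge by (intro divide_left_mono) auto
  then show y: "y \<le> n / 2" using zr assms(3) by linarith
  have "v \<le> L" "v \<le> 1 - L" using L01 mult_mono[of L 1 "1 - L" "1 - L"] mult_mono[of L L "1 - L" 1] by auto
  then have zL: "1 / z \<le> L" "1 / z \<le> 1 - L" using v_ge by linarith+
  have h: "n / (2 * z) \<le> c * (n - y)" if "1 / z \<le> c" for c
  proof -
    have "1 / z * (real n / 2) \<le> c * (n - y)" using that z_pos y by (intro mult_mono) (auto intro: order_trans[OF _ that])
    then show ?thesis by simp
  qed
  have d: "n / (2 * z) = n / (4 * z) + n / (4 * z)" by (simp add: field_simps)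
  show "0 < x" using h[OF zL(1)] assms(1) zr d zr1 unfolding right_diff_distrib by (simp add: mult.commute)
  show "x + y < n" using h[OF zL(2)] assms(1) zr d zr1 unfolding right_diff_distrib left_diff_distrib by (simp add: mult.commute)
qed

lemma bx_range:
  assumes "\<bar>eta n s t H k\<bar> \<le> z * r" "k < n"
  shows "1 \<le> t k" "t k + indeg H k < n"
proof -
  have "\<bar>real (t k) - n * L + L * indeg H k\<bar> \<le> z * r" using assms(1) by (simp add: eta_def avg_L)
  from range_aux[OF this _ in_le[OF assms(2)]] show "1 \<le> t k" "t k + indeg H k < n" by linarith+
qed

lemma FF_pos: assumes "bx t" shows "0 < FF t"
proof -
  have "0 < (n - indeg H k) choose t k" if "k < n" for k
    using bx_range(2)[of t k] assms that by (simp add: bx_def zero_less_binomial_iff) 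
  then show ?thesis unfolding FF_def wt_def by (intro mult_pos_pos prod_pos) auto
qed

text \<open>Grouped by columns, the sum is affine in \<open>t\<close> with coefficients independent
  of \<open>t\<close>. This serves both for the increment under a move and for expectations over
  random column sums.\<close>

lemma Yval_cols: "Yval n s t H = (\<Sum>k<n. (\<Sum>j\<in>{j. (j,k) \<in> H}. dl j) * eta n s t H k)"
proof -
  have "(\<Sum>k<n. (\<Sum>j\<in>{j. (j,k) \<in> H}. dl j) * eta n s t H k) = (\<Sum>k<n. \<Sum>j\<in>{j. (j,k) \<in> H}. dl j * eta n s t H k)"
    by (simp add: sum_distrib_right)
  also have "\<dots> = (\<Sum>(k,j)\<in>(SIGMA k:{..<n}. {j. (j,k) \<in> H}). dl j * eta n s t H k)"
    using finite_H_col by (subst sum.Sigma) auto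
  also have "\<dots> = (\<Sum>(j,k)\<in>H. dl j * eta n s t H k)"
    by (rule sum.reindex_bij_witness[where i = "\<lambda>(k,j). (j,k)" and j = "\<lambda>(k,j). (j,k)"]) (use H_sub in auto)
  finally show ?thesis by (simp add: Yval_def)
qed

end

lemma sum_shift:
  fixes g :: "nat \<Rightarrow> nat \<Rightarrow> real"
  assumes "a < n" "b < n" "a \<noteq> b"
  shows "(\<Sum>k<n. g k (shift a b t k)) = (\<Sum>k<n. g k (t k)) + (g a (Suc (t a)) - g a (t a)) + (g b (t b - 1) - g b (t b))"
proof -
  have "(\<Sum>k<n. g k (shift a b t k)) - (\<Sum>k<n. g k (t k)) = (\<Sum>k<n. g k (shift a b t k) - g k (t k))" by (simp add: sum_subtractf)
  also have "\<dots> = (\<Sum>k\<in>{a,b}. g k (shift a b t k) - g k (t k))"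
    using assms by (intro sum.mono_neutral_right) (auto simp: shift_def)
  finally show ?thesis using assms by (simp add: shift_def)
qed

context margins
begin

text \<open>Only two binomial coefficients change, C grows by 2 (t_a - t_b + 1) and Y by
  \<open>DH a b\<close>, so the quotient is computed exactly.\<close>

lemma FF_shift:
  assumes ab: "a < n" "b < n" "a \<noteq> b"
  shows "FF (shift a b t) = FF t * Phi a b"
proof -
  let ?t = "shift a b t" and ?q = "v * real n ^ 2"
  have rg: "1 \<le> t k" "t k + indeg H k < n" if "k < n" for k using bx_range[OF eta_le[OF that] that] by auto
  have bn: "real (m choose Suc k) = real (m choose k) * ((real m - k) / (k + 1))" if "k \<le> m" for m k
  proof -
    have "Suc k * (m choose Suc k) = (m - k) * (m choose k)" using binomial_absorb_comp[of m k] binomial_absorption[of k "m"] by simp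
    then have "real (Suc k) * real (m choose Suc k) = real (m - k) * real (m choose k)" by (metis of_nat_mult)
    then show ?thesis using that by (simp add: of_nat_diff field_simps)
  qed
  have pos: "0 < real ((n - indeg H k) choose t k)" if "k < n" for k using rg[OF that] by (simp add: zero_less_binomial_iff)
  have "wt ?t / wt t = (\<Prod>k<n. real ((n - indeg H k) choose ?t k) / real ((n - indeg H k) choose t k))" unfolding wt_def prod_dividef ..
  also have "\<dots> = (\<Prod>k\<in>{a,b}. real ((n - indeg H k) choose ?t k) / real ((n - indeg H k) choose t k))"
    using ab pos by (intro prod.mono_neutral_right) (auto simp: shift_def less_le)
  also have "\<dots> = (real ((n - indeg H a) choose Suc (t a)) / real ((n - indeg H a) choose t a)) * (real ((n - indeg H b) choose (t b - 1)) / real ((n - indeg H b) choose t b))"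
    using ab by (simp add: shift_def)
  also have "real ((n - indeg H a) choose Suc (t a)) / real ((n - indeg H a) choose t a) = (real n - indeg H a - t a) / (t a + 1)"
    using pos[OF ab(1)] rg[OF ab(1)] by (subst bn) (auto simp: of_nat_diff)
  also have "real ((n - indeg H b) choose (t b - 1)) / real ((n - indeg H b) choose t b) = t b / (real n - indeg H b - t b + 1)"
  proof -
    have tb: "Suc (t b - 1) = t b" "real (t b - 1) = real (t b) - 1" using rg[OF ab(2)] by (simp_all add: of_nat_diff)
    have m: "real (n - indeg H b) = real n - indeg H b" "real n - indeg H b - t b > 0" using rg[OF ab(2)] by (simp_all add: of_nat_diff)
    have "real ((n - indeg H b) choose t b) = real ((n - indeg H b) choose (t b - 1)) * ((real n - indeg H b - t b + 1) / t b)"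
      using bn[of "t b - 1" "n - indeg H b"] rg[OF ab(2)] unfolding tb m by (simp add: algebra_simps)
    moreover have "real (t b) > 0" using rg[OF ab(2)] by simp
    moreover have "0 < real n - indeg H b - t b + 1" using m by linarith
    moreover have "x / y = c / d" if "y = x * (d / c)" "0 < c" "0 < d" "0 < y" for x y c d :: real using that by (auto simp: field_simps)
    ultimately show ?thesis using pos[OF ab(2)] by blast
  qed
  finally have w: "wt ?t = wt t * ((real n - indeg H a - t a) * t b / ((t a + 1) * (real n - indeg H b - t b + 1)))"
  proof -
    assume *: "wt ?t / wt t = (real n - indeg H a - t a) / (t a + 1) * (t b / (real n - indeg H b - t b + 1))"
    have "wt t > 0" unfolding wt_def using pos by (intro prod_pos) auto
    then have "wt ?t = wt t * (wt ?t / wt t)" by simp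
    then show ?thesis unfolding * by simp
  qed
  have tb: "real (t b - 1) = real (t b) - 1" using rg[OF ab(2)] by (simp add: of_nat_diff)
  have C: "Cval n s ?t = Cval n s t + 2 * (real (t a) - t b + 1)"
    unfolding Cval_def sum_shift[OF ab, of "\<lambda>k x. (real x - avg_deg n s)\<^sup>2"] tb by (simp add: power2_eq_square algebra_simps)
  have Y: "Yval n s ?t H = Yval n s t H + DH a b"
  proof -
    have sp: "(\<Sum>j\<in>{j. (j,c) \<in> H}. dl j) = (\<Sum>j\<in>hs c d. dl j) + (\<Sum>j\<in>{j. (j,c) \<in> H \<and> (j,d) \<in> H}. dl j)" for c d
    proof -
      have "{j. (j,c) \<in> H} = hs c d \<union> {j. (j,c) \<in> H \<and> (j,d) \<in> H}" by (auto simp: hs_def)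
      then show ?thesis using finite_hs finite_hc by (simp add: sum.union_disjoint hs_def disjoint_iff)
    qed
    have cm: "{j. (j,b) \<in> H \<and> (j,a) \<in> H} = {j. (j,a) \<in> H \<and> (j,b) \<in> H}" by auto
    show ?thesis unfolding Yval_cols eta_def DH_def tb
      unfolding sum_shift[OF ab, of "\<lambda>k x. (\<Sum>j\<in>{j. (j,k) \<in> H}. dl j) * (real x - avg_deg n s + L * real (indeg H k))"] tb
      using sp[of a b] sp[of b a] unfolding cm by (simp add: algebra_simps)
  qed
  have "Bt ?t = Bt t + ((1 - Rval n s / ?q) * (real (t a) - t b + 1) / ?q - DH a b / ?q)"
    
  proof -
    have "- (1/2) * x * (1 - (c + 2 * d) / q) - (y + e) / q = - (1/2) * x * (1 - c / q) - y / q + (x * d / q - e / q)" for x c d q y e :: real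
      by (simp add: add_divide_distrib diff_divide_distrib algebra_simps)
    then show ?thesis unfolding Bt_def C Y of_nat_power by blast
  qed
  then have "exp (Bt ?t) = exp (Bt t) * exp ((1 - Rval n s / ?q) * (real (t a) - t b + 1) / ?q - DH a b / ?q)"
    by (simp add: exp_add)
  then show ?thesis unfolding FF_def w Phi_def by (simp add: mult_ac)
qed

text \<open>Matrices without a backward move are exceptional, so the count in
  \<open>single_move_sum\<close> is almost the whole class.\<close>

lemma drows_nonempty:
  assumes ab: "a < n" "b < n" "a \<noteq> b"
  shows "hp 3 (\<lambda>G. drows H a b {..<n} G \<noteq> {})"
proof (rule hp_mono[OF uu_hp[OF ab]])
  fix G assume d: "\<bar>uu a b G\<bar> \<le> z ^ 3 * r"
  have "n / (2 * z) \<le> u0 a b" by (rule u0_ge[OF ab(1,2)])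
  moreover have "z ^ 3 * r + 1 < n / (2 * z)"
  proof -
    have "4 * (z ^ 4 * r) \<le> z ^ 5 * r" using absorb[of r 4 4] r_pos by (simp add: eval_nat_numeral)
    also have "\<dots> \<le> r * r" using z_le_r[of 5] r_pos by (intro mult_right_mono) auto
    finally have "2 * (z ^ 3 * r) \<le> n / (2 * z)" using z_pos by (simp add: field_simps eval_nat_numeral)
    then show ?thesis using zkr[of 3] by linarith
  qed
  ultimately have "real (card (drows H a b {..<n} G)) > 0" using d unfolding uu_def by linarith
  then show "drows H a b {..<n} G \<noteq> {}" by auto
qed simp

end

context host
begin

lemma margins_bx: assumes "bx t" "Mat n H s t \<noteq> {}" shows "margins n H s z t"
proof unfold_locales
  show "(\<Sum>j<n. s j) = (\<Sum>j<n. t j)" "Mat n H s t \<noteq> {}" using assms by (auto simp: bx_def)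
  show "\<bar>eta n s t H k\<bar> \<le> z * r" if "k < n" for k using assms that by (auto simp: bx_def)
qed

section \<open>Chains of moves\<close>

text \<open>A one-sided bound suffices, since the roles of the two vectors can be exchanged along a
  path. If the shifted class is empty the bound is trivial. Otherwise some matrix in it admits a
  backward move, which shows that the original class is nonempty and makes expectations over it
  meaningful.\<close>

lemma step_ratio:
  assumes ab: "a < n" "b < n" "a \<noteq> b" and t: "bx t" and t': "bx (shift a b t)"
  shows "real (card (Mat n H s (shift a b t))) * FF t \<le> real (card (Mat n H s t)) * FF (shift a b t)
    * exp (z ^ 42 / n^2 * (1 + real (indeg H a) + real (indeg H b)))"
proof (cases "Mat n H s (shift a b t) = {}")
  case True
  then show ?thesis using FF_pos[OF t'] by simp
next
  case False
  interpret m': margins n H s z "shift a b t" by (rule margins_bx[OF t' False])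
  let ?N' = "real (card (Mat n H s (shift a b t)))" and ?N = "real (card (Mat n H s t))"
  let ?g = "{G\<in>Mat n H s (shift a b t). drows H a b {..<n} G \<noteq> {}}"
  let ?b = "{G\<in>Mat n H s (shift a b t). \<not> drows H a b {..<n} G \<noteq> {}}"
  \<comment> \<open>The failure probability in \<open>drows_nonempty\<close>.\<close>
  define \<epsilon> where "\<epsilon> = 3 / real n ^ 10"
  have N': "0 < ?N'" by (rule m'.card_M)
  have \<epsilon>: "0 \<le> \<epsilon>" "\<epsilon> \<le> 3 / n^2" "\<epsilon> \<le> 1 / 2"
  proof -
    have "real n ^ 2 \<le> real n ^ 10" using n_ge by (intro power_increasing) auto
    then show 1: "\<epsilon> \<le> 3 / n^2" unfolding \<epsilon>_def of_nat_power using n_pos by (intro divide_left_mono) auto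
    have "real n ^ 1 \<le> real n ^ 2" using n_ge by (intro power_increasing) auto
    then have n2: "10000 \<le> real n ^ 2" using n_ge unfolding power_one_right by linarith
    have "3 / real n ^ 2 \<le> 3 / (10000::real)" using n2 n_pos by (intro divide_left_mono) auto
    then show "\<epsilon> \<le> 1 / 2" using 1 by simp
  qed (simp add: \<epsilon>_def)
  have "real (card ?b) * real n ^ 10 \<le> 3 * ?N'" using m'.drows_nonempty[OF ab] by (simp add: m'.hp_def)
  then have bb: "real (card ?b) \<le> \<epsilon> * ?N'" using n_pos by (simp add: \<epsilon>_def field_simps)
  have "Mat n H s (shift a b t) = ?g \<union> ?b" by auto
  moreover have "card (?g \<union> ?b) = card ?g + card ?b" by (rule card_Un_disjoint) (auto simp: finite_Mat)
  ultimately have "?N' = real (card ?g + card ?b)" by presburger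
  then have "?N' = real (card ?g) + real (card ?b)" by simp
  then have gg: "(1 - \<epsilon>) * ?N' \<le> real (card ?g)" using bb unfolding left_diff_distrib by linarith
  have "0 < (1 - \<epsilon>) * ?N'" using N' \<epsilon>(3) by (intro mult_pos_pos) auto
  then have "0 < real (card ?g)" using gg by linarith
  then have "?g \<noteq> {}" by (metis card.empty less_irrefl of_nat_0)
  then obtain G i where Gi: "G \<in> Mat n H s (shift a b t)" "i \<in> drows H a b {..<n} G" by auto
  have tb: "1 \<le> t b" using bx_range(1) t ab by (auto simp: bx_def)
  have "mv a b i G \<in> Mat n H s (shift b a (shift a b t))" using Gi ab by (intro mv_in_Mat) auto
  then have ne: "Mat n H s t \<noteq> {}" using tb ab by (auto simp: shift_shift)
  interpret m: margins n H s z t by (rule margins_bx[OF t ne])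
  let ?Ph = "m.Phi a b" and ?c = "1 + real (indeg H a) + real (indeg H b)"
  define e where "e = z ^ 40 / n^2 * ?c"
  have e0: "0 \<le> e" using z_pos by (simp add: e_def)
  have "m.EE (\<lambda>G. real (card (drows H b a {..<n} G)) / (real (card (drows H a b {..<n} G)) + 1)) = real (card ?g) / ?N"
    unfolding m.EE_def by (subst single_move_sum[where t = t, OF ab tb]) simp
  then have "real (card ?g) / ?N \<le> ?Ph + e" using m.EE_ratio(1)[OF ab] unfolding e_def m.yy_def by (simp add: add.assoc)
  then have "real (card ?g) \<le> ?N * (?Ph + e)" using m.card_M by (simp add: field_simps)
  also have "?N * (?Ph + e) \<le> ?N * (?Ph * (1 + 2 * e))"
  proof (rule mult_left_mono)
    have "1 / 2 * (2 * e) \<le> ?Ph * (2 * e)" using m.EE_ratio(2)[OF ab] e0 by (intro mult_right_mono) auto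
    then show "?Ph + e \<le> ?Ph * (1 + 2 * e)" unfolding distrib_left by simp
  qed simp
  also have "\<dots> \<le> ?N * (?Ph * exp (2 * e))"
    using m.EE_ratio(2)[OF ab] exp_ge_add_one_self[of "2 * e"] by (intro mult_left_mono) auto
  finally have g1: "(1 - \<epsilon>) * ?N' \<le> ?N * (?Ph * exp (2 * e))" using gg by linarith
  have e1: "1 \<le> (1 - \<epsilon>) * exp (2 * \<epsilon>)"
  proof -
    have "0 \<le> \<epsilon> * (1 - 2 * \<epsilon>)" using \<epsilon> by simp
    then have "1 \<le> (1 - \<epsilon>) * (1 + 2 * \<epsilon>)" by (simp add: algebra_simps)
    also have "\<dots> \<le> (1 - \<epsilon>) * exp (2 * \<epsilon>)" using \<epsilon> exp_ge_add_one_self[of "2 * \<epsilon>"] by (intro mult_left_mono) auto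
    finally show ?thesis .
  qed
  have "?N' \<le> ((1 - \<epsilon>) * exp (2 * \<epsilon>)) * ?N'" using mult_right_mono[OF e1, of ?N'] by simp
  also have "\<dots> = ((1 - \<epsilon>) * ?N') * exp (2 * \<epsilon>)" by (simp add: mult_ac)
  also have "\<dots> \<le> (?N * (?Ph * exp (2 * e))) * exp (2 * \<epsilon>)" using g1 by (rule mult_right_mono) simp
  also have "\<dots> = ?N * ?Ph * exp (2 * e + 2 * \<epsilon>)" by (simp add: exp_add mult_ac)
  also have "\<dots> \<le> ?N * ?Ph * exp (z ^ 42 / n^2 * ?c)"
  proof (rule mult_left_mono)
    have "3 / n^2 * 1 \<le> z ^ 40 / n^2 * ?c" using z1[of 40] z_ge self_le_power[of z 40] by (intro mult_mono divide_right_mono) auto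
    then have "2 * e + 2 * \<epsilon> \<le> 4 * (z ^ 40 * (?c / n^2))" using \<epsilon>(2) unfolding e_def by simp
    also have "\<dots> \<le> z ^ 41 * (?c / n^2)" using absorb[of "?c / n^2" 4 40] by simp
    also have "\<dots> \<le> z ^ 42 * (?c / n^2)" by (intro zr_mono) auto
    finally show "exp (2 * e + 2 * \<epsilon>) \<le> exp (z ^ 42 / n^2 * ?c)" by simp
    show "0 \<le> ?N * ?Ph" using m.EE_ratio(2)[OF ab] by simp
  qed
  finally have "?N' \<le> ?N * ?Ph * exp (z ^ 42 / n^2 * ?c)" .
  then have "?N' * FF t \<le> ?N * ?Ph * exp (z ^ 42 / n^2 * ?c) * FF t" using FF_pos[OF t] by (intro mult_right_mono) auto
  then show ?thesis unfolding m.FF_shift[OF ab] by (simp add: mult_ac)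
qed

text \<open>Each unit moved into or out of column k is charged 1 + y_k. A whole path thus costs a
  weighted L1 distance, in units of z^42 / n^2.\<close>

definition pcost :: "(nat \<Rightarrow> nat) \<Rightarrow> (nat \<Rightarrow> nat) \<Rightarrow> real" where
  "pcost t t' = (\<Sum>k<n. \<bar>real (t' k) - real (t k)\<bar> * (1 + real (indeg H k)))"

text \<open>Induction on the L1 distance. Equal sums provide a column with a surplus and one with a
  deficit, and one unit is moved back. The new vector lies coordinatewise between the two given
  ones, so it satisfies the same bounds on eta and the estimate for a single move is
  available.\<close>

lemma path_aux:
  assumes "(\<Sum>k<n. nat \<bar>int (t' k) - int (t k)\<bar>) = d" "bx t" "bx t'"
  shows "real (card (Mat n H s t')) * FF t \<le> real (card (Mat n H s t)) * FF t' * exp (z ^ 42 / n^2 * pcost t t')"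
  using assms
proof (induction d arbitrary: t' rule: less_induct)
  case (less d t')
  let ?N = "\<lambda>t. real (card (Mat n H s t))"
  show ?case
  proof (cases "\<forall>k<n. t' k = t k")
    case True
    have 1: "Mat n H s t' = Mat n H s t" using True by (auto simp: Mat_def)
    have 2: "eta n s t' H k = eta n s t H k" if "k < n" for k using True that by (simp add: eta_def)
    have "FF t' = FF t" using True 2 unfolding FF_def wt_def Bt_def Cval_def Yval_cols by simp
    moreover have "pcost t t' = 0" using True by (simp add: pcost_def)
    ultimately show ?thesis unfolding 1 by simp
  next
    case False
    have sums: "(\<Sum>k<n. t' k) = (\<Sum>k<n. t k)" using less.prems by (simp add: bx_def)
    have "\<exists>a<n. t a < t' a"
    proof (rule ccontr)
      assume "\<not> ?thesis"
      then have le: "\<forall>k<n. t' k \<le> t k" by (meson not_less)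
      then have "(\<Sum>k<n. t' k) < (\<Sum>k<n. t k)" using False by (intro sum_strict_mono_ex1) (auto simp: less_le)
      then show False using sums by simp
    qed
    then obtain a where a: "a < n" "t a < t' a" by blast
    have "\<exists>b<n. t' b < t b"
    proof (rule ccontr)
      assume "\<not> ?thesis"
      then have le: "\<forall>k<n. t k \<le> t' k" by (meson not_less)
      have "(\<Sum>k<n. t k) < (\<Sum>k<n. t' k)"
      proof (rule sum_strict_mono_ex1)
        show "\<exists>k\<in>{..<n}. t k < t' k" using False le by (metis lessThan_iff less_le)
      qed (use le in auto)
      then show False using sums by simp
    qed
    then obtain b where b: "b < n" "t' b < t b" by blast
    have ab: "a \<noteq> b" using a b by auto
    define u where "u = shift b a t'"
    have u: "u = t'(b := Suc (t' b), a := t' a - 1)" by (simp add: u_def shift_def)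
    have t'u: "t' = shift a b u" unfolding u_def using a ab by (intro shift_shift[symmetric]) auto
    have "(\<Sum>k<n. real (u k)) = (\<Sum>k<n. real (t' k)) + 1 - 1"
      unfolding u_def using sum_shift[OF b(1) a(1), of "\<lambda>k x. real x" t'] ab a by (simp add: of_nat_diff)
    then have su: "(\<Sum>k<n. u k) = (\<Sum>k<n. t' k)" by (simp flip: of_nat_sum)
    have btw: "(t k \<le> u k \<and> u k \<le> t' k) \<or> (t' k \<le> u k \<and> u k \<le> t k)" for k using a b ab unfolding u fun_upd_def by presburger
    have bu: "bx u" unfolding bx_def
    proof (intro conjI allI impI)
      show "(\<Sum>j<n. s j) = (\<Sum>j<n. u j)" using su less.prems by (simp add: bx_def)
      fix k assume k: "k < n"
      have "\<bar>eta n s t H k\<bar> \<le> z * r" "\<bar>eta n s t' H k\<bar> \<le> z * r" using less.prems k by (auto simp: bx_def)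
      moreover have "(real (t k) \<le> u k \<and> real (u k) \<le> t' k) \<or> (real (t' k) \<le> u k \<and> real (u k) \<le> t k)" using btw[of k] by auto
      ultimately show "\<bar>eta n s u H k\<bar> \<le> z * r" unfolding eta_def by linarith
    qed
    have dec: "(\<Sum>k<n. nat \<bar>int (u k) - int (t k)\<bar>) < d" unfolding less.prems(1)[symmetric]
    proof (rule sum_strict_mono_ex1)
      show "\<forall>k\<in>{..<n}. nat \<bar>int (u k) - int (t k)\<bar> \<le> nat \<bar>int (t' k) - int (t k)\<bar>" 
      proof
        fix k
        show "nat \<bar>int (u k) - int (t k)\<bar> \<le> nat \<bar>int (t' k) - int (t k)\<bar>" using btw[of k] by linarith
      qed
      show "\<exists>k\<in>{..<n}. nat \<bar>int (u k) - int (t k)\<bar> < nat \<bar>int (t' k) - int (t k)\<bar>"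
        using a ab by (intro bexI[of _ a]) (auto simp: u)
    qed simp
    let ?e1 = "z ^ 42 / n^2 * (1 + real (indeg H a) + real (indeg H b))" and ?e2 = "z ^ 42 / n^2 * pcost t u"
    have cost: "?e1 + ?e2 \<le> z ^ 42 / n^2 * pcost t t'"
    proof -
      have pc: "pcost t u = pcost t t' - (1 + real (indeg H a)) - (1 + real (indeg H b))"
        unfolding pcost_def u_def sum_shift[OF b(1) a(1) ab[symmetric], of "\<lambda>k x. \<bar>real x - real (t k)\<bar> * (1 + real (indeg H k))" t']
        using a b by (simp add: of_nat_diff algebra_simps)
      have "z ^ 42 / n^2 * (1 + real (indeg H a) + real (indeg H b) + pcost t u) \<le> z ^ 42 / n^2 * pcost t t'"
        unfolding pc using z_pos by (intro mult_left_mono) auto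
      then show ?thesis by (simp add: distrib_left)
    qed
    have s1: "?N t' * FF u \<le> ?N u * FF t' * exp ?e1"
      using step_ratio[OF a(1) b(1) ab bu] less.prems(3) unfolding t'u[symmetric] by blast
    have s2: "?N u * FF t \<le> ?N t * FF u * exp ?e2" by (rule less.IH[OF dec refl less.prems(2) bu])
    have "?N t' * FF t * FF u = (?N t' * FF u) * FF t" by (simp add: mult_ac)
    also have "\<dots> \<le> (?N u * FF t' * exp ?e1) * FF t" using s1 FF_pos[OF less.prems(2)] by (intro mult_right_mono) auto
    also have "\<dots> = (?N u * FF t) * (FF t' * exp ?e1)" by (simp add: mult_ac)
    also have "\<dots> \<le> (?N t * FF u * exp ?e2) * (FF t' * exp ?e1)" using s2 FF_pos[OF less.prems(3)] by (intro mult_right_mono) auto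
    also have "\<dots> = (?N t * FF t' * exp (?e1 + ?e2)) * FF u" by (simp add: exp_add mult_ac)
    finally have "?N t' * FF t \<le> ?N t * FF t' * exp (?e1 + ?e2)" using FF_pos[OF bu] by simp
    also have "\<dots> \<le> ?N t * FF t' * exp (z ^ 42 / n^2 * pcost t t')" using cost FF_pos[OF less.prems(3)] by (intro mult_left_mono) auto
    finally show ?thesis .
  qed
qed

text \<open>A column changes by at most 2 z r and the 1 + y_k add up to n + X, so the cost is of
  order z^2 r n. After division by n^2 a negative power of n remains.\<close>

lemma path:
  assumes t: "bx t" and t': "bx t'"
  shows "real (card (Mat n H s t')) * FF t \<le> real (card (Mat n H s t)) * FF t' * exp (z ^ 45 / r)"
proof -
  have "pcost t t' \<le> (\<Sum>k<n. 2 * (z * r) * (1 + real (indeg H k)))" unfolding pcost_def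
  proof (rule sum_mono, rule mult_right_mono)
    fix k assume "k \<in> {..<n}"
    then have "\<bar>eta n s t H k\<bar> \<le> z * r" "\<bar>eta n s t' H k\<bar> \<le> z * r" using t t' by (auto simp: bx_def)
    then show "\<bar>real (t' k) - real (t k)\<bar> \<le> 2 * (z * r)" unfolding eta_def by linarith
  qed auto
  also have "\<dots> = 2 * (z * r) * (n + X)" unfolding sum_distrib_left[symmetric] sum.distrib sum_in by simp
  also have "\<dots> \<le> 2 * (z * r) * (2 * z * n)"
  proof (rule mult_left_mono)
    have "1 * real n \<le> z * real n" using z_ge by (intro mult_right_mono) auto
    then show "n + X \<le> 2 * z * n" using X_le by linarith
  qed (use z_pos in auto)
  finally have "z ^ 42 / n^2 * pcost t t' \<le> z ^ 42 / n^2 * (2 * (z * r) * (2 * z * n))" using z_pos by (intro mult_left_mono) auto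
  also have "\<dots> = 4 * (z ^ 44 * (r / n))" using n_pos by (simp add: field_simps eval_nat_numeral)
  also have "\<dots> \<le> z ^ 45 * (r / n)" using absorb[of "r / n" 4 44] by simp
  also have "\<dots> = z ^ 45 / r" unfolding r_over_n by simp
  finally have "exp (z ^ 42 / n^2 * pcost t t') \<le> exp (z ^ 45 / r)" by simp
  then have "real (card (Mat n H s t)) * FF t' * exp (z ^ 42 / n^2 * pcost t t') \<le> real (card (Mat n H s t)) * FF t' * exp (z ^ 45 / r)"
    using FF_pos[OF t'] by (intro mult_left_mono) auto
  then show ?thesis using path_aux[OF refl t t'] by linarith
qed

end

section \<open>Column sums in the two product-like models\<close>

text \<open>The exponential of the count is a product of factors 1 + x 1_A, which expands into a sum
  over index sets. With x \<ge> 0, upper bounds on joint occurrence are all that enters, so the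
  Chernoff bound covers negatively dependent events such as sampling without replacement.\<close>

lemma family_tail:
  fixes p :: "'i \<Rightarrow> real"
  assumes fin: "finite Om" "finite S"
    and up: "\<And>I. I \<subseteq> S \<Longrightarrow> real (card {G\<in>Om. \<forall>i\<in>I. A i G}) \<le> (\<Prod>i\<in>I. p i) * real (card Om)"
    and p: "\<And>i. i \<in> S \<Longrightarrow> 0 \<le> p i" and \<theta>: "0 \<le> \<theta>"
  shows "real (card {G\<in>Om. u \<le> real (card {i\<in>S. A i G})}) \<le> real (card Om) * exp ((exp \<theta> - 1) * (\<Sum>i\<in>S. p i) - \<theta> * u)"
proof -
  define x where "x = exp \<theta> - 1"
  have x: "0 \<le> x" using \<theta> by (simp add: x_def)
  have pt: "exp (\<theta> * real (card {i\<in>S. A i G})) = (\<Sum>I\<in>Pow S. x ^ card I * of_bool (\<forall>i\<in>I. A i G))" for G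
  proof -
    have "exp (\<theta> * real (card {i\<in>S. A i G})) = exp \<theta> ^ card {i\<in>S. A i G}" by (subst mult.commute) (rule exp_of_nat_mult)
    also have "\<dots> = (\<Prod>i\<in>{i\<in>S. A i G}. exp \<theta>)" by simp
    also have "\<dots> = (\<Prod>i\<in>S. if A i G then exp \<theta> else 1)" by (rule prod.inter_filter[OF fin(2)])
    also have "\<dots> = (\<Prod>i\<in>S. x * of_bool (A i G) + 1)" by (rule prod.cong) (auto simp: x_def)
    also have "\<dots> = (\<Sum>I\<in>Pow S. (\<Prod>i\<in>I. x * of_bool (A i G)) * (\<Prod>i\<in>S - I. 1))" by (rule prod_add[OF fin(2)])
    also have "\<dots> = (\<Sum>I\<in>Pow S. x ^ card I * of_bool (\<forall>i\<in>I. A i G))"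
    proof (rule sum.cong[OF refl])
      fix I assume "I \<in> Pow S"
      then have "finite I" using fin(2) finite_subset by auto
      then show "(\<Prod>i\<in>I. x * of_bool (A i G)) * (\<Prod>i\<in>S - I. 1) = x ^ card I * of_bool (\<forall>i\<in>I. A i G)"
        by (auto simp: prod.distrib prod_zero_iff)
    qed
    finally show ?thesis .
  qed
  have "real (card {G\<in>Om. u \<le> real (card {i\<in>S. A i G})}) * exp (\<theta> * u) = (\<Sum>G\<in>{G\<in>Om. u \<le> real (card {i\<in>S. A i G})}. exp (\<theta> * u))" by simp
  also have "\<dots> \<le> (\<Sum>G\<in>{G\<in>Om. u \<le> real (card {i\<in>S. A i G})}. exp (\<theta> * real (card {i\<in>S. A i G})))"
    using \<theta> by (intro sum_mono) (auto intro!: mult_left_mono)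
  also have "\<dots> \<le> (\<Sum>G\<in>Om. exp (\<theta> * real (card {i\<in>S. A i G})))" using fin by (intro sum_mono2) auto
  also have "\<dots> = (\<Sum>I\<in>Pow S. x ^ card I * real (card {G\<in>Om. \<forall>i\<in>I. A i G}))"
    unfolding pt by (subst sum.swap) (simp add: sum_distrib_left[symmetric] of_bool_def sum.If_cases fin Int_def)
  also have "\<dots> \<le> (\<Sum>I\<in>Pow S. x ^ card I * ((\<Prod>i\<in>I. p i) * real (card Om)))"
    using up x by (intro sum_mono mult_left_mono) auto
  also have "\<dots> = (\<Sum>I\<in>Pow S. (\<Prod>i\<in>I. x * p i) * (\<Prod>i\<in>S - I. 1)) * real (card Om)"
    unfolding sum_distrib_right by (intro sum.cong) (auto simp: prod.distrib)
  also have "\<dots> = (\<Prod>i\<in>S. x * p i + 1) * real (card Om)" unfolding prod_add[OF fin(2)] ..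
  also have "\<dots> \<le> (\<Prod>i\<in>S. exp (x * p i)) * real (card Om)"
  proof (intro mult_right_mono prod_mono)
    fix i assume "i \<in> S"
    then have "0 \<le> x * p i" using x p by simp
    then show "0 \<le> x * p i + 1 \<and> x * p i + 1 \<le> exp (x * p i)" using exp_ge_add_one_self[of "x * p i"] by linarith
  qed simp
  also have "(\<Prod>i\<in>S. exp (x * p i)) = exp (x * (\<Sum>i\<in>S. p i))" using fin by (simp add: exp_sum sum_distrib_left)
  finally show ?thesis unfolding x_def[symmetric] by (simp add: exp_diff field_simps)
qed

lemma card_rows:
  assumes "\<And>i. i < n \<Longrightarrow> \<A> i \<subseteq> Pow {..<n}"
  shows "card {G. G \<subseteq> {..<n::nat} \<times> {..<n::nat} \<and> (\<forall>i<n. {k. (i,k) \<in> G} \<in> \<A> i)} = (\<Prod>i<n. card (\<A> i))"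
proof -
  let ?f = "\<lambda>G. \<lambda>i\<in>{..<n}. {k. (i,k) \<in> G}" and ?g = "\<lambda>F. {(i,k). i < n \<and> k \<in> F i}"
  have "bij_betw ?f {G. G \<subseteq> {..<n} \<times> {..<n} \<and> (\<forall>i<n. {k. (i,k) \<in> G} \<in> \<A> i)} (\<Pi>\<^sub>E i\<in>{..<n}. \<A> i)"
  proof (rule bij_betw_byWitness[where f' = ?g])
    show "\<forall>G\<in>{G. G \<subseteq> {..<n} \<times> {..<n} \<and> (\<forall>i<n. {k. (i,k) \<in> G} \<in> \<A> i)}. ?g (?f G) = G" by auto
    show "\<forall>F\<in>(\<Pi>\<^sub>E i\<in>{..<n}. \<A> i). ?f (?g F) = F" by (auto simp: restrict_def PiE_def extensional_def fun_eq_iff)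
    show "?f ` {G. G \<subseteq> {..<n} \<times> {..<n} \<and> (\<forall>i<n. {k. (i,k) \<in> G} \<in> \<A> i)} \<subseteq> (\<Pi>\<^sub>E i\<in>{..<n}. \<A> i)" by auto
    show "?g ` (\<Pi>\<^sub>E i\<in>{..<n}. \<A> i) \<subseteq> {G. G \<subseteq> {..<n} \<times> {..<n} \<and> (\<forall>i<n. {k. (i,k) \<in> G} \<in> \<A> i)}"
    proof
      fix G assume "G \<in> ?g ` (\<Pi>\<^sub>E i\<in>{..<n}. \<A> i)"
      then obtain F where F: "F \<in> (\<Pi>\<^sub>E i\<in>{..<n}. \<A> i)" "G = ?g F" by blast
      then have m: "F i \<in> \<A> i" if "i < n" for i using that by auto
      have "{k. (i,k) \<in> G} = F i" if "i < n" for i using F that by auto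
      moreover have "G \<subseteq> {..<n} \<times> {..<n}" using F m assms by blast
      ultimately show "G \<in> {G. G \<subseteq> {..<n} \<times> {..<n} \<and> (\<forall>i<n. {k. (i,k) \<in> G} \<in> \<A> i)}" using m by auto
    qed
  qed
  then show ?thesis by (simp add: bij_betw_same_card card_PiE)
qed

lemma card_cols:
  assumes "\<And>k. k < n \<Longrightarrow> \<A> k \<subseteq> Pow {..<n}"
  shows "card {G. G \<subseteq> {..<n::nat} \<times> {..<n::nat} \<and> (\<forall>k<n. {i. (i,k) \<in> G} \<in> \<A> k)} = (\<Prod>k<n. card (\<A> k))"
proof -
  have "{G. G \<subseteq> {..<n} \<times> {..<n} \<and> (\<forall>k<n. {i. (i,k) \<in> G} \<in> \<A> k)} = converse ` {G. G \<subseteq> {..<n} \<times> {..<n} \<and> (\<forall>i<n. {k. (i,k) \<in> G} \<in> \<A> i)}"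
    (is "?L = converse ` ?R")
  proof
    show "?L \<subseteq> converse ` ?R"
    proof
      fix G assume "G \<in> ?L"
      then have "G\<inverse> \<in> ?R" by auto
      then show "G \<in> converse ` ?R" by (rule rev_image_eqI) simp
    qed
  qed auto
  moreover have "inj_on converse ?R" by (intro inj_onI) (metis converse_converse)
  ultimately show ?thesis using card_rows[OF assms] by (simp add: card_image)
qed

context host
begin

definition W :: "arcs" where "W = {..<n} \<times> {..<n} - H"
definition Wc :: "nat \<Rightarrow> nat set" where "Wc k = {i. i < n \<and> (i,k) \<notin> H}"
definition Wr :: "nat \<Rightarrow> nat set" where "Wr i = {k. k < n \<and> (i,k) \<notin> H}"

lemma finite_Wc: "finite (Wc k)" and finite_Wr: "finite (Wr k)" by (simp_all add: Wc_def Wr_def)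

lemma card_Wc: "card (Wc k) = n - indeg H k" and in_le_n: "indeg H k \<le> n"
proof -
  have s: "{i. (i,k) \<in> H} \<subseteq> {..<n}" using H_sub by auto
  have "Wc k = {..<n} - {i. (i,k) \<in> H}" by (auto simp: Wc_def)
  then show "card (Wc k) = n - indeg H k" using s by (simp add: card_Diff_subset indeg_def finite_H_col)
  show "indeg H k \<le> n" unfolding indeg_def using card_mono[OF _ s] by simp
qed

lemma card_Wr: "card (Wr i) = n - outdeg H i"
proof -
  have s: "{k. (i,k) \<in> H} \<subseteq> {..<n}" using H_sub by auto
  have "Wr i = {..<n} - {k. (i,k) \<in> H}" by (auto simp: Wr_def)
  then show "card (Wr i) = n - outdeg H i" using s by (simp add: card_Diff_subset outdeg_def finite_row[OF H_sub])
qed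

lemma card_Wc_real: "real (card (Wc k)) = real n - indeg H k" using card_Wc in_le_n by (simp add: of_nat_diff)

lemma divide_vn: "x / (v * n^2) = 1 / v * (x / n^2)" by simp

lemma div_v: assumes "\<bar>x\<bar> \<le> c" shows "\<bar>x / (v * n^2)\<bar> \<le> z * (c / n^2)"
proof -
  have "\<bar>1 / v * (x / n^2)\<bar> \<le> z * (c / n^2)"
    using assms inv_v v_pos by (intro abs_mult_le) (auto intro!: divide_right_mono)
  then show ?thesis unfolding divide_vn .
qed

lemma Rv_le: "\<bar>1 - Rval n s / (v * n^2)\<bar> \<le> z ^ 4"
proof -
  have "Rval n s / (v * n^2) \<le> z * (4 * z^2)" unfolding divide_vn using inv_v Rval_le v_pos z_pos by (intro mult_mono) auto
  moreover have "0 \<le> Rval n s / (v * n^2)" using v_pos by (simp add: Rval_def sum_nonneg)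
  moreover have "4 * (z ^ 3 * 1) + 1 \<le> z ^ 4" using absorb[of 1 5 3] z1[of 3] by simp
  ultimately show ?thesis by (simp add: eval_nat_numeral)
qed

lemma sum_H_col_le: "k < n \<Longrightarrow> \<bar>\<Sum>j\<in>{j. (j,k) \<in> H}. dl j\<bar> \<le> indeg H k * (z * r)"
proof -
  have "\<bar>\<Sum>j\<in>{j. (j,k) \<in> H}. dl j\<bar> \<le> (\<Sum>j\<in>{j. (j,k) \<in> H}. z * r)"
    using H_sub delta_le by (intro order_trans[OF sum_abs] sum_mono) auto
  then show ?thesis by (simp add: indeg_def)
qed

end

text \<open>This covers both the uniformly random set of allowed cells of given size and the model with independent
  uniformly random rows.\<close>

locale colmodel = host +
  fixes Om :: "arcs set" and p :: "nat \<Rightarrow> real"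
  assumes fin: "finite Om" and ne: "Om \<noteq> {}" and sub: "\<And>G. G \<in> Om \<Longrightarrow> G \<subseteq> W"
    and total: "\<And>G. G \<in> Om \<Longrightarrow> (\<Sum>j<n. s j) = (\<Sum>k<n. indeg G k)"
    and p01: "\<And>i. i < n \<Longrightarrow> 0 \<le> p i \<and> p i \<le> 1"
    and pL: "\<And>i. i < n \<Longrightarrow> \<bar>p i - L\<bar> \<le> 2 * z / r"
    and up: "\<And>k I. k < n \<Longrightarrow> I \<subseteq> Wc k \<Longrightarrow> real (card {G\<in>Om. \<forall>i\<in>I. (i,k) \<in> G}) \<le> (\<Prod>i\<in>I. p i) * card Om"
    and dn: "\<And>k I. k < n \<Longrightarrow> I \<subseteq> Wc k \<Longrightarrow> real (card {G\<in>Om. \<forall>i\<in>I. (i,k) \<notin> G}) \<le> (\<Prod>i\<in>I. 1 - p i) * card Om"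
    and pair_ge: "\<And>k i j. k < n \<Longrightarrow> i \<in> Wc k \<Longrightarrow> j \<in> Wc k \<Longrightarrow> i \<noteq> j \<Longrightarrow>
      (p i * p j - 2 / n^2) * card Om \<le> real (card {G\<in>Om. (i,k) \<in> G \<and> (j,k) \<in> G})"
    and eta_mean: "\<And>k. k < n \<Longrightarrow> \<bar>\<Sum>i\<in>Wc k. p i - L\<bar> \<le> z ^ 3"
begin

section \<open>Mean of the exponent over random column sums\<close>

definition Ex :: "(arcs \<Rightarrow> real) \<Rightarrow> real" where "Ex f = (\<Sum>G\<in>Om. f G) / card Om"

lemma card_Om: "0 < real (card Om)" using fin ne by (simp add: card_gt_0_iff)

lemma Ex_add: "Ex (\<lambda>G. f G + g G) = Ex f + Ex g" by (simp add: Ex_def sum.distrib add_divide_distrib)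
lemma Ex_diff: "Ex (\<lambda>G. f G - g G) = Ex f - Ex g" by (simp add: Ex_def sum_subtractf diff_divide_distrib)
lemma Ex_cmult: "Ex (\<lambda>G. c * f G) = c * Ex f" by (simp add: Ex_def sum_distrib_left[symmetric])
lemma Ex_divide: "Ex (\<lambda>G. f G / c) = Ex f / c" by (simp add: Ex_def sum_divide_distrib[symmetric])
lemma Ex_const: "Ex (\<lambda>G. c) = c" using card_Om by (simp add: Ex_def)
lemma Ex_sum: "Ex (\<lambda>G. \<Sum>i\<in>I. f i G) = (\<Sum>i\<in>I. Ex (f i))"
  unfolding Ex_def by (subst sum.swap) (simp add: sum_divide_distrib)
lemma Ex_cong: "(\<And>G. G \<in> Om \<Longrightarrow> f G = g G) \<Longrightarrow> Ex f = Ex g" by (simp add: Ex_def)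
lemma Ex_bool: "Ex (\<lambda>G. of_bool (A G)) = real (card {G\<in>Om. A G}) / card Om"
  unfolding Ex_def by (simp add: of_bool_def sum.If_cases fin Int_def)

definition ind :: "nat \<Rightarrow> nat \<Rightarrow> arcs \<Rightarrow> real" where "ind i k G = of_bool ((i,k) \<in> G)"

lemma Wc_n: "i \<in> Wc k \<Longrightarrow> i < n" by (simp add: Wc_def)

lemma indeg_ind: assumes "G \<in> Om" "k < n" shows "real (indeg G k) = (\<Sum>i\<in>Wc k. ind i k G)"
proof -
  have "{i. (i,k) \<in> G} = {i\<in>Wc k. (i,k) \<in> G}" using sub[OF assms(1)] by (auto simp: Wc_def W_def)
  then show ?thesis by (simp add: indeg_def ind_def of_bool_def sum.If_cases finite_Wc Int_def)
qed

text \<open>The bounds for presence and for absence of a cell add up to one, so both are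
  equalities.\<close>

lemma Ex_ind: assumes k: "k < n" and i: "i \<in> Wc k" shows "Ex (ind i k) = p i"
proof -
  have 1: "real (card {G\<in>Om. (i,k) \<in> G}) \<le> p i * card Om" using up[OF k, of "{i}"] i by simp
  have 2: "real (card {G\<in>Om. (i,k) \<notin> G}) \<le> (1 - p i) * card Om" using dn[OF k, of "{i}"] i by simp
  have "card Om = card ({G\<in>Om. (i,k) \<in> G} \<union> {G\<in>Om. (i,k) \<notin> G})" by (rule arg_cong[where f = card]) auto
  also have "\<dots> = card {G\<in>Om. (i,k) \<in> G} + card {G\<in>Om. (i,k) \<notin> G}" by (rule card_Un_disjoint) (auto simp: fin)
  finally have "real (card Om) = real (card {G\<in>Om. (i,k) \<in> G}) + real (card {G\<in>Om. (i,k) \<notin> G})" by simp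
  then have "real (card {G\<in>Om. (i,k) \<in> G}) = p i * card Om" using 1 2 unfolding left_diff_distrib by linarith
  then show ?thesis unfolding ind_def[abs_def] Ex_bool using card_Om by simp
qed

lemma Ex_pair: assumes k: "k < n" and ij: "i \<in> Wc k" "j \<in> Wc k" "i \<noteq> j"
  shows "\<bar>Ex (\<lambda>G. ind i k G * ind j k G) - p i * p j\<bar> \<le> 2 / n^2"
proof -
  have e: "Ex (\<lambda>G. ind i k G * ind j k G) = real (card {G\<in>Om. (i,k) \<in> G \<and> (j,k) \<in> G}) / card Om"
    unfolding Ex_bool[symmetric] by (rule Ex_cong) (simp add: ind_def)
  have "real (card {G\<in>Om. (i,k) \<in> G \<and> (j,k) \<in> G}) \<le> p i * p j * card Om" using up[OF k, of "{i,j}"] ij by simp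
  then have "Ex (\<lambda>G. ind i k G * ind j k G) \<le> p i * p j" unfolding e using card_Om by (simp add: divide_le_eq)
  moreover have "p i * p j - 2 / n^2 \<le> Ex (\<lambda>G. ind i k G * ind j k G)" unfolding e using pair_ge[OF k ij] card_Om by (simp add: le_divide_eq)
  moreover have "0 \<le> 2 / real (n^2)" by simp
  ultimately show ?thesis by linarith
qed

definition mu :: "nat \<Rightarrow> real" where "mu k = (\<Sum>i\<in>Wc k. p i)"

lemma Ex_indeg: assumes k: "k < n" shows "Ex (\<lambda>G. real (indeg G k)) = mu k"
proof -
  have "Ex (\<lambda>G. real (indeg G k)) = Ex (\<lambda>G. \<Sum>i\<in>Wc k. ind i k G)" by (rule Ex_cong) (simp add: indeg_ind k)
  then show ?thesis unfolding Ex_sum mu_def using Ex_ind[OF k] by simp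
qed

lemma mu_eq: "mu k - real n * L + L * indeg H k = (\<Sum>i\<in>Wc k. p i - L)"
  unfolding mu_def sum_subtractf by (simp add: card_Wc_real algebra_simps)

lemma Ex_eta: assumes "k < n" shows "\<bar>Ex (\<lambda>G. eta n s (indeg G) H k)\<bar> \<le> z ^ 3"
proof -
  have "Ex (\<lambda>G. eta n s (indeg G) H k) = mu k - real n * L + L * indeg H k"
    unfolding eta_def Ex_add Ex_diff Ex_const Ex_indeg[OF assms] avg_L ..
  then show ?thesis unfolding mu_eq using eta_mean[OF assms] by simp
qed

text \<open>The diagonal gives n v up to order z r. The slack 2 / n^2 in the pair correlations adds
  up to at most 2 over all pairs.\<close>

lemma Ex_var: assumes k: "k < n" shows "\<bar>Ex (\<lambda>G. (real (indeg G k) - mu k)\<^sup>2) - n * v\<bar> \<le> 4 * (z * r)"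
proof -
  let ?c = "\<lambda>i j. Ex (\<lambda>G. ind i k G * ind j k G) - p i * p j"
  have "Ex (\<lambda>G. (real (indeg G k) - mu k)\<^sup>2) = Ex (\<lambda>G. \<Sum>i\<in>Wc k. \<Sum>j\<in>Wc k. (ind i k G - p i) * (ind j k G - p j))"
    by (rule Ex_cong) (simp add: indeg_ind k mu_def power2_eq_square sum_subtractf[symmetric] sum_product)
  also have "\<dots> = (\<Sum>i\<in>Wc k. \<Sum>j\<in>Wc k. Ex (\<lambda>G. (ind i k G - p i) * (ind j k G - p j)))" unfolding Ex_sum ..
  also have "\<dots> = (\<Sum>i\<in>Wc k. \<Sum>j\<in>Wc k. ?c i j)"
  proof (intro sum.cong refl)
    fix i j assume ij: "i \<in> Wc k" "j \<in> Wc k"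
    have "Ex (\<lambda>G. (ind i k G - p i) * (ind j k G - p j)) = Ex (\<lambda>G. ind i k G * ind j k G - p j * ind i k G - p i * ind j k G + p i * p j)"
      by (rule Ex_cong) (simp add: algebra_simps)
    also have "\<dots> = ?c i j" unfolding Ex_add Ex_diff Ex_cmult Ex_const Ex_ind[OF k ij(1)] Ex_ind[OF k ij(2)] by simp
    finally show "Ex (\<lambda>G. (ind i k G - p i) * (ind j k G - p j)) = ?c i j" .
  qed
  also have "\<dots> = (\<Sum>i\<in>Wc k. p i * (1 - p i) + (\<Sum>j\<in>Wc k - {i}. ?c i j))"
  proof (intro sum.cong refl)
    fix i assume i: "i \<in> Wc k"
    have "Ex (\<lambda>G. ind i k G * ind i k G) = p i" unfolding Ex_ind[OF k i, symmetric] by (rule Ex_cong) (simp add: ind_def)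
    then show "(\<Sum>j\<in>Wc k. ?c i j) = p i * (1 - p i) + (\<Sum>j\<in>Wc k - {i}. ?c i j)"
      unfolding sum.remove[OF finite_Wc i] by (simp add: algebra_simps)
  qed
  finally have e: "Ex (\<lambda>G. (real (indeg G k) - mu k)\<^sup>2) = (\<Sum>i\<in>Wc k. p i * (1 - p i)) + (\<Sum>i\<in>Wc k. \<Sum>j\<in>Wc k - {i}. ?c i j)"
    by (simp add: sum.distrib)
  have cn: "real (card (Wc k)) \<le> n" using card_Wc_real[of k] by simp
  have "\<bar>\<Sum>i\<in>Wc k. \<Sum>j\<in>Wc k - {i}. ?c i j\<bar> \<le> (\<Sum>i\<in>Wc k. n * (2 / n^2))"
  proof (rule order_trans[OF sum_abs], rule sum_mono)
    fix i assume i: "i \<in> Wc k"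
    have "\<bar>\<Sum>j\<in>Wc k - {i}. ?c i j\<bar> \<le> (\<Sum>j\<in>Wc k - {i}. 2 / n^2)"
      by (rule order_trans[OF sum_abs], rule sum_mono) (use Ex_pair[OF k i] in auto)
    also have "\<dots> = real (card (Wc k - {i})) * (2 / n^2)" by simp
    also have "\<dots> \<le> n * (2 / n^2)"
      using cn card_mono[OF finite_Wc Diff_subset, of k "{i}"] by (intro mult_right_mono) auto
    finally show "\<bar>\<Sum>j\<in>Wc k - {i}. ?c i j\<bar> \<le> n * (2 / n^2)" .
  qed
  also have "\<dots> = real (card (Wc k)) * (n * (2 / n^2))" by simp
  also have "\<dots> \<le> n * (n * (2 / n^2))" by (intro mult_right_mono cn) auto
  also have "\<dots> = 2" using n_pos by (simp add: power2_eq_square)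
  finally have 1: "\<bar>\<Sum>i\<in>Wc k. \<Sum>j\<in>Wc k - {i}. ?c i j\<bar> \<le> 2" .
  have "\<bar>(\<Sum>i\<in>Wc k. p i * (1 - p i)) - card (Wc k) * v\<bar> = \<bar>\<Sum>i\<in>Wc k. (p i - L) * (1 - p i - L)\<bar>"
  proof -
    have "(\<Sum>i\<in>Wc k. p i * (1 - p i)) - card (Wc k) * v = (\<Sum>i\<in>Wc k. p i * (1 - p i) - v)" by (simp add: sum_subtractf)
    also have "\<dots> = (\<Sum>i\<in>Wc k. (p i - L) * (1 - p i - L))" by (intro sum.cong) (auto simp: algebra_simps)
    finally show ?thesis by simp
  qed
  also have "\<dots> \<le> (\<Sum>i\<in>Wc k. 2 * z / r * 1)"
  proof (rule order_trans[OF sum_abs], rule sum_mono, rule abs_mult_le)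
    fix i assume "i \<in> Wc k"
    then have i: "i < n" by (rule Wc_n)
    show "\<bar>p i - L\<bar> \<le> 2 * z / r" by (rule pL[OF i])
    show "\<bar>1 - p i - L\<bar> \<le> 1" using p01[OF i] L01 by linarith
  qed
  also have "\<dots> = real (card (Wc k)) * (2 * z / r)" by simp
  also have "\<dots> \<le> n * (2 * z / r)" using z_pos r_pos by (intro mult_right_mono cn) auto
  also have "\<dots> = 2 * (z * r)"
  proof -
    have "r * r * (2 * z / r) = 2 * (z * r)" using r_pos by (simp del: real_sqrt_mult_self)
    then show ?thesis by simp
  qed
  finally have 2: "\<bar>(\<Sum>i\<in>Wc k. p i * (1 - p i)) - card (Wc k) * v\<bar> \<le> 2 * (z * r)" .
  have "indeg H k * v \<le> (z * r) * 1" using in_le[OF k] v_pos v_le z_pos r_pos by (intro mult_mono) auto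
  moreover have "0 \<le> indeg H k * v" using v_pos by simp
  moreover have "card (Wc k) * v = n * v - indeg H k * v" unfolding card_Wc_real by (simp only: left_diff_distrib)
  ultimately show ?thesis unfolding e using 1 2 zkr[of 1] by simp
qed

text \<open>Column variances near n v put C near v n^2, which is where the factor 1 - C / (v n^2) of
  the exponent vanishes. The squared biases are summed with the help of the total X of the
  y_k.\<close>

lemma Ex_C: "\<bar>Ex (\<lambda>G. Cval n s (indeg G)) - v * n^2\<bar> \<le> z ^ 7 * (r * n)"
proof -
  have sq: "Ex (\<lambda>G. (real (indeg G k) - avg_deg n s)\<^sup>2) = Ex (\<lambda>G. (real (indeg G k) - mu k)\<^sup>2) + (mu k - n * L)\<^sup>2" if k: "k < n" for k
  proof -
    have "Ex (\<lambda>G. (real (indeg G k) - avg_deg n s)\<^sup>2) = Ex (\<lambda>G. (real (indeg G k) - mu k)\<^sup>2 + 2 * (mu k - n * L) * (real (indeg G k) - mu k) + (mu k - n * L)\<^sup>2)"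
      by (rule Ex_cong) (simp add: avg_L power2_eq_square algebra_simps)
    then show ?thesis unfolding Ex_add Ex_cmult Ex_diff Ex_const Ex_indeg[OF k] by simp
  qed
  have sq_le: "(mu k - n * L)\<^sup>2 \<le> 2 * z ^ 6 + 2 * (z * r) * indeg H k" if k: "k < n" for k
  proof -
    have y: "0 \<le> L * indeg H k" "L * indeg H k \<le> real (indeg H k)" using L01 by (auto intro!: mult_left_le_one_le)
    have "\<bar>mu k - n * L\<bar> \<le> z ^ 3 + indeg H k" using eta_mean[OF k] y unfolding mu_eq[symmetric] by linarith
    then have "(mu k - n * L)\<^sup>2 \<le> (z ^ 3 + indeg H k)\<^sup>2" by (intro abs_le_square_iff[THEN iffD1]) simp
    also have "\<dots> \<le> 2 * (z ^ 3)\<^sup>2 + 2 * (real (indeg H k))\<^sup>2"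
    proof -
      have "0 \<le> (z ^ 3 - real (indeg H k))\<^sup>2" by simp
      then show ?thesis by (simp add: power2_eq_square algebra_simps)
    qed
    also have "(real (indeg H k))\<^sup>2 \<le> (z * r) * indeg H k" unfolding power2_eq_square using mult_right_mono[OF in_le[OF k], of "indeg H k"] by simp
    finally show ?thesis by simp
  qed
  have "Ex (\<lambda>G. Cval n s (indeg G)) = (\<Sum>k<n. Ex (\<lambda>G. (real (indeg G k) - mu k)\<^sup>2) + (mu k - n * L)\<^sup>2)"
    unfolding Cval_def Ex_sum by (intro sum.cong) (auto simp: sq)
  then have e: "Ex (\<lambda>G. Cval n s (indeg G)) - v * n^2 = (\<Sum>k<n. (Ex (\<lambda>G. (real (indeg G k) - mu k)\<^sup>2) - n * v) + (mu k - n * L)\<^sup>2)"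
    by (simp add: sum.distrib sum_subtractf power2_eq_square)
  have "\<bar>Ex (\<lambda>G. Cval n s (indeg G)) - v * n^2\<bar> \<le> (\<Sum>k<n. 4 * (z * r) + (2 * z ^ 6 + 2 * (z * r) * indeg H k))"
    unfolding e by (rule order_trans[OF sum_abs], rule sum_mono, rule abs_add_le) (use Ex_var sq_le in auto)
  also have "\<dots> = 4 * (z * (r * n)) + 2 * (z ^ 6 * n) + 2 * (z * r) * X"
    unfolding sum.distrib sum_distrib_left[symmetric] sum_in by simp
  also have "\<dots> \<le> z ^ 7 * (r * n)"
  proof -
    have r1: "1 \<le> r" using r_ge by linarith
    have "2 * (z * r) * X \<le> 2 * (z * r) * (z * n)" using X_le z_pos by (intro mult_left_mono) auto
    moreover have "z ^ 6 * (1 * real n) \<le> z ^ 6 * (r * n)" using r1 z_pos by (intro mult_left_mono mult_right_mono) auto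
    moreover have "z ^ 1 * (r * n) \<le> z ^ 6 * (r * n)" "z ^ 2 * (r * n) \<le> z ^ 6 * (r * n)" by (intro zr_mono; simp)+
    moreover have "8 * (z ^ 6 * (r * n)) \<le> z ^ 7 * (r * n)" using absorb[of "r * n" 8 6] by simp
    ultimately show ?thesis by (simp add: power2_eq_square mult_ac)
  qed
  finally show ?thesis .
qed

lemma Ex_Y: "\<bar>Ex (\<lambda>G. Yval n s (indeg G) H)\<bar> \<le> z ^ 5 * (r * n)"
proof -
  have e: "Ex (\<lambda>G. Yval n s (indeg G) H) = (\<Sum>k<n. (\<Sum>j\<in>{j. (j,k) \<in> H}. dl j) * Ex (\<lambda>G. eta n s (indeg G) H k))"
    unfolding Yval_cols Ex_sum Ex_cmult ..
  have "\<bar>Ex (\<lambda>G. Yval n s (indeg G) H)\<bar> \<le> (\<Sum>k<n. (indeg H k * (z * r)) * z ^ 3)"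
    unfolding e by (rule order_trans[OF sum_abs], rule sum_mono, rule abs_mult_le) (use sum_H_col_le Ex_eta in auto)
  also have "\<dots> = X * (z * r * z ^ 3)" unfolding sum_distrib_right[symmetric] sum_in[symmetric] by (simp add: mult.assoc)
  also have "\<dots> \<le> (z * n) * (z * r * z ^ 3)" using X_le z_pos by (intro mult_right_mono) auto
  also have "\<dots> = z ^ 5 * (r * n)" by (simp add: eval_nat_numeral)
  finally show ?thesis .
qed

lemma rn: "r * n / n^2 = 1 / r"
  using r_over_n n_pos by (simp add: power2_eq_square)

lemma Ex_B: "\<bar>Ex (\<lambda>G. Bt (indeg G))\<bar> \<le> z ^ 13 / r"
proof -
  have vn: "v * n^2 \<noteq> 0" using mult_pos_pos[OF v_pos, of "real (n^2)"] n_pos by (metis less_irrefl of_nat_0_less_iff zero_less_power)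
  have "Ex (\<lambda>G. Bt (indeg G)) = - (1/2) * (1 - Rval n s / (v * n^2)) * (1 - Ex (\<lambda>G. Cval n s (indeg G)) / (v * n^2)) - Ex (\<lambda>G. Yval n s (indeg G) H) / (v * n^2)"
    unfolding Bt_def Ex_diff Ex_cmult Ex_divide Ex_const ..
  also have "1 - Ex (\<lambda>G. Cval n s (indeg G)) / (v * n^2) = - ((Ex (\<lambda>G. Cval n s (indeg G)) - v * n^2) / (v * n^2))"
    using vn by (simp add: diff_divide_distrib)
  finally have e: "Ex (\<lambda>G. Bt (indeg G)) = 1 / 2 * (1 - Rval n s / (v * n^2)) * ((Ex (\<lambda>G. Cval n s (indeg G)) - v * n^2) / (v * n^2)) - Ex (\<lambda>G. Yval n s (indeg G) H) / (v * n^2)"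
    by simp
  have 1: "\<bar>1 / 2 * (1 - Rval n s / (v * n^2)) * ((Ex (\<lambda>G. Cval n s (indeg G)) - v * n^2) / (v * n^2))\<bar> \<le> 1 * z ^ 4 * (z * (z ^ 7 * (r * n) / n^2))"
    using Rv_le div_v[OF Ex_C] by (intro abs_mult_le) auto
  have 2: "\<bar>Ex (\<lambda>G. Yval n s (indeg G) H) / (v * n^2)\<bar> \<le> z * (z ^ 5 * (r * n) / n^2)" by (rule div_v[OF Ex_Y])
  have "\<bar>Ex (\<lambda>G. Bt (indeg G))\<bar> \<le> 1 * z ^ 4 * (z * (z ^ 7 * (r * n) / n^2)) + z * (z ^ 5 * (r * n) / n^2)" unfolding e by (rule abs_diff_le[OF 1 2])
  also have "\<dots> = z ^ 12 * (r * n / n^2) + z ^ 6 * (r * n / n^2)" by (simp add: eval_nat_numeral)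
  also have "\<dots> = z ^ 12 * (1 / r) + z ^ 6 * (1 / r)" unfolding rn ..
  also have "\<dots> \<le> z ^ 13 * (1 / r)" using absorb[of "1 / r" 2 12] zr_mono[of 6 12 "1 / r"] by simp
  finally show ?thesis by simp
qed

lemma Bt_le: assumes G: "G \<in> Om" shows "\<bar>Bt (indeg G)\<bar> \<le> real n ^ 2"
proof -
  have dn: "0 \<le> real (indeg G k)" "real (indeg G k) \<le> n" if "k < n" for k
  proof -
    have "real (indeg G k) \<le> (\<Sum>i\<in>Wc k. 1)" unfolding indeg_ind[OF G that] by (rule sum_mono) (simp add: ind_def)
    then show "real (indeg G k) \<le> n" using card_Wc_real[of k] by simp
  qed simp
  have nL: "0 \<le> n * L" "n * L \<le> real n" using L01 by (auto intro!: mult_right_le_one_le)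
  have y: "0 \<le> L * indeg H k" "L * indeg H k \<le> real (indeg H k)" "indeg H k \<le> real n" for k using L01 in_le_n by (auto intro!: mult_left_le_one_le)
  have "\<bar>Cval n s (indeg G)\<bar> \<le> (\<Sum>k<n. real n ^ 2)" unfolding Cval_def
  proof (rule order_trans[OF sum_abs], rule sum_mono)
    fix k assume "k \<in> {..<n}"
    then have "\<bar>real (indeg G k) - avg_deg n s\<bar> \<le> \<bar>real n\<bar>" using dn[of k] nL unfolding avg_L abs_of_nat lessThan_iff by linarith
    then show "\<bar>(real (indeg G k) - avg_deg n s)\<^sup>2\<bar> \<le> real n ^ 2" unfolding abs_power2 by (rule abs_le_square_iff[THEN iffD1])
  qed
  then have "\<bar>Cval n s (indeg G)\<bar> \<le> real n * real n ^ 2" by simp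
  from div_v[OF this] have c: "\<bar>Cval n s (indeg G) / (v * n^2)\<bar> \<le> z * n" using n_pos by simp
  have "1 * 1 \<le> z * n" using z_ge n_ge by (intro mult_mono) auto
  then have c': "\<bar>1 - Cval n s (indeg G) / (v * n^2)\<bar> \<le> 2 * (z * n)" using c by linarith
  have "\<bar>Yval n s (indeg G) H\<bar> \<le> (\<Sum>k<n. (indeg H k * (z * r)) * (2 * n))" unfolding Yval_cols
  proof (rule order_trans[OF sum_abs], rule sum_mono, rule abs_mult_le)
    fix k assume "k \<in> {..<n}"
    then have k: "k < n" by simp
    show "\<bar>\<Sum>j\<in>{j. (j,k) \<in> H}. dl j\<bar> \<le> indeg H k * (z * r)" by (rule sum_H_col_le[OF k])
    show "\<bar>eta n s (indeg G) H k\<bar> \<le> 2 * n" using dn[OF k] nL y[of k] unfolding eta_def avg_L by simp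
  qed
  also have "\<dots> = X * (z * r * (2 * n))" unfolding sum_distrib_right[symmetric] sum_in[symmetric] by (simp add: mult.assoc)
  also have "\<dots> \<le> (z * n) * (z * r * (2 * n))" using X_le z_pos by (intro mult_right_mono) auto
  finally have "\<bar>Yval n s (indeg G) H\<bar> \<le> 2 * (z ^ 2 * r) * real n ^ 2" by (simp add: power2_eq_square mult_ac)
  from div_v[OF this] have yv: "\<bar>Yval n s (indeg G) H / (v * n^2)\<bar> \<le> 2 * (z ^ 3 * r)" using n_pos by (simp add: power2_eq_square power3_eq_cube)
  have "\<bar>Bt (indeg G)\<bar> \<le> (1/2) * z ^ 4 * (2 * (z * n)) + 2 * (z ^ 3 * r)" unfolding Bt_def
    using Rv_le c' by (intro abs_diff_le[OF _ yv] abs_mult_le) auto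
  also have "\<dots> = z ^ 5 * n + 2 * (z ^ 3 * r)" by (simp add: eval_nat_numeral)
  also have "\<dots> \<le> 3 * (z ^ 5 * n)"
  proof -
    have "z ^ 3 * r \<le> z ^ 5 * n" using z_ge r_le_n by (intro mult_mono power_increasing) auto
    then show ?thesis by linarith
  qed
  also have "\<dots> \<le> z ^ 6 * n" using absorb[of n 3 5] by simp
  also have "\<dots> \<le> n * n" using z_le_r[of 6] r_le_n unfolding of_nat_mult by (intro mult_right_mono) auto
  finally show ?thesis by (simp add: power2_eq_square)
qed

text \<open>The upper tail counts present cells and the lower tail absent ones. Both use \<theta> =
  4 / r and deviation z r / 2: the linear gain is 2z and the quadratic loss at most 16. The other
  half of z r covers the mean of eta.\<close>

lemma col_tail: assumes k: "k < n"
  shows "real (card {G\<in>Om. \<not> \<bar>eta n s (indeg G) H k\<bar> \<le> z * r}) \<le> 2 * exp (- z) * card Om"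
proof -
  let ?a = "z * r / 2"
  let ?U = "{G\<in>Om. mu k + ?a \<le> real (card {i\<in>Wc k. (i,k) \<in> G})}"
  let ?D = "{G\<in>Om. (card (Wc k) - mu k) + ?a \<le> real (card {i\<in>Wc k. (i,k) \<notin> G})}"
  have th: "exp (4 / r) - 1 \<le> 4 / r + (4 / r)\<^sup>2" 
  proof -
    have "0 \<le> 4 / r" "4 / r \<le> 1" using r_ge r_pos by (simp_all add: divide_le_eq)
    then show ?thesis using exp_bound[of "4 / r"] by linarith
  qed
  have ex: "(exp (4 / r) - 1) * m - 4 / r * (m + ?a) \<le> - z" if "0 \<le> m" "m \<le> n" for m :: real
  proof -
    have "(exp (4 / r) - 1) * m \<le> (4 / r + (4 / r)\<^sup>2) * m" using th that by (intro mult_right_mono) auto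
    moreover have "(4 / r)\<^sup>2 * m \<le> (4 / r)\<^sup>2 * n" using that by (intro mult_left_mono) auto
    moreover have "(4 / r)\<^sup>2 * n = 16" using n_pos by (simp add: power_divide)
    moreover have "4 / r * ?a = 2 * z" using r_pos by simp
    moreover have "P - (a + d) \<le> - z" if "P \<le> a + b" "b \<le> c" "c = 16" "d = 2 * z" for P a b c d :: real using that z_ge by linarith
    ultimately show ?thesis unfolding distrib_left distrib_right by blast
  qed
  have mu: "0 \<le> mu k" "mu k \<le> card (Wc k)"
    unfolding mu_def using p01 Wc_n by (auto intro!: sum_nonneg sum_bounded_above[of _ _ 1, simplified])
  have cn: "real (card (Wc k)) \<le> n" using card_Wc_real[of k] by simp
  have "real (card ?U) \<le> card Om * exp ((exp (4 / r) - 1) * (\<Sum>i\<in>Wc k. p i) - 4 / r * (mu k + ?a))"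
    by (rule family_tail[OF fin finite_Wc up[OF k]]) (use p01 Wc_n in auto)
  also have "\<dots> \<le> card Om * exp (- z)" using ex[of "mu k"] mu cn by (intro mult_left_mono) (auto simp: mu_def[symmetric])
  finally have U: "real (card ?U) \<le> card Om * exp (- z)" .
  have m2: "(\<Sum>i\<in>Wc k. 1 - p i) = card (Wc k) - mu k" by (simp add: sum_subtractf mu_def)
  have "real (card ?D) \<le> card Om * exp ((exp (4 / r) - 1) * (\<Sum>i\<in>Wc k. 1 - p i) - 4 / r * ((card (Wc k) - mu k) + ?a))"
    by (rule family_tail[OF fin finite_Wc dn[OF k]]) (use p01 Wc_n in auto)
  also have "\<dots> \<le> card Om * exp (- z)" unfolding m2 using ex[of "card (Wc k) - mu k"] mu cn by (intro mult_left_mono) auto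
  finally have D: "real (card ?D) \<le> card Om * exp (- z)" .
  have "{G\<in>Om. \<not> \<bar>eta n s (indeg G) H k\<bar> \<le> z * r} \<subseteq> ?U \<union> ?D"
  proof
    fix G assume "G \<in> {G\<in>Om. \<not> \<bar>eta n s (indeg G) H k\<bar> \<le> z * r}"
    then have G: "G \<in> Om" "z * r < \<bar>eta n s (indeg G) H k\<bar>" by auto
    have e: "eta n s (indeg G) H k = (indeg G k - mu k) + (\<Sum>i\<in>Wc k. p i - L)" unfolding eta_def avg_L mu_eq[symmetric] by simp
    have z3: "z ^ 3 \<le> z * r / 2"
    proof -
      have "2 * (z ^ 2 * 1) \<le> z ^ 3 * 1" using absorb[of 1 2 2] by (simp add: eval_nat_numeral)
      also have "\<dots> \<le> r" using z_le_r[of 3] by simp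
      finally have "z * (2 * z ^ 2) \<le> z * r" using z_pos by (intro mult_left_mono) auto
      then show ?thesis by (simp add: eval_nat_numeral)
    qed
    have c1: "real (card {i\<in>Wc k. (i,k) \<in> G}) = indeg G k" unfolding indeg_ind[OF G(1) k] ind_def
      by (simp add: of_bool_def sum.If_cases finite_Wc Int_def)
    have "card (Wc k) = card ({i\<in>Wc k. (i,k) \<in> G} \<union> {i\<in>Wc k. (i,k) \<notin> G})" by (rule arg_cong[where f = card]) auto
    also have "\<dots> = card {i\<in>Wc k. (i,k) \<in> G} + card {i\<in>Wc k. (i,k) \<notin> G}" by (rule card_Un_disjoint) (auto simp: finite_Wc)
    finally have c2: "real (card {i\<in>Wc k. (i,k) \<notin> G}) = card (Wc k) - indeg G k" using c1 by linarith
    have "mu k + ?a \<le> indeg G k \<or> indeg G k \<le> mu k - ?a" using G(2) eta_mean[OF k] z3 unfolding e by linarith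
    then show "G \<in> ?U \<union> ?D" using c1 c2 G(1) by auto
  qed
  then have "card {G\<in>Om. \<not> \<bar>eta n s (indeg G) H k\<bar> \<le> z * r} \<le> card (?U \<union> ?D)" using fin by (intro card_mono) auto
  also have "\<dots> \<le> card ?U + card ?D" by (rule card_Un_le)
  finally show ?thesis using U D by (simp add: mult.commute)
qed

lemma box_tail: "real (card {G\<in>Om. \<not> bx (indeg G)}) * real n ^ 30 \<le> card Om"
proof -
  have "{G\<in>Om. \<not> bx (indeg G)} \<subseteq> (\<Union>k\<in>{..<n}. {G\<in>Om. \<not> \<bar>eta n s (indeg G) H k\<bar> \<le> z * r})"
    using total by (auto simp: bx_def)
  then have "card {G\<in>Om. \<not> bx (indeg G)} \<le> card (\<Union>k\<in>{..<n}. {G\<in>Om. \<not> \<bar>eta n s (indeg G) H k\<bar> \<le> z * r})"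
    using fin by (intro card_mono) auto
  also have "\<dots> \<le> (\<Sum>k<n. card {G\<in>Om. \<not> \<bar>eta n s (indeg G) H k\<bar> \<le> z * r})" by (rule card_UN_le) simp
  finally have "real (card {G\<in>Om. \<not> bx (indeg G)}) \<le> (\<Sum>k<n. real (card {G\<in>Om. \<not> \<bar>eta n s (indeg G) H k\<bar> \<le> z * r}))" by (simp flip: of_nat_sum)
  also have "\<dots> \<le> (\<Sum>k<n. 2 * exp (- z) * card Om)" by (rule sum_mono) (use col_tail in auto)
  also have "\<dots> = (2 * real n) * (exp (- z) * card Om)" by simp
  finally have "real (card {G\<in>Om. \<not> bx (indeg G)}) * real n ^ 30 \<le> (2 * real n) * (exp (- z) * card Om) * real n ^ 30" by (rule mult_right_mono) simp
  also have "\<dots> = (exp (- z) * card Om) * (2 * real n * real n ^ 30)" by simp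
  also have "\<dots> \<le> (exp (- z) * card Om) * real n ^ 40"
  proof (rule mult_left_mono)
    have "real n * 2 * real n ^ 30 \<le> real n * real n * real n ^ 30" using n_ge by (intro mult_right_mono mult_left_mono) auto
    also have "\<dots> = real n ^ 32" by (simp add: eval_nat_numeral)
    also have "\<dots> \<le> real n ^ 40" using n_ge by (intro power_increasing) auto
    finally show "2 * real n * real n ^ 30 \<le> real n ^ 40" by (simp add: mult_ac)
  qed simp
  also have "\<dots> = (exp (- z) * real n ^ 40) * card Om" by simp
  also have "\<dots> \<le> 1 * real (card Om)" by (rule mult_right_mono[OF exp_z]) simp
  finally show ?thesis by simp
qed

text \<open>The column sums outside the admissible range have probability at most n^(-30), and there
  1 + \<sigma> B is at most n^3, so restricting the mean loses little. The two signs serve the two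
  models.\<close>

lemma box_mean:
  assumes \<sigma>: "\<bar>\<sigma>\<bar> = 1"
  shows "(1 - z ^ 14 / r) * card Om \<le> (\<Sum>G\<in>{G\<in>Om. bx (indeg G)}. 1 + \<sigma> * Bt (indeg G))"
proof -
  let ?b = "{G\<in>Om. \<not> bx (indeg G)}" and ?g = "{G\<in>Om. bx (indeg G)}"
  have "(\<Sum>G\<in>Om. 1 + \<sigma> * Bt (indeg G)) = (\<Sum>G\<in>?g \<union> ?b. 1 + \<sigma> * Bt (indeg G))" by (rule sum.cong) auto
  also have "\<dots> = (\<Sum>G\<in>?g. 1 + \<sigma> * Bt (indeg G)) + (\<Sum>G\<in>?b. 1 + \<sigma> * Bt (indeg G))"
    by (rule sum.union_disjoint) (auto simp: fin)
  finally have sp: "(\<Sum>G\<in>?g. 1 + \<sigma> * Bt (indeg G)) = (\<Sum>G\<in>Om. 1 + \<sigma> * Bt (indeg G)) - (\<Sum>G\<in>?b. 1 + \<sigma> * Bt (indeg G))" by linarith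
  have "(\<Sum>G\<in>Om. 1 + \<sigma> * Bt (indeg G)) = card Om * (1 + \<sigma> * Ex (\<lambda>G. Bt (indeg G)))"
    using card_Om by (simp add: Ex_def sum.distrib sum_distrib_left[symmetric] field_simps)
  also have "\<dots> \<ge> card Om * (1 - z ^ 13 / r)"
  proof (rule mult_left_mono)
    have "\<bar>\<sigma> * Ex (\<lambda>G. Bt (indeg G))\<bar> \<le> z ^ 13 / r" using Ex_B \<sigma> by (simp add: abs_mult)
    then show "1 - z ^ 13 / r \<le> 1 + \<sigma> * Ex (\<lambda>G. Bt (indeg G))" by linarith
  qed simp
  finally have 1: "card Om * (1 - z ^ 13 / r) \<le> (\<Sum>G\<in>Om. 1 + \<sigma> * Bt (indeg G))" .
  have "(\<Sum>G\<in>?b. 1 + \<sigma> * Bt (indeg G)) \<le> (\<Sum>G\<in>?b. real n ^ 3)"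
  proof (rule sum_mono)
    fix G assume "G \<in> ?b"
    then have "\<bar>\<sigma> * Bt (indeg G)\<bar> \<le> real n ^ 2" using Bt_le \<sigma> by (simp add: abs_mult)
    moreover have "1 + real n ^ 2 \<le> real n ^ 3"
    proof -
      have "1 * real n ^ 2 + 1 * real n ^ 2 \<le> real n * real n ^ 2" using n_ge mult_right_mono[of 2 "real n" "real n ^ 2"] by simp
      moreover have "1 \<le> real n ^ 2" using n_ge by (intro one_le_power) auto
      ultimately show ?thesis by (simp add: eval_nat_numeral)
    qed
    ultimately show "1 + \<sigma> * Bt (indeg G) \<le> real n ^ 3" by linarith
  qed
  also have "\<dots> = real (card ?b) * real n ^ 3" by simp
  also have "\<dots> \<le> card Om * (1 / n)"
  proof -
    have "real (card ?b) * real n ^ 4 \<le> real (card ?b) * real n ^ 30" using n_ge by (intro mult_left_mono power_increasing) auto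
    then have "real (card ?b) * real n ^ 3 * n \<le> card Om" using box_tail by (simp add: eval_nat_numeral mult_ac)
    then show ?thesis using n_pos by (simp add: field_simps)
  qed
  also have "\<dots> \<le> card Om * (z ^ 13 / r)"
  proof (rule mult_left_mono)
    have "1 / n \<le> 1 / r" using r_le_n r_pos by (intro divide_left_mono) auto
    also have "\<dots> \<le> z ^ 13 / r" using z1 r_pos by (intro divide_right_mono) auto
    finally show "1 / n \<le> z ^ 13 / r" .
  qed simp
  finally have 2: "(\<Sum>G\<in>?b. 1 + \<sigma> * Bt (indeg G)) \<le> card Om * (z ^ 13 / r)" .
  have "card Om * (2 * (z ^ 13 / r)) \<le> card Om * (z ^ 14 / r)" using absorb[of "1 / r" 2 13] by (intro mult_left_mono) auto
  moreover have "(1 - d) * c \<le> x - y" if "c * (2 * e) \<le> c * d" "c * (1 - e) \<le> x" "y \<le> c * e" for c d e x y :: real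
    using that by (simp add: algebra_simps)
  ultimately show ?thesis unfolding sp using 1 2 by blast
qed

end

section \<open>Normalisation\<close>

lemma card_supersets:
  assumes "finite A" "T \<subseteq> A" "card T \<le> m"
  shows "card {B. B \<subseteq> A \<and> card B = m \<and> T \<subseteq> B} = (card A - card T) choose (m - card T)"
proof -
  have fT: "finite T" using assms finite_subset by blast
  have "bij_betw (\<lambda>B. B \<union> T) {B. B \<subseteq> A - T \<and> card B = m - card T} {B. B \<subseteq> A \<and> card B = m \<and> T \<subseteq> B}"
  proof (rule bij_betw_byWitness[where f' = "\<lambda>B. B - T"])
    show "(\<lambda>B. B \<union> T) ` {B. B \<subseteq> A - T \<and> card B = m - card T} \<subseteq> {B. B \<subseteq> A \<and> card B = m \<and> T \<subseteq> B}"
    proof clarify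
      fix B assume B: "B \<subseteq> A - T" "card B = m - card T"
      then have "card (B \<union> T) = card B + card T" using assms fT finite_subset[of B A] by (intro card_Un_disjoint) auto
      then show "B \<union> T \<subseteq> A \<and> card (B \<union> T) = m \<and> T \<subseteq> B \<union> T" using B assms by auto
    qed
    show "(\<lambda>B. B - T) ` {B. B \<subseteq> A \<and> card B = m \<and> T \<subseteq> B} \<subseteq> {B. B \<subseteq> A - T \<and> card B = m - card T}"
      using fT by (auto simp: card_Diff_subset)
  qed auto
  then have "card {B. B \<subseteq> A \<and> card B = m \<and> T \<subseteq> B} = card {B. B \<subseteq> A - T \<and> card B = m - card T}" by (simp add: bij_betw_same_card)
  then show ?thesis using assms fT by (simp add: n_subsets card_Diff_subset)
qed

lemma card_avoiding:
  assumes "finite A" "T \<subseteq> A"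
  shows "card {B. B \<subseteq> A \<and> card B = m \<and> B \<inter> T = {}} = (card A - card T) choose m"
proof -
  have "{B. B \<subseteq> A \<and> card B = m \<and> B \<inter> T = {}} = {B. B \<subseteq> A - T \<and> card B = m}" by auto
  then show ?thesis using assms finite_subset[OF assms(2,1)] by (simp add: n_subsets card_Diff_subset)
qed

lemma binomial_pred: "real w * real ((w - 1) choose (N - 1)) = real N * real (w choose N)" if "1 \<le> N"
  using times_binomial_minus1_eq[of N w] that by (metis less_eq_Suc_le One_nat_def of_nat_mult)

lemma binomial_pred': "real w * real ((w - 1) choose N) = (real w - real N) * real (w choose N)" if "N \<le> w"
  using binomial_absorb_comp[of w N] that by (metis of_nat_diff of_nat_mult)

text \<open>Drawing without replacement, each further prescribed element has conditional probability
  (N - j) / (w - j) \<le> N / w, so prescribed elements are negatively correlated.\<close>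

lemma binomial_superset_le:
  assumes "N \<le> w" "0 < w" "j \<le> N"
  shows "real ((w - j) choose (N - j)) \<le> (real N / real w) ^ j * real (w choose N)"
  using assms(3)
proof (induction j)
  case (Suc j)
  have wj: "0 < w - j" using Suc.prems assms by simp
  have "real (w - j) * real ((w - j - 1) choose (N - j - 1)) = real (N - j) * real ((w - j) choose (N - j))"
    using Suc.prems by (intro binomial_pred) simp
  then have "real ((w - Suc j) choose (N - Suc j)) = real (N - j) / real (w - j) * real ((w - j) choose (N - j))"
    using wj by (simp add: field_simps)
  also have "\<dots> \<le> real N / real w * ((real N / real w) ^ j * real (w choose N))"
  proof (rule mult_mono)
    have "real (N - j) * real w \<le> real N * real (w - j)" using Suc.prems assms mult_right_mono[of "real N" "real w" "real j"] by (simp add: of_nat_diff algebra_simps)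
    then show "real (N - j) / real (w - j) \<le> real N / real w" using wj assms by (simp add: field_simps)
    show "real ((w - j) choose (N - j)) \<le> (real N / real w) ^ j * real (w choose N)" using Suc by simp
  qed auto
  finally show ?case by simp
qed simp

lemma binomial_avoid_le:
  assumes "N \<le> w" "0 < w" "j \<le> w"
  shows "real ((w - j) choose N) \<le> (1 - real N / real w) ^ j * real (w choose N)"
  using assms(3)
proof (induction j)
  case (Suc j)
  have wj: "0 < w - j" using Suc.prems by simp
  have q: "0 \<le> 1 - real N / real w" using assms by simp
  show ?case
  proof (cases "N \<le> w - j")
    case True
    have "real (w - j) * real ((w - j - 1) choose N) = (real (w - j) - real N) * real ((w - j) choose N)" by (rule binomial_pred'[OF True])
    then have "real ((w - Suc j) choose N) = (real (w - j) - real N) / real (w - j) * real ((w - j) choose N)"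
      using wj by (simp add: field_simps)
    also have "\<dots> \<le> (1 - real N / real w) * ((1 - real N / real w) ^ j * real (w choose N))"
    proof (rule mult_mono)
      have "real N * real (w - j) \<le> real N * real w" by (intro mult_left_mono) auto
      then have "real N / real w \<le> real N / real (w - j)" using wj assms by (simp add: field_simps)
      moreover have "(real (w - j) - real N) / real (w - j) = 1 - real N / real (w - j)" using wj by (simp add: diff_divide_distrib)
      ultimately show "(real (w - j) - real N) / real (w - j) \<le> 1 - real N / real w" by simp
      show "real ((w - j) choose N) \<le> (1 - real N / real w) ^ j * real (w choose N)" using Suc by simp
    qed (use q in auto)
    finally show ?thesis by simp
  next
    case False
    then have c: "(w - Suc j) choose N = 0" by (simp add: binomial_eq_0)
    show ?thesis unfolding c using zero_le_power[OF q, of "Suc j"] by simp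
  qed
qed simp

lemma card_outdeg: assumes "G \<subseteq> {..<n} \<times> {..<n}" shows "card G = (\<Sum>i<n. outdeg G i)"
proof -
  have "G = (SIGMA i:{..<n}. {k. (i,k) \<in> G})" using assms by auto
  then have "card G = card (SIGMA i:{..<n}. {k. (i,k) \<in> G})" by simp
  also have "\<dots> = (\<Sum>i<n. outdeg G i)" unfolding outdeg_def using finite_row[OF assms] by (intro card_SigmaI) auto
  finally show ?thesis .
qed

lemma card_indeg: assumes "G \<subseteq> {..<n} \<times> {..<n}" shows "card G = (\<Sum>k<n. indeg G k)"
proof -
  have "card G = card (G\<inverse>)" by (simp add: card_inverse)
  also have "\<dots> = (\<Sum>i<n. outdeg (G\<inverse>) i)" using assms by (intro card_outdeg) auto
  finally show ?thesis by (simp add: outdeg_def indeg_def)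
qed

context host
begin

section \<open>Uniform sets of cells and independent rows\<close>

definition Nt :: nat where "Nt = (\<Sum>j<n. s j)"

definition OmU :: "arcs set" where "OmU = {G. G \<subseteq> W \<and> card G = Nt}"
definition OmR :: "arcs set" where "OmR = {G. G \<subseteq> W \<and> (\<forall>i<n. outdeg G i = s i)}"

lemma W_sub: "W \<subseteq> {..<n} \<times> {..<n}" and finite_W: "finite W" by (auto simp: W_def)

lemma finite_Om: "finite OmU" "finite OmR"
  by (rule finite_subset[of _ "Pow W"]; auto simp: OmU_def OmR_def finite_W)+

lemma card_W: "card W = n^2 - Xnum n H"
proof -
  have "card W = card ({..<n} \<times> {..<n}) - card H" unfolding W_def using H_sub finite_subset[OF H_sub] by (intro card_Diff_subset) auto
  then show ?thesis using card_outdeg[OF H_sub] by (simp add: Xnum_def power2_eq_square)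
qed

lemma X_half: "X + 1 \<le> real n ^ 2 / 2" "z * n \<le> real n ^ 2 / (4 * z)"
proof -
  have "4 * (z ^ 2 * 1) \<le> z ^ 3 * 1" using absorb[of 1 4 2] by (simp add: eval_nat_numeral)
  also have "\<dots> \<le> n" using z_le_r[of 3] r_le_n by simp
  finally have "4 * z ^ 2 * n \<le> n * real n" using n_pos by (intro mult_right_mono) auto
  then show 1: "z * n \<le> real n ^ 2 / (4 * z)" using z_pos by (simp add: field_simps power2_eq_square)
  have "real n ^ 2 / (4 * z) \<le> real n ^ 2 / 4" using z_ge by (intro divide_left_mono) auto
  moreover have "10000 * 10000 \<le> real n ^ 2" using mult_mono[OF n_ge n_ge] by (simp add: power2_eq_square)
  ultimately show "X + 1 \<le> real n ^ 2 / 2" using X_le 1 by linarith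
qed

lemma card_W_real: "real (card W) = real n ^ 2 - X" "real n ^ 2 / 2 \<le> real (card W) - 1"
proof -
  have "real (Xnum n H) \<le> real (n^2)" using X_half(1) zero_le_power2[of "real n"] unfolding of_nat_power by linarith
  then show 1: "real (card W) = real n ^ 2 - X" unfolding card_W by (simp add: of_nat_diff)
  show "real n ^ 2 / 2 \<le> real (card W) - 1" unfolding 1 using X_half by simp
qed

lemma Nt_L: "real Nt = L * real n ^ 2"
  using n_pos by (simp add: Nt_def lam_def avg_deg_def power2_eq_square)

lemma Nt_bounds: "2 \<le> Nt" "Nt \<le> card W"
proof -
  have "v \<le> L" "v \<le> 1 - L" using L01 mult_mono[of L 1 "1 - L" "1 - L"] mult_mono[of L L "1 - L" 1] by auto
  then have zL: "1 / z \<le> L" "1 / z \<le> 1 - L" using v_ge by linarith+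
  have 1: "real n ^ 2 / z \<le> c * real n ^ 2" if "1 / z \<le> c" for c using mult_right_mono[OF that, of "real n ^ 2"] by simp
  have "2 * 1 \<le> z * real n" using z_ge n_ge by (intro mult_mono) auto
  moreover have "real n ^ 2 / (4 * z) \<le> real n ^ 2 / z" using z_pos by (intro divide_left_mono) auto
  ultimately have "2 \<le> real Nt" unfolding Nt_L using 1[OF zL(1)] X_half(2) by linarith
  then show "2 \<le> Nt" by linarith
  have "real n ^ 2 / (4 * z) \<le> real n ^ 2 / z" using z_pos by (intro divide_left_mono) auto
  then have "X \<le> (1 - L) * real n ^ 2" using 1[OF zL(2)] X_half(2) X_le by linarith
  then have "real Nt \<le> real (card W)" unfolding Nt_L card_W_real(1) by (simp add: algebra_simps)
  then show "Nt \<le> card W" by linarith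
qed

lemma card_OmU: "card OmU = (card W choose Nt)"
  unfolding OmU_def using finite_W by (simp add: n_subsets)

lemma prod_const_image: "card ((\<lambda>i. (i,k)) ` I) = card I" by (rule card_image) (simp add: inj_on_def)

text \<open>The density on the allowed cells exceeds L by at most 2 z / n, because only X of the n^2
  cells are removed. The mean of eta in a column is therefore at most 2z.\<close>

lemma uniform_model: "colmodel n H s z OmU (\<lambda>_. real Nt / real (card W))"
proof
  let ?p = "real Nt / real (card W)"
  have w0: "0 < card W" using Nt_bounds by linarith
  show "finite OmU" by (rule finite_Om)
  have "0 < card OmU" unfolding card_OmU using Nt_bounds by (simp add: zero_less_binomial_iff)
  then show "OmU \<noteq> {}" by auto
  show "G \<subseteq> W" if "G \<in> OmU" for G using that by (simp add: OmU_def)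
  show "(\<Sum>j<n. s j) = (\<Sum>k<n. indeg G k)" if "G \<in> OmU" for G
  proof -
    have "G \<subseteq> {..<n} \<times> {..<n}" using that W_sub by (auto simp: OmU_def)
    from card_indeg[OF this] show ?thesis using that by (simp add: OmU_def Nt_def)
  qed
  show "0 \<le> ?p \<and> ?p \<le> 1" using Nt_bounds w0 by (simp add: divide_le_eq)
  have pe: "?p - L = L * X / card W"
  proof -
    have "?p - L = (L * real n ^ 2 - L * card W) / card W" using w0 by (simp add: Nt_L diff_divide_distrib)
    then show ?thesis unfolding card_W_real(1) by (simp add: algebra_simps)
  qed
  have pl: "0 \<le> ?p - L" "?p - L \<le> 2 * z / n"
  proof -
    show "0 \<le> ?p - L" unfolding pe using L01 by simp
    have "L * X / card W \<le> (1 * (z * n)) / (real n ^ 2 / 2)"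
      using L01 X_le card_W_real(2) n_pos z_pos by (intro frac_le mult_mono) auto
    also have "\<dots> = 2 * z / n" using n_pos by (simp add: power2_eq_square)
    finally show "?p - L \<le> 2 * z / n" unfolding pe .
  qed
  show "\<bar>?p - L\<bar> \<le> 2 * z / r"
  proof -
    have "2 * z / n \<le> 2 * z / r" using r_le_n r_pos z_pos by (intro divide_left_mono) auto
    then show ?thesis using pl by linarith
  qed
  show "\<bar>\<Sum>i\<in>Wc k. ?p - L\<bar> \<le> z ^ 3" for k
  proof -
    have "\<bar>\<Sum>i\<in>Wc k. ?p - L\<bar> = real (card (Wc k)) * (?p - L)" using pl(1) by (simp add: abs_mult)
    also have "\<dots> \<le> n * (2 * z / n)" using pl card_Wc_real[of k] by (intro mult_mono) auto
    also have "\<dots> = 2 * (z ^ 1 * 1)" using n_pos by simp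
    also have "\<dots> \<le> z ^ 3" using absorb[of 1 2 1] zr_mono[of 2 3 1] by (simp add: eval_nat_numeral)
    finally show ?thesis .
  qed
  fix k assume k: "k < n"
  have T: "(\<lambda>i. (i,k)) ` I \<subseteq> W" if "I \<subseteq> Wc k" for I using that k by (auto simp: Wc_def W_def)
  show "real (card {G\<in>OmU. \<forall>i\<in>I. (i,k) \<in> G}) \<le> (\<Prod>i\<in>I. ?p) * card OmU" if I: "I \<subseteq> Wc k" for I
  proof -
    have e: "{G\<in>OmU. \<forall>i\<in>I. (i,k) \<in> G} = {G. G \<subseteq> W \<and> card G = Nt \<and> (\<lambda>i. (i,k)) ` I \<subseteq> G}" by (auto simp: OmU_def)
    show ?thesis
    proof (cases "card I \<le> Nt")
      case True
      have "card {G\<in>OmU. \<forall>i\<in>I. (i,k) \<in> G} = ((card W - card I) choose (Nt - card I))"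
        unfolding e using card_supersets[OF finite_W T[OF I]] True by (simp add: prod_const_image)
      then show ?thesis using binomial_superset_le[OF Nt_bounds(2) w0 True] by (simp add: card_OmU)
    next
      case False
      have "{G\<in>OmU. \<forall>i\<in>I. (i,k) \<in> G} = {}"
      proof (rule ccontr)
        assume "\<not> ?thesis"
        then obtain G where G: "G \<subseteq> W" "card G = Nt" "(\<lambda>i. (i,k)) ` I \<subseteq> G" unfolding e by blast
        then have "card ((\<lambda>i. (i,k)) ` I) \<le> card G" using finite_subset[OF G(1) finite_W] by (intro card_mono) auto
        then show False using False G by (simp add: prod_const_image)
      qed
      then have c: "card {G\<in>OmU. \<forall>i\<in>I. (i,k) \<in> G} = 0" by (simp only: card.empty)
      show ?thesis unfolding c by simp
    qed
  qed
  show "real (card {G\<in>OmU. \<forall>i\<in>I. (i,k) \<notin> G}) \<le> (\<Prod>i\<in>I. 1 - ?p) * card OmU" if I: "I \<subseteq> Wc k" for I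
  proof -
    have e: "{G\<in>OmU. \<forall>i\<in>I. (i,k) \<notin> G} = {G. G \<subseteq> W \<and> card G = Nt \<and> G \<inter> (\<lambda>i. (i,k)) ` I = {}}" by (auto simp: OmU_def)
    have "card I \<le> card W" using card_mono[OF finite_W T[OF I]] by (simp add: prod_const_image)
    then show ?thesis unfolding e using card_avoiding[OF finite_W T[OF I], of Nt] binomial_avoid_le[OF Nt_bounds(2) w0, of "card I"]
      by (simp add: prod_const_image card_OmU)
  qed
  fix i j assume ij: "i \<in> Wc k" "j \<in> Wc k" "i \<noteq> j"
  show "(?p * ?p - 2 / n^2) * card OmU \<le> real (card {G\<in>OmU. (i,k) \<in> G \<and> (j,k) \<in> G})"
  proof -
    let ?w = "real (card W)" and ?N = "real Nt"
    have e: "{G\<in>OmU. (i,k) \<in> G \<and> (j,k) \<in> G} = {G. G \<subseteq> W \<and> card G = Nt \<and> {(i,k),(j,k)} \<subseteq> G}" by (auto simp: OmU_def)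
    have c: "card {G\<in>OmU. (i,k) \<in> G \<and> (j,k) \<in> G} = ((card W - 2) choose (Nt - 2))"
      unfolding e using card_supersets[OF finite_W, of "{(i,k),(j,k)}" Nt] T[of "{i,j}"] ij Nt_bounds by (simp add: numeral_2_eq_2)
    have mult: "w * w' * y = a * a' * c" if "w * x = a * c" "w' * y = a' * x" for w w' x y a a' c :: real using that by algebra
    have "?w * real ((card W - 1) choose (Nt - 1)) = ?N * real (card W choose Nt)" using Nt_bounds by (intro binomial_pred) simp
    moreover have "real (card W - 1) * real ((card W - 1 - 1) choose (Nt - 1 - 1)) = real (Nt - 1) * real ((card W - 1) choose (Nt - 1))"
      using Nt_bounds by (intro binomial_pred) simp
    ultimately have "?w * real (card W - 1) * real ((card W - 1 - 1) choose (Nt - 1 - 1)) = ?N * real (Nt - 1) * real (card W choose Nt)"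
      by (rule mult)
    moreover have "card W - 1 - 1 = card W - 2" "Nt - 1 - 1 = Nt - 2" "real (card W - 1) = ?w - 1" "real (Nt - 1) = ?N - 1"
      using Nt_bounds by (simp_all add: of_nat_diff)
    ultimately have 1: "?w * (?w - 1) * real ((card W - 2) choose (Nt - 2)) = ?N * (?N - 1) * real (card W choose Nt)" by simp
    have w1: "1 < ?w"
    proof -
      have "0 < real n ^ 2 / 2" using n_pos by simp
      then show ?thesis using card_W_real(2) by linarith
    qed
    have 2: "(?p * ?p - 2 / n^2) * (?w * (?w - 1)) \<le> ?N * (?N - 1)"
    proof -
      have p1: "0 \<le> ?p" "?p \<le> 1" using Nt_bounds w0 by (simp_all add: divide_le_eq)
      have "?p * ?p * (?w * (?w - 1)) = ?N * (?p * (?w - 1))" using w0 by simp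
      also have "?p * (?w - 1) = ?N - ?p" using w0 by (simp add: right_diff_distrib)
      finally have 1: "?p * ?p * (?w * (?w - 1)) = ?N * (?N - 1) + ?N * (1 - ?p)" by (simp add: algebra_simps)
      have "?N * (1 - ?p) \<le> ?w * 1" using p1 Nt_bounds by (intro mult_mono) auto
      moreover have "1 * ?w \<le> 2 / n^2 * (?w - 1) * ?w"
      proof (rule mult_right_mono)
        have "2 / n^2 * (real n ^ 2 / 2) \<le> 2 / n^2 * (?w - 1)" using card_W_real(2) by (intro mult_left_mono) auto
        then show "1 \<le> 2 / n^2 * (?w - 1)" using n_pos by simp
      qed simp
      ultimately show ?thesis using 1 unfolding left_diff_distrib by (simp add: mult_ac)
    qed
    have fin: "x * c \<le> y" if "d * y = e * c" "x * d \<le> e" "0 < d" "0 \<le> c" for x y c d e :: real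
    proof -
      have "d * (x * c) \<le> d * y" unfolding that(1) using mult_right_mono[OF that(2,4)] by (simp add: mult_ac)
      then show ?thesis using that(3) by simp
    qed
    show ?thesis unfolding card_OmU c by (rule fin[OF 1 2]) (use w1 in auto)
  qed
qed

lemma row_range: assumes "i < n" shows "1 \<le> s i" "s i + outdeg H i < n" "real (outdeg H i) \<le> n / 2"
proof -
  have "\<bar>real (s i) - n * L + L * outdeg H i\<bar> \<le> z * r" using delta_le[OF assms] by (simp add: delta_def avg_L)
  from range_aux[OF this _ out_le[OF assms]] show "1 \<le> s i" "s i + outdeg H i < n" "real (outdeg H i) \<le> n / 2" by linarith+
qed

lemma card_OmR_gen:
  assumes "\<And>i. i < n \<Longrightarrow> \<A> i \<subseteq> {B. B \<subseteq> Wr i \<and> card B = s i}"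
  shows "card {G\<in>OmR. \<forall>i<n. {k. (i,k) \<in> G} \<in> \<A> i} = (\<Prod>i<n. card (\<A> i))"
proof -
  have "{G\<in>OmR. \<forall>i<n. {k. (i,k) \<in> G} \<in> \<A> i} = {G. G \<subseteq> {..<n} \<times> {..<n} \<and> (\<forall>i<n. {k. (i,k) \<in> G} \<in> \<A> i)}"
  proof (intro equalityI subsetI)
    fix G assume "G \<in> {G\<in>OmR. \<forall>i<n. {k. (i,k) \<in> G} \<in> \<A> i}"
    then show "G \<in> {G. G \<subseteq> {..<n} \<times> {..<n} \<and> (\<forall>i<n. {k. (i,k) \<in> G} \<in> \<A> i)}" using W_sub by (auto simp: OmR_def)
  next
    fix G assume "G \<in> {G. G \<subseteq> {..<n} \<times> {..<n} \<and> (\<forall>i<n. {k. (i,k) \<in> G} \<in> \<A> i)}"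
    then have G: "G \<subseteq> {..<n} \<times> {..<n}" "\<And>i. i < n \<Longrightarrow> {k. (i,k) \<in> G} \<in> \<A> i" by auto
    then have "\<And>i. i < n \<Longrightarrow> {k. (i,k) \<in> G} \<subseteq> Wr i \<and> card {k. (i,k) \<in> G} = s i" using assms by blast
    then have "G \<in> OmR" using G(1) by (auto simp: OmR_def outdeg_def W_def Wr_def)
    then show "G \<in> {G\<in>OmR. \<forall>i<n. {k. (i,k) \<in> G} \<in> \<A> i}" using G by simp
  qed
  moreover have "\<A> i \<subseteq> Pow {..<n}" if "i < n" for i using assms[OF that] by (auto simp: Wr_def)
  ultimately show ?thesis using card_rows[of n \<A>] by simp
qed

lemma OmR_row: "G \<in> OmR \<Longrightarrow> i < n \<Longrightarrow> {k. (i,k) \<in> G} \<subseteq> Wr i \<and> card {k. (i,k) \<in> G} = s i"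
  by (auto simp: OmR_def outdeg_def W_def Wr_def)

lemma card_OmR: "card OmR = (\<Prod>i<n. (n - outdeg H i) choose s i)"
proof -
  have "{G\<in>OmR. \<forall>i<n. {k. (i,k) \<in> G} \<in> {B. B \<subseteq> Wr i \<and> card B = s i}} = OmR" using OmR_row by auto
  then have "card OmR = (\<Prod>i<n. card {B. B \<subseteq> Wr i \<and> card B = s i})"
    using card_OmR_gen[of "\<lambda>i. {B. B \<subseteq> Wr i \<and> card B = s i}"] by simp
  then show ?thesis by (simp add: n_subsets finite_Wr card_Wr)
qed

text \<open>The cells of one column lie in different rows and the rows are chosen independently, so
  the joint probabilities are exact products.\<close>

lemma row_counts:
  assumes k: "k < n" and I: "I \<subseteq> Wc k"
  defines "p \<equiv> \<lambda>i. real (s i) / (real n - outdeg H i)"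
  shows "real (card {G\<in>OmR. \<forall>i\<in>I. (i,k) \<in> G}) = (\<Prod>i\<in>I. p i) * card OmR"
    "real (card {G\<in>OmR. \<forall>i\<in>I. (i,k) \<notin> G}) = (\<Prod>i\<in>I. 1 - p i) * card OmR"
proof -
  have kw: "k \<in> Wr i" "i < n" if "i \<in> I" for i using I that k by (auto simp: Wc_def Wr_def)
  have cW: "real (card (Wr i)) = real n - outdeg H i" "0 < real n - outdeg H i" "s i \<le> card (Wr i)" if "i < n" for i
    using row_range[OF that] by (auto simp: card_Wr of_nat_diff)
  have sub: "I \<subseteq> {..<n}" using kw by auto
  have gen: "real (card {G\<in>OmR. \<forall>i\<in>I. P i G}) = (\<Prod>i\<in>I. q i) * card OmR"
    if P: "\<And>G i. i < n \<Longrightarrow> P i G = Q {k. (i,k) \<in> G}"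
      and c: "\<And>i. i \<in> I \<Longrightarrow> real (card {B. B \<subseteq> Wr i \<and> card B = s i \<and> Q B}) = q i * real (card (Wr i) choose s i)" for P Q q
  proof -
    define \<A> where "\<A> i = {B. B \<subseteq> Wr i \<and> card B = s i \<and> (i \<in> I \<longrightarrow> Q B)}" for i
    have "{G\<in>OmR. \<forall>i\<in>I. P i G} = {G\<in>OmR. \<forall>i<n. {k. (i,k) \<in> G} \<in> \<A> i}" using OmR_row kw P unfolding \<A>_def by auto
    then have "card {G\<in>OmR. \<forall>i\<in>I. P i G} = (\<Prod>i<n. card (\<A> i))" using card_OmR_gen[of \<A>] by (auto simp: \<A>_def)
    then have "real (card {G\<in>OmR. \<forall>i\<in>I. P i G}) = (\<Prod>i<n. real (card (\<A> i)))" by simp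
    also have "\<dots> = (\<Prod>i<n. (if i \<in> I then q i else 1) * real ((n - outdeg H i) choose s i))"
      by (rule prod.cong) (auto simp: \<A>_def c n_subsets finite_Wr card_Wr)
    also have "\<dots> = (\<Prod>i<n. if i \<in> I then q i else 1) * (\<Prod>i<n. real ((n - outdeg H i) choose s i))" by (rule prod.distrib)
    also have "(\<Prod>i<n. if i \<in> I then q i else 1) = (\<Prod>i\<in>I. q i)" using sub by (simp add: prod.If_cases Int_absorb1)
    finally show ?thesis by (simp add: card_OmR)
  qed
  show "real (card {G\<in>OmR. \<forall>i\<in>I. (i,k) \<in> G}) = (\<Prod>i\<in>I. p i) * card OmR"
  proof (rule gen[where Q = "\<lambda>B. k \<in> B"])
    fix i assume I: "i \<in> I"
    then have i: "i < n" by (rule kw)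
    have "card {B. B \<subseteq> Wr i \<and> card B = s i \<and> k \<in> B} = ((card (Wr i) - 1) choose (s i - 1))"
      using card_supersets[OF finite_Wr, of "{k}" i "s i"] kw[OF I] row_range(1)[OF i] by simp
    moreover have "real (card (Wr i)) * real ((card (Wr i) - 1) choose (s i - 1)) = real (s i) * real (card (Wr i) choose s i)"
      by (rule binomial_pred[OF row_range(1)[OF i]])
    moreover have "y = c / w * x" if "w * y = c * x" "0 < w" for w y c x :: real using that by (simp add: field_simps)
    ultimately show "real (card {B. B \<subseteq> Wr i \<and> card B = s i \<and> k \<in> B}) = p i * real (card (Wr i) choose s i)"
      using cW[OF i] unfolding p_def by metis
  qed simp
  show "real (card {G\<in>OmR. \<forall>i\<in>I. (i,k) \<notin> G}) = (\<Prod>i\<in>I. 1 - p i) * card OmR"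
  proof (rule gen[where Q = "\<lambda>B. k \<notin> B"])
    fix i assume I: "i \<in> I"
    then have i: "i < n" by (rule kw)
    have "card {B. B \<subseteq> Wr i \<and> card B = s i \<and> k \<notin> B} = ((card (Wr i) - 1) choose s i)"
      using card_avoiding[OF finite_Wr, of "{k}" i "s i"] kw[OF I] by simp
    moreover have "real (card (Wr i)) * real ((card (Wr i) - 1) choose s i) = (real (card (Wr i)) - real (s i)) * real (card (Wr i) choose s i)"
      by (rule binomial_pred'[OF cW(3)[OF i]])
    moreover have "y = (1 - c / w) * x" if "w * y = (w - c) * x" "0 < w" for w y c x :: real using that by (simp add: field_simps)
    ultimately show "real (card {B. B \<subseteq> Wr i \<and> card B = s i \<and> k \<notin> B}) = (1 - p i) * real (card (Wr i) choose s i)"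
      using cW[OF i] unfolding p_def by metis
  qed simp
qed

text \<open>The cell probabilities satisfy p_i - L = delta_i / (n - x_i). Over all rows these sum to
  order z^2, because the delta_i add up to only L X; the at most z r forbidden rows of a column
  remove terms of size at most 2 z / r each.\<close>

lemma row_model: "colmodel n H s z OmR (\<lambda>i. real (s i) / (real n - outdeg H i))"
proof
  let ?p = "\<lambda>i. real (s i) / (real n - outdeg H i)"
  show "finite OmR" by (rule finite_Om)
  have "0 < card OmR" unfolding card_OmR
  proof (rule prod_pos, rule zero_less_binomial)
    show "s i \<le> n - outdeg H i" if "i \<in> {..<n}" for i using row_range(2)[of i] that by simp
  qed
  then show "OmR \<noteq> {}" by auto
  show "G \<subseteq> W" if "G \<in> OmR" for G using that by (simp add: OmR_def)
  show "(\<Sum>j<n. s j) = (\<Sum>k<n. indeg G k)" if "G \<in> OmR" for G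
  proof -
    have "G \<subseteq> {..<n} \<times> {..<n}" using that W_sub by (auto simp: OmR_def)
    from card_indeg[OF this] card_outdeg[OF this] show ?thesis using that by (simp add: OmR_def)
  qed
  have half: "n / 2 \<le> real n - outdeg H i" "0 < real n - outdeg H i" if "i < n" for i using row_range[OF that] by linarith+
  have pd: "?p i - L = dl i / (real n - outdeg H i)" if "i < n" for i
    using half[OF that] by (simp add: delta_def avg_L field_simps)
  show "0 \<le> ?p i \<and> ?p i \<le> 1" if "i < n" for i using half[OF that] row_range[OF that] by (auto simp: divide_le_eq)
  have zr2: "z * r / (n / 2) = 2 * z / r"
  proof -
    have "z * r / (n / 2) = 2 * (z * r / n)" by simp
    then show ?thesis unfolding zr_n by simp
  qed
  show "\<bar>?p i - L\<bar> \<le> 2 * z / r" if "i < n" for i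
    unfolding pd[OF that] zr2[symmetric] using half[OF that] delta_le[OF that] n_pos by (intro abs_divide_le) auto
  show "\<bar>\<Sum>i\<in>Wc k. ?p i - L\<bar> \<le> z ^ 3" if k: "k < n" for k
  proof -
    have 1: "(\<Sum>i\<in>Wc k. ?p i - L) = (\<Sum>i<n. ?p i - L) - (\<Sum>i\<in>{i. (i,k) \<in> H}. ?p i - L)"
    proof -
      have "Wc k = {..<n} - {i. (i,k) \<in> H}" by (auto simp: Wc_def)
      then show ?thesis using H_sub finite_H_col by (simp add: sum_diff subset_iff)
    qed
    have "(\<Sum>i<n. ?p i - L) = (\<Sum>i<n. dl i / n + dl i / n * (outdeg H i / (real n - outdeg H i)))"
    proof (rule sum.cong[OF refl])
      fix i assume "i \<in> {..<n}"
      then have i: "i < n" by simp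
      show "?p i - L = dl i / n + dl i / n * (outdeg H i / (real n - outdeg H i))"
        unfolding pd[OF i] using half[OF i] n_pos by (simp add: field_simps)
    qed
    then have e: "(\<Sum>i<n. ?p i - L) = L * X / n + (\<Sum>i<n. dl i / n * (outdeg H i / (real n - outdeg H i)))"
      by (simp add: sum.distrib sum_divide_distrib[symmetric] sum_dl)
    have "\<bar>\<Sum>i<n. dl i / n * (outdeg H i / (real n - outdeg H i))\<bar> \<le> (\<Sum>i<n. z / r * (2 * z / r))"
    proof (rule order_trans[OF sum_abs], rule sum_mono, rule abs_mult_le)
      fix i assume "i \<in> {..<n}"
      then have i: "i < n" by simp
      show "\<bar>dl i / n\<bar> \<le> z / r" by (rule dl_n[OF i])
      show "\<bar>outdeg H i / (real n - outdeg H i)\<bar> \<le> 2 * z / r"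
        unfolding zr2[symmetric] using half[OF i] out_le[OF i] n_pos by (intro abs_divide_le) auto
    qed
    also have "\<dots> = 2 * z ^ 2" using n_pos by (simp add: power2_eq_square)
    finally have 2: "\<bar>\<Sum>i<n. dl i / n * (outdeg H i / (real n - outdeg H i))\<bar> \<le> 2 * z ^ 2" .
    have "\<bar>\<Sum>i\<in>{i. (i,k) \<in> H}. ?p i - L\<bar> \<le> (\<Sum>i\<in>{i. (i,k) \<in> H}. 2 * z / r)"
    proof (rule order_trans[OF sum_abs], rule sum_mono)
      fix i assume "i \<in> {i. (i,k) \<in> H}"
      then have i: "i < n" using H_sub by auto
      show "\<bar>?p i - L\<bar> \<le> 2 * z / r" unfolding pd[OF i] zr2[symmetric] using half[OF i] delta_le[OF i] n_pos by (intro abs_divide_le) auto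
    qed
    also have "\<dots> = indeg H k * (2 * z / r)" by (simp add: indeg_def)
    also have "\<dots> \<le> z * r * (2 * z / r)" using in_le[OF k] z_pos r_pos by (intro mult_right_mono) auto
    also have "\<dots> = 2 * z ^ 2" using r_pos by (simp add: power2_eq_square)
    finally have 3: "\<bar>\<Sum>i\<in>{i. (i,k) \<in> H}. ?p i - L\<bar> \<le> 2 * z ^ 2" .
    have 4: "0 \<le> L * X / n" "L * X / n \<le> z"
    proof -
      have "L * X \<le> 1 * (z * n)" using L01 X_le by (intro mult_mono) auto
      then show "L * X / n \<le> z" using n_pos by (simp add: divide_le_eq)
    qed (use L01 in auto)
    have "z \<le> z ^ 2" "5 * (z ^ 2 * 1) \<le> z ^ 3 * 1" using z_ge absorb[of 1 5 2] by (simp_all add: power2_eq_square power3_eq_cube)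
    then show ?thesis unfolding 1 e using 2 3 4 by simp
  qed
  fix k assume k: "k < n"
  show "real (card {G\<in>OmR. \<forall>i\<in>I. (i,k) \<in> G}) \<le> (\<Prod>i\<in>I. ?p i) * card OmR" if I: "I \<subseteq> Wc k" for I
    using row_counts(1)[OF k I] by simp
  show "real (card {G\<in>OmR. \<forall>i\<in>I. (i,k) \<notin> G}) \<le> (\<Prod>i\<in>I. 1 - ?p i) * card OmR" if I: "I \<subseteq> Wc k" for I
    using row_counts(2)[OF k I] by simp
  fix i j assume ij: "i \<in> Wc k" "j \<in> Wc k" "i \<noteq> j"
  have "real (card {G\<in>OmR. (i,k) \<in> G \<and> (j,k) \<in> G}) = ?p i * ?p j * card OmR" using row_counts(1)[OF k, of "{i,j}"] ij by simp
  moreover have "(?p i * ?p j - 2 / n^2) * card OmR \<le> ?p i * ?p j * card OmR" by (intro mult_right_mono) auto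
  ultimately show "(?p i * ?p j - 2 / n^2) * card OmR \<le> real (card {G\<in>OmR. (i,k) \<in> G \<and> (j,k) \<in> G})" by linarith
qed

lemma indeg_outside: "G \<subseteq> W \<Longrightarrow> n \<le> k \<Longrightarrow> indeg G k = 0"
proof -
  assume "G \<subseteq> W" "n \<le> k"
  then have "{i. (i,k) \<in> G} = {}" by (auto simp: W_def)
  then show ?thesis by (simp add: indeg_def)
qed

text \<open>Column sums are compared as functions on all naturals, hence the condition that
  \<open>t\<close> vanishes from n on.\<close>

lemma count_OmR: assumes "\<And>k. n \<le> k \<Longrightarrow> t k = 0" shows "{G\<in>OmR. indeg G = t} = Mat n H s t"
proof (intro equalityI subsetI)
  fix G assume "G \<in> Mat n H s t"
  then have G: "G \<subseteq> W" "\<And>j. j < n \<Longrightarrow> outdeg G j = s j" "\<And>j. j < n \<Longrightarrow> indeg G j = t j" by (auto simp: Mat_def W_def)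
  have "indeg G = t"
  proof
    fix k show "indeg G k = t k" using G(3) indeg_outside[OF G(1)] assms by (cases "k < n") auto
  qed
  then show "G \<in> {G\<in>OmR. indeg G = t}" using G by (simp add: OmR_def)
qed (auto simp: OmR_def Mat_def W_def)

lemma count_OmU: assumes "\<And>k. n \<le> k \<Longrightarrow> t k = 0" "Nt = (\<Sum>k<n. t k)" shows "real (card {G\<in>OmU. indeg G = t}) = wt t"
proof -
  define \<A> where "\<A> k = {B. B \<subseteq> Wc k \<and> card B = t k}" for k
  have "{G\<in>OmU. indeg G = t} = {G. G \<subseteq> {..<n} \<times> {..<n} \<and> (\<forall>k<n. {i. (i,k) \<in> G} \<in> \<A> k)}"
  proof (intro equalityI subsetI)
    fix G assume "G \<in> {G\<in>OmU. indeg G = t}"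
    then have "G \<subseteq> W" "indeg G = t" by (auto simp: OmU_def)
    then show "G \<in> {G. G \<subseteq> {..<n} \<times> {..<n} \<and> (\<forall>k<n. {i. (i,k) \<in> G} \<in> \<A> k)}" by (auto simp: \<A>_def indeg_def W_def Wc_def)
  next
    fix G assume "G \<in> {G. G \<subseteq> {..<n} \<times> {..<n} \<and> (\<forall>k<n. {i. (i,k) \<in> G} \<in> \<A> k)}"
    then have G: "G \<subseteq> {..<n} \<times> {..<n}" "\<And>k. k < n \<Longrightarrow> {i. (i,k) \<in> G} \<subseteq> Wc k \<and> indeg G k = t k" by (auto simp: \<A>_def indeg_def)
    have W: "G \<subseteq> W" using G by (auto simp: W_def Wc_def)
    have "indeg G = t"
    proof
      fix k show "indeg G k = t k" using G(2) indeg_outside[OF W] assms(1) by (cases "k < n") auto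
    qed
    then show "G \<in> {G\<in>OmU. indeg G = t}" using W card_indeg[OF G(1)] assms(2) by (simp add: OmU_def)
  qed
  moreover have "\<A> k \<subseteq> Pow {..<n}" for k by (auto simp: \<A>_def Wc_def)
  ultimately have "card {G\<in>OmU. indeg G = t} = (\<Prod>k<n. card (\<A> k))" using card_cols[of n \<A>] by simp
  then show ?thesis by (simp add: \<A>_def n_subsets finite_Wc card_Wc wt_def)
qed

section \<open>Comparison of the two total counts\<close>

text \<open>For the first bound, multiply N(u) F(t) \<le> N(t) F(u) exp \<kappa> by exp (-B(u)). The
  right side becomes N(t) wt(u) exp \<kappa>, summable to the uniform count, and on the left 1 -
  B(u) is a lower bound whose mean over random rows is known. The second bound is the mirror image,
  with 1 + B and the uniform model.\<close>

lemma norm_bounds: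
  assumes t: "bx t"
  defines "\<kappa> \<equiv> z ^ 45 / r"
  shows "FF t * ((1 - z ^ 14 / r) * card OmR) \<le> real (card (Mat n H s t)) * exp \<kappa> * card OmU"
    "real (card (Mat n H s t)) * ((1 - z ^ 14 / r) * card OmU) \<le> FF t * exp \<kappa> * card OmR"
proof -
  interpret U: colmodel n H s z OmU "\<lambda>_. real Nt / real (card W)" by (rule uniform_model)
  interpret R: colmodel n H s z OmR "\<lambda>i. real (s i) / (real n - outdeg H i)" by (rule row_model)
  let ?N = "\<lambda>t. real (card (Mat n H s t))"
  \<comment> \<open>Admissible column sums occurring in either model: one finite index set over
    which both families are regrouped.\<close>
  define TT where "TT = {u \<in> indeg ` (OmU \<union> OmR). bx u}"
  have finT: "finite TT" unfolding TT_def using finite_Om by auto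
  have T: "bx u" "\<And>k. n \<le> k \<Longrightarrow> u k = 0" "Nt = (\<Sum>k<n. u k)" if "u \<in> TT" for u
    using that indeg_outside by (auto simp: TT_def bx_def OmU_def OmR_def Nt_def)
  have grpR: "(\<Sum>G\<in>{G\<in>OmR. bx (indeg G)}. f (indeg G)) = (\<Sum>u\<in>TT. ?N u * f u)" for f :: "_ \<Rightarrow> real"
  proof -
    have "(\<Sum>G\<in>{G\<in>OmR. bx (indeg G)}. f (indeg G)) = (\<Sum>u\<in>TT. \<Sum>G\<in>{G\<in>{G\<in>OmR. bx (indeg G)}. indeg G = u}. f (indeg G))"
      using finT finite_Om by (intro sum.group[symmetric]) (auto simp: TT_def)
    also have "\<dots> = (\<Sum>u\<in>TT. \<Sum>G\<in>{G\<in>OmR. indeg G = u}. f u)" by (intro sum.cong) (auto dest: T(1))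
    also have "\<dots> = (\<Sum>u\<in>TT. ?N u * f u)" using count_OmR T(2) by (intro sum.cong) auto
    finally show ?thesis .
  qed
  have grpU: "(\<Sum>G\<in>{G\<in>OmU. bx (indeg G)}. f (indeg G)) = (\<Sum>u\<in>TT. wt u * f u)" for f :: "_ \<Rightarrow> real"
  proof -
    have "(\<Sum>G\<in>{G\<in>OmU. bx (indeg G)}. f (indeg G)) = (\<Sum>u\<in>TT. \<Sum>G\<in>{G\<in>{G\<in>OmU. bx (indeg G)}. indeg G = u}. f (indeg G))"
      using finT finite_Om by (intro sum.group[symmetric]) (auto simp: TT_def)
    also have "\<dots> = (\<Sum>u\<in>TT. \<Sum>G\<in>{G\<in>OmU. indeg G = u}. f u)" by (intro sum.cong) (auto dest: T(1))
    also have "\<dots> = (\<Sum>u\<in>TT. wt u * f u)"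
    proof (rule sum.cong[OF refl])
      fix u assume "u \<in> TT"
      from count_OmU[OF T(2,3)[OF this]] show "(\<Sum>G\<in>{G\<in>OmU. indeg G = u}. f u) = wt u * f u" by simp
    qed
    finally show ?thesis .
  qed
  have F0: "0 < FF t" by (rule FF_pos[OF t])
  have wt0: "0 \<le> wt u" for u by (simp add: wt_def prod_nonneg)
  have "FF t * ((1 - z ^ 14 / r) * card OmR) \<le> FF t * (\<Sum>G\<in>{G\<in>OmR. bx (indeg G)}. 1 + (-1) * Bt (indeg G))"
    using F0 by (intro mult_left_mono R.box_mean) auto
  also have "\<dots> = (\<Sum>u\<in>TT. FF t * (?N u * (1 + (-1) * Bt u)))" unfolding grpR[of "\<lambda>u. 1 + (-1) * Bt u"] by (rule sum_distrib_left)
  also have "\<dots> \<le> (\<Sum>u\<in>TT. ?N t * exp \<kappa> * wt u)"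
  proof (rule sum_mono)
    fix u assume u: "u \<in> TT"
    have "FF t * (?N u * (1 + (-1) * Bt u)) \<le> FF t * (?N u * exp (- Bt u))"
      using F0 exp_ge_add_one_self[of "- Bt u"] by (intro mult_left_mono) auto
    also have "\<dots> = (?N u * FF t) * exp (- Bt u)" by (simp add: mult_ac)
    also have "\<dots> \<le> (?N t * FF u * exp \<kappa>) * exp (- Bt u)" unfolding \<kappa>_def by (intro mult_right_mono path t T(1)[OF u]) auto
    also have "\<dots> = ?N t * exp \<kappa> * wt u * (exp (Bt u) * exp (- Bt u))" by (simp add: FF_def mult_ac)
    also have "exp (Bt u) * exp (- Bt u) = 1" by (simp flip: exp_add)
    finally show "FF t * (?N u * (1 + (-1) * Bt u)) \<le> ?N t * exp \<kappa> * wt u" by simp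
  qed
  also have "\<dots> = ?N t * exp \<kappa> * (\<Sum>G\<in>{G\<in>OmU. bx (indeg G)}. 1)" using grpU[of "\<lambda>_. 1"] by (simp add: sum_distrib_left)
  also have "\<dots> \<le> ?N t * exp \<kappa> * card OmU" using card_mono[OF finite_Om(1), of "{G\<in>OmU. bx (indeg G)}"] by (intro mult_left_mono) auto
  finally show "FF t * ((1 - z ^ 14 / r) * card OmR) \<le> ?N t * exp \<kappa> * card OmU" .
  have "?N t * ((1 - z ^ 14 / r) * card OmU) \<le> ?N t * (\<Sum>G\<in>{G\<in>OmU. bx (indeg G)}. 1 + 1 * Bt (indeg G))"
    by (intro mult_left_mono U.box_mean) auto
  also have "\<dots> = (\<Sum>u\<in>TT. ?N t * (wt u * (1 + 1 * Bt u)))" unfolding grpU[of "\<lambda>u. 1 + 1 * Bt u"] by (rule sum_distrib_left)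
  also have "\<dots> \<le> (\<Sum>u\<in>TT. FF t * exp \<kappa> * ?N u)"
  proof (rule sum_mono)
    fix u assume u: "u \<in> TT"
    have "?N t * (wt u * (1 + 1 * Bt u)) \<le> ?N t * (wt u * exp (Bt u))"
      using wt0 exp_ge_add_one_self[of "Bt u"] by (intro mult_left_mono) auto
    also have "\<dots> = ?N t * FF u" by (simp add: FF_def)
    also have "\<dots> \<le> ?N u * FF t * exp \<kappa>" unfolding \<kappa>_def by (intro path t T(1)[OF u])
    finally show "?N t * (wt u * (1 + 1 * Bt u)) \<le> FF t * exp \<kappa> * ?N u" by (simp add: mult_ac)
  qed
  also have "\<dots> = FF t * exp \<kappa> * (\<Sum>G\<in>{G\<in>OmR. bx (indeg G)}. 1)" using grpR[of "\<lambda>_. 1"] by (simp add: sum_distrib_left)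
  also have "\<dots> \<le> FF t * exp \<kappa> * card OmR" using F0 card_mono[OF finite_Om(2), of "{G\<in>OmR. bx (indeg G)}"] by (intro mult_left_mono) auto
  finally show "?N t * ((1 - z ^ 14 / r) * card OmU) \<le> FF t * exp \<kappa> * card OmR" .
qed

lemma count_formula:
  assumes t: "bx t"
  obtains err where "\<bar>err\<bar> \<le> z ^ 46 / r"
    "real (card (Mat n H s t)) = inverse (real (card OmU)) * real (card OmR) * FF t * exp err"
proof -
  let ?N = "real (card (Mat n H s t))" and ?U = "real (card OmU)" and ?R = "real (card OmR)" and ?F = "FF t"
  define e where "e = z ^ 14 / r"
  have e: "0 \<le> e" "e \<le> 1 / 2"
  proof -
    show "0 \<le> e" using z_pos by (simp add: e_def)
    show "e \<le> 1 / 2" using zr_small[of 14] by (simp add: e_def)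
  qed
  have F: "0 < ?F" by (rule FF_pos[OF t])
  have U: "0 < ?U" using uniform_model by (intro colmodel.card_Om)
  have R: "0 < ?R" using row_model by (intro colmodel.card_Om)
  have e1: "exp (- (2 * e)) \<le> 1 - e"
  proof -
    have "0 \<le> e * (1 - 2 * e)" using e by simp
    then have "1 \<le> (1 - e) * (1 + 2 * e)" by (simp add: algebra_simps)
    also have "\<dots> \<le> (1 - e) * exp (2 * e)" using e exp_ge_add_one_self[of "2 * e"] by (intro mult_left_mono) auto
    finally have "1 * exp (- (2 * e)) \<le> (1 - e) * exp (2 * e) * exp (- (2 * e))" by (rule mult_right_mono) simp
    then show ?thesis by (simp add: mult.assoc flip: exp_add)
  qed
  define k where "k = z ^ 45 / r + 2 * e"
  have a1: "?F * ?R \<le> ?N * ?U * exp k"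
  proof -
    have "?F * (exp (- (2 * e)) * ?R) \<le> ?F * ((1 - e) * ?R)" using F e1 by (intro mult_left_mono mult_right_mono) auto
    also have "\<dots> \<le> ?N * exp (z ^ 45 / r) * ?U" using norm_bounds(1)[OF t] by (simp add: e_def)
    finally have "?F * (exp (- (2 * e)) * ?R) * exp (2 * e) \<le> ?N * exp (z ^ 45 / r) * ?U * exp (2 * e)" by (rule mult_right_mono) simp
    moreover have "?F * (exp (- (2 * e)) * ?R) * exp (2 * e) = ?F * ?R" by (simp add: exp_minus)
    moreover have "?N * exp (z ^ 45 / r) * ?U * exp (2 * e) = ?N * ?U * exp k" unfolding k_def exp_add by (simp add: mult_ac)
    ultimately show ?thesis by linarith
  qed
  have a2: "?N * ?U \<le> ?F * ?R * exp k"
  proof -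
    have "?N * (exp (- (2 * e)) * ?U) \<le> ?N * ((1 - e) * ?U)" using e1 by (intro mult_left_mono mult_right_mono) auto
    also have "\<dots> \<le> ?F * exp (z ^ 45 / r) * ?R" using norm_bounds(2)[OF t] by (simp add: e_def)
    finally have "?N * (exp (- (2 * e)) * ?U) * exp (2 * e) \<le> ?F * exp (z ^ 45 / r) * ?R * exp (2 * e)" by (rule mult_right_mono) simp
    moreover have "?N * (exp (- (2 * e)) * ?U) * exp (2 * e) = ?N * ?U" by (simp add: exp_minus)
    moreover have "?F * exp (z ^ 45 / r) * ?R * exp (2 * e) = ?F * ?R * exp k" unfolding k_def exp_add by (simp add: mult_ac)
    ultimately show ?thesis by linarith
  qed
  have FR: "0 < ?F * ?R" using F R by simp
  \<comment> \<open>Existence of a matrix is a consequence here: the lower bound forces N to be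
    positive, so the logarithm defining the error term makes sense.\<close>
  have NU: "0 < ?N * ?U"
  proof (rule ccontr)
    assume "\<not> ?thesis"
    then have "?N * ?U * exp k \<le> 0" unfolding not_less by (rule mult_nonpos_nonneg) simp
    then show False using a1 FR by linarith
  qed
  define err where "err = ln (?N * ?U / (?F * ?R))"
  have q: "0 < ?N * ?U / (?F * ?R)" using NU FR by simp
  have "err \<le> k"
  proof -
    have "?N * ?U / (?F * ?R) \<le> exp k" using a2 FR by (simp add: divide_le_eq mult_ac)
    then show ?thesis unfolding err_def using q by (metis exp_ln exp_le_cancel_iff)
  qed
  moreover have "- k \<le> err"
  proof -
    have "1 \<le> ?N * ?U / (?F * ?R) * exp k" using a1 FR by (simp add: le_divide_eq)
    then have "exp (- k) \<le> ?N * ?U / (?F * ?R)" by (simp add: exp_minus inverse_eq_divide divide_le_eq)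
    then show ?thesis unfolding err_def using q by (metis exp_ln exp_le_cancel_iff)
  qed
  moreover have "k \<le> z ^ 46 / r"
  proof -
    have "z ^ 14 * (1 / r) \<le> z ^ 45 * (1 / r)" by (rule zr_mono) auto
    moreover have "3 * (z ^ 45 * (1 / r)) \<le> z ^ 46 * (1 / r)" using absorb[of "1 / r" 3 45] by simp
    ultimately show ?thesis unfolding k_def e_def by simp
  qed
  ultimately have "\<bar>err\<bar> \<le> z ^ 46 / r" by linarith
  moreover have "?N = inverse ?U * ?R * ?F * exp err"
    unfolding err_def exp_ln[OF q] using U R F by (simp add: field_simps)
  ultimately show ?thesis by (rule that)
qed

end

section \<open>The counting formula\<close>

definition dg :: "nat \<Rightarrow> arcs" where "dg n = (\<lambda>i. (i,i)) ` {..<n}"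

lemma outdeg_dg: assumes "simple_digraph n H" "j < n" shows "outdeg (H \<union> dg n) j = outdeg H j + 1"
proof -
  have "{k. (j,k) \<in> H \<union> dg n} = insert j {k. (j,k) \<in> H}" using assms by (auto simp: dg_def)
  moreover have "finite {k. (j,k) \<in> H}" by (rule finite_subset[of _ "{..<n}"]) (use assms in \<open>auto simp: simple_digraph_def arcs_on_def\<close>)
  moreover have "(j,j) \<notin> H" using assms by (auto simp: simple_digraph_def arcs_on_def)
  ultimately show ?thesis by (simp add: outdeg_def)
qed

lemma indeg_dg: assumes "simple_digraph n H" "j < n" shows "indeg (H \<union> dg n) j = indeg H j + 1"
proof -
  have "{i. (i,j) \<in> H \<union> dg n} = insert j {i. (i,j) \<in> H}" using assms by (auto simp: dg_def)
  moreover have "finite {i. (i,j) \<in> H}" by (rule finite_subset[of _ "{..<n}"]) (use assms in \<open>auto simp: simple_digraph_def arcs_on_def\<close>)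
  moreover have "(j,j) \<notin> H" using assms by (auto simp: simple_digraph_def arcs_on_def)
  ultimately show ?thesis by (simp add: indeg_def)
qed

lemma Xnum_dg: assumes "simple_digraph n H" shows "Xnum n (H \<union> dg n) = Xnum n H + n"
proof -
  have "(\<Sum>j<n. outdeg (H \<union> dg n) j) = (\<Sum>j<n. outdeg H j + 1)" using outdeg_dg[OF assms] by (intro sum.cong) auto
  then show ?thesis unfolding Xnum_def sum.distrib by simp
qed

lemma DsetH_Mat: "DsetH n s t H = Mat n (H \<union> dg n) s t"
proof -
  have "simple_digraph n G \<and> G \<inter> H = {} \<longleftrightarrow> G \<subseteq> {..<n} \<times> {..<n} - (H \<union> dg n)" for G
    by (auto simp: simple_digraph_def arcs_on_def dg_def)
  then show ?thesis unfolding DsetH_def Mat_def by blast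
qed

definition count_estimate :: "nat \<Rightarrow> (nat \<Rightarrow> nat) \<Rightarrow> (nat \<Rightarrow> nat) \<Rightarrow> arcs \<Rightarrow> real \<Rightarrow> real" where
  "count_estimate n s t H err =
    inverse (real ((n^2 - Xnum n H - n) choose (\<Sum>j<n. s j))) *
    (\<Prod>j<n. real ((n - outdeg H j - 1) choose s j) * real ((n - indeg H j - 1) choose t j)) *
    exp (- (1/2) * (1 - Rval n s / (2 * Acoef n s * real n ^ 2)) * (1 - Cval n s t / (2 * Acoef n s * real n ^ 2))
         - (Yval n s t H + (\<Sum>j<n. (real (s j) - avg_deg n s) * (real (t j) - avg_deg n s))) / (2 * Acoef n s * real n ^ 2) + err)"

context host
begin

text \<open>The diagonal arcs contribute the sum of delta_j eta_j, which differs from the sum of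
  (s_j - s) (t_j - s) by terms containing x_j or y_j. In addition the diagonal raises every delta
  and eta by L. Divided by v n^2, the total discrepancy is at most z^4 / r.\<close>

lemma Yval_dg:
  assumes H: "H = H0 \<union> dg n" "simple_digraph n H0" and t: "bx t"
  shows "\<bar>Yval n s t H - (Yval n s t H0 + (\<Sum>j<n. (real (s j) - avg_deg n s) * (real (t j) - avg_deg n s)))\<bar> \<le> z ^ 3 * (r * n)"
proof -
  let ?e = "eta n s t H"
  have disj: "H0 \<inter> dg n = {}" using H(2) by (auto simp: simple_digraph_def arcs_on_def dg_def)
  have H0n: "H0 \<subseteq> {..<n} \<times> {..<n}" using H(2) by (auto simp: simple_digraph_def arcs_on_def)
  have f: "finite H0" using finite_subset[OF H0n] by simp
  have d0: "delta n s H0 j = dl j - L" if "j < n" for j using outdeg_dg[OF H(2) that] unfolding H(1) delta_def by (simp add: algebra_simps)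
  have e0: "eta n s t H0 j = ?e j - L" if "j < n" for j using indeg_dg[OF H(2) that] unfolding H(1) eta_def by (simp add: algebra_simps)
  have eb: "\<bar>?e k\<bar> \<le> z * r" if "k < n" for k using t that by (simp add: bx_def)
  have "Yval n s t H = (\<Sum>(j,k)\<in>H0. dl j * ?e k) + (\<Sum>(j,k)\<in>dg n. dl j * ?e k)"
    unfolding Yval_def by (subst (3) H(1), rule sum.union_disjoint) (use f disj in \<open>auto simp: dg_def\<close>)
  also have "(\<Sum>(j,k)\<in>dg n. dl j * ?e k) = (\<Sum>j<n. dl j * ?e j)" unfolding dg_def by (subst sum.reindex) (auto simp: inj_on_def)
  finally have 1: "Yval n s t H = (\<Sum>(j,k)\<in>H0. dl j * ?e k) + (\<Sum>j<n. dl j * ?e j)" .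
  have 2: "Yval n s t H0 = (\<Sum>(j,k)\<in>H0. (dl j - L) * (?e k - L))"
    unfolding Yval_def using H0n d0 e0 by (intro sum.cong) auto
  have 3: "(\<Sum>j<n. (real (s j) - avg_deg n s) * (real (t j) - avg_deg n s)) = (\<Sum>j<n. (dl j - L * outdeg H j) * (?e j - L * indeg H j))"
    by (simp add: delta_def eta_def)
  have e: "Yval n s t H - (Yval n s t H0 + (\<Sum>j<n. (real (s j) - avg_deg n s) * (real (t j) - avg_deg n s)))
    = (\<Sum>(j,k)\<in>H0. L * dl j + L * ?e k - L * L) + (\<Sum>j<n. L * indeg H j * dl j + L * outdeg H j * ?e j - L * outdeg H j * (L * indeg H j))"
    unfolding 1 2 3 by (simp add: case_prod_unfold sum.distrib sum_subtractf algebra_simps)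
  have L': "\<bar>L\<bar> \<le> 1" using L01 by simp
  have a: "\<bar>\<Sum>(j,k)\<in>H0. L * dl j + L * ?e k - L * L\<bar> \<le> 3 * (z ^ 2 * (r * n))"
  proof -
    have "\<bar>\<Sum>(j,k)\<in>H0. L * dl j + L * ?e k - L * L\<bar> \<le> (\<Sum>x\<in>H0. 1 * (z * r) + 1 * (z * r) + 1 * 1)"
    proof (rule order_trans[OF sum_abs], rule sum_mono)
      fix x assume "x \<in> H0"
      then obtain j k where x: "x = (j,k)" "j < n" "k < n" using H0n by auto
      show "\<bar>case x of (j,k) \<Rightarrow> L * dl j + L * ?e k - L * L\<bar> \<le> 1 * (z * r) + 1 * (z * r) + 1 * 1"
        unfolding x(1) prod.case using L' delta_le[OF x(2)] eb[OF x(3)] by (intro abs_diff_le abs_add_le abs_mult_le) auto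
    qed
    also have "\<dots> = real (card H0) * (2 * (z * r) + 1)" by simp
    also have "\<dots> \<le> (z * n) * (3 * (z * r))"
    proof (rule mult_mono)
      have "card H0 \<le> card H" using H(1) finite_subset[OF H_sub] by (intro card_mono) auto
      also have "\<dots> = Xnum n H" using card_outdeg[OF H_sub] by (simp add: Xnum_def)
      finally show "real (card H0) \<le> z * n" using X_le by linarith
      show "2 * (z * r) + 1 \<le> 3 * (z * r)" using zkr[of 1] by simp
    qed (use z_pos in auto)
    finally show ?thesis by (simp add: power2_eq_square mult_ac)
  qed
  have b: "\<bar>\<Sum>j<n. L * indeg H j * dl j + L * outdeg H j * ?e j - L * outdeg H j * (L * indeg H j)\<bar> \<le> 3 * (z ^ 2 * (r * n))"
  proof -
    have "\<bar>\<Sum>j<n. L * indeg H j * dl j + L * outdeg H j * ?e j - L * outdeg H j * (L * indeg H j)\<bar>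
      \<le> (\<Sum>j<n. 1 * indeg H j * (z * r) + 1 * outdeg H j * (z * r) + 1 * outdeg H j * (1 * (z * r)))"
    proof (rule order_trans[OF sum_abs], rule sum_mono)
      fix j assume "j \<in> {..<n}"
      then have j: "j < n" by simp
      show "\<bar>L * indeg H j * dl j + L * outdeg H j * ?e j - L * outdeg H j * (L * indeg H j)\<bar>
        \<le> 1 * indeg H j * (z * r) + 1 * outdeg H j * (z * r) + 1 * outdeg H j * (1 * (z * r))"
        unfolding of_nat_mult using L' delta_le[OF j] eb[OF j] in_le[OF j] by (intro abs_diff_le abs_add_le abs_mult_le) auto
    qed
    also have "\<dots> = X * (z * r) + X * (z * r) + X * (z * r)"
      unfolding sum.distrib mult_1 sum_distrib_right[symmetric] sum_in sum_out ..
    also have "\<dots> \<le> (z * n) * (z * r) + (z * n) * (z * r) + (z * n) * (z * r)"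
      using X_le z_pos by (intro add_mono mult_right_mono) auto
    finally show ?thesis by (simp add: power2_eq_square mult_ac)
  qed
  have "6 * (z ^ 2 * (r * n)) \<le> z ^ 3 * (r * n)" using absorb[of "r * n" 6 2] by (simp add: eval_nat_numeral)
  then show ?thesis unfolding e using a b by linarith
qed

lemma count_digraphs:
  assumes H: "H = H0 \<union> dg n" "simple_digraph n H0" and t: "bx t"
  shows "\<exists>err. \<bar>err\<bar> \<le> z ^ 47 / r \<and> real (card (DsetH n s t H0)) = count_estimate n s t H0 err"
proof -
  obtain err where err: "\<bar>err\<bar> \<le> z ^ 46 / r"
    "real (card (Mat n H s t)) = inverse (real (card OmU)) * real (card OmR) * FF t * exp err"
    using count_formula[OF t] by blast
  let ?Y = "Yval n s t H0 + (\<Sum>j<n. (real (s j) - avg_deg n s) * (real (t j) - avg_deg n s))"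
  let ?q = "2 * Acoef n s * real n ^ 2"
  have q: "?q = v * n^2" by (simp add: Acoef_def)
  define d where "d = (?Y - Yval n s t H) / ?q"
  have "\<bar>d\<bar> \<le> z * (z ^ 3 * (r * n) / n^2)" unfolding d_def q
    by (rule div_v) (use Yval_dg[OF H t] in \<open>simp add: abs_minus_commute\<close>)
  also have "\<dots> = z ^ 4 * (r / n)" using n_pos by (simp add: eval_nat_numeral)
  also have "\<dots> = z ^ 4 * (1 / r)" unfolding r_over_n ..
  also have "\<dots> \<le> z ^ 46 * (1 / r)" by (rule zr_mono) auto
  finally have "\<bar>err + d\<bar> \<le> 2 * (z ^ 46 * (1 / r))" using err(1) by simp
  also have "\<dots> \<le> z ^ 47 * (1 / r)" using absorb[of "1 / r" 2 46] by simp
  finally have b: "\<bar>err + d\<bar> \<le> z ^ 47 / r" by simp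
  have deg: "n - outdeg H j = n - outdeg H0 j - 1" "n - indeg H j = n - indeg H0 j - 1" if "j < n" for j
    using outdeg_dg[OF H(2) that] indeg_dg[OF H(2) that] unfolding H(1) by auto
  have U: "card OmU = ((n^2 - Xnum n H0 - n) choose (\<Sum>j<n. s j))"
    unfolding card_OmU card_W Nt_def using Xnum_dg[OF H(2)] unfolding H(1) by simp
  have R: "real (card OmR) * wt t = (\<Prod>j<n. real ((n - outdeg H0 j - 1) choose s j) * real ((n - indeg H0 j - 1) choose t j))"
    unfolding card_OmR wt_def of_nat_prod prod.distrib[symmetric] by (rule prod.cong) (auto simp: deg)
  have B: "Bt t + err = - (1/2) * (1 - Rval n s / ?q) * (1 - Cval n s t / ?q) - ?Y / ?q + (err + d)"
    unfolding Bt_def d_def q by (simp add: diff_divide_distrib)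
  have "real (card (DsetH n s t H0)) = inverse (real (card OmU)) * (real (card OmR) * wt t) * (exp (Bt t) * exp err)"
    unfolding DsetH_Mat H(1)[symmetric] err(2) FF_def by (simp add: mult_ac)
  also have "\<dots> = count_estimate n s t H0 (err + d)" unfolding U R count_estimate_def B[symmetric] exp_add ..
  finally show ?thesis using b by blast
qed

end

text \<open>Then some out-degree is at least n. No loopless digraph has it and its binomial
  coefficient is zero, so in this degenerate case the formula reads 0 = 0.\<close>

lemma lam_ge_1:
  assumes "n \<ge> 1" "simple_digraph n H" "1 \<le> lam n s"
  shows "DsetH n s t H = {}" "(\<Prod>j<n. real ((n - outdeg H j - 1) choose s j) * real ((n - indeg H j - 1) choose t j)) = 0"
proof -
  have "\<exists>j<n. n \<le> s j"
  proof (rule ccontr)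
    assume "\<not> ?thesis"
    then have "\<forall>j<n. s j < n" by (meson not_less)
    then have "(\<Sum>j<n. s j) < (\<Sum>j<n. n)" using assms(1) by (intro sum_strict_mono) auto
    then have "(\<Sum>j<n. real (s j)) < real n * real n" by (simp flip: of_nat_sum of_nat_mult)
    then have "lam n s < 1" using assms(1) by (simp add: lam_def avg_deg_def divide_less_eq)
    then show False using assms(3) by simp
  qed
  then obtain j where j: "j < n" "n \<le> s j" by blast
  show "DsetH n s t H = {}"
  proof (rule ccontr)
    assume "DsetH n s t H \<noteq> {}"
    then obtain G where G: "G \<in> DsetH n s t H" by blast
    then have "{k. (j,k) \<in> G} \<subseteq> {..<n} - {j}" by (auto simp: DsetH_def simple_digraph_def arcs_on_def)
    then have "outdeg G j \<le> card ({..<n} - {j})" unfolding outdeg_def by (rule card_mono[rotated]) simp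
    then show False using G j by (simp add: DsetH_def)
  qed
  have "(n - outdeg H j - 1) choose s j = 0" by (rule binomial_eq_0) (use j assms(1) in linarith)
  then show "(\<Prod>j<n. real ((n - outdeg H j - 1) choose s j) * real ((n - indeg H j - 1) choose t j)) = 0"
    using j by (intro prod_zero) auto
qed

text \<open>Put w = n^\<epsilon>, so that z = w^3. All requirements follow once w exceeds a constant
  M, because logarithms are at most w / \<epsilon> and M w \<le> w^2 \<le> w^3.\<close>

lemma eventually_params:
  fixes a c \<epsilon> :: real
  assumes "0 < \<epsilon>" "0 < c" "0 < a"
  shows "\<exists>N\<ge>1. \<forall>n\<ge>N. 100 \<le> real n powr (3 * \<epsilon>) \<and> 40 * ln (real n) \<le> real n powr (3 * \<epsilon>)
    \<and> 4 + 3 / 2 * a * ln (real n) \<le> real n powr (3 * \<epsilon>)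
    \<and> 2 * c * real n powr (1/2 + \<epsilon>) + 1 \<le> real n powr (1/2 + 3 * \<epsilon>)
    \<and> c * real n powr (1 + 2 * \<epsilon>) + real n \<le> real n powr (1 + 3 * \<epsilon>)"
proof -
  define M where "M = 100 + (2 * c + 1) + 40 / \<epsilon> + (4 + 3 / 2 * a / \<epsilon>)"
  have pos: "0 < 40 / \<epsilon>" "0 < 3 / 2 * a / \<epsilon>" using assms by simp_all
  have M: "100 \<le> M" "2 * c + 1 \<le> M" "40 / \<epsilon> \<le> M" "4 + 3 / 2 * a / \<epsilon> \<le> M" using pos assms by (auto simp: M_def)
  define N where "N = nat \<lceil>M powr (1 / \<epsilon>)\<rceil> + 1"
  have "100 \<le> real n powr (3 * \<epsilon>) \<and> 40 * ln (real n) \<le> real n powr (3 * \<epsilon>)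
    \<and> 4 + 3 / 2 * a * ln (real n) \<le> real n powr (3 * \<epsilon>)
    \<and> 2 * c * real n powr (1/2 + \<epsilon>) + 1 \<le> real n powr (1/2 + 3 * \<epsilon>)
    \<and> c * real n powr (1 + 2 * \<epsilon>) + real n \<le> real n powr (1 + 3 * \<epsilon>)" if n: "N \<le> n" for n
  proof -
    define w where "w = real n powr \<epsilon>"
    have n1: "1 \<le> real n" using n by (simp add: N_def)
    have "M powr (1 / \<epsilon>) \<le> real n" using n unfolding N_def by linarith
    then have "(M powr (1 / \<epsilon>)) powr \<epsilon> \<le> w" unfolding w_def using assms by (intro powr_mono2) auto
    then have w: "M \<le> w" using M assms by (simp add: powr_powr)
    have w1: "1 \<le> w" "0 \<le> w" using w M by linarith+
    have w2: "M * w \<le> w * w" using w w1 by (intro mult_right_mono) auto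
    have w3: "w * w \<le> w ^ 3" using mult_right_mono[of 1 w "w * w"] w1 by (simp add: power3_eq_cube)
    have p3: "real n powr (3 * \<epsilon>) = w ^ 3" unfolding w_def using n1 by (simp add: powr_realpow[symmetric] powr_powr mult.commute)
    have p2: "real n powr (2 * \<epsilon>) = w ^ 2" unfolding w_def using n1 by (simp add: powr_realpow[symmetric] powr_powr mult.commute)
    have ln: "ln (real n) \<le> w / \<epsilon>" unfolding w_def using ln_powr_bound[OF n1 assms(1)] .
    have "M * 1 \<le> M * w" using M w1 by (intro mult_left_mono) auto
    then have 1: "100 \<le> w ^ 3" using M(1) w2 w3 by linarith
    have "40 * ln (real n) \<le> 40 / \<epsilon> * w" using ln by simp
    also have "\<dots> \<le> M * w" using M(3) w1 by (intro mult_right_mono) auto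
    finally have 2: "40 * ln (real n) \<le> w ^ 3" using w2 w3 by linarith
    have "3 / 2 * a * ln (real n) \<le> 3 / 2 * a * (w / \<epsilon>)" using ln assms by (intro mult_left_mono) auto
    then have "4 + 3 / 2 * a * ln (real n) \<le> 4 * w + 3 / 2 * a / \<epsilon> * w" using w1 by simp
    also have "\<dots> = (4 + 3 / 2 * a / \<epsilon>) * w" by (simp add: distrib_right)
    also have "\<dots> \<le> M * w" using M(4) w1 by (intro mult_right_mono) auto
    finally have 3: "4 + 3 / 2 * a * ln (real n) \<le> w ^ 3" using w2 w3 by linarith
    define h where "h = real n powr (1/2)"
    have h: "1 \<le> h" unfolding h_def using n1 by (intro ge_one_powr_ge_zero) auto
    have "(2 * c + 1) * w \<le> M * w" using M(2) w1 by (intro mult_right_mono) auto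
    then have "h * ((2 * c + 1) * w) \<le> h * w ^ 3" using h w2 w3 by (intro mult_left_mono) auto
    moreover have "1 * 1 \<le> h * w" using h w1 by (intro mult_mono) auto
    ultimately have 4: "2 * c * (h * w) + 1 \<le> h * w ^ 3" by (simp add: algebra_simps)
    have "c + 1 \<le> w" using M(2) w assms by linarith
    then have "(c + 1) * w^2 \<le> w ^ 3" using mult_right_mono[of "c + 1" w "w^2"] by (simp add: power3_eq_cube power2_eq_square)
    moreover have "1 \<le> w\<^sup>2" using w1 by (intro one_le_power) auto
    ultimately have "c * w^2 + 1 \<le> w ^ 3" by (simp add: algebra_simps)
    then have "real n * (c * w^2 + 1) \<le> real n * w ^ 3" by (rule mult_left_mono) simp
    then have 5: "c * (real n * w^2) + real n \<le> real n * w ^ 3" by (simp add: algebra_simps)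
    have e: "real n powr (1/2 + \<epsilon>) = h * w" "real n powr (1/2 + 3 * \<epsilon>) = h * w ^ 3" "real n powr (1 + 2 * \<epsilon>) = real n * w^2" "real n powr (1 + 3 * \<epsilon>) = real n * w ^ 3"
      using n1 unfolding powr_add p3 p2 h_def w_def by simp_all
    show ?thesis unfolding e p3 using 1 2 3 4 5 by simp
  qed
  then show ?thesis by (intro exI[of _ N]) (auto simp: N_def)
qed

theorem theorem3p1:
  fixes a b :: real
  assumes "a > 0" "b > 0" "a + b < 1/2"
  shows "\<exists>\<epsilon>0>0. \<forall>\<epsilon>. 0 < \<epsilon> \<and> \<epsilon> < \<epsilon>0 \<longrightarrow>
    (\<forall>c>0. \<exists>K N. \<forall>(n::nat) (s::nat\<Rightarrow>nat) (t::nat\<Rightarrow>nat) (H::(nat\<times>nat) set).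
      n \<ge> N \<and>
      (\<forall>j<n. s j \<ge> 1 \<and> t j \<ge> 1) \<and>
      (\<Sum>j<n. s j) = (\<Sum>j<n. t j) \<and>
      simple_digraph n H \<and>
      (\<forall>j<n. \<bar>real (s j) - avg_deg n s\<bar> \<le> c * real n powr (1/2 + \<epsilon>)
            \<and> real (outdeg H j) \<le> c * real n powr (1/2 + \<epsilon>)
            \<and> \<bar>real (t j) - avg_deg n s\<bar> \<le> c * real n powr (1/2 + \<epsilon>)
            \<and> real (indeg H j) \<le> c * real n powr (1/2 + \<epsilon>)) \<and>
      real (Xnum n H) \<le> c * real n powr (1 + 2 * \<epsilon>) \<and>
      (1 - 2 * lam n s)^2 / (3 * Acoef n s) \<le> a * ln (real n)
      \<longrightarrow>
      (\<exists>err. \<bar>err\<bar> \<le> K * real n powr (- b) \<and>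
        real (card (DsetH n s t H)) =
          inverse (real ((n^2 - Xnum n H - n) choose (\<Sum>j<n. s j))) *
          (\<Prod>j<n. real ((n - outdeg H j - 1) choose s j) *
                   real ((n - indeg H j - 1) choose t j)) *
          exp (- (1/2) * (1 - Rval n s / (2 * Acoef n s * real n ^ 2))
                       * (1 - Cval n s t / (2 * Acoef n s * real n ^ 2))
               - (Yval n s t H + (\<Sum>j<n. (real (s j) - avg_deg n s) * (real (t j) - avg_deg n s)))
                   / (2 * Acoef n s * real n ^ 2)
               + err)))"
proof -
  \<comment> \<open>The first entry keeps 180 \<epsilon> below 1/2, which gives z^60 \<le> sqrt n.
    The second keeps 141 \<epsilon> below 1/2 - b, so that the final error z^47 / sqrt n is at most
    n^(-b).\<close>
  define e0 where "e0 = min (1 / 400) ((1/2 - b) / 200)"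
  have e0: "0 < e0" using assms by (simp add: e0_def)
  \<comment> \<open>Matching against the goal names its hypothesis \<open>?P\<close> and its
    conclusion \<open>?Q\<close>, so that they need not be written out again.\<close>
  let "\<exists>\<epsilon>0>0. \<forall>\<epsilon>. 0 < \<epsilon> \<and> \<epsilon> < \<epsilon>0 \<longrightarrow> (\<forall>c>0. \<exists>K N. \<forall>(n::nat) (s::nat\<Rightarrow>nat) (t::nat\<Rightarrow>nat) (H::(nat\<times>nat) set).
    ?P \<epsilon> c N n s t H \<longrightarrow> ?Q K n s t H)" = ?thesis
  have main: "?Q 1 n s t H"
    if \<epsilon>: "0 < \<epsilon>" "\<epsilon> < e0" and "0 < c" and n1: "1 \<le> n"
      and P: "100 \<le> real n powr (3 * \<epsilon>)" "40 * ln (real n) \<le> real n powr (3 * \<epsilon>)" "4 + 3 / 2 * a * ln (real n) \<le> real n powr (3 * \<epsilon>)"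
        "2 * c * real n powr (1/2 + \<epsilon>) + 1 \<le> real n powr (1/2 + 3 * \<epsilon>)" "c * real n powr (1 + 2 * \<epsilon>) + real n \<le> real n powr (1 + 3 * \<epsilon>)"
      and hyp: "?P \<epsilon> c N n s t H"
    for \<epsilon> c :: real and N n :: nat and s t :: "nat \<Rightarrow> nat" and H :: "arcs"
    unfolding count_estimate_def[symmetric]
  proof (cases "1 \<le> lam n s")
    case True
    have H: "simple_digraph n H" using hyp by blast
    have "real (card (DsetH n s t H)) = count_estimate n s t H 0" unfolding count_estimate_def lam_ge_1[OF n1 H True] by simp
    then show "\<exists>err. \<bar>err\<bar> \<le> 1 * real n powr - b \<and> real (card (DsetH n s t H)) = count_estimate n s t H err" by (intro exI[of _ 0]) simp
  next
    case False
    let ?L = "lam n s" and ?z = "real n powr (3 * \<epsilon>)" and ?r = "sqrt (real n)" and ?H = "H \<union> dg n"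
    have np: "0 < real n" using n1 by simp
    from hyp have st: "\<forall>j<n. s j \<ge> 1 \<and> t j \<ge> 1" "(\<Sum>j<n. s j) = (\<Sum>j<n. t j)" and H: "simple_digraph n H"
      and bd: "\<forall>j<n. \<bar>real (s j) - avg_deg n s\<bar> \<le> c * real n powr (1/2 + \<epsilon>)
            \<and> real (outdeg H j) \<le> c * real n powr (1/2 + \<epsilon>)
            \<and> \<bar>real (t j) - avg_deg n s\<bar> \<le> c * real n powr (1/2 + \<epsilon>)
            \<and> real (indeg H j) \<le> c * real n powr (1/2 + \<epsilon>)"
      and X: "real (Xnum n H) \<le> c * real n powr (1 + 2 * \<epsilon>)"
      and A: "(1 - 2 * lam n s)^2 / (3 * Acoef n s) \<le> a * ln (real n)" by blast+
    have "0 < (\<Sum>j<n. real (s j))" using st(1) n1 by (intro sum_pos) (auto simp: lessThan_empty_iff)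
    then have L0: "0 < ?L" using np by (simp add: lam_def avg_deg_def)
    have L1: "?L < 1" using False by simp
    define v where "v = ?L * (1 - ?L)"
    have v0: "0 < v" using L0 L1 by (simp add: v_def)
    \<comment> \<open>Since (1 - 2L)^2 = 1 - 4v, the density hypothesis becomes a lower bound on v
      of order 1 / log n, which is stronger than 1 / z for large n.\<close>
    have v: "1 / ?z \<le> v"
    proof -
      have "(1 - 2 * ?L)\<^sup>2 = 1 - 4 * v" by (simp add: v_def power2_eq_square algebra_simps)
      moreover have "3 * Acoef n s = 3 / 2 * v" by (simp add: Acoef_def v_def)
      ultimately have "(1 - 4 * v) / (3 / 2 * v) \<le> a * ln (real n)" using A by (simp only:)
      then have "1 - 4 * v \<le> a * ln (real n) * (3 / 2 * v)" using v0 by (simp add: divide_le_eq)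
      then have "1 \<le> (4 + 3 / 2 * a * ln (real n)) * v" by (simp add: algebra_simps)
      also have "\<dots> \<le> ?z * v" using P(3) v0 by (intro mult_right_mono) auto
      finally show ?thesis using np by (simp add: divide_le_eq mult.commute)
    qed
    have r: "?r = real n powr (1/2)" using np by (simp add: powr_half_sqrt)
    have zr: "?z * ?r = real n powr (1/2 + 3 * \<epsilon>)" unfolding r by (simp add: powr_add)
    have zn: "?z * real n = real n powr (1 + 3 * \<epsilon>)" using np by (simp add: powr_add)
    have zpow: "?z ^ k = real n powr (3 * \<epsilon> * real k)" for k using np by (simp add: powr_realpow[symmetric] powr_powr)
    have z60: "?z ^ 60 \<le> ?r" unfolding zpow r using \<epsilon> n1 by (intro powr_mono) (auto simp: e0_def)
    have deg: "real (outdeg ?H j) = real (outdeg H j) + 1" "real (indeg ?H j) = real (indeg H j) + 1" if "j < n" for j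
      using outdeg_dg[OF H that] indeg_dg[OF H that] by auto
    \<comment> \<open>Adjoining the diagonal raises every degree by one, and L \<le> 1 allows the
      degree to be added to the deviation; this explains the requirement with 2 c and the extra
      1.\<close>
    have box: "\<bar>x + ?L * (y + 1)\<bar> \<le> ?z * ?r \<and> y + 1 \<le> ?z * ?r"
      if "\<bar>x\<bar> \<le> c * real n powr (1/2 + \<epsilon>)" "0 \<le> y" "y \<le> c * real n powr (1/2 + \<epsilon>)" for x y
    proof -
      have lin: "\<bar>x + q\<bar> \<le> Z \<and> y + 1 \<le> Z" if "q \<le> 1 * (y + 1)" "0 \<le> q" "2 * k + 1 \<le> Z" "\<bar>x\<bar> \<le> k" "y \<le> k" for q Z k
        using that by (smt (verit))
      have 1: "?L * (y + 1) \<le> 1 * (y + 1)" "0 \<le> ?L * (y + 1)" using L0 L1 that by (auto intro!: mult_right_mono)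
      have 2: "2 * (c * real n powr (1/2 + \<epsilon>)) + 1 \<le> real n powr (1/2 + 3 * \<epsilon>)" using P(4) by simp
      show ?thesis unfolding zr by (rule lin[OF 1 2 that(1,3)])
    qed
    interpret host n ?H s ?z
    proof
      show "?H \<subseteq> {..<n} \<times> {..<n}" using H by (auto simp: simple_digraph_def arcs_on_def dg_def)
      show "100 \<le> ?z" "40 * ln (real n) \<le> ?z" by (rule P)+
      show "?z ^ 60 \<le> ?r" by (rule z60)
      show "0 \<le> ?L" using L0 by simp
      show "1 / ?z \<le> ?L * (1 - ?L)" using v by (simp add: v_def)
      show "\<bar>delta n s ?H i\<bar> \<le> ?z * ?r" if "i < n" for i unfolding delta_def deg[OF that]
        by (rule box[THEN conjunct1]) (use bd that in auto)
      show "real (outdeg ?H i) \<le> ?z * ?r" "real (indeg ?H i) \<le> ?z * ?r" if "i < n" for i unfolding deg[OF that]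
        by (rule box[of 0, THEN conjunct2]; use bd that \<open>0 < c\<close> in auto)+
      show "real (Xnum n ?H) \<le> ?z * real n" unfolding Xnum_dg[OF H] zn using X P(5) by simp
    qed
    have bt: "bx t" unfolding bx_def
    proof (intro conjI allI impI)
      show "\<bar>eta n s t ?H k\<bar> \<le> ?z * ?r" if "k < n" for k unfolding eta_def deg[OF that]
        by (rule box[THEN conjunct1]) (use bd that in auto)
    qed (rule st(2))
    have "?z ^ 47 / ?r = real n powr (141 * \<epsilon> - 1/2)" unfolding zpow r by (simp add: powr_diff)
    also have "\<dots> \<le> 1 * real n powr (- b)" unfolding mult_1 using \<epsilon> n1 by (intro powr_mono) (auto simp: e0_def)
    finally have le: "?z ^ 47 / ?r \<le> 1 * real n powr (- b)" .
    show "\<exists>err. \<bar>err\<bar> \<le> 1 * real n powr - b \<and> real (card (DsetH n s t H)) = count_estimate n s t H err"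
    proof (rule ex_forward[OF count_digraphs[OF refl H bt]], elim conjE, intro conjI)
      show "\<bar>x\<bar> \<le> 1 * real n powr (- b)" if "\<bar>x\<bar> \<le> ?z ^ 47 / ?r" for x using that le by linarith
    qed
  qed
  show ?thesis
  proof (rule exI[of _ e0], intro conjI allI impI)
    show "0 < e0" by (rule e0)
  next
    fix \<epsilon> c :: real assume \<epsilon>: "0 < \<epsilon> \<and> \<epsilon> < e0" and c: "0 < c"
    obtain N where N: "1 \<le> N" "\<forall>n\<ge>N. 100 \<le> real n powr (3 * \<epsilon>) \<and> 40 * ln (real n) \<le> real n powr (3 * \<epsilon>)
      \<and> 4 + 3 / 2 * a * ln (real n) \<le> real n powr (3 * \<epsilon>)
      \<and> 2 * c * real n powr (1/2 + \<epsilon>) + 1 \<le> real n powr (1/2 + 3 * \<epsilon>)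
      \<and> c * real n powr (1 + 2 * \<epsilon>) + real n \<le> real n powr (1 + 3 * \<epsilon>)"
      using eventually_params[of \<epsilon> c a] \<epsilon> c assms(1) by blast
    show "\<exists>K N. \<forall>n s t H. ?P \<epsilon> c N n s t H \<longrightarrow> ?Q K n s t H"
    \<comment> \<open>The constant c is absorbed into the threshold N, so K = 1 works for the error
      term.\<close>
    proof (rule exI[of _ 1], rule exI[of _ N], intro allI impI)
      fix n s t H assume hyp: "?P \<epsilon> c N n s t H"
      then have n: "N \<le> n" by blast
      show "?Q 1 n s t H"
        by (rule main[OF _ _ c _ _ _ _ _ _ hyp]) (use N(2)[rule_format, OF n] \<epsilon> n N(1) in auto)
    qed
  qed
qed

end
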